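(* Let $\mathcal T$ be a big tt-category whose frame $\mathrm S^\otimes(\mathcal T)$ of smashing tensor-ideals is a spatial frame, and suppose that the smashing spectrum $\mathrm{Spc}^s(\mathcal T)$ is $T_D$. Equip $\mathcal T$ with the small smashing support--cosupport pair. Then: (a) $\mathcal T$ satisfies cominimality if and only if $\mathcal T/P$ satisfies cominimality, for all $P\in\mathrm{Spc}^s(\mathcal T)$. (b) Suppose that $\mathcal T$ satisfies the colocal-to-global principle. Then $\mathcal T$ is costratified if and only if $\mathcal T/P$ is costratified, for all $P\in\mathrm{Spc}^s(\mathcal T)$.
   Context: A big tt-category is a rigidly-compactly generated tensor-triangulated category $\mathcal T=(\mathcal T,\otimes,1)$: a tensor-triangulated category with arbitrary coproducts (preserved by $\otimes$ in each variable), generated as a localizing subcategory by its compact objects, whose compact objects form an essentially small tensor-triangulated subcategory and coincide with the rigid objects. Its internal hom is $[-,-]$. A colocalizing left $\hom$-ideal is a triangulated subcategory closed under products and under $[X,-]$ for all $X\in\mathcal T$. $I$ is the product of the Brown--Comenetz duals of the compact objects of $\mathcal T$ (one for each object of a skeleton), the dual of $x$ representing $\mathrm{Hom}_{\mathbb Z}(\mathrm{Hom}_{\mathcal T}(x,-),\mathbb Q/\mathbb Z)$; $\mathcal T$ is the smallest colocalizing subcategory containing $I$. A smashing ideal $\mathcal S$ is a localizing tensor-ideal such that the quotient functor $j_{\mathcal S}\colon\mathcal T\to\mathcal T/\mathcal S$ has a coproduct-preserving right adjoint $k_{\mathcal S}$. It has a left idempotent $e_{\mathcal S}$ and right idempotent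 $f_{\mathcal S}$, the images of $1$ under the associated acyclization and localization functors (so there is a triangle $e_{\mathcal S}\to1\to f_{\mathcal S}$ with $\mathcal S=\mathrm{Ker}(f_{\mathcal S}\otimes-)$). The smashing ideals ordered by inclusion form the frame $\mathrm S^\otimes(\mathcal T)$. $\mathrm{Spc}^s(\mathcal T)$ is the set of meet-prime smashing ideals (smashing $P$ such that $\mathcal S_1\cap\mathcal S_2\subseteq P$ implies $\mathcal S_1\subseteq P$ or $\mathcal S_2\subseteq P$ for smashing $\mathcal S_1,\mathcal S_2$), with open subsets $U_{\mathcal S}=\{P\mid\mathcal S\not\subseteq P\}$ and closed subsets $V_{\mathcal S}=\{P\mid\mathcal S\subseteq P\}$. It is $T_D$ if every point is locally closed; then for each $P$ there is a smashing ideal $\mathcal S$ with $\{P\}=U_{\mathcal S}\cap V_P$, and $\Gamma_P=e_{\mathcal S}\otimes f_P$. The small smashing support--cosupport is $\mathrm{Supp}^s(X)=\{P\mid\Gamma_P\otimes X\ne0\}$, $\mathrm{Cosupp}^s(X)=\{P\mid[\Gamma_P,X]\neq0\}$. For a smashing ideal $\mathcal M$ (including $\mathcal M=0$), $\mathcal N=\mathcal T/\mathcal M$ is a $\mathcal T$-module via $X\ast j_{\mathcal M}(B)=j_{\mathcal M}(X\otimes B)$; $[X,-]_\ast$ is the right adjoint of $X\ast-$ on $\mathcal N$; a colocalizing $\hom$-submodule of $\mathcal N$ is a triangulated subcategory closed under products and all $[X,-]_\ast$, $X\in\mathcal T$; $\mathrm{coloc}^{\hom}(\mathcal A)$ is the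 smallest one containing $\mathcal A$. Let $\ell_{\mathcal M}$ be the right adjoint of $k_{\mathcal M}$ and $I_{\mathcal N}=\ell_{\mathcal M}(I)$ (so $I_{\mathcal T}=I$). Put $\mathrm c^\ast(A)=\{Q\in\mathrm{Spc}^s(\mathcal T)\mid[\Gamma_Q,A]_\ast\neq0\}$ for $A\in\mathcal N$. Cominimality of $\mathcal N$: for all $Q\in\mathrm{Spc}^s(\mathcal T)$, $\mathrm{coloc}^{\hom}([\Gamma_Q,I_{\mathcal N}]_\ast)$ contains no colocalizing $\hom$-submodule other than $0$ and itself. Colocal-to-global principle: $\mathrm{coloc}^{\hom}(A)=\mathrm{coloc}^{\hom}([\Gamma_Q,A]_\ast\mid Q\in\mathrm{Spc}^s(\mathcal T))$ for all $A\in\mathcal N$. Costratified: $W\mapsto\{A\mid\mathrm c^\ast(A)\subseteq W\}$ and $\mathcal C\mapsto\bigcup_{A\in\mathcal C}\mathrm c^\ast(A)$ are mutually inverse bijections between the power set of $\mathrm c^\ast(I_{\mathcal N})$ and the collection of colocalizing $\hom$-submodules of $\mathcal N$. *)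

theory Defs
  imports "HOL-Algebra.Product_Groups" "HOL-Algebra.FiniteProduct" "HOL-Analysis.Abstract_Topology"
begin

section \<open>Universes\<close>

text \<open>
  Set-theoretic size is measured against a set \<open>U\<close> whose cardinality is an uncountable strongly
  inaccessible cardinal: a set is small if it has strictly fewer elements than \<open>U\<close>, that is, if it is
  in bijection with a member of the Grothendieck universe determined by that cardinal. Every small set
  is in bijection with a small subset of \<open>U\<close>, so small families are indexed by small subsets of \<open>U\<close>.
\<close>

definition universe :: "'u set \<Rightarrow> bool" where
  "universe U \<longleftrightarrow>
     (UNIV :: nat set) \<prec> U \<and>
     (\<forall>A\<subseteq>U. A \<prec> U \<longrightarrow> Pow A \<prec> U) \<and>
     (\<forall>A F. A \<subseteq> U \<longrightarrow> A \<prec> U \<longrightarrow> (\<forall>a\<in>A. F a \<subseteq> U \<and> F a \<prec> U) \<longrightarrow> (\<Union>a\<in>A. F a) \<prec> U)"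


section \<open>Categories and functors\<close>

record ('o, 'm) cat =
  obj :: "'o set"
  arr :: "'m set"
  src :: "'m \<Rightarrow> 'o"
  tgt :: "'m \<Rightarrow> 'o"
  idn :: "'o \<Rightarrow> 'm"
  cmp :: "'m \<Rightarrow> 'm \<Rightarrow> 'm"  (infixr \<open>\<cdot>\<index>\<close> 75)

definition Mor :: "('o, 'm, 'z) cat_scheme \<Rightarrow> 'o \<Rightarrow> 'o \<Rightarrow> 'm set" where
  "Mor C x y = {f \<in> arr C. src C f = x \<and> tgt C f = y}"

locale category =
  fixes C :: "('o, 'm, 'z) cat_scheme" (structure)
  assumes src_obj: "f \<in> arr C \<Longrightarrow> src C f \<in> obj C"
    and tgt_obj: "f \<in> arr C \<Longrightarrow> tgt C f \<in> obj C"
    and idn_Mor: "x \<in> obj C \<Longrightarrow> idn C x \<in> Mor C x x"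
    and cmp_Mor: "\<lbrakk>f \<in> Mor C x y; g \<in> Mor C y z\<rbrakk> \<Longrightarrow> g \<cdot> f \<in> Mor C x z"
    and cmp_idn: "f \<in> Mor C x y \<Longrightarrow> f \<cdot> idn C x = f"
    and idn_cmp: "f \<in> Mor C x y \<Longrightarrow> idn C y \<cdot> f = f"
    and cmp_assoc: "\<lbrakk>f \<in> Mor C w x; g \<in> Mor C x y; h \<in> Mor C y z\<rbrakk> \<Longrightarrow> (h \<cdot> g) \<cdot> f = h \<cdot> (g \<cdot> f)"

definition inverse_arrows :: "('o, 'm, 'z) cat_scheme \<Rightarrow> 'm \<Rightarrow> 'm \<Rightarrow> bool" where
  "inverse_arrows C f g \<longleftrightarrow>
     f \<in> arr C \<and> g \<in> Mor C (tgt C f) (src C f) \<and>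
     g \<cdot>\<^bsub>C\<^esub> f = idn C (src C f) \<and> f \<cdot>\<^bsub>C\<^esub> g = idn C (tgt C f)"

definition is_iso :: "('o, 'm, 'z) cat_scheme \<Rightarrow> 'm \<Rightarrow> bool" where
  "is_iso C f \<longleftrightarrow> (\<exists>g. inverse_arrows C f g)"

definition inv_arr :: "('o, 'm, 'z) cat_scheme \<Rightarrow> 'm \<Rightarrow> 'm" where
  "inv_arr C f = (THE g. inverse_arrows C f g)"

definition isomorphic :: "('o, 'm, 'z) cat_scheme \<Rightarrow> 'o \<Rightarrow> 'o \<Rightarrow> bool" where
  "isomorphic C x y \<longleftrightarrow> (\<exists>f\<in>Mor C x y. is_iso C f)"

definition is_coproduct ::
  "('o, 'm, 'z) cat_scheme \<Rightarrow> 'i set \<Rightarrow> ('i \<Rightarrow> 'o) \<Rightarrow> 'o \<Rightarrow> ('i \<Rightarrow> 'm) \<Rightarrow> bool" where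
  "is_coproduct C J X c \<iota> \<longleftrightarrow>
     c \<in> obj C \<and> (\<forall>j\<in>J. \<iota> j \<in> Mor C (X j) c) \<and>
     (\<forall>z\<in>obj C. \<forall>\<phi>. (\<forall>j\<in>J. \<phi> j \<in> Mor C (X j) z) \<longrightarrow>
        (\<exists>!h. h \<in> Mor C c z \<and> (\<forall>j\<in>J. h \<cdot>\<^bsub>C\<^esub> \<iota> j = \<phi> j)))"

definition is_product ::
  "('o, 'm, 'z) cat_scheme \<Rightarrow> 'i set \<Rightarrow> ('i \<Rightarrow> 'o) \<Rightarrow> 'o \<Rightarrow> ('i \<Rightarrow> 'm) \<Rightarrow> bool" where
  "is_product C J X p \<pi> \<longleftrightarrow>
     p \<in> obj C \<and> (\<forall>j\<in>J. \<pi> j \<in> Mor C p (X j)) \<and>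
     (\<forall>z\<in>obj C. \<forall>\<phi>. (\<forall>j\<in>J. \<phi> j \<in> Mor C z (X j)) \<longrightarrow>
        (\<exists>!h. h \<in> Mor C z p \<and> (\<forall>j\<in>J. \<pi> j \<cdot>\<^bsub>C\<^esub> h = \<phi> j)))"

record ('o, 'm, 'p, 'n) func =
  fob :: "'o \<Rightarrow> 'p"
  far :: "'m \<Rightarrow> 'n"

definition is_functor ::
  "('o, 'm, 'z) cat_scheme \<Rightarrow> ('p, 'n, 'y) cat_scheme \<Rightarrow> ('o, 'm, 'p, 'n) func \<Rightarrow> bool" where
  "is_functor C D F \<longleftrightarrow>
     (\<forall>x\<in>obj C. fob F x \<in> obj D \<and> far F (idn C x) = idn D (fob F x)) \<and>
     (\<forall>f\<in>arr C. far F f \<in> Mor D (fob F (src C f)) (fob F (tgt C f))) \<and>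
     (\<forall>f\<in>arr C. \<forall>g\<in>arr C. tgt C f = src C g \<longrightarrow> far F (g \<cdot>\<^bsub>C\<^esub> f) = far F g \<cdot>\<^bsub>D\<^esub> far F f)"

definition func_comp ::
  "('p, 'n, 'q, 'l) func \<Rightarrow> ('o, 'm, 'p, 'n) func \<Rightarrow> ('o, 'm, 'q, 'l) func" where
  "func_comp G F = \<lparr>fob = fob G \<circ> fob F, far = far G \<circ> far F\<rparr>"

definition is_equivalence ::
  "('o, 'm, 'z) cat_scheme \<Rightarrow> ('p, 'n, 'y) cat_scheme \<Rightarrow> ('o, 'm, 'p, 'n) func \<Rightarrow> bool" where
  "is_equivalence C D F \<longleftrightarrow>
     is_functor C D F \<and>
     (\<forall>x\<in>obj C. \<forall>y\<in>obj C. bij_betw (far F) (Mor C x y) (Mor D (fob F x) (fob F y))) \<and>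
     (\<forall>d\<in>obj D. \<exists>x\<in>obj C. isomorphic D (fob F x) d)"

text \<open>\<open>F\<close> is left adjoint to \<open>G\<close>: natural bijections \<open>Mor D (F x) y \<cong> Mor C x (G y)\<close>.\<close>

definition adjoint ::
  "('o, 'm, 'z) cat_scheme \<Rightarrow> ('p, 'n, 'y) cat_scheme \<Rightarrow>
   ('o, 'm, 'p, 'n) func \<Rightarrow> ('p, 'n, 'o, 'm) func \<Rightarrow> bool" where
  "adjoint C D F G \<longleftrightarrow>
     (\<exists>\<Phi>. (\<forall>x\<in>obj C. \<forall>y\<in>obj D. bij_betw (\<Phi> x y) (Mor D (fob F x) y) (Mor C x (fob G y))) \<and>
       (\<forall>u\<in>arr C. \<forall>v\<in>arr D. \<forall>a\<in>Mor D (fob F (tgt C u)) (src D v).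
          \<Phi> (src C u) (tgt D v) (v \<cdot>\<^bsub>D\<^esub> (a \<cdot>\<^bsub>D\<^esub> far F u)) =
          far G v \<cdot>\<^bsub>C\<^esub> (\<Phi> (tgt C u) (src D v) a \<cdot>\<^bsub>C\<^esub> u)))"

text \<open>A right adjoint is unique up to natural isomorphism; one is chosen. (If there is none, the chosen
  value is meaningless.)\<close>

definition right_adjoint ::
  "('o, 'm, 'z) cat_scheme \<Rightarrow> ('p, 'n, 'y) cat_scheme \<Rightarrow>
   ('o, 'm, 'p, 'n) func \<Rightarrow> ('p, 'n, 'o, 'm) func" where
  "right_adjoint C D F = (SOME G. is_functor D C G \<and> adjoint C D F G)"

definition preserves_coproducts ::
  "'u set \<Rightarrow> ('o, 'm, 'z) cat_scheme \<Rightarrow> ('p, 'n, 'y) cat_scheme \<Rightarrow> ('o, 'm, 'p, 'n) func \<Rightarrow> bool" where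
  "preserves_coproducts U C D F \<longleftrightarrow>
     (\<forall>J X c \<iota>. J \<subseteq> U \<longrightarrow> J \<prec> U \<longrightarrow> is_coproduct C J X c \<iota> \<longrightarrow>
        is_coproduct D J (\<lambda>j. fob F (X j)) (fob F c) (\<lambda>j. far F (\<iota> j)))"

definition full_subcat :: "('o, 'm, 'z) cat_scheme \<Rightarrow> 'o set \<Rightarrow> ('o, 'm, 'z) cat_scheme" where
  "full_subcat C S = C\<lparr>obj := S, arr := {f \<in> arr C. src C f \<in> S \<and> tgt C f \<in> S}\<rparr>"


section \<open>Triangulated categories\<close>

text \<open>\<open>tri C\<close> is the class of distinguished triangles \<open>(f, g, h)\<close>,
  with \<open>f : x \<rightarrow> y\<close>, \<open>g : y \<rightarrow> z\<close> and \<open>h : z \<rightarrow> \<Sigma> x\<close>.\<close>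

record ('o, 'm) tricat = "('o, 'm) cat" +
  zer :: "'o \<Rightarrow> 'o \<Rightarrow> 'm"
  add :: "'m \<Rightarrow> 'm \<Rightarrow> 'm"
  shift :: "('o, 'm, 'o, 'm) func"
  tri :: "('m \<times> 'm \<times> 'm) set"

definition HomG :: "('o, 'm, 'z) tricat_scheme \<Rightarrow> 'o \<Rightarrow> 'o \<Rightarrow> 'm monoid" where
  "HomG C x y = \<lparr>carrier = Mor C x y, monoid.mult = add C, one = zer C x y\<rparr>"

definition neg :: "('o, 'm, 'z) tricat_scheme \<Rightarrow> 'm \<Rightarrow> 'm" where
  "neg C f = m_inv (HomG C (src C f) (tgt C f)) f"

definition is_zero :: "('o, 'm, 'z) tricat_scheme \<Rightarrow> 'o \<Rightarrow> bool" where
  "is_zero C x \<longleftrightarrow> x \<in> obj C \<and> idn C x = zer C x x"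

locale additive_category = category C
  for C :: "('o, 'm, 'z) tricat_scheme" (structure) +
  assumes HomG_comm_group: "\<lbrakk>x \<in> obj C; y \<in> obj C\<rbrakk> \<Longrightarrow> comm_group (HomG C x y)"
    and cmp_add_left:
      "\<lbrakk>f \<in> Mor C x y; g \<in> Mor C y z; g' \<in> Mor C y z\<rbrakk> \<Longrightarrow> add C g g' \<cdot> f = add C (g \<cdot> f) (g' \<cdot> f)"
    and cmp_add_right:
      "\<lbrakk>f \<in> Mor C x y; f' \<in> Mor C x y; g \<in> Mor C y z\<rbrakk> \<Longrightarrow> g \<cdot> add C f f' = add C (g \<cdot> f) (g \<cdot> f')"
    and zero_object: "\<exists>z. is_zero C z"
    and binary_coproducts: "\<lbrakk>x \<in> obj C; y \<in> obj C\<rbrakk> \<Longrightarrow>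
      \<exists>c \<iota>. is_coproduct C (UNIV :: bool set) (\<lambda>b. if b then x else y) c \<iota>"

definition additive_functor ::
  "('o, 'm, 'z) tricat_scheme \<Rightarrow> ('p, 'n, 'y) tricat_scheme \<Rightarrow> ('o, 'm, 'p, 'n) func \<Rightarrow> bool" where
  "additive_functor C D F \<longleftrightarrow>
     is_functor C D F \<and>
     (\<forall>x\<in>obj C. \<forall>y\<in>obj C. \<forall>f\<in>Mor C x y. \<forall>g\<in>Mor C x y. far F (add C f g) = add D (far F f) (far F g))"

fun tri_shape :: "('o, 'm, 'z) tricat_scheme \<Rightarrow> 'm \<times> 'm \<times> 'm \<Rightarrow> bool" where
  "tri_shape C (f, g, h) \<longleftrightarrow>
     f \<in> arr C \<and> g \<in> arr C \<and> h \<in> arr C \<and>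
     tgt C f = src C g \<and> tgt C g = src C h \<and> tgt C h = fob (shift C) (src C f)"

fun tri_mor ::
  "('o, 'm, 'z) tricat_scheme \<Rightarrow> 'm \<times> 'm \<times> 'm \<Rightarrow> 'm \<times> 'm \<times> 'm \<Rightarrow> 'm \<times> 'm \<times> 'm \<Rightarrow> bool" where
  "tri_mor C (f, g, h) (f', g', h') (a, b, c) \<longleftrightarrow>
     a \<in> Mor C (src C f) (src C f') \<and> b \<in> Mor C (src C g) (src C g') \<and> c \<in> Mor C (src C h) (src C h') \<and>
     b \<cdot>\<^bsub>C\<^esub> f = f' \<cdot>\<^bsub>C\<^esub> a \<and> c \<cdot>\<^bsub>C\<^esub> g = g' \<cdot>\<^bsub>C\<^esub> b \<and> far (shift C) a \<cdot>\<^bsub>C\<^esub> h = h' \<cdot>\<^bsub>C\<^esub> c"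

definition tri_iso ::
  "('o, 'm, 'z) tricat_scheme \<Rightarrow> 'm \<times> 'm \<times> 'm \<Rightarrow> 'm \<times> 'm \<times> 'm \<Rightarrow> bool" where
  "tri_iso C t t' \<longleftrightarrow>
     (\<exists>a b c. tri_mor C t t' (a, b, c) \<and> is_iso C a \<and> is_iso C b \<and> is_iso C c)"

locale triangulated_category = additive_category C
  for C :: "('o, 'm, 'z) tricat_scheme" (structure) +
  assumes shift_equivalence: "is_equivalence C C (shift C)"
    and shift_additive: "additive_functor C C (shift C)"
    and tri_tri_shape: "t \<in> tri C \<Longrightarrow> tri_shape C t"
    and TR1_iso: "\<lbrakk>t \<in> tri C; tri_shape C t'; tri_iso C t t'\<rbrakk> \<Longrightarrow> t' \<in> tri C"
    and TR1_idn: "\<lbrakk>x \<in> obj C; is_zero C z\<rbrakk> \<Longrightarrow> (idn C x, zer C x z, zer C z (fob (shift C) x)) \<in> tri C"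
    and TR1_cone: "f \<in> arr C \<Longrightarrow> \<exists>g h. (f, g, h) \<in> tri C"
    and TR2: "tri_shape C (f, g, h) \<Longrightarrow>
      (f, g, h) \<in> tri C \<longleftrightarrow> (g, h, neg C (far (shift C) f)) \<in> tri C"
    and TR3: "\<lbrakk>(f, g, h) \<in> tri C; (f', g', h') \<in> tri C;
        a \<in> Mor C (src C f) (src C f'); b \<in> Mor C (tgt C f) (tgt C f'); b \<cdot> f = f' \<cdot> a\<rbrakk> \<Longrightarrow>
      \<exists>c. tri_mor C (f, g, h) (f', g', h') (a, b, c)"
    and TR4: "\<lbrakk>(f, f1, f2) \<in> tri C; (g, g1, g2) \<in> tri C; tgt C f = src C g; (g \<cdot> f, k1, k2) \<in> tri C\<rbrakk> \<Longrightarrow>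
      \<exists>u v. (u, v, far (shift C) f1 \<cdot> g2) \<in> tri C \<and>
        u \<in> Mor C (tgt C f1) (tgt C k1) \<and> v \<in> Mor C (tgt C k1) (tgt C g1) \<and>
        u \<cdot> f1 = k1 \<cdot> g \<and> k2 \<cdot> u = f2 \<and> v \<cdot> k1 = g1 \<and> g2 \<cdot> v = far (shift C) f \<cdot> k2"

definition exact_functor ::
  "('o, 'm, 'z) tricat_scheme \<Rightarrow> ('p, 'n, 'y) tricat_scheme \<Rightarrow> ('o, 'm, 'p, 'n) func \<Rightarrow> bool" where
  "exact_functor C D F \<longleftrightarrow>
     additive_functor C D F \<and>
     (\<exists>\<phi>. (\<forall>x\<in>obj C. \<phi> x \<in> Mor D (fob F (fob (shift C) x)) (fob (shift D) (fob F x)) \<and> is_iso D (\<phi> x)) \<and>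
       (\<forall>f\<in>arr C. \<phi> (tgt C f) \<cdot>\<^bsub>D\<^esub> far F (far (shift C) f) = far (shift D) (far F f) \<cdot>\<^bsub>D\<^esub> \<phi> (src C f)) \<and>
       (\<forall>f g h. (f, g, h) \<in> tri C \<longrightarrow> (far F f, far F g, \<phi> (src C f) \<cdot>\<^bsub>D\<^esub> far F h) \<in> tri D))"

text \<open>Triangulated subcategories are full and replete, hence given by their objects. The
  two-out-of-three condition includes closure under isomorphisms and under shifts in both directions
  (apply it to the triangles \<open>x \<rightarrow> y \<rightarrow> 0 \<rightarrow> \<Sigma> x\<close> and \<open>x \<rightarrow> 0 \<rightarrow> \<Sigma> x \<rightarrow> \<Sigma> x\<close>).\<close>

definition triangulated_subcat :: "('o, 'm, 'z) tricat_scheme \<Rightarrow> 'o set \<Rightarrow> bool" where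
  "triangulated_subcat C S \<longleftrightarrow>
     S \<subseteq> obj C \<and> {z. is_zero C z} \<subseteq> S \<and>
     (\<forall>f g h. (f, g, h) \<in> tri C \<longrightarrow>
        (src C f \<in> S \<and> src C g \<in> S \<longrightarrow> src C h \<in> S) \<and>
        (src C g \<in> S \<and> src C h \<in> S \<longrightarrow> src C f \<in> S) \<and>
        (src C f \<in> S \<and> src C h \<in> S \<longrightarrow> src C g \<in> S))"

definition localizing :: "'u set \<Rightarrow> ('o, 'm, 'z) tricat_scheme \<Rightarrow> 'o set \<Rightarrow> bool" where
  "localizing U C S \<longleftrightarrow>
     triangulated_subcat C S \<and>
     (\<forall>J X c \<iota>. J \<subseteq> U \<longrightarrow> J \<prec> U \<longrightarrow> X ` J \<subseteq> S \<longrightarrow> is_coproduct C J X c \<iota> \<longrightarrow> c \<in> S)"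

text \<open>\<open>x\<close> is compact if, for each small coproduct \<open>c\<close> of objects \<open>X j\<close>, the canonical map from the
  direct sum of the groups \<open>Mor C x (X j)\<close> to \<open>Mor C x c\<close> is bijective.\<close>

definition compact_objects :: "'u set \<Rightarrow> ('o, 'm, 'z) tricat_scheme \<Rightarrow> 'o set" where
  "compact_objects U C =
     {x \<in> obj C. \<forall>J X c \<iota>. J \<subseteq> U \<longrightarrow> J \<prec> U \<longrightarrow> is_coproduct C J X c \<iota> \<longrightarrow>
        bij_betw
          (\<lambda>\<phi>. finprod (HomG C x c) (\<lambda>j. \<iota> j \<cdot>\<^bsub>C\<^esub> \<phi> j) {j \<in> J. \<phi> j \<noteq> zer C x (X j)})
          (carrier (sum_group J (\<lambda>j. HomG C x (X j)))) (Mor C x c)}"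


section \<open>Verdier quotients\<close>

text \<open>
  The Verdier quotient of \<open>C\<close> by a triangulated subcategory \<open>S\<close>, by calculus of fractions: it has the
  objects of \<open>C\<close>, and a morphism \<open>x \<rightarrow> y\<close> is an equivalence class of roofs \<open>x \<leftarrow> w \<rightarrow> y\<close>, written
  \<open>(s, f)\<close> with \<open>s : w \<rightarrow> x\<close> and \<open>f : w \<rightarrow> y\<close>, where the cone of \<open>s\<close> is in \<open>S\<close>. Operations on classes
  are defined as unions over representatives; all the classes in the union coincide.
\<close>

definition cone_in :: "('o, 'm, 'z) tricat_scheme \<Rightarrow> 'o set \<Rightarrow> 'm set" where
  "cone_in C S = {s \<in> arr C. \<exists>g h. (s, g, h) \<in> tri C \<and> tgt C g \<in> S}"

definition roofs :: "('o, 'm, 'z) tricat_scheme \<Rightarrow> 'o set \<Rightarrow> ('m \<times> 'm) set" where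
  "roofs C S = {(s, f). s \<in> cone_in C S \<and> f \<in> arr C \<and> src C s = src C f}"

definition frac :: "('o, 'm, 'z) tricat_scheme \<Rightarrow> 'o set \<Rightarrow> 'm \<Rightarrow> 'm \<Rightarrow> ('m \<times> 'm) set" where
  "frac C S s f =
     {(s', f'). (s, f) \<in> roofs C S \<and> (s', f') \<in> roofs C S \<and>
        (\<exists>u\<in>arr C. \<exists>u'\<in>arr C. src C u = src C u' \<and> tgt C u = src C s \<and> tgt C u' = src C s' \<and>
           s \<cdot>\<^bsub>C\<^esub> u = s' \<cdot>\<^bsub>C\<^esub> u' \<and> s \<cdot>\<^bsub>C\<^esub> u \<in> cone_in C S \<and> f \<cdot>\<^bsub>C\<^esub> u = f' \<cdot>\<^bsub>C\<^esub> u')}"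

definition frac_map ::
  "('o, 'm, 'z) tricat_scheme \<Rightarrow> 'o set \<Rightarrow> ('m \<Rightarrow> 'm) \<Rightarrow> ('m \<times> 'm) set \<Rightarrow> ('m \<times> 'm) set" where
  "frac_map C S F a = (\<Union>(s, f)\<in>a. frac C S (F s) (F f))"

definition quot_functor ::
  "('o, 'm, 'z) tricat_scheme \<Rightarrow> 'o set \<Rightarrow> ('o, 'm, 'o, ('m \<times> 'm) set) func" where
  "quot_functor C S = \<lparr>fob = (\<lambda>x. x), far = (\<lambda>f. frac C S (idn C (src C f)) f)\<rparr>"

text \<open>The quotient before its distinguished triangles are specified.\<close>

definition verdier_pre ::
  "('o, 'm, 'z) tricat_scheme \<Rightarrow> 'o set \<Rightarrow> ('o, ('m \<times> 'm) set) tricat" where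
  "verdier_pre C S =
     \<lparr>obj = obj C,
      arr = {frac C S s f | s f. (s, f) \<in> roofs C S},
      src = (\<lambda>a. THE x. \<forall>(s, f)\<in>a. tgt C s = x),
      tgt = (\<lambda>a. THE y. \<forall>(s, f)\<in>a. tgt C f = y),
      idn = (\<lambda>x. frac C S (idn C x) (idn C x)),
      cmp = (\<lambda>b a. \<Union>{frac C S (s \<cdot>\<^bsub>C\<^esub> t') (g \<cdot>\<^bsub>C\<^esub> f') | s f t g t' f'.
               (s, f) \<in> a \<and> (t, g) \<in> b \<and> (t', f') \<in> roofs C S \<and>
               tgt C t' = src C f \<and> tgt C f' = src C t \<and> f \<cdot>\<^bsub>C\<^esub> t' = t \<cdot>\<^bsub>C\<^esub> f'}),
      zer = (\<lambda>x y. frac C S (idn C x) (zer C x y)),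
      add = (\<lambda>a b. \<Union>{frac C S s (add C f g) | s f g. (s, f) \<in> a \<and> (s, g) \<in> b}),
      shift = \<lparr>fob = fob (shift C), far = frac_map C S (far (shift C))\<rparr>,
      tri = {}\<rparr>"

definition verdier :: "('o, 'm, 'z) tricat_scheme \<Rightarrow> 'o set \<Rightarrow> ('o, ('m \<times> 'm) set) tricat" where
  "verdier C S =
     (let N = verdier_pre C S; j = far (quot_functor C S) in
      N\<lparr>tri := {t. tri_shape N t \<and> (\<exists>(f, g, h)\<in>tri C. tri_iso N (j f, j g, j h) t)}\<rparr>)"


section \<open>Big tensor-triangulated categories\<close>

record ('o, 'm) ttcat = "('o, 'm) tricat" +
  unit :: "'o"
  tenO :: "'o \<Rightarrow> 'o \<Rightarrow> 'o"  (infixr \<open>\<boxtimes>\<index>\<close> 80)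
  tenA :: "'m \<Rightarrow> 'm \<Rightarrow> 'm"  (infixr \<open>\<boxdot>\<index>\<close> 80)
  assoc :: "'o \<Rightarrow> 'o \<Rightarrow> 'o \<Rightarrow> 'm"
  lunit :: "'o \<Rightarrow> 'm"
  runit :: "'o \<Rightarrow> 'm"
  braid :: "'o \<Rightarrow> 'o \<Rightarrow> 'm"

locale symmetric_monoidal_category = category C
  for C :: "('o, 'm, 'z) ttcat_scheme" (structure) +
  assumes unit_obj: "unit C \<in> obj C"
    and ten_obj: "\<lbrakk>x \<in> obj C; y \<in> obj C\<rbrakk> \<Longrightarrow> x \<boxtimes> y \<in> obj C"
    and ten_Mor: "\<lbrakk>f \<in> Mor C x y; f' \<in> Mor C x' y'\<rbrakk> \<Longrightarrow> f \<boxdot> f' \<in> Mor C (x \<boxtimes> x') (y \<boxtimes> y')"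
    and ten_idn: "\<lbrakk>x \<in> obj C; y \<in> obj C\<rbrakk> \<Longrightarrow> idn C x \<boxdot> idn C y = idn C (x \<boxtimes> y)"
    and ten_cmp: "\<lbrakk>f \<in> Mor C x y; g \<in> Mor C y z; f' \<in> Mor C x' y'; g' \<in> Mor C y' z'\<rbrakk> \<Longrightarrow>
      (g \<cdot> f) \<boxdot> (g' \<cdot> f') = (g \<boxdot> g') \<cdot> (f \<boxdot> f')"
    and assoc_iso: "\<lbrakk>x \<in> obj C; y \<in> obj C; z \<in> obj C\<rbrakk> \<Longrightarrow>
      assoc C x y z \<in> Mor C ((x \<boxtimes> y) \<boxtimes> z) (x \<boxtimes> (y \<boxtimes> z)) \<and> is_iso C (assoc C x y z)"
    and assoc_natural: "\<lbrakk>f \<in> Mor C x x'; g \<in> Mor C y y'; h \<in> Mor C z z'\<rbrakk> \<Longrightarrow>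
      assoc C x' y' z' \<cdot> ((f \<boxdot> g) \<boxdot> h) = (f \<boxdot> (g \<boxdot> h)) \<cdot> assoc C x y z"
    and lunit_iso: "x \<in> obj C \<Longrightarrow> lunit C x \<in> Mor C (unit C \<boxtimes> x) x \<and> is_iso C (lunit C x)"
    and lunit_natural: "f \<in> Mor C x y \<Longrightarrow> lunit C y \<cdot> (idn C (unit C) \<boxdot> f) = f \<cdot> lunit C x"
    and runit_iso: "x \<in> obj C \<Longrightarrow> runit C x \<in> Mor C (x \<boxtimes> unit C) x \<and> is_iso C (runit C x)"
    and runit_natural: "f \<in> Mor C x y \<Longrightarrow> runit C y \<cdot> (f \<boxdot> idn C (unit C)) = f \<cdot> runit C x"
    and braid_Mor: "\<lbrakk>x \<in> obj C; y \<in> obj C\<rbrakk> \<Longrightarrow> braid C x y \<in> Mor C (x \<boxtimes> y) (y \<boxtimes> x)"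
    and braid_natural: "\<lbrakk>f \<in> Mor C x x'; g \<in> Mor C y y'\<rbrakk> \<Longrightarrow>
      braid C x' y' \<cdot> (f \<boxdot> g) = (g \<boxdot> f) \<cdot> braid C x y"
    and braid_symmetric: "\<lbrakk>x \<in> obj C; y \<in> obj C\<rbrakk> \<Longrightarrow> braid C y x \<cdot> braid C x y = idn C (x \<boxtimes> y)"
    and pentagon: "\<lbrakk>w \<in> obj C; x \<in> obj C; y \<in> obj C; z \<in> obj C\<rbrakk> \<Longrightarrow>
      (idn C w \<boxdot> assoc C x y z) \<cdot> assoc C w (x \<boxtimes> y) z \<cdot> (assoc C w x y \<boxdot> idn C z) =
      assoc C w x (y \<boxtimes> z) \<cdot> assoc C (w \<boxtimes> x) y z"
    and triangle: "\<lbrakk>x \<in> obj C; y \<in> obj C\<rbrakk> \<Longrightarrow>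
      (idn C x \<boxdot> lunit C y) \<cdot> assoc C x (unit C) y = runit C x \<boxdot> idn C y"
    and hexagon: "\<lbrakk>x \<in> obj C; y \<in> obj C; z \<in> obj C\<rbrakk> \<Longrightarrow>
      assoc C y z x \<cdot> braid C x (y \<boxtimes> z) \<cdot> assoc C x y z =
      (idn C y \<boxdot> braid C x z) \<cdot> assoc C y x z \<cdot> (braid C x y \<boxdot> idn C z)"

definition ltensor :: "('o, 'm, 'z) ttcat_scheme \<Rightarrow> 'o \<Rightarrow> ('o, 'm, 'o, 'm) func" where
  "ltensor C x = \<lparr>fob = (\<lambda>y. x \<boxtimes>\<^bsub>C\<^esub> y), far = (\<lambda>f. idn C x \<boxdot>\<^bsub>C\<^esub> f)\<rparr>"

definition rtensor :: "('o, 'm, 'z) ttcat_scheme \<Rightarrow> 'o \<Rightarrow> ('o, 'm, 'o, 'm) func" where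
  "rtensor C x = \<lparr>fob = (\<lambda>y. y \<boxtimes>\<^bsub>C\<^esub> x), far = (\<lambda>f. f \<boxdot>\<^bsub>C\<^esub> idn C x)\<rparr>"

text \<open>Rigid means dualizable: there are a dual \<open>d\<close>, a coevaluation \<open>\<eta> : 1 \<rightarrow> d \<otimes> x\<close> and an evaluation
  \<open>\<epsilon> : x \<otimes> d \<rightarrow> 1\<close> satisfying the two triangle identities.\<close>

definition rigid_objects :: "('o, 'm, 'z) ttcat_scheme \<Rightarrow> 'o set" where
  "rigid_objects C =
     {x \<in> obj C. \<exists>d\<in>obj C. \<exists>\<eta>\<in>Mor C (unit C) (d \<boxtimes>\<^bsub>C\<^esub> x). \<exists>\<epsilon>\<in>Mor C (x \<boxtimes>\<^bsub>C\<^esub> d) (unit C).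
        lunit C x \<cdot>\<^bsub>C\<^esub> (\<epsilon> \<boxdot>\<^bsub>C\<^esub> idn C x) \<cdot>\<^bsub>C\<^esub> inv_arr C (assoc C x d x) \<cdot>\<^bsub>C\<^esub> (idn C x \<boxdot>\<^bsub>C\<^esub> \<eta>) = runit C x \<and>
        runit C d \<cdot>\<^bsub>C\<^esub> (idn C d \<boxdot>\<^bsub>C\<^esub> \<epsilon>) \<cdot>\<^bsub>C\<^esub> assoc C d x d \<cdot>\<^bsub>C\<^esub> (\<eta> \<boxdot>\<^bsub>C\<^esub> idn C d) = lunit C d}"

locale tensor_triangulated_category = triangulated_category C + symmetric_monoidal_category C
  for C :: "('o, 'm, 'z) ttcat_scheme" (structure) +
  assumes ltensor_exact: "x \<in> obj C \<Longrightarrow> exact_functor C C (ltensor C x)"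
    and rtensor_exact: "x \<in> obj C \<Longrightarrow> exact_functor C C (rtensor C x)"

locale big_tt_category = tensor_triangulated_category T
  for U :: "'u set" and T :: "('o, 'm, 'z) ttcat_scheme" (structure) +
  assumes universe: "universe U"
    and locally_small: "\<lbrakk>x \<in> obj T; y \<in> obj T\<rbrakk> \<Longrightarrow> Mor T x y \<prec> U"
    and coproducts: "\<lbrakk>J \<subseteq> U; J \<prec> U; X ` J \<subseteq> obj T\<rbrakk> \<Longrightarrow> \<exists>c \<iota>. is_coproduct T J X c \<iota>"
    and ltensor_coproducts: "x \<in> obj T \<Longrightarrow> preserves_coproducts U T T (ltensor T x)"
    and rtensor_coproducts: "x \<in> obj T \<Longrightarrow> preserves_coproducts U T T (rtensor T x)"
    and compactly_generated: "\<lbrakk>localizing U T L; compact_objects U T \<subseteq> L\<rbrakk> \<Longrightarrow> L = obj T"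
    and compact_essentially_small:
      "\<exists>K\<subseteq>compact_objects U T. K \<prec> U \<and> (\<forall>x\<in>compact_objects U T. \<exists>y\<in>K. isomorphic T x y)"
    and compact_triangulated: "triangulated_subcat T (compact_objects U T)"
    and compact_unit: "unit T \<in> compact_objects U T"
    and compact_tensor:
      "\<lbrakk>x \<in> compact_objects U T; y \<in> compact_objects U T\<rbrakk> \<Longrightarrow> x \<boxtimes> y \<in> compact_objects U T"
    and compact_eq_rigid: "compact_objects U T = rigid_objects T"


section \<open>Brown--Comenetz duals\<close>

definition QZ :: "rat set monoid" where
  "QZ = \<lparr>carrier = (UNIV :: rat set), monoid.mult = (+), one = 0\<rparr> Mod \<int>"

text \<open>The elements of \<open>Hom\<^sub>\<int>(Mor x y, \<rat>/\<int>)\<close> are represented by extensional functions.\<close>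

definition char_group :: "('o, 'm, 'z) tricat_scheme \<Rightarrow> 'o \<Rightarrow> 'o \<Rightarrow> ('m \<Rightarrow> rat set) set" where
  "char_group C x y = hom (HomG C x y) QZ \<inter> extensional (Mor C x y)"

text \<open>\<open>d\<close> represents the contravariant functor \<open>y \<mapsto> Hom\<^sub>\<int>(Mor x y, \<rat>/\<int>)\<close>.\<close>

definition brown_comenetz_dual :: "('o, 'm, 'z) tricat_scheme \<Rightarrow> 'o \<Rightarrow> 'o \<Rightarrow> bool" where
  "brown_comenetz_dual C x d \<longleftrightarrow>
     d \<in> obj C \<and>
     (\<exists>\<Phi>. (\<forall>y\<in>obj C. bij_betw (\<Phi> y) (Mor C y d) (char_group C x y)) \<and>
       (\<forall>u\<in>arr C. \<forall>a\<in>Mor C (tgt C u) d.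
          \<Phi> (src C u) (a \<cdot>\<^bsub>C\<^esub> u) = (\<lambda>b\<in>Mor C x (src C u). \<Phi> (tgt C u) a (u \<cdot>\<^bsub>C\<^esub> b))))"

text \<open>The object \<open>I\<close>, unique up to isomorphism.\<close>

definition BC :: "'u set \<Rightarrow> ('o, 'm, 'z) tricat_scheme \<Rightarrow> 'o" where
  "BC U C =
     (SOME I. \<exists>K D \<pi>.
        K \<subseteq> compact_objects U C \<and> (\<forall>x\<in>compact_objects U C. \<exists>!y. y \<in> K \<and> isomorphic C x y) \<and>
        (\<forall>x\<in>K. brown_comenetz_dual C x (D x)) \<and> is_product C K D I \<pi>)"


section \<open>Smashing ideals and the smashing spectrum\<close>

definition localizing_ideal :: "'u set \<Rightarrow> ('o, 'm, 'z) ttcat_scheme \<Rightarrow> 'o set \<Rightarrow> bool" where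
  "localizing_ideal U T S \<longleftrightarrow> localizing U T S \<and> (\<forall>x\<in>obj T. \<forall>s\<in>S. x \<boxtimes>\<^bsub>T\<^esub> s \<in> S)"

definition smashing :: "'u set \<Rightarrow> ('o, 'm, 'z) ttcat_scheme \<Rightarrow> 'o set \<Rightarrow> bool" where
  "smashing U T S \<longleftrightarrow>
     localizing_ideal U T S \<and>
     (\<exists>k. is_functor (verdier T S) T k \<and> adjoint T (verdier T S) (quot_functor T S) k \<and>
        preserves_coproducts U (verdier T S) T k)"

definition kfun ::
  "('o, 'm, 'z) ttcat_scheme \<Rightarrow> 'o set \<Rightarrow> ('o, ('m \<times> 'm) set, 'o, 'm) func" where
  "kfun T S = right_adjoint T (verdier T S) (quot_functor T S)"

definition ellfun ::
  "('o, 'm, 'z) ttcat_scheme \<Rightarrow> 'o set \<Rightarrow> ('o, 'm, 'o, ('m \<times> 'm) set) func" where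
  "ellfun T S = right_adjoint (verdier T S) T (kfun T S)"

definition localization_functor :: "('o, 'm, 'z) ttcat_scheme \<Rightarrow> 'o set \<Rightarrow> ('o, 'm, 'o, 'm) func" where
  "localization_functor T S = func_comp (kfun T S) (quot_functor T S)"

text \<open>The acyclization functor is the right adjoint of the inclusion of \<open>S\<close>, viewed as an endofunctor
  of \<open>T\<close>; the inclusion is the identity on objects and morphisms.\<close>

definition acyclization_functor :: "('o, 'm, 'z) ttcat_scheme \<Rightarrow> 'o set \<Rightarrow> ('o, 'm, 'o, 'm) func" where
  "acyclization_functor T S = right_adjoint (full_subcat T S) T \<lparr>fob = (\<lambda>x. x), far = (\<lambda>f. f)\<rparr>"

definition left_idem :: "('o, 'm, 'z) ttcat_scheme \<Rightarrow> 'o set \<Rightarrow> 'o" where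
  "left_idem T S = fob (acyclization_functor T S) (unit T)"

definition right_idem :: "('o, 'm, 'z) ttcat_scheme \<Rightarrow> 'o set \<Rightarrow> 'o" where
  "right_idem T S = fob (localization_functor T S) (unit T)"

text \<open>The ordered set of smashing ideals is a spatial frame: it is isomorphic to the lattice of open
  sets of a topological space. The points of such a space can be taken to be meet-prime elements of
  the frame, so it is no restriction to ask for a topology on a set of elements of type \<open>'o set\<close>.\<close>

definition smashing_frame_spatial :: "'u set \<Rightarrow> ('o, 'm, 'z) ttcat_scheme \<Rightarrow> bool" where
  "smashing_frame_spatial U T \<longleftrightarrow>
     (\<exists>(X :: 'o set topology) \<phi>. bij_betw \<phi> {S. smashing U T S} {V. openin X V} \<and>
        (\<forall>S S'. smashing U T S \<longrightarrow> smashing U T S' \<longrightarrow> (S \<subseteq> S' \<longleftrightarrow> \<phi> S \<subseteq> \<phi> S')))"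

text \<open>As usual for prime elements of a lattice, the top element is not prime.\<close>

definition Spcs :: "'u set \<Rightarrow> ('o, 'm, 'z) ttcat_scheme \<Rightarrow> 'o set set" where
  "Spcs U T =
     {P. smashing U T P \<and> P \<noteq> obj T \<and>
        (\<forall>S1 S2. smashing U T S1 \<longrightarrow> smashing U T S2 \<longrightarrow> S1 \<inter> S2 \<subseteq> P \<longrightarrow> S1 \<subseteq> P \<or> S2 \<subseteq> P)}"

definition Spcs_open :: "'u set \<Rightarrow> ('o, 'm, 'z) ttcat_scheme \<Rightarrow> 'o set \<Rightarrow> 'o set set" where
  "Spcs_open U T S = {P \<in> Spcs U T. \<not> S \<subseteq> P}"

definition Spcs_closed :: "'u set \<Rightarrow> ('o, 'm, 'z) ttcat_scheme \<Rightarrow> 'o set \<Rightarrow> 'o set set" where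
  "Spcs_closed U T S = {P \<in> Spcs U T. S \<subseteq> P}"

definition Spcs_TD :: "'u set \<Rightarrow> ('o, 'm, 'z) ttcat_scheme \<Rightarrow> bool" where
  "Spcs_TD U T \<longleftrightarrow>
     (\<forall>P\<in>Spcs U T. \<exists>S S'. smashing U T S \<and> smashing U T S' \<and> {P} = Spcs_open U T S \<inter> Spcs_closed U T S')"

definition Gam :: "'u set \<Rightarrow> ('o, 'm, 'z) ttcat_scheme \<Rightarrow> 'o set \<Rightarrow> 'o" where
  "Gam U T P =
     (let S = (SOME S. smashing U T S \<and> {P} = Spcs_open U T S \<inter> Spcs_closed U T P)
      in left_idem T S \<boxtimes>\<^bsub>T\<^esub> right_idem T P)"


section \<open>Modules and costratification\<close>

text \<open>
  A triangulated category on which \<open>T\<close> acts, together with the object playing the role of \<open>I\<^sub>N\<close>: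
  \<open>act N x\<close> is the endofunctor \<open>x \<^emph>\<open>*\<close> -\<close> of \<open>N\<close>. The two instances considered are \<open>T\<close> itself, acting
  by the tensor product, and the quotients \<open>T / M\<close>.
\<close>

record ('p, 'n, 'o) ttmodule = "('p, 'n) tricat" +
  act :: "'o \<Rightarrow> ('p, 'n, 'p, 'n) func"
  cogen :: "'p"

definition regular_module :: "'u set \<Rightarrow> ('o, 'm, 'z) ttcat_scheme \<Rightarrow> ('o, 'm, 'o) ttmodule" where
  "regular_module U T = tricat.extend (tricat.truncate T) (ttmodule.fields (ltensor T) (BC U T))"

definition quotient_module ::
  "'u set \<Rightarrow> ('o, 'm, 'z) ttcat_scheme \<Rightarrow> 'o set \<Rightarrow> ('o, ('m \<times> 'm) set, 'o) ttmodule" where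
  "quotient_module U T M =
     tricat.extend (verdier T M)
       (ttmodule.fields
          (\<lambda>x. \<lparr>fob = fob (ltensor T x), far = frac_map T M (far (ltensor T x))\<rparr>)
          (fob (ellfun T M) (BC U T)))"

definition hom_star :: "('p, 'n, 'o) ttmodule \<Rightarrow> 'o \<Rightarrow> 'p \<Rightarrow> 'p" where
  "hom_star N x a = fob (right_adjoint N N (act N x)) a"

definition hom_submodule ::
  "'u set \<Rightarrow> ('o, 'm, 'z) ttcat_scheme \<Rightarrow> ('p, 'n, 'o) ttmodule \<Rightarrow> 'p set \<Rightarrow> bool" where
  "hom_submodule U T N C \<longleftrightarrow>
     triangulated_subcat N C \<and>
     (\<forall>J A p \<pi>. J \<subseteq> U \<longrightarrow> J \<prec> U \<longrightarrow> A ` J \<subseteq> C \<longrightarrow> is_product N J A p \<pi> \<longrightarrow> p \<in> C) \<and>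
     (\<forall>x\<in>obj T. \<forall>a\<in>C. hom_star N x a \<in> C)"

definition coloc ::
  "'u set \<Rightarrow> ('o, 'm, 'z) ttcat_scheme \<Rightarrow> ('p, 'n, 'o) ttmodule \<Rightarrow> 'p set \<Rightarrow> 'p set" where
  "coloc U T N A = \<Inter>{C. hom_submodule U T N C \<and> A \<subseteq> C}"

text \<open>For \<open>N = T\<close> this is the small smashing cosupport.\<close>

definition cosupp ::
  "'u set \<Rightarrow> ('o, 'm, 'z) ttcat_scheme \<Rightarrow> ('p, 'n, 'o) ttmodule \<Rightarrow> 'p \<Rightarrow> 'o set set" where
  "cosupp U T N a = {Q \<in> Spcs U T. \<not> is_zero N (hom_star N (Gam U T Q) a)}"

definition cominimality ::
  "'u set \<Rightarrow> ('o, 'm, 'z) ttcat_scheme \<Rightarrow> ('p, 'n, 'o) ttmodule \<Rightarrow> bool" where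
  "cominimality U T N \<longleftrightarrow>
     (\<forall>Q\<in>Spcs U T. \<forall>C. hom_submodule U T N C \<longrightarrow>
        C \<subseteq> coloc U T N {hom_star N (Gam U T Q) (cogen N)} \<longrightarrow>
        C = {a. is_zero N a} \<or> C = coloc U T N {hom_star N (Gam U T Q) (cogen N)})"

definition colocal_to_global ::
  "'u set \<Rightarrow> ('o, 'm, 'z) ttcat_scheme \<Rightarrow> ('p, 'n, 'o) ttmodule \<Rightarrow> bool" where
  "colocal_to_global U T N \<longleftrightarrow>
     (\<forall>a\<in>obj N. coloc U T N {a} = coloc U T N {hom_star N (Gam U T Q) a | Q. Q \<in> Spcs U T})"

definition costratified ::
  "'u set \<Rightarrow> ('o, 'm, 'z) ttcat_scheme \<Rightarrow> ('p, 'n, 'o) ttmodule \<Rightarrow> bool" where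
  "costratified U T N \<longleftrightarrow>
     (let \<theta> = (\<lambda>W. {a \<in> obj N. cosupp U T N a \<subseteq> W});
          \<sigma> = (\<lambda>C. \<Union>a\<in>C. cosupp U T N a);
          \<W> = Pow (cosupp U T N (cogen N));
          \<C> = {C. hom_submodule U T N C}
      in \<theta> ` \<W> \<subseteq> \<C> \<and> \<sigma> ` \<C> \<subseteq> \<W> \<and>
         (\<forall>W\<in>\<W>. \<sigma> (\<theta> W) = W) \<and> (\<forall>C\<in>\<C>. \<theta> (\<sigma> C) = C))"

end

theory Submission
  imports "HOL-Algebra.Multiplicative_Group" Defs
begin

text \<open>
  A prime \<open>P\<close> yields a localization of \<open>T\<close>: the quotient \<open>T / P\<close> is equivalent to the category
  \<open>P\<^sup>\<bottom>\<close> of local objects, and the reflection is \<open>X \<mapsto> f\<^sub>P \<otimes> X\<close> (\<open>tensor_localization\<close>). Under this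
  equivalence the action of \<open>[X, -]\<close> on \<open>T / P\<close> becomes the internal hom of \<open>T\<close>, and the object
  \<open>I\<close> of \<open>T / P\<close> becomes \<open>[f\<^sub>P, I]\<close>. So the submodules of \<open>T / P\<close> are the submodules of \<open>T\<close> that
  consist of local objects (\<open>locals_pullback\<close>, \<open>pullback_locals\<close>), and all statements about \<open>T / P\<close> are
  statements about submodules of \<open>T\<close>.

  Cominimality of \<open>T / P\<close> at \<open>Q\<close> then says that \<open>coloc [\<Gamma>\<^sub>Q, [f\<^sub>P, I]]\<close>, or
  \<open>coloc [f\<^sub>P \<otimes> \<Gamma>\<^sub>Q, I]\<close>, is minimal. Here \<open>f\<^sub>P \<otimes> \<Gamma>\<^sub>Q\<close> is \<open>\<Gamma>\<^sub>Q\<close> if \<open>P \<subseteq> Q\<close> and zero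
  otherwise (\<open>Gam_right_idem\<close>, \<open>Gam_right_idem_zero\<close>). The second case is where spatiality enters: joins of
  smashing ideals must be detected by primes. Thus \<open>T / P\<close> tests the primes that contain \<open>P\<close>, among
  them \<open>P\<close> itself, which proves (a).

  For (b), let \<open>X\<close> be a submodule of \<open>T\<close> generated by one object \<open>c\<close>; the cases of interest are
  \<open>X = T\<close>, \<open>c = I\<close> and \<open>X = P\<^sup>\<bottom>\<close>, \<open>c = [f\<^sub>P, I]\<close>. Because the \<open>\<Gamma>\<^sub>Q\<close> are orthogonal idempotents,
  costratification of \<open>X\<close> makes every \<open>coloc [\<Gamma>\<^sub>Q, c]\<close> minimal (\<open>costratifies_minimal\<close>), and the converse holds
  under the colocal-to-global principle (\<open>minimal_costratifies\<close>). So (b) follows from (a).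

  The generation of \<open>T\<close> by \<open>I\<close> is Brown--Comenetz duality: characters separate the elements of
  an abelian group, so each object maps to a product of copies of \<open>I\<close> by a map that compact objects see as
  injective, and iterating on the fibres gives a tower with vanishing limit (\<open>BC_cogenerates\<close>). The
  existence of products, internal homs and Brown--Comenetz duals is Brown representability
  (\<open>brown_representability\<close>).

  The composite of \<open>f\<close> and \<open>g\<close> is written \<open>g ** f\<close>; the tensor products of objects and of morphisms
  are written \<open>><\<close> and \<open>##\<close>.
\<close>

notation cmp (infixr \<open>**\<index>\<close> 75)
notation tenO (infixr \<open>><\<index>\<close> 80)
notation tenA (infixr \<open>##\<index>\<close> 80)

section \<open>Small sets\<close>

lemma small_image: "A \<prec> U ==> f ` A \<prec> U"
 by (rule lesspoll_trans1[OF image_lepoll])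

lemma small_subset: "A \<prec> U ==> B \<subseteq> A ==> B \<prec> U"
 by (rule lesspoll_trans1[OF subset_imp_lepoll])

lemma small_reindex:
 assumes "A \<prec> U"
 obtains J f where "J \<subseteq> U" "J \<prec> U" "bij_betw f J A"
proof -
 obtain g where g: "inj_on g A" "g ` A \<subseteq> U" using assms unfolding lesspoll_def lepoll_def by blast
 have b: "bij_betw (inv_into A g) (g ` A) A" using g(1) by (simp add: bij_betw_inv_into inj_on_imp_bij_betw)
 show ?thesis by (rule that[OF g(2) small_image[OF assms] b])
qed

lemma universe_infinite: "universe U ==> infinite U"
 by (simp add: universe_def infinite_le_lepoll lesspoll_imp_lepoll)

lemma countable_small: "universe U ==> countable A ==> A \<prec> U"
proof -
 assume U: "universe U" and "countable A"
 then have "A \<lesssim> (UNIV :: nat set)" unfolding countable_def lepoll_def by blast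
 moreover have "(UNIV :: nat set) \<prec> U" using U unfolding universe_def by (rule conjunct1)
 ultimately show ?thesis by (rule lesspoll_trans1)
qed

lemma small_Pow:
 assumes U: "universe U" and A: "A \<prec> U"
 shows "Pow A \<prec> U"
proof -
 obtain J f where J: "J \<subseteq> U" "J \<prec> U" "bij_betw f J A" using small_reindex[OF A] .
 have "Pow A \<approx> Pow J" using bij_betw_Pow[OF J(3)] eqpoll_sym unfolding eqpoll_def by metis
 moreover have "Pow J \<prec> U" using U J unfolding universe_def by blast
 ultimately show ?thesis by (rule eq_lesspoll_trans)
qed

text \<open>The axiom on unions speaks of subsets of \<open>U\<close>. The summands are moved into disjoint
  subsets of \<open>U\<close> with an injection \<open>U \<times> U \<rightarrow> U\<close>.\<close>

lemma small_Sigma: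
 assumes U: "universe U" and A: "A \<prec> U" and F: "!!a. a : A ==> F a \<prec> U"
 shows "Sigma A F \<prec> U"
proof -
 obtain p where p: "inj_on p (U \<times> U)" "p ` (U \<times> U) \<subseteq> U"
  using card_of_Times_same_infinite[OF universe_infinite[OF U]] ordIso_imp_ordLeq
   card_of_ordLeq[of "U \<times> U" U] by blast
 obtain i where i: "inj_on i A" "i ` A \<subseteq> U" using A unfolding lesspoll_def lepoll_def by blast
 have "ALL a:A. EX g. inj_on g (F a) & g ` F a \<subseteq> U" using F unfolding lesspoll_def lepoll_def by blast
 then obtain g where g: "!!a. a : A ==> inj_on (g a) (F a)" "!!a. a : A ==> g a ` F a \<subseteq> U" by metis
 define G where "G b = (%x. p (b, g (inv_into A i b) x)) ` F (inv_into A i b)" for b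
 have inv: "inv_into A i (i a) = a" if "a : A" for a using i that by simp
 have Gi: "G (i a) = (%x. p (i a, g a x)) ` F a" if "a : A" for a using inv[OF that] by (simp add: G_def)
 have "(\<Union>b\<in>i ` A. G b) \<prec> U"
 proof -
  have "i ` A \<subseteq> U" "i ` A \<prec> U" by (fact i(2), rule small_image[OF A])
  moreover have "G b \<subseteq> U & G b \<prec> U" if "b : i ` A" for b
  proof -
   obtain a where a: "a : A" "b = i a" using \<open>b : i ` A\<close> by blast
   have "G b \<subseteq> U" unfolding a(2) Gi[OF a(1)] using p(2) i(2) g(2)[OF a(1)] a(1) by (auto simp: image_subset_iff)
   moreover have "G b \<prec> U" unfolding a(2) Gi[OF a(1)] using small_image[OF F[OF a(1)]] .
   ultimately show ?thesis by blast
  qed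
  ultimately show ?thesis using U unfolding universe_def by blast
 qed
 moreover have "Sigma A F \<lesssim> (\<Union>b\<in>i ` A. G b)"
 proof -
  have "inj_on (%(a, x). p (i a, g a x)) (Sigma A F)"
  proof (rule inj_onI, clarify)
   fix a x a' x' assume h: "a : A" "x : F a" "a' : A" "x' : F a'" "p (i a, g a x) = p (i a', g a' x')"
   have "(i a, g a x) : U \<times> U" "(i a', g a' x') : U \<times> U" using h g(2)[OF h(1)] g(2)[OF h(3)] i(2) by auto
   then have "(i a, g a x) = (i a', g a' x')" using p(1) h(5) by (meson inj_onD)
   then have "a = a'" "g a x = g a' x'" using i(1) h(1,3) by (auto dest: inj_onD)
   then show "a = a' & x = x'" using g(1) h by (auto dest: inj_onD)
  qed
  moreover have "(%(a, x). p (i a, g a x)) ` Sigma A F \<subseteq> (\<Union>b\<in>i ` A. G b)" using Gi by auto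
  ultimately show ?thesis unfolding lepoll_def by blast
 qed
 ultimately show ?thesis by (rule lesspoll_trans1[rotated])
qed

lemma small_PiE:
 assumes U: "universe U" and A: "A \<prec> U" and F: "!!a. a : A ==> F a \<prec> U"
 shows "PiE A F \<prec> U"
proof -
 have "inj_on (%f. (%a. (a, f a)) ` A) (PiE A F)"
 proof (rule inj_onI)
  fix f g assume fg: "f : PiE A F" "g : PiE A F" "(%a. (a, f a)) ` A = (%a. (a, g a)) ` A"
  have "f a = g a" if "a : A" for a
  proof -
   have "(a, f a) : (%a. (a, g a)) ` A" using that fg(3) by blast
   then show ?thesis by auto
  qed
  then show "f = g" using fg(1,2) by (meson PiE_ext)
 qed
 moreover have "(%f. (%a. (a, f a)) ` A) ` PiE A F \<subseteq> Pow (Sigma A F)" by auto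
 ultimately have "PiE A F \<lesssim> Pow (Sigma A F)" unfolding lepoll_def by blast
 then show ?thesis by (rule lesspoll_trans1[OF _ small_Pow[OF U small_Sigma[OF U A F]]])
qed

section \<open>Categories, functors and universal arrows\<close>

lemma in_Mor [simp]: "f : Mor C x y \<longleftrightarrow> f : arr C & src C f = x & tgt C f = y"
 by (auto simp: Mor_def)

context category begin

abbreviation "Hom \<equiv> Mor C"
abbreviation "Ob \<equiv> obj C"

lemma arr_cmp [simp]: "f : arr C ==> g : arr C ==> src C g = tgt C f ==> g ** f : arr C"
 and src_cmp [simp]: "f : arr C ==> g : arr C ==> src C g = tgt C f ==> src C (g ** f) = src C f"
 and tgt_cmp [simp]: "f : arr C ==> g : arr C ==> src C g = tgt C f ==> tgt C (g ** f) = tgt C g"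
 using cmp_Mor[of f "src C f" "tgt C f" g "tgt C g"] by auto

lemma assoc_cmp [simp]:
 "f : arr C ==> g : arr C ==> h : arr C ==> src C g = tgt C f ==> src C h = tgt C g ==>
 (h ** g) ** f = h ** (g ** f)" using cmp_assoc[of f "src C f" "tgt C f" g "tgt C g" h "tgt C h"] by auto

lemma arr_idn [simp]: "x : Ob ==> idn C x : arr C"
 and src_idn [simp]: "x : Ob ==> src C (idn C x) = x"
 and tgt_idn [simp]: "x : Ob ==> tgt C (idn C x) = x" using idn_Mor[of x] by auto

lemma idn_left [simp]: "f : arr C ==> tgt C f = x ==> idn C x ** f = f"
 and idn_right [simp]: "f : arr C ==> src C f = x ==> f ** idn C x = f"
 using idn_cmp[of f "src C f" "tgt C f"] cmp_idn[of f "src C f" "tgt C f"] by auto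

lemma Mor_objs: "f : Hom x y ==> x : Ob & y : Ob"
 using src_obj tgt_obj by auto

declare src_obj [simp] tgt_obj [simp]

text \<open>Rewriting with an equation between composites inside a longer right-nested composite.\<close>

lemma pre_eq:
 "h ** g = k ==> h : arr C ==> g : arr C ==> src C h = tgt C g ==>
 f : arr C ==> src C g = tgt C f ==> h ** (g ** f) = k ** f" using assoc_cmp by auto

lemma inverse_arrowsI:
 "f : Hom x y ==> g : Hom y x ==> g ** f = idn C x ==> f ** g = idn C y ==> inverse_arrows C f g" by (auto simp: inverse_arrows_def)

lemma inverse_unique:
 assumes "inverse_arrows C f g" "inverse_arrows C f g'"
 shows "g = g'"
proof -
 have g: "f : arr C" "g : arr C" "src C g = tgt C f" "tgt C g = src C f"
  "g' : arr C" "src C g' = tgt C f" "tgt C g' = src C f" and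
  e: "g ** f = idn C (src C f)" "f ** g' = idn C (tgt C f)" using assms by (auto simp: inverse_arrows_def)
 have "g = g ** (f ** g')" using g e by simp
 also have "\<dots> = (g ** f) ** g'" using g by simp
 also have "\<dots> = g'" using g e by simp
 finally show ?thesis .
qed

lemma inv_arr_inverse: "is_iso C f ==> inverse_arrows C f (inv_arr C f)"
 unfolding is_iso_def inv_arr_def using inverse_unique theI' by metis

lemma is_isoE:
 assumes "is_iso C f" "f : Hom x y"
 obtains g where "g : Hom y x" "g ** f = idn C x" "f ** g = idn C y" "is_iso C g"
proof -
 obtain g where g: "inverse_arrows C f g" using assms unfolding is_iso_def by blast
 then have "inverse_arrows C g f" using assms by (auto simp: inverse_arrows_def)
 then have "is_iso C g" unfolding is_iso_def by blast
 then show ?thesis using g assms that[of g] by (auto simp: inverse_arrows_def)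
qed

lemma is_isoI:
 "f : Hom x y ==> g : Hom y x ==> g ** f = idn C x ==> f ** g = idn C y ==> is_iso C f" unfolding is_iso_def using inverse_arrowsI by blast

lemma is_iso_idn [simp]: "x : Ob ==> is_iso C (idn C x)"
 by (rule is_isoI[of _ x x "idn C x"]) auto

lemma is_iso_arr: "is_iso C f ==> f : arr C"
 by (auto simp: is_iso_def inverse_arrows_def)

lemma is_iso_cmp:
 assumes "is_iso C f" "is_iso C g" "src C g = tgt C f"
 shows "is_iso C (g ** f)"
proof -
 have a: "f : arr C" "g : arr C" using assms is_iso_arr by auto
 obtain f' where f': "f' : Hom (tgt C f) (src C f)" "f' ** f = idn C (src C f)" "f ** f' = idn C (tgt C f)"
  using is_isoE[OF assms(1), of "src C f" "tgt C f"] a by auto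
 obtain g' where g': "g' : Hom (tgt C g) (src C g)" "g' ** g = idn C (src C g)" "g ** g' = idn C (tgt C g)"
  using is_isoE[OF assms(2), of "src C g" "tgt C g"] a by auto
 show ?thesis by (rule is_isoI[of _ "src C f" "tgt C g" "f' ** g'"])
   (use a f' g' assms in \<open>auto simp: pre_eq[OF g'(2)] pre_eq[OF f'(3)]\<close>)
qed

lemma iso_of_left_right:
 assumes "f : Hom x y" "is_iso C (g ** f)" "g : Hom y x'" "is_iso C (f ** h)" "h : Hom y' x"
 shows "is_iso C f"
proof -
 obtain a where a: "a : Hom x' x" "a ** (g ** f) = idn C x" using assms is_isoE[OF assms(2), of x x'] by auto
 obtain b where b: "b : Hom y y'" "(f ** h) ** b = idn C y" using assms is_isoE[OF assms(4), of y' y] by auto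
 have ob: "x : Ob" "y : Ob" using assms Mor_objs by blast+
 have "a ** g = (a ** g) ** ((f ** h) ** b)" unfolding b(2) using a(1) assms ob by simp
 also have "\<dots> = (a ** (g ** f)) ** (h ** b)" using a(1) b(1) assms ob by simp
 also have "\<dots> = h ** b" unfolding a(2) using b(1) assms by simp
 finally have e: "a ** g = h ** b" .
 have "f ** (a ** g) = idn C y" unfolding e using b assms by simp
 moreover have "(a ** g) ** f = idn C x" using a assms by simp
 ultimately show ?thesis using is_isoI[of f x y "a ** g"] assms a by auto
qed

lemma isomorphicI: "f : Hom x y ==> is_iso C f ==> isomorphic C x y"
 unfolding isomorphic_def by blast

lemma isomorphicE:
 assumes "isomorphic C x y"
 obtains f g where "f : Hom x y" "g : Hom y x" "g ** f = idn C x" "f ** g = idn C y"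
  "is_iso C f" "is_iso C g" "x : Ob" "y : Ob"
proof -
 obtain f where f: "f : Hom x y" "is_iso C f" using assms unfolding isomorphic_def by blast
 obtain g where "g : Hom y x" "g ** f = idn C x" "f ** g = idn C y" "is_iso C g" using is_isoE[OF f(2,1)] .
 then show ?thesis using that f Mor_objs[OF f(1)] by blast
qed

lemma isomorphic_refl: "x : Ob ==> isomorphic C x x"
 using isomorphicI[of "idn C x" x x] by auto

lemma isomorphic_sym: "isomorphic C x y ==> isomorphic C y x"
 using isomorphicE isomorphicI by metis

lemma isomorphic_trans:
 assumes "isomorphic C x y" "isomorphic C y z" shows "isomorphic C x z"
proof -
 obtain f where f: "f : Hom x y" "is_iso C f" using assms(1) unfolding isomorphic_def by blast
 obtain g where g: "g : Hom y z" "is_iso C g" using assms(2) unfolding isomorphic_def by blast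
 show ?thesis by (rule isomorphicI[of "g ** f"]) (use f g is_iso_cmp in auto)
qed

lemma isomorphic_objs: "isomorphic C x y ==> x : Ob & y : Ob"
 unfolding isomorphic_def using Mor_objs by blast

end

lemma functor_simps:
 assumes "is_functor C D F"
 shows "x : obj C ==> fob F x : obj D"
  "x : obj C ==> far F (idn C x) = idn D (fob F x)"
  "f : arr C ==> far F f : arr D"
  "f : arr C ==> src D (far F f) = fob F (src C f)"
  "f : arr C ==> tgt D (far F f) = fob F (tgt C f)"
  "f : arr C ==> g : arr C ==> src C g = tgt C f ==> far F (g **\<^bsub>C\<^esub> f) = far F g **\<^bsub>D\<^esub> far F f"
 using assms unfolding is_functor_def by auto

lemma functor_iso:
 assumes C: "category C" and D: "category D" and F: "is_functor C D F" and f: "is_iso C f"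
 shows "is_iso D (far F f)"
proof -
 obtain g where g: "inverse_arrows C f g" using f unfolding is_iso_def by blast
 have gf: "g : arr C" "f : arr C" "src C g = tgt C f" "tgt C g = src C f"
  "g **\<^bsub>C\<^esub> f = idn C (src C f)" "f **\<^bsub>C\<^esub> g = idn C (tgt C f)" using g by (auto simp: inverse_arrows_def)
 have o: "src C f : obj C" "tgt C f : obj C" using gf category.src_obj[OF C] category.tgt_obj[OF C] by auto
 note s = functor_simps[OF F]
 have "far F g **\<^bsub>D\<^esub> far F f = idn D (fob F (src C f))" "far F f **\<^bsub>D\<^esub> far F g = idn D (fob F (tgt C f))"
  using s(6)[of f g] s(6)[of g f] gf s(2)[OF o(1)] s(2)[OF o(2)] by auto
 then have "inverse_arrows D (far F f) (far F g)" using gf o s(3-5) by (auto simp: inverse_arrows_def)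
 then show ?thesis unfolding is_iso_def by blast
qed

lemma functor_isomorphic:
 assumes C: "category C" and D: "category D" and F: "is_functor C D F" and f: "isomorphic C x y"
 shows "isomorphic D (fob F x) (fob F y)"
proof -
 obtain f where f: "f : Mor C x y" "is_iso C f" using f unfolding isomorphic_def by blast
 then have "far F f : Mor D (fob F x) (fob F y)" using functor_simps[OF F] by auto
 then show ?thesis using functor_iso[OF C D F f(2)] unfolding isomorphic_def by blast
qed

text \<open>\<open>ep\<close> is a universal arrow from the functor \<open>F\<close> to \<open>y\<close>, that is, \<open>r\<close> is the value at \<open>y\<close>
  of a right adjoint of \<open>F\<close>, with counit \<open>ep\<close>.\<close>

definition univ_arrow where
 "univ_arrow C D F y r ep \<longleftrightarrow>
  r : obj C & ep : Mor D (fob F r) y &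
  (ALL z:obj C. ALL ph:Mor D (fob F z) y. EX! u. u : Mor C z r & ep **\<^bsub>D\<^esub> far F u = ph)"

lemma univ_arrow_unique:
 assumes C: "category C" and D: "category D" and F: "is_functor C D F"
  and r: "univ_arrow C D F y r ep" and r': "univ_arrow C D F y r' ep'"
 shows "isomorphic C r r'"
proof -
 interpret C: category C by fact
 interpret D: category D by fact
 note s = functor_simps[OF F]
 have *: "EX u. u : Mor C r r' & ep' **\<^bsub>D\<^esub> far F u = ep"
  if "univ_arrow C D F y r ep" "univ_arrow C D F y r' ep'" for r r' ep ep' using that unfolding univ_arrow_def by blast
 have 1: "u = idn C r" if "univ_arrow C D F y r ep" "u : Mor C r r" "ep **\<^bsub>D\<^esub> far F u = ep" for r ep u
 proof -
  have "idn C r : Mor C r r & ep **\<^bsub>D\<^esub> far F (idn C r) = ep" using that(1) s unfolding univ_arrow_def by auto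
  then show ?thesis using that unfolding univ_arrow_def by blast
 qed
 obtain u where u: "u : Mor C r r'" "ep' **\<^bsub>D\<^esub> far F u = ep" using *[OF r r'] by blast
 obtain v where v: "v : Mor C r' r" "ep **\<^bsub>D\<^esub> far F v = ep'" using *[OF r' r] by blast
 have e: "ep : Mor D (fob F r) y" "ep' : Mor D (fob F r') y" using r r' unfolding univ_arrow_def by auto
 have "ep **\<^bsub>D\<^esub> far F (v **\<^bsub>C\<^esub> u) = ep" "ep' **\<^bsub>D\<^esub> far F (u **\<^bsub>C\<^esub> v) = ep'"
  using u v e s by (auto simp: D.pre_eq[OF v(2)] D.pre_eq[OF u(2)])
 then have "v **\<^bsub>C\<^esub> u = idn C r" "u **\<^bsub>C\<^esub> v = idn C r'" using 1[OF r] 1[OF r'] u v by auto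
 then show ?thesis using C.isomorphicI[OF u(1)] C.is_isoI[OF u(1) v(1)] by blast
qed

lemma right_adjoint_exists:
 assumes C: "category C" and D: "category D" and F: "is_functor C D F"
  and ex: "!!y. y : obj D ==> EX r ep. univ_arrow C D F y r ep"
 shows "EX G. is_functor D C G & adjoint C D F G"
proof -
 interpret C: category C by fact
 interpret D: category D by fact
 note s = functor_simps[OF F]
 obtain r ep where re: "!!y. y : obj D ==> univ_arrow C D F y (r y) (ep y)" using ex by metis
 have r: "r y : obj C" "ep y : arr D" "src D (ep y) = fob F (r y)" "tgt D (ep y) = y"
  if "y : obj D" for y using re[OF that] unfolding univ_arrow_def by auto
 define Ph where "Ph x y a = (THE u. u : Mor C x (r y) & ep y **\<^bsub>D\<^esub> far F u = a)" for x y a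
 have ex1: "EX! u. u : Mor C x (r y) & ep y **\<^bsub>D\<^esub> far F u = a"
  if "x : obj C" "y : obj D" "a : Mor D (fob F x) y" for x y a using re[OF that(2)] that unfolding univ_arrow_def by blast
 have P: "Ph x y a : arr C" "src C (Ph x y a) = x" "tgt C (Ph x y a) = r y" "ep y **\<^bsub>D\<^esub> far F (Ph x y a) = a"
  if "x : obj C" "y : obj D" "a : Mor D (fob F x) y" for x y a using theI'[OF ex1[OF that]] unfolding Ph_def by auto
 have Pu: "Ph x y a = u" if "y : obj D" "u : Mor C x (r y)" "ep y **\<^bsub>D\<^esub> far F u = a" for x y a u
 proof -
  have x: "x : obj C" using C.Mor_objs[OF that(2)] by blast
  have a: "a : Mor D (fob F x) y" using that r[OF that(1)] s x by auto
  show ?thesis using ex1[OF x that(1) a] P[OF x that(1) a] that(2,3) by auto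
 qed
 define G where "G = \<lparr>fob = r, far = (%v. Ph (r (src D v)) (tgt D v) (v **\<^bsub>D\<^esub> ep (src D v)))\<rparr>"
 have Gv: "far G v : arr C & src C (far G v) = r (src D v) & tgt C (far G v) = r (tgt D v) &
  ep (tgt D v) **\<^bsub>D\<^esub> far F (far G v) = v **\<^bsub>D\<^esub> ep (src D v)" if "v : arr D" for v
  using P[of "r (src D v)" "tgt D v" "v **\<^bsub>D\<^esub> ep (src D v)"] that r[of "src D v"] unfolding G_def by auto
 have Gfun: "is_functor D C G" unfolding is_functor_def
 proof (intro conjI ballI impI)
  fix y assume y: "y : obj D"
  show "fob G y : obj C" using r y by (simp add: G_def)
  show "far G (idn D y) = idn C (fob G y)" using y r[OF y] s by (auto simp: G_def intro!: Pu)
 next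
  fix v assume "v : arr D" then show "far G v : Mor C (fob G (src D v)) (fob G (tgt D v))" using Gv by (simp add: G_def)
 next
  fix v w assume vw: "v : arr D" "w : arr D" "tgt D v = src D w"
  note gv = Gv[OF vw(1)] Gv[OF vw(2)]
  have ty: "far G v : arr C" "src C (far G v) = r (src D v)" "tgt C (far G v) = r (src D w)"
   "far G w : arr C" "src C (far G w) = r (src D w)" "tgt C (far G w) = r (tgt D w)" using gv vw by auto
  have "Ph (r (src D v)) (tgt D w) ((w **\<^bsub>D\<^esub> v) **\<^bsub>D\<^esub> ep (src D v)) = far G w **\<^bsub>C\<^esub> far G v"
  proof (rule Pu)
   have "ep (tgt D w) **\<^bsub>D\<^esub> far F (far G w **\<^bsub>C\<^esub> far G v) = (ep (tgt D w) **\<^bsub>D\<^esub> far F (far G w)) **\<^bsub>D\<^esub> far F (far G v)"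
    using vw ty s r[of "tgt D w"] by auto
   also have "\<dots> = (w **\<^bsub>D\<^esub> ep (src D w)) **\<^bsub>D\<^esub> far F (far G v)" using gv by simp
   also have "\<dots> = w **\<^bsub>D\<^esub> (ep (tgt D v) **\<^bsub>D\<^esub> far F (far G v))" using vw gv s r[of "tgt D v"] by simp
   also have "\<dots> = w **\<^bsub>D\<^esub> (v **\<^bsub>D\<^esub> ep (src D v))" using gv by simp
   also have "\<dots> = (w **\<^bsub>D\<^esub> v) **\<^bsub>D\<^esub> ep (src D v)" using vw r[of "src D v"] by simp
   finally show "ep (tgt D w) **\<^bsub>D\<^esub> far F (far G w **\<^bsub>C\<^esub> far G v) = (w **\<^bsub>D\<^esub> v) **\<^bsub>D\<^esub> ep (src D v)" .
  qed (use vw gv in auto)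
  then show "far G (w **\<^bsub>D\<^esub> v) = far G w **\<^bsub>C\<^esub> far G v" using vw by (auto simp: G_def)
 qed
 have "adjoint C D F G" unfolding adjoint_def
 proof (intro exI[of _ Ph] conjI ballI)
  fix x y assume xy: "x : obj C" "y : obj D"
  show "bij_betw (Ph x y) (Mor D (fob F x) y) (Mor C x (fob G y))"
  proof (rule bij_betw_byWitness[of _ "%u. ep y **\<^bsub>D\<^esub> far F u"])
   show "ALL a:Mor D (fob F x) y. ep y **\<^bsub>D\<^esub> far F (Ph x y a) = a" using P xy by blast
   show "ALL a':Mor C x (fob G y). Ph x y (ep y **\<^bsub>D\<^esub> far F a') = a'" using Pu xy by (auto simp: G_def)
   show "Ph x y ` Mor D (fob F x) y \<subseteq> Mor C x (fob G y)" using P xy by (auto simp: G_def)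
   show "(%u. ep y **\<^bsub>D\<^esub> far F u) ` Mor C x (fob G y) \<subseteq> Mor D (fob F x) y" using r[OF xy(2)] s xy by (auto simp: G_def)
  qed
 next
  fix u v a assume uva: "u : arr C" "v : arr D" "a : Mor D (fob F (tgt C u)) (src D v)"
  have o: "tgt C u : obj C" "src D v : obj D" "tgt D v : obj D" using uva by auto
  note Pa = P[OF o(1,2) uva(3)] and gv = Gv[OF uva(2)]
  have ty: "far G v : arr C" "src C (far G v) = r (src D v)" "tgt C (far G v) = r (tgt D v)" using gv by auto
  show "Ph (src C u) (tgt D v) (v **\<^bsub>D\<^esub> (a **\<^bsub>D\<^esub> far F u)) = far G v **\<^bsub>C\<^esub> (Ph (tgt C u) (src D v) a **\<^bsub>C\<^esub> u)"
  proof (rule Pu)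
   have "ep (tgt D v) **\<^bsub>D\<^esub> far F (far G v **\<^bsub>C\<^esub> (Ph (tgt C u) (src D v) a **\<^bsub>C\<^esub> u))
    = (ep (tgt D v) **\<^bsub>D\<^esub> far F (far G v)) **\<^bsub>D\<^esub> (far F (Ph (tgt C u) (src D v) a) **\<^bsub>D\<^esub> far F u)"
    using uva Pa(1-3) ty s r[OF o(3)] o by auto
   also have "\<dots> = v **\<^bsub>D\<^esub> ((ep (src D v) **\<^bsub>D\<^esub> far F (Ph (tgt C u) (src D v) a)) **\<^bsub>D\<^esub> far F u)"
    using uva Pa(1-3) gv s r[OF o(2)] o by auto
   also have "\<dots> = v **\<^bsub>D\<^esub> (a **\<^bsub>D\<^esub> far F u)" using Pa by simp
   finally show "ep (tgt D v) **\<^bsub>D\<^esub> far F (far G v **\<^bsub>C\<^esub> (Ph (tgt C u) (src D v) a **\<^bsub>C\<^esub> u)) = v **\<^bsub>D\<^esub> (a **\<^bsub>D\<^esub> far F u)" .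
  qed (use uva Pa gv in auto)
 qed
 then show ?thesis using Gfun by blast
qed

lemma adjoint_univ_arrow:
 assumes C: "category C" and D: "category D" and F: "is_functor C D F" and G: "is_functor D C G"
  and adj: "adjoint C D F G" and y: "y : obj D"
 shows "EX ep. univ_arrow C D F y (fob G y) ep"
proof -
 interpret C: category C by fact
 interpret D: category D by fact
 note s = functor_simps[OF F] and t = functor_simps[OF G]
 obtain Ph where bij: "!!x y. x : obj C ==> y : obj D ==> bij_betw (Ph x y) (Mor D (fob F x) y) (Mor C x (fob G y))"
  and nat: "!!u v a. u : arr C ==> v : arr D ==> a : Mor D (fob F (tgt C u)) (src D v) ==>
     Ph (src C u) (tgt D v) (v **\<^bsub>D\<^esub> (a **\<^bsub>D\<^esub> far F u)) =
     far G v **\<^bsub>C\<^esub> (Ph (tgt C u) (src D v) a **\<^bsub>C\<^esub> u)" using adj unfolding adjoint_def by blast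
 let ?r = "fob G y"
 have r: "?r : obj C" using t y by simp
 obtain ep where e: "ep : Mor D (fob F ?r) y" "Ph ?r y ep = idn C ?r"
 proof -
  have "idn C ?r : Ph ?r y ` Mor D (fob F ?r) y"  unfolding bij_betw_imp_surj_on[OF bij[OF r y]] by (rule C.idn_Mor[OF r])
  then show ?thesis using that by (elim imageE) metis
 qed
 have *: "Ph z y (ep **\<^bsub>D\<^esub> far F u) = u" if u: "u : Mor C z ?r" for z u
 proof -
  have "Ph z y (idn D y **\<^bsub>D\<^esub> (ep **\<^bsub>D\<^esub> far F u)) = far G (idn D y) **\<^bsub>C\<^esub> (Ph ?r y ep **\<^bsub>C\<^esub> u)"
   using nat[of u "idn D y" ep] u e(1) y by simp
  then show ?thesis using u e y r t(2)[OF y] s(3-5)[of u] by simp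
 qed
 have "EX! u. u : Mor C z ?r & ep **\<^bsub>D\<^esub> far F u = ph" if z: "z : obj C" and p: "ph : Mor D (fob F z) y" for z ph
 proof (rule ex1I[of _ "Ph z y ph"])
  have 1: "Ph z y ph : Mor C z ?r" using bij_betwE[OF bij[OF z y]] p by blast
  have "ep **\<^bsub>D\<^esub> far F (Ph z y ph) : Mor D (fob F z) y" using 1 e s by auto
  moreover have "Ph z y (ep **\<^bsub>D\<^esub> far F (Ph z y ph)) = Ph z y ph" using *[OF 1] .
  ultimately have "ep **\<^bsub>D\<^esub> far F (Ph z y ph) = ph" using bij[OF z y] p unfolding bij_betw_def inj_on_def by blast
  then show "Ph z y ph : Mor C z ?r & ep **\<^bsub>D\<^esub> far F (Ph z y ph) = ph" using 1 by blast
  fix u assume "u : Mor C z ?r & ep **\<^bsub>D\<^esub> far F u = ph"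
  then show "u = Ph z y ph" using *[of u z] by auto
 qed
 then show ?thesis using e r unfolding univ_arrow_def by blast
qed

lemma right_adjoint_isomorphic:
 assumes C: "category C" and D: "category D" and F: "is_functor C D F"
  and ex: "!!y. y : obj D ==> EX r ep. univ_arrow C D F y r ep"
  and r: "univ_arrow C D F y r ep" and y: "y : obj D"
 shows "isomorphic C (fob (right_adjoint C D F) y) r"
proof -
 have *: "is_functor D C (right_adjoint C D F) & adjoint C D F (right_adjoint C D F)"
  unfolding right_adjoint_def by (rule someI_ex[OF right_adjoint_exists[OF C D F ex]])
 then obtain ep' where "univ_arrow C D F y (fob (right_adjoint C D F) y) ep'" using adjoint_univ_arrow[OF C D F _ _ y] by blast
 then show ?thesis using univ_arrow_unique[OF C D F _ r] by blast
qed

section \<open>Additive categories\<close>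

text \<open>Cones of differences \<open>al - be\<close> replace coequalizers below.\<close>

definition sub :: "('o, 'm, 'z) tricat_scheme \<Rightarrow> 'm \<Rightarrow> 'm \<Rightarrow> 'm" where
 "sub C f g = add C f (neg C g)"

context additive_category begin

lemma comm_group_Mor: "x : Ob ==> y : Ob ==> comm_group (HomG C x y)"
 by (rule HomG_comm_group)

lemma HomG_simps [simp]:
 "carrier (HomG C x y) = Hom x y" "monoid.mult (HomG C x y) = add C" "one (HomG C x y) = zer C x y" by (auto simp: HomG_def)

lemma zer_arr [simp]: "x : Ob ==> y : Ob ==> zer C x y : arr C"
 and zer_src [simp]: "x : Ob ==> y : Ob ==> src C (zer C x y) = x"
 and zer_tgt [simp]: "x : Ob ==> y : Ob ==> tgt C (zer C x y) = y"
proof -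
 assume o: "x : Ob" "y : Ob"
 interpret G: comm_group "HomG C x y" using comm_group_Mor[OF o] .
 show "zer C x y : arr C" "src C (zer C x y) = x" "tgt C (zer C x y) = y" using G.one_closed by auto
qed

lemma
 assumes f: "f : arr C" and g: "g : arr C" "src C g = src C f" "tgt C g = tgt C f"
 shows add_arr [simp]: "add C f g : arr C"
  and add_src [simp]: "src C (add C f g) = src C f"
  and add_tgt [simp]: "tgt C (add C f g) = tgt C f"
  and add_commute: "add C f g = add C g f"
proof -
 interpret G: comm_group "HomG C (src C f) (tgt C f)" using comm_group_Mor f by simp
 show "add C f g : arr C" "src C (add C f g) = src C f" "tgt C (add C f g) = tgt C f" using G.m_closed[of f g] f g by auto
 show "add C f g = add C g f" using G.m_comm[of f g] f g by auto
qed

lemma add_assoc: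
 assumes "f : arr C" "g : arr C" "h : arr C" "src C g = src C f" "tgt C g = tgt C f"
  "src C h = src C f" "tgt C h = tgt C f"
 shows "add C (add C f g) h = add C f (add C g h)"
proof -
 interpret G: comm_group "HomG C (src C f) (tgt C f)" using comm_group_Mor assms by simp
 show ?thesis using G.m_assoc[of f g h] assms by auto
qed

lemma
 assumes f: "f : arr C"
 shows neg_arr [simp]: "neg C f : arr C"
  and neg_src [simp]: "src C (neg C f) = src C f"
  and neg_tgt [simp]: "tgt C (neg C f) = tgt C f"
  and neg_add: "add C (neg C f) f = zer C (src C f) (tgt C f)"
  and add_neg: "add C f (neg C f) = zer C (src C f) (tgt C f)"
  and zer_add: "add C (zer C (src C f) (tgt C f)) f = f"
  and add_zer: "add C f (zer C (src C f) (tgt C f)) = f"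
proof -
 interpret G: comm_group "HomG C (src C f) (tgt C f)" using comm_group_Mor f by simp
 have "neg C f : carrier (HomG C (src C f) (tgt C f))" unfolding neg_def using f by (intro G.inv_closed) simp
 then show "neg C f : arr C" "src C (neg C f) = src C f" "tgt C (neg C f) = tgt C f" by auto
 show "add C (neg C f) f = zer C (src C f) (tgt C f)" "add C f (neg C f) = zer C (src C f) (tgt C f)"
  using G.l_inv[of f] G.r_inv[of f] f by (auto simp: neg_def)
 show "add C (zer C (src C f) (tgt C f)) f = f" "add C f (zer C (src C f) (tgt C f)) = f" using G.l_one[of f] G.r_one[of f] f by auto
qed

lemma zer_add' [simp]: "f : arr C ==> src C f = x ==> tgt C f = y ==> add C (zer C x y) f = f"
 and add_zer' [simp]: "f : arr C ==> src C f = x ==> tgt C f = y ==> add C f (zer C x y) = f" using zer_add add_zer by auto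

lemma add_cancel:
 assumes "f : arr C" "g : arr C" "h : arr C" "src C g = src C f" "tgt C g = tgt C f"
  "src C h = src C f" "tgt C h = tgt C f" "add C f g = add C f h"
 shows "g = h"
proof -
 have "add C (neg C f) (add C f g) = add C (neg C f) (add C f h)" using assms by simp
 then show ?thesis using assms add_assoc[of "neg C f" f g] add_assoc[of "neg C f" f h] neg_add by auto
qed

lemma
 assumes f: "f : arr C" and g: "g : arr C" "src C g = src C f" "tgt C g = tgt C f"
 shows sub_arr [simp]: "sub C f g : arr C"
  and sub_src [simp]: "src C (sub C f g) = src C f"
  and sub_tgt [simp]: "tgt C (sub C f g) = tgt C f"
  and sub_add [simp]: "add C (sub C f g) g = f"
  and add_sub [simp]: "add C g (sub C f g) = f"
  and add_sub_same [simp]: "sub C (add C f g) g = f"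
proof -
 show a: "sub C f g : arr C" "src C (sub C f g) = src C f" "tgt C (sub C f g) = tgt C f" using assms by (auto simp: sub_def)
 show b: "add C (sub C f g) g = f" using assms add_assoc[of f "neg C g" g] neg_add[of g] by (auto simp: sub_def)
 show "add C g (sub C f g) = f" using add_commute[of g "sub C f g"] a b assms by auto
 show "sub C (add C f g) g = f" using assms add_assoc[of f g "neg C g"] add_neg[of g] by (auto simp: sub_def)
qed

lemma sub_self [simp]: "f : arr C ==> sub C f f = zer C (src C f) (tgt C f)"
 by (simp add: sub_def add_neg)

lemma sub_eq_zer:
 assumes "f : arr C" "g : arr C" "src C g = src C f" "tgt C g = tgt C f"
 shows "sub C f g = zer C (src C f) (tgt C f) \<longleftrightarrow> f = g"
proof
 assume "sub C f g = zer C (src C f) (tgt C f)"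
 then show "f = g" using sub_add[OF assms] zer_add'[of g "src C f" "tgt C f"] assms by simp
next
 assume "f = g" then show "sub C f g = zer C (src C f) (tgt C f)" using assms by simp
qed

lemma sub_eq_zerD:
 assumes "sub C f g = zer C x y" "f : Hom x y" "g : Hom x y"
 shows "f = g" using sub_eq_zer[of f g] assms by auto

lemma cmp_zer [simp]:
 assumes "g : arr C" "src C g = y" "x : Ob"
 shows "g ** zer C x y = zer C x (tgt C g)"
proof -
 have y: "y : Ob" using assms by auto
 have "g ** zer C x y = add C (g ** zer C x y) (g ** zer C x y)" using cmp_add_right[of "zer C x y" x y "zer C x y" g "tgt C g"] assms y by simp
 then have "add C (g ** zer C x y) (zer C x (tgt C g)) = add C (g ** zer C x y) (g ** zer C x y)" using assms y by simp
 then show ?thesis using assms y add_cancel[of "g ** zer C x y" "zer C x (tgt C g)" "g ** zer C x y"] by simp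
qed

lemma zer_cmp [simp]:
 assumes "f : arr C" "tgt C f = x" "y : Ob"
 shows "zer C x y ** f = zer C (src C f) y"
proof -
 have x: "x : Ob" using assms by auto
 have "zer C x y ** f = add C (zer C x y ** f) (zer C x y ** f)" using cmp_add_left[of f "src C f" x "zer C x y" y "zer C x y"] assms x by simp
 then have "add C (zer C x y ** f) (zer C (src C f) y) = add C (zer C x y ** f) (zer C x y ** f)" using assms x by simp
 then show ?thesis using assms x add_cancel[of "zer C x y ** f" "zer C (src C f) y" "zer C x y ** f"] by simp
qed

lemma cmp_add:
 assumes "f : arr C" "f' : arr C" "src C f' = src C f" "tgt C f' = tgt C f" "g : arr C" "src C g = tgt C f"
 shows "g ** add C f f' = add C (g ** f) (g ** f')" using cmp_add_right[of f "src C f" "tgt C f" f' g "tgt C g"] assms by auto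

lemma add_cmp:
 assumes "g : arr C" "g' : arr C" "src C g' = src C g" "tgt C g' = tgt C g" "f : arr C" "src C g = tgt C f"
 shows "add C g g' ** f = add C (g ** f) (g' ** f)" using cmp_add_left[of f "src C f" "tgt C f" g "tgt C g" g'] assms by auto

lemma neg_unique:
 assumes "f : arr C" "g : arr C" "src C g = src C f" "tgt C g = tgt C f"
  "add C f g = zer C (src C f) (tgt C f)"
 shows "g = neg C f" using add_cancel[of f g "neg C f"] add_neg[of f] assms by auto

lemma cmp_neg:
 assumes "f : arr C" "g : arr C" "src C g = tgt C f"
 shows "g ** neg C f = neg C (g ** f)" by (rule neg_unique) (use assms cmp_add[of f "neg C f" g] add_neg[of f] in auto)

lemma neg_cmp:
 assumes "f : arr C" "g : arr C" "src C g = tgt C f"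
 shows "neg C g ** f = neg C (g ** f)" by (rule neg_unique) (use assms add_cmp[of g "neg C g" f] add_neg[of g] in auto)

lemma neg_neg [simp]: "f : arr C ==> neg C (neg C f) = f"
 by (rule neg_unique[symmetric]) (auto simp: neg_add)

lemma neg_zer [simp]: "x : Ob ==> y : Ob ==> neg C (zer C x y) = zer C x y"
 by (rule neg_unique[symmetric]) auto

lemma neg_eq_zer: "f : arr C ==> neg C f = zer C (src C f) (tgt C f) ==> f = zer C (src C f) (tgt C f)"
 using neg_neg[of f] by auto

lemma cmp_sub:
 assumes "f : arr C" "f' : arr C" "src C f' = src C f" "tgt C f' = tgt C f" "g : arr C" "src C g = tgt C f"
 shows "g ** sub C f f' = sub C (g ** f) (g ** f')" using assms by (simp add: sub_def cmp_add cmp_neg)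

lemma sub_cmp:
 assumes "g : arr C" "g' : arr C" "src C g' = src C g" "tgt C g' = tgt C g" "f : arr C" "src C g = tgt C f"
 shows "sub C g g' ** f = sub C (g ** f) (g' ** f)" using assms by (simp add: sub_def add_cmp neg_cmp)

lemma sub_zer [simp]: "f : arr C ==> src C f = x ==> tgt C f = y ==> sub C f (zer C x y) = f"
 by (auto simp: sub_def)

lemma is_zeroD: "is_zero C z ==> z : Ob"
 by (simp add: is_zero_def)

lemma to_zero: "is_zero C z ==> f : Hom x z ==> f = zer C x z"
proof -
 assume z: "is_zero C z" and f: "f : Hom x z"
 have "f = idn C z ** f" using f by simp
 also have "\<dots> = zer C x z" using z f by (simp add: is_zero_def)
 finally show ?thesis .
qed

lemma from_zero: "is_zero C z ==> f : Hom z x ==> f = zer C z x"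
proof -
 assume z: "is_zero C z" and f: "f : Hom z x"
 have "f = f ** idn C z" using f by simp
 also have "\<dots> = zer C z x" using z f by (simp add: is_zero_def)
 finally show ?thesis .
qed

lemma is_zero_isomorphic:
 assumes "is_zero C x" "isomorphic C x y" shows "is_zero C y"
proof -
 obtain f g where fg: "f : Hom x y" "g : Hom y x" "f ** g = idn C y" "y : Ob" "x : Ob" using isomorphicE[OF assms(2)] by metis
 have "g = zer C y x" using to_zero[OF assms(1) fg(2)] .
 then have "f ** g = zer C y y" using fg by auto
 then show ?thesis using fg by (simp add: is_zero_def)
qed

end

lemma additive_functorD:
 assumes "additive_functor C D F"
 shows "is_functor C D F"
  and "f : arr C ==> g : arr C ==> src C g = src C f ==> tgt C g = tgt C f ==> category C ==>
   far F (add C f g) = add D (far F f) (far F g)" using assms category.src_obj[of C f] category.tgt_obj[of C f] unfolding additive_functor_def by auto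

lemma additive_functor_zer:
 assumes C: "additive_category C" and D: "additive_category D" and F: "additive_functor C D F"
  and o: "x : obj C" "y : obj C"
 shows "far F (zer C x y) = zer D (fob F x) (fob F y)"
proof -
 interpret C: additive_category C by fact
 interpret D: additive_category D by fact
 let ?z = "far F (zer C x y)"
 have z: "?z : arr D" "src D ?z = fob F x" "tgt D ?z = fob F y" "fob F x : obj D" "fob F y : obj D"
  using functor_simps[OF additive_functorD(1)[OF F]] o by auto
 have "?z = add D ?z ?z" using additive_functorD(2)[OF F, of "zer C x y" "zer C x y"] o C.category_axioms by simp
 then have "add D ?z (zer D (fob F x) (fob F y)) = add D ?z ?z" using z by simp
 then show ?thesis using D.add_cancel[of ?z "zer D (fob F x) (fob F y)" ?z] z by auto
qed

lemma additive_functor_neg: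
 assumes C: "additive_category C" and D: "additive_category D" and F: "additive_functor C D F" and f: "f : arr C"
 shows "far F (neg C f) = neg D (far F f)"
proof -
 interpret C: additive_category C by fact
 interpret D: additive_category D by fact
 note s = functor_simps[OF additive_functorD(1)[OF F]]
 have "add D (far F f) (far F (neg C f)) = far F (add C f (neg C f))" using additive_functorD(2)[OF F, of f "neg C f"] f C.category_axioms by auto
 also have "\<dots> = zer D (src D (far F f)) (tgt D (far F f))" using f s C.add_neg[OF f] additive_functor_zer[OF C D F] by simp
 finally show ?thesis using f s by (intro D.neg_unique) auto
qed

lemma additive_functor_sub:
 assumes C: "additive_category C" and D: "additive_category D" and F: "additive_functor C D F"
  and "f : arr C" "g : arr C" "src C g = src C f" "tgt C g = tgt C f"
 shows "far F (sub C f g) = sub D (far F f) (far F g)"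
proof -
 interpret C: additive_category C by fact
 show ?thesis using additive_functorD(2)[OF F, of f "neg C g"] additive_functor_neg[OF C D F] assms C.category_axioms by (simp add: sub_def)
qed

lemma additive_functor_zero:
 assumes C: "additive_category C" and D: "additive_category D" and F: "additive_functor C D F" and z: "is_zero C z"
 shows "is_zero D (fob F z)" using additive_functor_zer[OF C D F, of z z] functor_simps(1,2)[OF additive_functorD(1)[OF F], of z] z
 unfolding is_zero_def by simp

section \<open>Triangulated categories\<close>

context triangulated_category begin

abbreviation "tsub \<equiv> triangulated_subcat C"

abbreviation Sh where "Sh x \<equiv> fob (shift C) x"
abbreviation Sa where "Sa f \<equiv> far (shift C) f"

lemma add_cat: "additive_category C" ..

lemmas shift_simps [simp] = functor_simps[OF additive_functorD(1)[OF shift_additive]]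
lemmas shift_zer [simp] = additive_functor_zer[OF add_cat add_cat shift_additive]
lemmas shift_neg [simp] = additive_functor_neg[OF add_cat add_cat shift_additive]
lemmas shift_zero = additive_functor_zero[OF add_cat add_cat shift_additive]

lemma shift_full: "x : Ob ==> y : Ob ==> u : Hom (Sh x) (Sh y) ==> EX v:Hom x y. Sa v = u"
 and shift_faithful: "u : Hom x y ==> v : Hom x y ==> Sa u = Sa v ==> u = v"
 and shift_ess_surj: "z : Ob ==> EX x:Ob. isomorphic C (Sh x) z"
proof -
 have b: "!!x y. x : Ob ==> y : Ob ==> bij_betw Sa (Hom x y) (Hom (Sh x) (Sh y))" using shift_equivalence unfolding is_equivalence_def by blast
 show "EX v:Hom x y. Sa v = u" if "x : Ob" "y : Ob" "u : Hom (Sh x) (Sh y)"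
 proof -
  have "u : Sa ` Hom x y" unfolding bij_betw_imp_surj_on[OF b[OF that(1,2)]] by (rule that(3))
  then show ?thesis by (elim imageE) metis
 qed
 show "u = v" if "u : Hom x y" "v : Hom x y" "Sa u = Sa v"
  using bij_betw_imp_inj_on[OF b[of x y]] Mor_objs[OF that(1)] inj_onD[of Sa "Hom x y" u v] that by metis
 show "EX x:Ob. isomorphic C (Sh x) z" if "z : Ob" using shift_equivalence that unfolding is_equivalence_def by blast
qed

definition dt where
 "dt x y z f g h \<longleftrightarrow> (f, g, h) : tri C & f : Hom x y & g : Hom y z & h : Hom z (Sh x)"

lemma dtD:
 assumes "dt x y z f g h"
 shows "(f, g, h) : tri C" "f : arr C" "src C f = x" "tgt C f = y" "g : arr C" "src C g = y" "tgt C g = z"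
  "h : arr C" "src C h = z" "tgt C h = Sh x" "x : Ob" "y : Ob" "z : Ob" using assms unfolding dt_def by auto

lemma tri_dt: "(f, g, h) : tri C ==> dt (src C f) (src C g) (src C h) f g h"
 using tri_tri_shape[of "(f, g, h)"] by (auto simp: dt_def)

lemma dt_rot: "dt x y z f g h ==> dt y z (Sh x) g h (neg C (Sa f))"
 using TR2[of f g h] tri_tri_shape[of "(f, g, h)"] by (auto simp: dt_def)

lemma dt_unrot: "dt y z (Sh x) g h (neg C (Sa f)) ==> f : Hom x y ==> dt x y z f g h"
 using TR2[of f g h] by (auto simp: dt_def)

lemma dt_cone: "f : Hom x y ==> EX z g h. dt x y z f g h"
 using TR1_cone[of f] tri_dt[of f] tri_tri_shape[of "(f, _, _)"] by fastforce

lemma dt_iso: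
 assumes t: "dt x y z f g h" and f': "f' : Hom x' y'" "g' : Hom y' z'" "h' : Hom z' (Sh x')"
  and abc: "a : Hom x x'" "b : Hom y y'" "c : Hom z z'" "is_iso C a" "is_iso C b" "is_iso C c"
  and e: "b ** f = f' ** a" "c ** g = g' ** b" "Sa a ** h = h' ** c"
 shows "dt x' y' z' f' g' h'"
proof -
 note t' = dtD[OF t]
 have "tri_iso C (f, g, h) (f', g', h')" unfolding tri_iso_def by (intro exI[of _ a] exI[of _ b] exI[of _ c]) (use t' f' abc e in auto)
 moreover have "tri_shape C (f', g', h')" using f' by auto
 ultimately have "(f', g', h') : tri C" using TR1_iso[OF t'(1)] by blast
 then show ?thesis using f' by (simp add: dt_def)
qed

lemma dt_idn: "x : Ob ==> is_zero C z ==> dt x x z (idn C x) (zer C x z) (zer C z (Sh x))"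
 using TR1_idn[of x z] is_zeroD[of z] by (auto simp: dt_def)

lemma dt_idn2: "x : Ob ==> is_zero C z ==> dt z x x (zer C z x) (idn C x) (zer C x (Sh z))"
proof (rule dt_unrot)
 assume x: "x : Ob" and z: "is_zero C z"
 have "dt x x (Sh z) (idn C x) (zer C x (Sh z)) (zer C (Sh z) (Sh x))" by (rule dt_idn[OF x shift_zero[OF z]])
 then show "dt x x (Sh z) (idn C x) (zer C x (Sh z)) (neg C (Sa (zer C z x)))" using x z is_zeroD by simp
 show "zer C z x : Hom z x" using x is_zeroD[OF z] by simp
qed

lemma dt_mor:
 assumes t: "dt x y z f g h" and t': "dt x' y' z' f' g' h'"
  and a: "a : Hom x x'" and b: "b : Hom y y'" and e: "b ** f = f' ** a"
 shows "EX c:Hom z z'. c ** g = g' ** b & Sa a ** h = h' ** c" using TR3[OF dtD(1)[OF t] dtD(1)[OF t'], of a b] dtD[OF t] dtD[OF t'] a b e by auto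

lemma dt_cmp0: assumes t: "dt x y z f g h" shows "g ** f = zer C x z"
proof -
 obtain w where w: "is_zero C w" using zero_object by blast
 note t' = dtD[OF t] and w' = is_zeroD[OF w]
 obtain c where c: "c : Hom w z" "c ** zer C x w = g ** f" using dt_mor[OF dt_idn[OF t'(11) w] t, of "idn C x" f] t' by auto
 then show ?thesis using t' w' by simp
qed

lemma dt_cmp2: assumes t: "dt x y z f g h" shows "Sa f ** h = zer C z (Sh y)"
proof -
 have "neg C (Sa f) ** h = zer C z (Sh y)" using dt_cmp0[OF dt_rot[OF dt_rot[OF t]]] .
 then have "neg C (Sa f ** h) = zer C z (Sh y)" using dtD[OF t] by (simp add: neg_cmp)
 then show ?thesis using neg_eq_zer[of "Sa f ** h"] dtD[OF t] by simp
qed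

lemma dt_wker:
 assumes t: "dt x y z f g h" and u: "u : Hom w y" and e: "g ** u = zer C w z"
 shows "EX v:Hom w x. f ** v = u"
proof -
 obtain o0 where o0: "is_zero C o0" using zero_object by blast
 note t' = dtD[OF t] and o0' = is_zeroD[OF o0]
 have w: "w : Ob" using Mor_objs[OF u] by blast
 obtain c where c: "c : Hom (Sh w) (Sh x)" "Sa u ** neg C (Sa (idn C w)) = neg C (Sa f) ** c"
  using dt_mor[OF dt_rot[OF dt_idn[OF w o0]] dt_rot[OF t] u, of "zer C o0 z"] t' o0' w u e by auto
 obtain v where v: "v : Hom w x" "Sa v = c" using shift_full[OF w t'(11) c(1)] by blast
 have "neg C (Sa u) = neg C (Sa (f ** v))" using c v u t' w by (simp add: neg_cmp cmp_neg)
 moreover have "neg C (neg C (Sa u)) = Sa u" "neg C (neg C (Sa (f ** v))) = Sa (f ** v)" using u v(1) t' by simp_all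
 ultimately have "Sa u = Sa (f ** v)" by metis
 then have "u = f ** v" using shift_faithful[of u w y "f ** v"] u v t' by simp
 then show ?thesis using v by blast
qed

lemma dt_wcok:
 assumes t: "dt x y z f g h" and u: "u : Hom y w" and e: "u ** f = zer C x w"
 shows "EX v:Hom z w. v ** g = u"
proof -
 obtain o0 where o0: "is_zero C o0" using zero_object by blast
 note t' = dtD[OF t] and o0' = is_zeroD[OF o0]
 have w: "w : Ob" using Mor_objs[OF u] by blast
 show ?thesis using dt_mor[OF t dt_idn2[OF w o0], of "zer C x o0" u] t' o0' w u e by auto
qed

lemmas dt_wker2 = dt_wker[OF dt_rot]
lemmas dt_wcok2 = dt_wcok[OF dt_rot]

lemma dt_wker3:
 assumes t: "dt x y z f g h" and u: "u : Hom w (Sh x)" and e: "Sa f ** u = zer C w (Sh y)"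
 shows "EX v:Hom w z. h ** v = u"
proof (rule dt_wker[OF dt_rot[OF dt_rot[OF t]] u])
 have "w : Ob" using Mor_objs[OF u] by blast
 then show "neg C (Sa f) ** u = zer C w (Sh y)" using e u dtD[OF t] by (simp add: neg_cmp)
qed

lemma dt_wcok3:
 assumes t: "dt x y z f g h" and u: "u : Hom (Sh x) w" and e: "u ** h = zer C z w"
 shows "EX v:Hom (Sh y) w. v ** Sa f = u"
proof -
 obtain v where v: "v : Hom (Sh y) w" "v ** neg C (Sa f) = u" using dt_wcok[OF dt_rot[OF dt_rot[OF t]] u e] by blast
 have "neg C v ** Sa f = u" using v dtD[OF t] by (simp add: neg_cmp cmp_neg)
 moreover have "neg C v : Hom (Sh y) w" using v by simp
 ultimately show ?thesis by blast
qed

text \<open>An endomorphism of a triangle that is the identity on two of the objects differs from the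
  identity on the third by a morphism of square zero.\<close>

lemma dt_endo_iso:
 assumes t: "dt x y z f g h" and c: "c : Hom z z" "c ** g = g" "h ** c = h"
 shows "is_iso C c"
proof -
 note t' = dtD[OF t]
 let ?n = "sub C c (idn C z)"
 have n: "?n : Hom z z" using c t' by simp
 have "?n ** g = zer C y z" using c t' by (simp add: sub_cmp)
 then obtain m where m: "m : Hom (Sh x) z" "m ** h = ?n" using dt_wcok2[OF t n] by blast
 have "h ** ?n = zer C z (Sh x)" using c t' by (simp add: cmp_sub)
 then have "m ** (h ** ?n) = zer C z z" using m(1) t' by simp
 moreover have "m ** (h ** ?n) = ?n ** ?n" using m(1) t' n by (intro pre_eq[OF m(2)]) simp_all
 ultimately have nn: "?n ** ?n = zer C z z" by simp
 have cn: "c = add C ?n (idn C z)" using c t' by simp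
 let ?d = "sub C (idn C z) ?n"
 have d: "?d : Hom z z" using n t' by simp
 have "?n ** ?d = ?n" using n nn t' by (simp add: cmp_sub)
 then have "c ** ?d = add C ?n ?d" using n d t' by (subst cn, simp add: add_cmp)
 then have 1: "c ** ?d = idn C z" using n t' by simp
 have "?d ** ?n = ?n" using n nn t' by (simp add: sub_cmp)
 then have "?d ** c = add C ?n ?d" using n d t' by (subst cn, simp add: cmp_add)
 then have 2: "?d ** c = idn C z" using n t' by simp
 show ?thesis by (rule is_isoI[OF c(1) d 2 1])
qed

lemma dt_five:
 assumes t: "dt x y z f g h" and t': "dt x' y' z' f' g' h'"
  and a: "a : Hom x x'" "is_iso C a" and b: "b : Hom y y'" "is_iso C b" and c: "c : Hom z z'"
  and e: "b ** f = f' ** a" "c ** g = g' ** b" "Sa a ** h = h' ** c"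
 shows "is_iso C c"
proof -
 note T = dtD[OF t] dtD[OF t']
 obtain a' where a': "a' : Hom x' x" "a' ** a = idn C x" "a ** a' = idn C x'" using is_isoE[OF a(2,1)] by metis
 obtain b' where b': "b' : Hom y' y" "b' ** b = idn C y" "b ** b' = idn C y'" using is_isoE[OF b(2,1)] by metis
 have "b' ** f' = b' ** (f' ** (a ** a'))" using a' T by simp
 also have "\<dots> = b' ** ((f' ** a) ** a')" using a a'(1) b'(1) T by simp
 also have "\<dots> = (b' ** b) ** (f ** a')" unfolding e(1)[symmetric] using a'(1) b b'(1) T by simp
 also have "\<dots> = f ** a'" unfolding b'(2) using a' T by simp
 finally have "b' ** f' = f ** a'" .
 then obtain d where d: "d : Hom z' z" "d ** g' = g ** b'" "Sa a' ** h' = h ** d" using dt_mor[OF t' t a'(1) b'(1)] by blast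
 have A: "Sa a' ** Sa a = idn C (Sh x)" "Sa a ** Sa a' = idn C (Sh x')" using shift_simps(6)[of a a'] shift_simps(6)[of a' a] a a' T by auto
 have dc: "is_iso C (d ** c)"
 proof (rule dt_endo_iso[OF t])
  show "d ** c : Hom z z" using c d by simp
  have "(d ** c) ** g = (d ** g') ** b" using c d(1) e(2) T b by simp
  also have "\<dots> = g" unfolding d(2) using b b' T by simp
  finally show "(d ** c) ** g = g" .
  have "h ** (d ** c) = (h ** d) ** c" using c d(1) T by simp
  also have "\<dots> = Sa a' ** (h' ** c)" unfolding d(3)[symmetric] using c a' T by simp
  also have "\<dots> = h" unfolding e(3)[symmetric] using A a a'(1) T by (simp add: pre_eq[OF A(1)])
  finally show "h ** (d ** c) = h" .
 qed
 have cd: "is_iso C (c ** d)"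
 proof (rule dt_endo_iso[OF t'])
  show "c ** d : Hom z' z'" using c d by simp
  have "(c ** d) ** g' = (c ** g) ** b'" using c d T b'(1) by simp
  also have "\<dots> = g'" unfolding e(2) using b b' T by simp
  finally show "(c ** d) ** g' = g'" .
  have "h' ** (c ** d) = (h' ** c) ** d" using c d(1) T by simp
  also have "\<dots> = Sa a ** (h ** d)" unfolding e(3)[symmetric] using d(1) a T by simp
  also have "\<dots> = h'" unfolding d(3)[symmetric] using A a a'(1) T by (simp add: pre_eq[OF A(2)])
  finally show "h' ** (c ** d) = h'" .
 qed
 show ?thesis by (rule iso_of_left_right[OF c dc d(1) cd d(1)])
qed

lemma dt_cone_unique:
 assumes t: "dt x y z f g h" and t': "dt x y z' f g' h'" shows "isomorphic C z z'"
proof -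
 note T = dtD[OF t]
 obtain c where c: "c : Hom z z'" "c ** g = g' ** idn C y" "Sa (idn C x) ** h = h' ** c" using dt_mor[OF t t', of "idn C x" "idn C y"] T by auto
 have "is_iso C c" by (rule dt_five[OF t t' _ _ _ _ c(1) _ c(2,3)]) (use T in auto)
 then show ?thesis using c isomorphicI by blast
qed

lemma dt_fibre:
 assumes g: "g : Hom y z" shows "EX x f h. dt x y z f g h"
proof -
 obtain w h' k where t: "dt y z w g h' k" using dt_cone[OF g] by blast
 note T = dtD[OF t]
 obtain x where x: "x : Ob" "isomorphic C (Sh x) w" using shift_ess_surj[OF T(13)] by blast
 obtain p q where p: "p : Hom (Sh x) w" "q : Hom w (Sh x)" "q ** p = idn C (Sh x)" "p ** q = idn C w" "is_iso C q" using isomorphicE[OF x(2)] by metis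
 have "k ** p : Hom (Sh x) (Sh y)" using p T by simp
 then obtain m where m: "m : Hom x y" "Sa m = k ** p" using shift_full[OF x(1) T(11)] by blast
 have "dt y z (Sh x) g (q ** h') (k ** p)"
 proof (rule dt_iso[OF t, of _ _ _ _ _ _ "idn C y" "idn C z" q])
  show "Sa (idn C y) ** k = (k ** p) ** q" using T p(1,2) p(4) by simp
  show "q ** h' = (q ** h') ** idn C z" using T p(2) by simp
  show "idn C z ** g = g ** idn C y" using T by simp
 qed (use T p x in simp_all)
 moreover have "neg C (Sa (neg C m)) = k ** p" using m p T by simp
 ultimately have "dt y z (Sh x) g (q ** h') (neg C (Sa (neg C m)))" by metis
 then have "dt x y z (neg C m) g (q ** h')" by (rule dt_unrot) (use m in simp)
 then show ?thesis by blast
qed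

lemma iso_dt:
 assumes f: "f : Hom x y" "is_iso C f" and z: "is_zero C z"
 shows "dt x y z f (zer C y z) (zer C z (Sh x))"
proof -
 have o: "x : Ob" "y : Ob" "z : Ob" using Mor_objs[OF f(1)] is_zeroD[OF z] by auto
 show ?thesis by (rule dt_iso[OF dt_idn[OF o(1) z], of _ _ _ _ _ _ "idn C x" f "idn C z"]) (use f o in auto)
qed

lemma dt_zero_iso:
 assumes t: "dt x y z f g h" and z: "is_zero C z" shows "is_iso C f"
proof -
 note T = dtD[OF t]
 obtain w f0 g0 where t1: "dt w x y f0 f g0" using dt_fibre[of f x y] T by auto
 have "isomorphic C (Sh w) z" using dt_cone_unique[OF dt_rot[OF t1] t] .
 then have zw: "is_zero C (Sh w)" using is_zero_isomorphic[OF z] isomorphic_sym by blast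
 have wo: "w : Ob" using dtD[OF t1] by blast
 have "Sa (idn C w) = Sa (zer C w w)" using zw wo by (simp add: is_zero_def)
 then have w: "is_zero C w" using shift_faithful[of "idn C w" w w "zer C w w"] wo by (auto simp: is_zero_def)
 have f0: "f0 = zer C w x" using from_zero[OF w, of f0 x] dtD[OF t1] by simp
 have g0: "g0 = zer C y (Sh w)" using to_zero[OF zw, of g0 y] dtD[OF t1] by simp
 show ?thesis
 proof (rule dt_five[OF dt_idn2[OF T(11) w] t1, of "idn C w" "idn C x" f])
 qed (use T w wo f0 g0 in auto)
qed

lemma dt_third_zero:
 assumes t: "dt x y z f g h" and f: "is_iso C f" shows "is_zero C z"
proof -
 obtain w where w: "is_zero C w" using zero_object by blast
 show ?thesis using dt_cone_unique[OF iso_dt[OF _ f w] t, of ] dtD[OF t] is_zero_isomorphic[OF w] by auto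
qed

end

section \<open>Products and coproducts\<close>

context category begin

lemma is_coproductD:
 assumes "is_coproduct C J X c io"
 shows "c : Ob" "!!j. j : J ==> io j : arr C" "!!j. j : J ==> src C (io j) = X j" "!!j. j : J ==> tgt C (io j) = c"
  "!!j. j : J ==> X j : Ob"
proof -
 show 1: "c : Ob" "!!j. j : J ==> io j : arr C" "!!j. j : J ==> src C (io j) = X j" "!!j. j : J ==> tgt C (io j) = c"
  using assms unfolding is_coproduct_def by auto
 show "X j : Ob" if "j : J" for j using 1(2,3)[OF that] src_obj by metis
qed

lemma coproduct_map:
 assumes "is_coproduct C J X c io" "z : Ob" "!!j. j : J ==> ph j : Hom (X j) z"
 obtains h where "h : Hom c z" "!!j. j : J ==> h ** io j = ph j"
proof -
 have "EX! h. h : Hom c z & (ALL j:J. h ** io j = ph j)"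
  using assms(1)[unfolded is_coproduct_def, THEN conjunct2, THEN conjunct2, rule_format, OF assms(2), of ph] assms(3) by blast
 then obtain h where "h : Hom c z & (ALL j:J. h ** io j = ph j)" by (elim ex1E)
 then show ?thesis using that by blast
qed

lemma coproduct_eq:
 assumes c: "is_coproduct C J X c io" and f: "f : Hom c z" and g: "g : Hom c z"
  and e: "!!j. j : J ==> f ** io j = g ** io j"
 shows "f = g"
proof -
 note d = is_coproductD[OF c]
 have z: "z : Ob" using Mor_objs[OF f] by blast
 have "EX! h. h : Hom c z & (ALL j:J. h ** io j = g ** io j)"
  by (rule c[unfolded is_coproduct_def, THEN conjunct2, THEN conjunct2, rule_format, OF z, of "%j. g ** io j"])
   (use d g in simp)
 then show ?thesis using f g e by blast
qed

lemma is_coproductI: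
 assumes "c : Ob" "!!j. j : J ==> io j : Hom (X j) c"
  "!!z ph. z : Ob ==> (!!j. j : J ==> ph j : Hom (X j) z) ==> EX h:Hom c z. ALL j:J. h ** io j = ph j"
  "!!z h h'. z : Ob ==> h : Hom c z ==> h' : Hom c z ==> (!!j. j : J ==> h ** io j = h' ** io j) ==> h = h'"
 shows "is_coproduct C J X c io" unfolding is_coproduct_def
proof (intro conjI ballI allI impI)
 show "c : Ob" by fact
 show "io j : Hom (X j) c" if "j : J" for j using assms(2) that .
 fix z ph assume z: "z : Ob" and p: "ALL j:J. ph j : Hom (X j) z"
 obtain h where "h : Hom c z" "ALL j:J. h ** io j = ph j" using assms(3)[OF z] p by blast
 then show "EX! h. h : Hom c z & (ALL j:J. h ** io j = ph j)" using assms(4)[OF z] by (intro ex1I[of _ h]) auto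
qed

lemma coproduct_iso:
 assumes c: "is_coproduct C J X c io" and t: "th : Hom c d" "is_iso C th"
 shows "is_coproduct C J X d (%j. th ** io j)"
proof -
 note d = is_coproductD[OF c]
 obtain t' where t': "t' : Hom d c" "t' ** th = idn C c" "th ** t' = idn C d" using is_isoE[OF t(2,1)] by metis
 show ?thesis
 proof (rule is_coproductI)
  show "d : Ob" using Mor_objs[OF t(1)] by blast
  show "th ** io j : Hom (X j) d" if "j : J" for j using d that t by simp
  show "EX h:Hom d z. ALL j:J. h ** (th ** io j) = ph j" if z: "z : Ob" and p: "!!j. j : J ==> ph j : Hom (X j) z" for z ph
  proof -
   obtain h where h: "h : Hom c z" "!!j. j : J ==> h ** io j = ph j" using coproduct_map[OF c z, of ph] p by blast
   then show ?thesis by (intro bexI[of _ "h ** t'"]) (use h t t' d in \<open>simp_all add: pre_eq[OF t'(2)]\<close>)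
  qed
  show "h = h'" if z: "z : Ob" and h: "h : Hom d z" "h' : Hom d z"
   and e: "!!j. j : J ==> h ** (th ** io j) = h' ** (th ** io j)" for z h h'
  proof -
   have "h ** th = h' ** th" by (rule coproduct_eq[OF c]) (use h t e d in simp_all)
   then have "(h ** th) ** t' = (h' ** th) ** t'" by simp
   then show ?thesis using h t t' by simp
  qed
 qed
qed

lemma coproduct_unique:
 assumes c: "is_coproduct C J X c io" and d: "is_coproduct C J X d ka"
 obtains th where "th : Hom c d" "is_iso C th" "!!j. j : J ==> th ** io j = ka j"
proof -
 note D = is_coproductD[OF c] is_coproductD[OF d]
 obtain t where t: "t : Hom c d" "!!j. j : J ==> t ** io j = ka j" using coproduct_map[OF c, of d ka] D by auto
 obtain s where s: "s : Hom d c" "!!j. j : J ==> s ** ka j = io j" using coproduct_map[OF d, of c io] D by auto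
 have "s ** t = idn C c" by (rule coproduct_eq[OF c]) (use s t D in simp_all)
 moreover have "t ** s = idn C d" by (rule coproduct_eq[OF d]) (use s t D in simp_all)
 ultimately show ?thesis using that[OF t(1) is_isoI[OF t(1) s(1)] t(2)] by blast
qed

lemma coproduct_replace:
 assumes c: "is_coproduct C J X c io" and b: "!!j. j : J ==> be j : Hom (Y j) (X j) & is_iso C (be j)"
 shows "is_coproduct C J Y c (%j. io j ** be j)"
proof -
 note d = is_coproductD[OF c]
 have "ALL j:J. EX b'. b' : Hom (X j) (Y j) & b' ** be j = idn C (Y j) & be j ** b' = idn C (X j)" using b is_isoE by metis
 then obtain b' where b': "!!j. j : J ==> b' j : Hom (X j) (Y j)" "!!j. j : J ==> b' j ** be j = idn C (Y j)"
  "!!j. j : J ==> be j ** b' j = idn C (X j)" by metis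
 show ?thesis
 proof (rule is_coproductI)
  show "c : Ob" by (rule d)
  show "io j ** be j : Hom (Y j) c" if "j : J" for j using d b that by simp
  show "EX h:Hom c z. ALL j:J. h ** (io j ** be j) = ph j" if z: "z : Ob" and p: "!!j. j : J ==> ph j : Hom (Y j) z" for z ph
  proof -
   obtain h where h: "h : Hom c z" "!!j. j : J ==> h ** io j = ph j ** b' j"
    by (rule coproduct_map[OF c z, of "%j. ph j ** b' j"]) (use b' p in simp_all)
   have "h ** (io j ** be j) = ph j" if j: "j : J" for j using h(1) d b[OF j] b'[OF j] p[OF j] j by (simp add: pre_eq[OF h(2)[OF j]])
   then show ?thesis using h(1) by blast
  qed
  show "h = h'" if z: "z : Ob" and h: "h : Hom c z" "h' : Hom c z"
   and e: "!!j. j : J ==> h ** (io j ** be j) = h' ** (io j ** be j)" for z h h'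
  proof (rule coproduct_eq[OF c h])
   fix j assume j: "j : J"
   have "(h ** (io j ** be j)) ** b' j = (h' ** (io j ** be j)) ** b' j" using e[OF j] by simp
   then show "h ** io j = h' ** io j" using h d b[OF j] b'[OF j] j by simp
  qed
 qed
qed

lemma coproduct_reindex:
 assumes c: "is_coproduct C A X c io" and f: "bij_betw f J A"
 shows "is_coproduct C J (%j. X (f j)) c (%j. io (f j))"
proof (rule is_coproductI)
 note d = is_coproductD[OF c] and fi = bij_betwE[OF f, rule_format]
 show "c : Ob" by (rule d)
 show "io (f j) : Hom (X (f j)) c" if "j : J" for j using d fi[OF that] by simp
 show "EX h:Hom c z. ALL j:J. h ** io (f j) = ph j" if z: "z : Ob" and p: "!!j. j : J ==> ph j : Hom (X (f j)) z" for z ph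
 proof -
  have g: "inv_into J f a : J" "f (inv_into J f a) = a" if "a : A" for a using that f by (auto simp: bij_betw_def inv_into_into f_inv_into_f)
  have g2: "inv_into J f (f j) = j" if "j : J" for j using f that by (simp add: bij_betw_inv_into_left)
  obtain h where "h : Hom c z" "!!a. a : A ==> h ** io a = ph (inv_into J f a)"
   by (rule coproduct_map[OF c z, of "%a. ph (inv_into J f a)"]) (use p g in simp_all)
  then show ?thesis using g2 fi by (intro bexI[of _ h]) auto
 qed
 show "h = h'" if z: "z : Ob" and h: "h : Hom c z" "h' : Hom c z"
   and e: "!!j. j : J ==> h ** io (f j) = h' ** io (f j)" for z h h'
 proof (rule coproduct_eq[OF c h])
  fix a assume "a : A"
  then obtain j where "j : J" "a = f j" using f by (auto simp: bij_betw_def)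
  then show "h ** io a = h' ** io a" using e by blast
 qed
qed

lemma coproduct_reindex':
 assumes c: "is_coproduct C J (%j. X (f j)) c io" and f: "bij_betw f J A"
 shows "is_coproduct C A X c (%a. io (inv_into J f a))"
proof -
 have g: "bij_betw (inv_into J f) A J" "!!a. a : A ==> f (inv_into J f a) = a" using bij_betw_inv_into[OF f] bij_betw_inv_into_right[OF f] by auto
 have "is_coproduct C A (%a. X (f (inv_into J f a))) c (%a. io (inv_into J f a))" using coproduct_reindex[OF c g(1)] .
 then show ?thesis using g(2) unfolding is_coproduct_def by (simp cong: ball_cong)
qed

lemma is_productD:
 assumes "is_product C J X p pr"
 shows "p : Ob" "!!j. j : J ==> pr j : arr C" "!!j. j : J ==> tgt C (pr j) = X j" "!!j. j : J ==> src C (pr j) = p"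
  "!!j. j : J ==> X j : Ob"
proof -
 show 1: "p : Ob" "!!j. j : J ==> pr j : arr C" "!!j. j : J ==> tgt C (pr j) = X j" "!!j. j : J ==> src C (pr j) = p"
  using assms unfolding is_product_def by auto
 show "X j : Ob" if "j : J" for j using 1(2,3)[OF that] tgt_obj by metis
qed

lemma product_map:
 assumes "is_product C J X p pr" "z : Ob" "!!j. j : J ==> ph j : Hom z (X j)"
 obtains h where "h : Hom z p" "!!j. j : J ==> pr j ** h = ph j"
proof -
 have "EX! h. h : Hom z p & (ALL j:J. pr j ** h = ph j)"
  using assms(1)[unfolded is_product_def, THEN conjunct2, THEN conjunct2, rule_format, OF assms(2), of ph] assms(3) by blast
 then obtain h where "h : Hom z p & (ALL j:J. pr j ** h = ph j)" by (elim ex1E)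
 then show ?thesis using that by blast
qed

lemma product_eq:
 assumes c: "is_product C J X p pr" and f: "f : Hom z p" and g: "g : Hom z p"
  and e: "!!j. j : J ==> pr j ** f = pr j ** g"
 shows "f = g"
proof -
 note d = is_productD[OF c]
 have z: "z : Ob" using Mor_objs[OF f] by blast
 have "EX! h. h : Hom z p & (ALL j:J. pr j ** h = pr j ** g)"
  by (rule c[unfolded is_product_def, THEN conjunct2, THEN conjunct2, rule_format, OF z, of "%j. pr j ** g"])
   (use d g in simp)
 then show ?thesis using f g e by blast
qed

lemma is_productI:
 assumes "p : Ob" "!!j. j : J ==> pr j : Hom p (X j)"
  "!!z ph. z : Ob ==> (!!j. j : J ==> ph j : Hom z (X j)) ==> EX h:Hom z p. ALL j:J. pr j ** h = ph j"
  "!!z h h'. z : Ob ==> h : Hom z p ==> h' : Hom z p ==> (!!j. j : J ==> pr j ** h = pr j ** h') ==> h = h'"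
 shows "is_product C J X p pr" unfolding is_product_def
proof (intro conjI ballI allI impI)
 show "p : Ob" by fact
 show "pr j : Hom p (X j)" if "j : J" for j using assms(2) that .
 fix z ph assume z: "z : Ob" and p: "ALL j:J. ph j : Hom z (X j)"
 obtain h where "h : Hom z p" "ALL j:J. pr j ** h = ph j" using assms(3)[OF z] p by blast
 then show "EX! h. h : Hom z p & (ALL j:J. pr j ** h = ph j)" using assms(4)[OF z] by (intro ex1I[of _ h]) auto
qed

lemma product_reindex:
 assumes c: "is_product C A X p pr" and f: "bij_betw f J A"
 shows "is_product C J (%j. X (f j)) p (%j. pr (f j))"
proof (rule is_productI)
 note d = is_productD[OF c] and fi = bij_betwE[OF f, rule_format]
 show "p : Ob" by (rule d)
 show "pr (f j) : Hom p (X (f j))" if "j : J" for j using d fi[OF that] by simp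
 show "EX h:Hom z p. ALL j:J. pr (f j) ** h = ph j" if z: "z : Ob" and p: "!!j. j : J ==> ph j : Hom z (X (f j))" for z ph
 proof -
  have g: "inv_into J f a : J" "f (inv_into J f a) = a" if "a : A" for a using that f by (auto simp: bij_betw_def inv_into_into f_inv_into_f)
  have g2: "inv_into J f (f j) = j" if "j : J" for j using f that by (simp add: bij_betw_inv_into_left)
  obtain h where "h : Hom z p" "!!a. a : A ==> pr a ** h = ph (inv_into J f a)"
   by (rule product_map[OF c z, of "%a. ph (inv_into J f a)"]) (use p g in simp_all)
  then show ?thesis using g2 fi by (intro bexI[of _ h]) auto
 qed
 show "h = h'" if z: "z : Ob" and h: "h : Hom z p" "h' : Hom z p"
   and e: "!!j. j : J ==> pr (f j) ** h = pr (f j) ** h'" for z h h'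
 proof (rule product_eq[OF c h])
  fix a assume "a : A"
  then obtain j where "j : J" "a = f j" using f by (auto simp: bij_betw_def)
  then show "pr a ** h = pr a ** h'" using e by blast
 qed
qed

lemma product_unique:
 assumes c: "is_product C J X c pr" and d: "is_product C J X d ka"
 shows "isomorphic C c d"
proof -
 note D = is_productD[OF c] is_productD[OF d]
 obtain t where t: "t : Hom c d" "!!j. j : J ==> ka j ** t = pr j" using product_map[OF d, of c pr] D by auto
 obtain s where s: "s : Hom d c" "!!j. j : J ==> pr j ** s = ka j" using product_map[OF c, of d ka] D by auto
 have "s ** t = idn C c" by (rule product_eq[OF c]) (use s t D in \<open>simp_all add: pre_eq[OF s(2)]\<close>)
 moreover have "t ** s = idn C d" by (rule product_eq[OF d]) (use s t D in \<open>simp_all add: pre_eq[OF t(2)]\<close>)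
 ultimately show ?thesis using isomorphicI[OF t(1) is_isoI[OF t(1) s(1)]] by blast
qed

end

section \<open>Triangulated subcategories and the morphisms they invert\<close>

context triangulated_category begin

lemma ts_sub: "tsub S ==> x : S ==> x : Ob"
 and ts_zero: "tsub S ==> is_zero C z ==> z : S" unfolding triangulated_subcat_def by blast+

lemma
 assumes "tsub S" "dt x y z f g h"
 shows ts_third: "x : S ==> y : S ==> z : S"
  and ts_first: "y : S ==> z : S ==> x : S"
  and ts_second: "x : S ==> z : S ==> y : S"
 using assms(1)[unfolded triangulated_subcat_def, THEN conjunct2, THEN conjunct2, rule_format, OF dtD(1)[OF assms(2)]]
  dtD[OF assms(2)] by auto

lemma ts_iso: assumes S: "tsub S" and x: "x : S" and i: "isomorphic C x y" shows "y : S"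
proof -
 obtain f where f: "f : Hom x y" "is_iso C f" using i unfolding isomorphic_def by blast
 obtain z where z: "is_zero C z" using zero_object by blast
 show ?thesis using ts_second[OF S iso_dt[OF f z] x ts_zero[OF S z]] .
qed

lemma ts_shift: "tsub S ==> x : S ==> Sh x : S"
 and ts_unshift: "tsub S ==> x : Ob ==> Sh x : S ==> x : S"
proof -
 obtain z where z: "is_zero C z" using zero_object by blast
 have t: "x : Ob ==> dt x z (Sh x) (zer C x z) (zer C z (Sh x)) (neg C (Sa (idn C x)))" by (rule dt_rot[OF dt_idn[OF _ z]])
 show "Sh x : S" if "tsub S" "x : S" using ts_third[OF that(1) t that(2)] ts_zero[OF that(1) z] ts_sub[OF that] by blast
 show "x : S" if "tsub S" "x : Ob" "Sh x : S" using ts_first[OF that(1) t[OF that(2)] ts_zero[OF that(1) z] that(3)] .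
qed

lemma triangulated_subcatI:
 assumes "S \<subseteq> Ob" "!!z. is_zero C z ==> z : S"
  "!!x y z f g h. dt x y z f g h ==> x : S ==> y : S ==> z : S"
  "!!x y z f g h. dt x y z f g h ==> y : S ==> z : S ==> x : S"
  "!!x y z f g h. dt x y z f g h ==> x : S ==> z : S ==> y : S"
 shows "tsub S" unfolding triangulated_subcat_def
proof (intro conjI allI impI)
 show "S \<subseteq> Ob" "{z. is_zero C z} \<subseteq> S" using assms(1,2) by blast+
 fix f g h assume "(f, g, h) : tri C"
 note t = tri_dt[OF this]
 show "src C h : S" if "src C f : S & src C g : S" using assms(3)[OF t] that by blast
 show "src C f : S" if "src C g : S & src C h : S" using assms(4)[OF t] that by blast
 show "src C g : S" if "src C f : S & src C h : S" using assms(5)[OF t] that by blast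
qed

lemma ts_obj: "tsub (Ob)"
 by (rule triangulated_subcatI) (auto simp: dtD is_zeroD dest: dtD(11-13))

lemma cone_inI: "dt x y z s g h ==> z : S ==> s : cone_in C S"
 unfolding cone_in_def using dtD(1,2,7)[of x y z s g h] by blast

lemma cone_in_arr: "s : cone_in C S ==> s : arr C"
 unfolding cone_in_def by blast

lemma cone_inE:
 assumes "s : cone_in C S" "s : Hom x y"
 obtains z g h where "dt x y z s g h" "z : S"
proof -
 obtain g h where "(s, g, h) : tri C" "tgt C g : S" using assms(1) unfolding cone_in_def by blast
 then show ?thesis using that[of "src C h" g h] tri_dt[of s g h] assms(2) dtD[of "src C s" "src C g" "src C h" s g h] by force
qed

lemma cone_inD:
 assumes S: "tsub S" and s: "s : cone_in C S" and t: "dt x y z s g h" shows "z : S"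
proof -
 have "s : Hom x y" using dtD[OF t] by simp
 then obtain z' g' h' where t': "dt x y z' s g' h'" "z' : S" using cone_inE[OF s] by metis
 show ?thesis using ts_iso[OF S t'(2) dt_cone_unique[OF t'(1) t]] .
qed

lemma cone_in_iso: assumes S: "tsub S" and s: "is_iso C s" shows "s : cone_in C S"
proof -
 have a: "s : Hom (src C s) (tgt C s)" using is_iso_arr[OF s] by simp
 obtain z where z: "is_zero C z" using zero_object by blast
 show ?thesis using cone_inI[OF iso_dt[OF a s z] ts_zero[OF S z]] .
qed

lemma octahedron:
 assumes f: "f : Hom x y" and g: "g : Hom y z"
 obtains a b c f1 f2 k1 k2 g1 g2 u v w where
  "dt x y a f f1 f2" "dt x z b (g ** f) k1 k2" "dt y z c g g1 g2" "dt a b c u v w"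
proof -
 obtain a f1 f2 where A: "dt x y a f f1 f2" using dt_cone[OF f] by blast
 have "g ** f : Hom x z" using f g by simp
 then obtain b k1 k2 where B: "dt x z b (g ** f) k1 k2" using dt_cone by blast
 obtain c g1 g2 where D: "dt y z c g g1 g2" using dt_cone[OF g] by blast
 have "tgt C f = src C g" using f g by simp
 then obtain u v where "(u, v, Sa f1 ** g2) : tri C" "u : Hom (tgt C f1) (tgt C k1)" "v : Hom (tgt C k1) (tgt C g1)"
  using TR4[OF dtD(1)[OF A] dtD(1)[OF D] _ dtD(1)[OF B]] by blast
 then have "dt a b c u v (Sa f1 ** g2)" using dtD[OF A] dtD[OF B] dtD[OF D] by (simp add: dt_def)
 then show ?thesis using that A B D by blast
qed

text \<open>By the octahedral axiom, morphisms whose cone lies in \<open>S\<close> have the two-out-of-three property.\<close>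

lemma
 assumes S: "tsub S" and f: "f : Hom x y" and g: "g : Hom y z"
 shows cone_in_cmp: "f : cone_in C S ==> g : cone_in C S ==> g ** f : cone_in C S"
  and cone_in_second: "f : cone_in C S ==> g ** f : cone_in C S ==> g : cone_in C S"
  and cone_in_first: "g : cone_in C S ==> g ** f : cone_in C S ==> f : cone_in C S"
proof -
 obtain a b c f1 f2 k1 k2 g1 g2 u v w where
  t: "dt x y a f f1 f2" "dt x z b (g ** f) k1 k2" "dt y z c g g1 g2" "dt a b c u v w" using octahedron[OF f g] .
 note d = cone_inD[OF S _ t(1)] cone_inD[OF S _ t(2)] cone_inD[OF S _ t(3)]
 show "g ** f : cone_in C S" if "f : cone_in C S" "g : cone_in C S" using cone_inI[OF t(2)] ts_second[OF S t(4)] d that by blast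
 show "g : cone_in C S" if "f : cone_in C S" "g ** f : cone_in C S" using cone_inI[OF t(3)] ts_third[OF S t(4)] d that by blast
 show "f : cone_in C S" if "g : cone_in C S" "g ** f : cone_in C S" using cone_inI[OF t(1)] ts_first[OF S t(4)] d that by blast
qed

lemma cone_in_pullback:
 assumes S: "tsub S" and s: "s : cone_in C S" "s : Hom w x" and f: "f : Hom z x"
 obtains v s' f' where "s' : Hom v z" "f' : Hom v w" "s' : cone_in C S" "f ** s' = s ** f'"
proof -
 obtain c g h where t: "dt w x c s g h" "c : S" using cone_inE[OF s] .
 note T = dtD[OF t(1)]
 have "g ** f : Hom z c" using f T by simp
 then obtain v s' h' where t': "dt v z c s' (g ** f) h'" using dt_fibre by blast
 note T' = dtD[OF t']
 have "g ** (f ** s') = zer C v c" using dt_cmp0[OF t'] T T' f by simp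
 then obtain f' where f': "f' : Hom v w" "s ** f' = f ** s'" using dt_wker[OF t(1), of "f ** s'" v] f T' by auto
 have "Sh v : Ob" using T' by simp
 have "s' : cone_in C S" using cone_inI[OF t' t(2)] .
 then show ?thesis using that[of s' v f'] f' T' by simp
qed

lemma cone_in_kill:
 assumes c: "c : S" and h: "h : Hom w c"
 obtains w' v where "v : Hom w' w" "v : cone_in C S" "h ** v = zer C w' c"
proof -
 obtain w' v k where t: "dt w' w c v h k" using dt_fibre[OF h] by blast
 show ?thesis using that[of v w'] dtD[OF t] cone_inI[OF t c] dt_cmp0[OF t] by simp
qed

lemma cone_in_equalize:
 assumes S: "tsub S" and s: "s : cone_in C S" "s : Hom x y"
  and f: "f : Hom w x" "g : Hom w x" and e: "s ** f = s ** g"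
 obtains w' v where "v : Hom w' w" "v : cone_in C S" "f ** v = g ** v"
proof -
 obtain c n m where t: "dt c x y n s m" using dt_fibre[OF s(2)] by blast
 note T = dtD[OF t]
 have c: "c : S" using ts_unshift[OF S T(11)] cone_inD[OF S s(1) dt_rot[OF t]] by blast
 have "s ** sub C f g = zer C w y" using f e s T Mor_objs[OF f(1)] by (simp add: cmp_sub)
 then obtain h where h: "h : Hom w c" "n ** h = sub C f g" using dt_wker[OF t, of "sub C f g" w] f by auto
 obtain w' v where v: "v : Hom w' w" "v : cone_in C S" "h ** v = zer C w' c" using cone_in_kill[OF c h(1)] .
 have w': "w' : Ob" using Mor_objs[OF v(1)] by blast
 have "sub C f g ** v = zer C w' x" unfolding h(2)[symmetric] using h(1) v T w' by simp
 then have "sub C (f ** v) (g ** v) = zer C w' x" using f v by (simp add: sub_cmp)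
 then have "f ** v = g ** v" by (rule sub_eq_zerD) (use f v in simp_all)
 then show ?thesis using that v by blast
qed

lemma is_iso_neg_idn: "x : Ob ==> is_iso C (neg C (idn C x))"
 by (rule is_isoI[of _ x x "neg C (idn C x)"]) (simp_all add: neg_cmp)

lemma cone_in_shift: assumes S: "tsub S" and s: "s : cone_in C S" shows "Sa s : cone_in C S"
proof -
 obtain x y where xy: "s : Hom x y" using cone_in_arr[OF s] by simp
 obtain z g h where t: "dt x y z s g h" "z : S" using cone_inE[OF s xy] .
 have o: "x : Ob" "y : Ob" using Mor_objs[OF xy] by auto
 have 1: "neg C (Sa s) : cone_in C S" using cone_inI[OF dt_rot[OF dt_rot[OF dt_rot[OF t(1)]]] ts_shift[OF S t(2)]] .
 have "neg C (Sa s) ** neg C (idn C (Sh x)) : cone_in C S" by (rule cone_in_cmp[OF S _ _ cone_in_iso[OF S is_iso_neg_idn] 1]) (use o xy in simp_all)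
 moreover have "neg C (Sa s) ** neg C (idn C (Sh x)) = Sa s" using o xy by (simp add: cmp_neg)
 ultimately show ?thesis by simp
qed

section \<open>Orthogonal subcategories\<close>

definition perp where
 "perp S = {y : Ob. ALL s:S. Hom s y \<subseteq> {zer C s y}}"

definition coperp where
 "coperp S = {x : Ob. ALL y:S. Hom x y \<subseteq> {zer C x y}}"

lemma perpD: "y : perp S ==> s : S ==> f : Hom s y ==> f = zer C s y"
 and coperpD: "x : coperp S ==> y : S ==> f : Hom x y ==> f = zer C x y"
 and perp_obj: "y : perp S ==> y : Ob"
 and coperp_obj: "y : coperp S ==> y : Ob" unfolding perp_def coperp_def by blast+

definition shift_closed where
 "shift_closed S \<longleftrightarrow> (ALL x:Ob. x : S \<longleftrightarrow> Sh x : S) & (ALL x y. x : S --> isomorphic C x y --> y : S) & S \<subseteq> Ob"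

lemma ts_shift_closed: "tsub S ==> shift_closed S"
 unfolding shift_closed_def using ts_shift ts_unshift ts_iso ts_sub by blast

lemma coperp_triangulated:
 assumes S: "shift_closed S" shows "tsub (coperp S)"
proof -
 let ?L = "coperp S"
 have 0: "Sh x : ?L" if x: "x : ?L" for x unfolding coperp_def
 proof (intro CollectI conjI ballI subsetI)
  note xo = coperp_obj[OF x]
  show "Sh x : Ob" using xo by simp
  fix y f assume y: "y : S" and f: "f : Hom (Sh x) y"
  have yo: "y : Ob" using Mor_objs[OF f] by blast
  obtain y' where y': "y' : Ob" "isomorphic C (Sh y') y" using shift_ess_surj[OF yo] by blast
  obtain p q where p: "p : Hom (Sh y') y" "q : Hom y (Sh y')" "p ** q = idn C y" using isomorphicE[OF y'(2)] by metis
  have y'S: "y' : S" using S y y' isomorphic_sym unfolding shift_closed_def by blast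
  have "q ** f : Hom (Sh x) (Sh y')" using p f by simp
  then obtain v where v: "v : Hom x y'" "Sa v = q ** f" using shift_full[OF xo y'(1)] by blast
  have "v = zer C x y'" using coperpD[OF x y'S v(1)] .
  then have "q ** f = zer C (Sh x) (Sh y')" using v xo y' by simp
  then have "p ** (q ** f) = zer C (Sh x) y" using p xo by simp
  then show "f : {zer C (Sh x) y}" using p f yo by (simp add: pre_eq[OF p(3)])
 qed
 have 1: "x : ?L" if x: "x : Ob" "Sh x : ?L" for x unfolding coperp_def
 proof (intro CollectI conjI ballI subsetI)
  show "x : Ob" by fact
  fix y f assume y: "y : S" and f: "f : Hom x y"
  have yo: "y : Ob" using Mor_objs[OF f] by blast
  have "Sh y : S" using S y yo unfolding shift_closed_def by blast
  then have "Sa f = zer C (Sh x) (Sh y)" using coperpD[OF x(2), of "Sh y" "Sa f"] f by simp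
  then have "Sa f = Sa (zer C x y)" using x yo by simp
  then show "f : {zer C x y}" using shift_faithful[of f x y "zer C x y"] f x yo by simp
 qed
 have 2: "y : ?L" if t: "dt x y z f g h" and x: "x : ?L" and z: "z : ?L" for x y z f g h unfolding coperp_def
 proof (intro CollectI conjI ballI subsetI)
  note T = dtD[OF t]
  show "y : Ob" by (rule T)
  fix a u assume a: "a : S" and u: "u : Hom y a"
  have ao: "a : Ob" using Mor_objs[OF u] by blast
  have "u ** f = zer C x a" using coperpD[OF x a, of "u ** f"] u T by simp
  then obtain v where v: "v : Hom z a" "v ** g = u" using dt_wcok[OF t u] by blast
  have "v = zer C z a" using coperpD[OF z a v(1)] .
  then show "u : {zer C y a}" using v T ao by simp
 qed
 show ?thesis
 proof (rule triangulated_subcatI)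
  show "?L \<subseteq> Ob" using coperp_obj by blast
  show "z : ?L" if "is_zero C z" for z unfolding coperp_def using that from_zero is_zeroD by blast
  show third: "z : ?L" if t: "dt x y z f g h" "x : ?L" "y : ?L" for x y z f g h using 2[OF dt_rot[OF t(1)] t(3) 0[OF t(2)]] .
  show "x : ?L" if t: "dt x y z f g h" "y : ?L" "z : ?L" for x y z f g h using third[OF dt_rot[OF t(1)] t(2,3)] 1 dtD(11)[OF t(1)] by blast
  show "y : ?L" if "dt x y z f g h" "x : ?L" "z : ?L" for x y z f g h using 2 that .
 qed
qed

lemma perp_triangulated:
 assumes S: "shift_closed S" shows "tsub (perp S)"
proof -
 let ?R = "perp S"
 have 0: "Sh x : ?R" if x: "x : ?R" for x unfolding perp_def
 proof (intro CollectI conjI ballI subsetI)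
  note xo = perp_obj[OF x]
  show "Sh x : Ob" using xo by simp
  fix y f assume y: "y : S" and f: "f : Hom y (Sh x)"
  have yo: "y : Ob" using Mor_objs[OF f] by blast
  obtain y' where y': "y' : Ob" "isomorphic C (Sh y') y" using shift_ess_surj[OF yo] by blast
  obtain p q where p: "p : Hom (Sh y') y" "q : Hom y (Sh y')" "p ** q = idn C y" using isomorphicE[OF y'(2)] by metis
  have y'S: "y' : S" using S y y' isomorphic_sym unfolding shift_closed_def by blast
  have "f ** p : Hom (Sh y') (Sh x)" using p f by simp
  then obtain v where v: "v : Hom y' x" "Sa v = f ** p" using shift_full[OF y'(1) xo] by blast
  have "v = zer C y' x" using perpD[OF x y'S v(1)] .
  then have "f ** p = zer C (Sh y') (Sh x)" using v xo y' by simp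
  then have "(f ** p) ** q = zer C y (Sh x)" using p xo by simp
  then show "f : {zer C y (Sh x)}" using p f yo by simp
 qed
 have 1: "x : ?R" if x: "x : Ob" "Sh x : ?R" for x unfolding perp_def
 proof (intro CollectI conjI ballI subsetI)
  show "x : Ob" by fact
  fix y f assume y: "y : S" and f: "f : Hom y x"
  have yo: "y : Ob" using Mor_objs[OF f] by blast
  have "Sh y : S" using S y yo unfolding shift_closed_def by blast
  then have "Sa f = zer C (Sh y) (Sh x)" using perpD[OF x(2), of "Sh y" "Sa f"] f by simp
  then have "Sa f = Sa (zer C y x)" using x yo by simp
  then show "f : {zer C y x}" using shift_faithful[of f y x "zer C y x"] f x yo by simp
 qed
 have 2: "y : ?R" if t: "dt x y z f g h" and x: "x : ?R" and z: "z : ?R" for x y z f g h unfolding perp_def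
 proof (intro CollectI conjI ballI subsetI)
  note T = dtD[OF t]
  show "y : Ob" by (rule T)
  fix a u assume a: "a : S" and u: "u : Hom a y"
  have ao: "a : Ob" using Mor_objs[OF u] by blast
  have "g ** u = zer C a z" using perpD[OF z a, of "g ** u"] u T by simp
  then obtain v where v: "v : Hom a x" "f ** v = u" using dt_wker[OF t u] by blast
  have "v = zer C a x" using perpD[OF x a v(1)] .
  then show "u : {zer C a y}" using v T ao by simp
 qed
 show ?thesis
 proof (rule triangulated_subcatI)
  show "?R \<subseteq> Ob" using perp_obj by blast
  show "z : ?R" if "is_zero C z" for z unfolding perp_def using that to_zero is_zeroD by blast
  show third: "z : ?R" if t: "dt x y z f g h" "x : ?R" "y : ?R" for x y z f g h using 2[OF dt_rot[OF t(1)] t(3) 0[OF t(2)]] .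
  show "x : ?R" if t: "dt x y z f g h" "y : ?R" "z : ?R" for x y z f g h using third[OF dt_rot[OF t(1)] t(2,3)] 1 dtD(11)[OF t(1)] by blast
  show "y : ?R" if "dt x y z f g h" "x : ?R" "z : ?R" for x y z f g h using 2 that .
 qed
qed

lemma perp_product:
 assumes p: "is_product C J X p pr" and X: "X ` J \<subseteq> perp S" and S: "S \<subseteq> Ob"
 shows "p : perp S" unfolding perp_def
proof (intro CollectI conjI ballI subsetI)
 note d = is_productD[OF p]
 show "p : Ob" by (rule d)
 fix a u assume a: "a : S" and u: "u : Hom a p"
 have ao: "a : Ob" using S a by blast
 have "u = zer C a p"
 proof (rule product_eq[OF p u])
  show "zer C a p : Hom a p" using ao d by simp
  fix j assume j: "j : J"
  have "pr j ** u = zer C a (X j)" using perpD[of "X j" S a "pr j ** u"] X j a u d by auto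
  then show "pr j ** u = pr j ** zer C a p" using d j ao by simp
 qed
 then show "u : {zer C a p}" by simp
qed

lemma coperp_coproduct:
 assumes p: "is_coproduct C J X p io" and X: "X ` J \<subseteq> coperp S" and S: "S \<subseteq> Ob"
 shows "p : coperp S" unfolding coperp_def
proof (intro CollectI conjI ballI subsetI)
 note d = is_coproductD[OF p]
 show "p : Ob" by (rule d)
 fix a u assume a: "a : S" and u: "u : Hom p a"
 have ao: "a : Ob" using S a by blast
 have "u = zer C p a"
 proof (rule coproduct_eq[OF p u])
  show "zer C p a : Hom p a" using ao d by simp
  fix j assume j: "j : J"
  have "u ** io j = zer C (X j) a" using coperpD[of "X j" S a "u ** io j"] X j a u d by auto
  then show "u ** io j = zer C p a ** io j" using d j ao by simp
 qed
 then show "u : {zer C p a}" by simp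
qed

text \<open>Maps into a local object extend uniquely along the morphisms with cone in \<open>S\<close>.\<close>

lemma local_cancel:
 assumes S: "tsub S" and s: "s : cone_in C S" "s : Hom w x" and z: "z : perp S"
  and f: "f : Hom x z" "g : Hom x z" and e: "f ** s = g ** s"
 shows "f = g"
proof -
 obtain c m n where t: "dt w x c s m n" "c : S" using cone_inE[OF s] .
 note T = dtD[OF t(1)]
 have zo: "z : Ob" using perp_obj[OF z] .
 have "sub C f g ** s = zer C w z" using f e T zo by (simp add: sub_cmp)
 then obtain v where v: "v : Hom c z" "v ** m = sub C f g" using dt_wcok[OF t(1), of "sub C f g" z] f by auto
 have "v = zer C c z" using perpD[OF z t(2) v(1)] .
 then have "sub C f g = zer C x z" using v T zo by simp
 then show ?thesis by (rule sub_eq_zerD) (use f in simp_all)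
qed

lemma local_extend:
 assumes S: "tsub S" and s: "s : cone_in C S" "s : Hom w x" and z: "z : perp S"
  and f: "f : Hom w z"
 obtains g where "g : Hom x z" "g ** s = f"
proof -
 obtain c n m where t: "dt c w x n s m" using dt_fibre[OF s(2)] by blast
 note T = dtD[OF t]
 have c: "c : S" using ts_unshift[OF S T(11)] cone_inD[OF S s(1) dt_rot[OF t]] by blast
 have "f ** n = zer C c z" using perpD[OF z c, of "f ** n"] f T by simp
 then show ?thesis using dt_wcok[OF t f] that by blast
qed

lemma local_iso:
 assumes S: "tsub S" and s: "s : cone_in C S" "s : Hom w x"
  and w: "w : perp S" and x: "x : perp S"
 shows "is_iso C s"
proof -
 have o: "w : Ob" "x : Ob" using w x perp_obj by auto
 obtain g where g: "g : Hom x w" "g ** s = idn C w" using local_extend[OF S s w, of "idn C w"] o by auto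
 have "s ** g = idn C x" by (rule local_cancel[OF S s x]) (use s g o in simp_all)
 then show ?thesis using is_isoI[OF s(2) g(1) g(2)] by blast
qed

lemma orth_zero:
 assumes "x : S" "x : perp S" shows "is_zero C x" using perpD[OF assms(2,1), of "idn C x"] perp_obj[OF assms(2)] by (simp add: is_zero_def)

section \<open>Split triangles and retracts\<close>

lemma dt_split:
 assumes t: "t : Hom a b" and q: "q : Hom b c" and s: "s : Hom b a" and r: "r : Hom c b"
  and e: "s ** t = idn C a" "q ** r = idn C c" "q ** t = zer C a c" "add C (t ** s) (r ** q) = idn C b"
 shows "EX h. dt a b c t q h"
proof -
 have o: "a : Ob" "b : Ob" "c : Ob" using Mor_objs t q by blast+
 obtain w g h where T: "dt a b w t g h" using dt_cone[OF t] by blast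
 note D = dtD[OF T]
 obtain q' where q': "q' : Hom w c" "q' ** g = q" using dt_wcok[OF T q e(3)] by blast
 have 1: "q' ** (g ** r) = idn C c" using q' r D e(2) by (simp add: pre_eq[OF q'(2)])
 have "Sa t ** h = zer C w (Sh b)" using dt_cmp2[OF T] .
 then have "Sa s ** (Sa t ** h) = zer C w (Sh a)" using D s by simp
 moreover have "Sa s ** Sa t = idn C (Sh a)" using shift_simps(6)[of t s] s t e(1) o by simp
 ultimately have h0: "h = zer C w (Sh a)" using D s t by (simp add: pre_eq)
 have "g ** (t ** s) = zer C b w" using D s t o dt_cmp0[OF T] by (simp add: pre_eq)
 moreover have "g ** add C (t ** s) (r ** q) = g" using D e(4) by simp
 ultimately have grq: "g ** (r ** q) = g" using D s t r q o by (simp add: cmp_add)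
 let ?m = "sub C ((g ** r) ** q') (idn C w)"
 have m: "?m : Hom w w" using D r q' by simp
 have "?m ** g = zer C b w" using D r q' grq o by (simp add: sub_cmp)
 then obtain v where v: "v : Hom (Sh a) w" "v ** h = ?m" using dt_wcok2[OF T m] by blast
 have "?m = zer C w w" using v(1) h0 D o unfolding v(2)[symmetric] by simp
 then have 2: "(g ** r) ** q' = idn C w" by (rule sub_eq_zerD) (use D r q' in simp_all)
 have iq: "is_iso C q'" by (rule is_isoI[OF q'(1), of "g ** r"]) (use D r 1 2 in simp_all)
 have "dt a b c t q (h ** (g ** r))"
 proof (rule dt_iso[OF T, of _ _ _ _ _ _ "idn C a" "idn C b" q'])
  show "Sa (idn C a) ** h = (h ** (g ** r)) ** q'" using 2 D r q'(1) o by simp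
 qed (use D t q r q' iq o in simp_all)
 then show ?thesis by blast
qed

text \<open>If \<open>1\<^sub>c\<close> factors through an object \<open>d\<close> of \<open>S\<close>, then, for \<open>b = \<Coprod>\<^sub>\<nat> c\<close>, the zero
  endomorphism of \<open>b\<close> has its cone in \<open>S\<close>; by two-out-of-three so has every endomorphism of \<open>b\<close>.
  The cone of the shift \<open>b \<rightarrow> b\<close> of the summands is \<open>c\<close>.\<close>

lemma retract_closed:
 assumes S: "tsub S" and i: "i : Hom c d" and r: "r : Hom d c" and ri: "r ** i = idn C c"
  and b: "is_coproduct C (UNIV :: nat set) (%_. c) b io" and b': "is_coproduct C (UNIV :: nat set) (%_. d) b' ka"
  and b'S: "b' : S"
 shows "c : S"
proof -
 note d = is_coproductD[OF b, simplified] and d' = is_coproductD[OF b', simplified]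
 have o: "c : Ob" "d : Ob" using Mor_objs[OF i] by auto
 obtain z0 where z0: "is_zero C z0" using zero_object by blast
 obtain I where I: "I : Hom b b'" "!!n. I ** io n = ka n ** i" by (rule coproduct_map[OF b d'(1), of "%n. ka n ** i"]) (use i d' in simp_all)
 obtain R where R: "R : Hom b' b" "!!n. R ** ka n = io n ** r" by (rule coproduct_map[OF b' d(1), of "%n. io n ** r"]) (use r d in simp_all)
 have RI: "R ** I = idn C b"
 proof (rule coproduct_eq[OF b])
  fix n :: nat
  have "(R ** I) ** io n = (io n ** r) ** i" using I R(1) d d' i by (simp add: pre_eq[OF R(2)])
  then show "(R ** I) ** io n = idn C b ** io n" using d i r ri by simp
 qed (use I R d in simp_all)
 obtain w v where v: "v : Hom w b" "v : cone_in C S" "I ** v = zer C w b'" using cone_in_kill[OF b'S I(1)] .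
 have wo: "w : Ob" using Mor_objs[OF v(1)] by blast
 have "R ** (I ** v) = zer C w b" unfolding v(3) using R wo by simp
 then have v0: "v = zer C w b" using pre_eq[OF RI, of v] I R v by simp
 let ?O = "zer C b b"
 have O: "?O : cone_in C S" by (rule cone_in_second[OF S v(1) _ v(2), of _ b]) (use v v0 d wo in simp_all)
 obtain sh where sh: "sh : Hom b b" "!!n. sh ** io n = io (Suc n)" by (rule coproduct_map[OF b d(1), of "%n. io (Suc n)"]) (use d in simp_all)
 obtain s where s: "s : Hom b b" "!!n. s ** io n = (case n of 0 \<Rightarrow> zer C c b | Suc m \<Rightarrow> io m)"
  by (rule coproduct_map[OF b d(1), of "%n. case n of 0 \<Rightarrow> zer C c b | Suc m \<Rightarrow> io m"]) (use d o in \<open>simp_all split: nat.split\<close>)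
 obtain q where q: "q : Hom b c" "!!n. q ** io n = (case n of 0 \<Rightarrow> idn C c | Suc m \<Rightarrow> zer C c c)"
  by (rule coproduct_map[OF b o(1), of "%n. case n of 0 \<Rightarrow> idn C c | Suc m \<Rightarrow> zer C c c"]) (use d o in \<open>simp_all split: nat.split\<close>)
 have q0: "q ** io 0 = idn C c" "!!n. q ** io (Suc n) = zer C c c" using q(2) by simp_all
 have s0: "s ** io 0 = zer C c b" "!!n. s ** io (Suc n) = io n" using s(2) by simp_all
 have "EX h. dt b b c sh q h"
 proof (rule dt_split[OF sh(1) q(1) s(1)])
  show "io 0 : Hom c b" using d by simp
  show "s ** sh = idn C b" by (rule coproduct_eq[OF b]) (use s(1) sh s0 d in simp_all)
  show "q ** io 0 = idn C c" by (rule q0)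
  show "q ** sh = zer C b c" by (rule coproduct_eq[OF b]) (use q(1) sh q0 d o in simp_all)
  show "add C (sh ** s) (io 0 ** q) = idn C b"
  proof (rule coproduct_eq[OF b])
   fix n show "add C (sh ** s) (io 0 ** q) ** io n = idn C b ** io n" using s(1) sh q(1) d o s0 q0 by (cases n) (simp_all add: add_cmp)
  qed (use s(1) sh q(1) d in simp_all)
 qed
 moreover have "sh : cone_in C S" by (rule cone_in_first[OF S sh(1), of ?O b]) (use O sh d in simp_all)
 ultimately show ?thesis using cone_inD[OF S] by blast
qed

end

section \<open>Exactness of joint right adjoints\<close>

context triangulated_category begin

lemma exact_functorE:
 assumes "exact_functor C C F"
 obtains ph where "additive_functor C C F" "!!x. x : Ob ==> ph x : arr C"
  "!!x. x : Ob ==> src C (ph x) = fob F (Sh x)" "!!x. x : Ob ==> tgt C (ph x) = Sh (fob F x)"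
  "!!x. x : Ob ==> is_iso C (ph x)"
  "!!f. f : arr C ==> ph (tgt C f) ** far F (Sa f) = Sa (far F f) ** ph (src C f)"
  "!!x y z f g h. dt x y z f g h ==> dt (fob F x) (fob F y) (fob F z) (far F f) (far F g) (ph x ** far F h)"
proof -
 obtain ph where p: "additive_functor C C F"
  "!!x. x : Ob ==> ph x : Hom (fob F (Sh x)) (Sh (fob F x)) & is_iso C (ph x)"
  "!!f. f : arr C ==> ph (tgt C f) ** far F (Sa f) = Sa (far F f) ** ph (src C f)"
  "!!f g h. (f, g, h) : tri C ==> (far F f, far F g, ph (src C f) ** far F h) : tri C" using assms unfolding exact_functor_def by blast
 note s = functor_simps[OF additive_functorD(1)[OF p(1)]]
 have "dt (fob F x) (fob F y) (fob F z) (far F f) (far F g) (ph x ** far F h)" if t: "dt x y z f g h" for x y z f g h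
 proof -
  note T = dtD[OF t]
  show ?thesis using p(4)[OF T(1)] p(2)[OF T(11)] T(2-13) s(3-5) by (simp add: dt_def)
 qed
 note t = this
 show ?thesis by (rule that[OF p(1) _ _ _ _ p(3) t]) (use p(2) in simp_all)
qed

lemma exact_additive: "exact_functor C C F ==> additive_functor C C F"
 and exact_is_functor: "exact_functor C C F ==> is_functor C C F" unfolding exact_functor_def additive_functor_def by blast+

lemma exact_dt: "exact_functor C C F ==> dt x y z f g h ==> EX h'. dt (fob F x) (fob F y) (fob F z) (far F f) (far F g) h'"
 by (elim exact_functorE) blast

lemma exact_preimage:
 assumes F: "exact_functor C C F" and S: "tsub S"
 shows "tsub {x : Ob. fob F x : S}"
proof (rule triangulated_subcatI)
 show "z : {x : Ob. fob F x : S}" if z: "is_zero C z" for z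
  using additive_functor_zero[OF add_cat add_cat exact_additive[OF F] z] ts_zero[OF S] is_zeroD[OF z] by simp
 fix x y z f g h assume t: "dt x y z f g h"
 obtain h' where t': "dt (fob F x) (fob F y) (fob F z) (far F f) (far F g) h'" using exact_dt[OF F t] by blast
 note T = dtD[OF t]
 show "z : {x : Ob. fob F x : S}" if "x : {x : Ob. fob F x : S}" "y : {x : Ob. fob F x : S}" using ts_third[OF S t'] that T by simp
 show "x : {x : Ob. fob F x : S}" if "y : {x : Ob. fob F x : S}" "z : {x : Ob. fob F x : S}" using ts_first[OF S t'] that T by simp
 show "y : {x : Ob. fob F x : S}" if "x : {x : Ob. fob F x : S}" "z : {x : Ob. fob F x : S}" using ts_second[OF S t'] that T by simp
qed blast

lemma exact_cone_in:
 assumes F: "exact_functor C C F" and s: "s : cone_in C S" and FS: "!!x. x : S ==> fob F x : S'"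
 shows "far F s : cone_in C S'"
proof -
 have "s : Hom (src C s) (tgt C s)" using cone_in_arr[OF s] by simp
 then obtain z g h where t: "dt (src C s) (tgt C s) z s g h" "z : S" using cone_inE[OF s] by metis
 then obtain h' where "dt (fob F (src C s)) (fob F (tgt C s)) (fob F z) (far F s) (far F g) h'" using exact_dt[OF F] by blast
 then show ?thesis using cone_inI FS[OF t(2)] by blast
qed

text \<open>\<open>A\<close> represents the functor \<open>z \<mapsto> \<Prod>\<^sub>j Hom (F\<^sub>j z, a\<^sub>j)\<close>. With one functor this is
  the value at \<open>a\<close> of its right adjoint; with all \<open>F\<^sub>j\<close> the identity it is the product of the
  \<open>a\<^sub>j\<close>.\<close>

definition joint_univ where
 "joint_univ J F a A p \<longleftrightarrow>
  A : Ob & (ALL j:J. p j : Hom (fob (F j) A) (a j)) &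
  (ALL z:Ob. ALL ph. (ALL j:J. ph j : Hom (fob (F j) z) (a j)) -->
   (EX! u. u : Hom z A & (ALL j:J. p j ** far (F j) u = ph j)))"

lemma joint_univD:
 assumes "joint_univ J F a A p"
 shows "A : Ob" "!!j. j : J ==> p j : arr C" "!!j. j : J ==> src C (p j) = fob (F j) A"
  "!!j. j : J ==> tgt C (p j) = a j" "!!j. j : J ==> a j : Ob"
proof -
 show 1: "A : Ob" "!!j. j : J ==> p j : arr C" "!!j. j : J ==> src C (p j) = fob (F j) A"
  "!!j. j : J ==> tgt C (p j) = a j" using assms unfolding joint_univ_def by auto
 show "a j : Ob" if "j : J" for j using 1(2,4)[OF that] tgt_obj by metis
qed

lemma joint_univ_map:
 assumes "joint_univ J F a A p" "z : Ob" "!!j. j : J ==> ph j : Hom (fob (F j) z) (a j)"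
 obtains u where "u : Hom z A" "!!j. j : J ==> p j ** far (F j) u = ph j"
proof -
 have "EX! u. u : Hom z A & (ALL j:J. p j ** far (F j) u = ph j)"
  using assms(1)[unfolded joint_univ_def, THEN conjunct2, THEN conjunct2, rule_format, OF assms(2), of ph] assms(3) by blast
 then obtain h where "h : Hom z A & (ALL j:J. p j ** far (F j) h = ph j)" by (elim ex1E)
 then show ?thesis using that by blast
qed

lemma joint_univ_eq:
 assumes A: "joint_univ J F a A p" and F: "!!j. j : J ==> is_functor C C (F j)"
  and f: "f : Hom z A" and g: "g : Hom z A"
  and e: "!!j. j : J ==> p j ** far (F j) f = p j ** far (F j) g"
 shows "f = g"
proof -
 note d = joint_univD[OF A]
 have z: "z : Ob" using Mor_objs[OF f] by blast
 have "EX! h. h : Hom z A & (ALL j:J. p j ** far (F j) h = p j ** far (F j) g)"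
  by (rule A[unfolded joint_univ_def, THEN conjunct2, THEN conjunct2, rule_format, OF z, of "%j. p j ** far (F j) g"])
   (use d g functor_simps[OF F] in simp)
 then show ?thesis using f g e by blast
qed

lemma joint_univ_unique:
 assumes A: "joint_univ J F a A p" and B: "joint_univ J F a B q"
  and F: "!!j. j : J ==> is_functor C C (F j)"
 shows "isomorphic C A B"
proof -
 note d = joint_univD[OF A] joint_univD[OF B]
 note s = functor_simps[OF F]
 obtain u where u: "u : Hom A B" "!!j. j : J ==> q j ** far (F j) u = p j" by (rule joint_univ_map[OF B d(1), of p]) (use d in simp_all)
 obtain v where v: "v : Hom B A" "!!j. j : J ==> p j ** far (F j) v = q j" by (rule joint_univ_map[OF A d(6), of q]) (use d in simp_all)
 have "v ** u = idn C A" by (rule joint_univ_eq[OF A F]) (use u v d s in \<open>simp_all add: pre_eq[OF v(2)]\<close>)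
 moreover have "u ** v = idn C B" by (rule joint_univ_eq[OF B F]) (use u v d s in \<open>simp_all add: pre_eq[OF u(2)]\<close>)
 ultimately show ?thesis using isomorphicI[OF u(1) is_isoI[OF u(1) v(1)]] by blast
qed

lemma joint_univ_shift:
 assumes A: "joint_univ J F a A p" and F: "!!j. j : J ==> is_functor C C (F j)"
  and p: "!!j x. j : J ==> x : Ob ==> ph j x : arr C"
  "!!j x. j : J ==> x : Ob ==> src C (ph j x) = fob (F j) (Sh x)"
  "!!j x. j : J ==> x : Ob ==> tgt C (ph j x) = Sh (fob (F j) x)"
  "!!j x. j : J ==> x : Ob ==> is_iso C (ph j x)"
  "!!j f. j : J ==> f : arr C ==> ph j (tgt C f) ** far (F j) (Sa f) = Sa (far (F j) f) ** ph j (src C f)"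
 shows "joint_univ J F (%j. Sh (a j)) (Sh A) (%j. Sa (p j) ** ph j A)"
proof -
 note d = joint_univD[OF A] and s = functor_simps[OF F]
 have key: "(Sa (p j) ** ph j A) ** far (F j) (Sa v) = Sa (p j ** far (F j) v) ** ph j z"
  if j: "j : J" and v: "v : Hom z A" for j v z
 proof -
  have zo: "z : Ob" using Mor_objs[OF v] by blast
  have "(Sa (p j) ** ph j A) ** far (F j) (Sa v) = Sa (p j) ** (ph j A ** far (F j) (Sa v))" using j v d p(1-3)[OF j d(1)] s[OF j] by simp
  also have "\<dots> = Sa (p j) ** (Sa (far (F j) v) ** ph j z)" using p(5)[OF j, of v] v by simp
  also have "\<dots> = Sa (p j ** far (F j) v) ** ph j z" using j v d p(1-3)[OF j zo] s[OF j] by simp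
  finally show ?thesis .
 qed
 have un: "EX z' th th'. z' : Ob & th : Hom (Sh z') z & th' : Hom z (Sh z') & th ** th' = idn C z" if "z : Ob" for z
  using shift_ess_surj[OF that] isomorphicE by metis
 show ?thesis unfolding joint_univ_def
 proof (intro conjI ballI allI impI)
  show "Sh A : Ob" using d by simp
  show "Sa (p j) ** ph j A : Hom (fob (F j) (Sh A)) (Sh (a j))" if j: "j : J" for j using d p(1-3)[OF j d(1)] j by simp
  fix z ps assume z: "z : Ob" and psi: "ALL j:J. ps j : Hom (fob (F j) z) (Sh (a j))"
  obtain z' th th' where t: "z' : Ob" "th : Hom (Sh z') z" "th' : Hom z (Sh z')" "th ** th' = idn C z" using un[OF z] by blast
  have "ALL j:J. EX b. b : Hom (Sh (fob (F j) z')) (fob (F j) (Sh z')) & b ** ph j z' = idn C (fob (F j) (Sh z'))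
    & ph j z' ** b = idn C (Sh (fob (F j) z'))"
  proof
   fix j assume j: "j : J"
   have "ph j z' : Hom (fob (F j) (Sh z')) (Sh (fob (F j) z'))" using p(1-3)[OF j t(1)] by simp
   then show "EX b. b : Hom (Sh (fob (F j) z')) (fob (F j) (Sh z')) & b ** ph j z' = idn C (fob (F j) (Sh z'))
    & ph j z' ** b = idn C (Sh (fob (F j) z'))" using is_isoE[OF p(4)[OF j t(1)]] by metis
  qed
  then obtain b where b: "!!j. j : J ==> b j : arr C" "!!j. j : J ==> src C (b j) = Sh (fob (F j) z')"
   "!!j. j : J ==> tgt C (b j) = fob (F j) (Sh z')" "!!j. j : J ==> b j ** ph j z' = idn C (fob (F j) (Sh z'))"
   "!!j. j : J ==> ph j z' ** b j = idn C (Sh (fob (F j) z'))" unfolding in_Mor by metis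
  have "ALL j:J. EX c:Hom (fob (F j) z') (a j). Sa c = ps j ** (far (F j) th ** b j)"
  proof
   fix j assume j: "j : J"
   show "EX c:Hom (fob (F j) z') (a j). Sa c = ps j ** (far (F j) th ** b j)" by (rule shift_full) (use j psi t s[OF j] b[OF j] d in simp_all)
  qed
  then obtain c where c: "!!j. j : J ==> c j : Hom (fob (F j) z') (a j)"
   "!!j. j : J ==> Sa (c j) = ps j ** (far (F j) th ** b j)" by metis
  obtain v where v: "v : Hom z' A" "!!j. j : J ==> p j ** far (F j) v = c j" using joint_univ_map[OF A t(1), of c] c(1) by blast
  show "EX! u. u : Hom z (Sh A) & (ALL j:J. (Sa (p j) ** ph j A) ** far (F j) u = ps j)"
  proof (rule ex1I[of _ "Sa v ** th'"], intro conjI ballI)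
   show "Sa v ** th' : Hom z (Sh A)" using v t by simp
   fix j assume j: "j : J"
   note P = p(1-3)[OF j t(1)] p(1-3)[OF j d(1)] and S = s[OF j] and B = b[OF j] and D = d(2-)[OF j]
   have ps: "ps j : arr C" "src C (ps j) = fob (F j) z" "tgt C (ps j) = Sh (a j)" using psi j by auto
   have "far (F j) th ** far (F j) th' = idn C (fob (F j) z)" using S(6)[of th' th] t S(2)[OF z] by simp
   note tt = this
   have "(Sa (p j) ** ph j A) ** far (F j) (Sa v ** th') = ((Sa (p j) ** ph j A) ** far (F j) (Sa v)) ** far (F j) th'"
    using v(1) t(2,3) S P D d(1) by simp
   also have "\<dots> = (Sa (c j) ** ph j z') ** far (F j) th'" unfolding key[OF j v(1)] v(2)[OF j] ..
   also have "\<dots> = ps j ** (far (F j) th ** ((b j ** ph j z') ** far (F j) th'))" unfolding c(2)[OF j] using ps t(2,3) S B(1-3) P by simp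
   also have "\<dots> = ps j ** (far (F j) th ** far (F j) th')" unfolding B(4) using t(1-3) S by simp
   also have "\<dots> = ps j" unfolding tt using ps z S by simp
   finally show "(Sa (p j) ** ph j A) ** far (F j) (Sa v ** th') = ps j" .
  next
   fix u assume u: "u : Hom z (Sh A) & (ALL j:J. (Sa (p j) ** ph j A) ** far (F j) u = ps j)"
   have "u ** th : Hom (Sh z') (Sh A)" using u t by simp
   then obtain w where w: "w : Hom z' A" "Sa w = u ** th" using shift_full[OF t(1) d(1)] by blast
   have "w = v"
   proof (rule joint_univ_eq[OF A F w(1) v(1)])
    fix j assume j: "j : J"
    note P = p(1-3)[OF j t(1)] p(1-3)[OF j d(1)] and S = s[OF j] and B = b[OF j] and D = d(2-)[OF j]
    have "Sa (p j ** far (F j) w) ** ph j z' = (Sa (p j) ** ph j A) ** far (F j) (u ** th)" unfolding key[OF j w(1), symmetric] w(2) ..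
    also have "\<dots> = ((Sa (p j) ** ph j A) ** far (F j) u) ** far (F j) th" using u t(1-3) S P D d(1) by simp
    also have "\<dots> = ps j ** far (F j) th" using u j by simp
    finally have e: "Sa (p j ** far (F j) w) ** ph j z' = ps j ** far (F j) th" .
    have "Sa (p j ** far (F j) w) = Sa (p j ** far (F j) w) ** (ph j z' ** b j)" unfolding B(5) using w(1) S D t(1) d(1) by simp
    also have "\<dots> = (Sa (p j ** far (F j) w) ** ph j z') ** b j" using w(1) S D t(1) d(1) B(1-3) P by simp
    also have "\<dots> = Sa (c j)" unfolding e c(2)[OF j] using psi j t(2) S B(1-3) by simp
    finally have "Sa (p j ** far (F j) w) = Sa (c j)" .
    then have "p j ** far (F j) w = c j" by (rule shift_faithful[rotated 2]) (use c(1)[OF j] w(1) S D in simp_all)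
    then show "p j ** far (F j) w = p j ** far (F j) v" using v(2)[OF j] by simp
   qed
   then have "u ** th = Sa v" using w by simp
   then have "(u ** th) ** th' = Sa v ** th'" by simp
   then show "u = Sa v ** th'" using u t by simp
  qed
 qed
qed

text \<open>A joint right adjoint of exact functors is exact: the cone of the induced map between two of
  its values has the universal property of the third, by the argument of the five lemma.\<close>

theorem joint_univ_triangle:
 assumes F: "!!j. j : J ==> exact_functor C C (F j)"
  and t: "!!j. j : J ==> dt (a j) (b j) (c j) (f j) (g j) (h j)"
  and A: "joint_univ J F a A p" and B: "joint_univ J F b B q" and E: "joint_univ J F c E r"
  and k: "k : Hom A B" "!!j. j : J ==> q j ** far (F j) k = f j ** p j"
 shows "EX W g' h'. dt A B W k g' h' & isomorphic C W E"
proof -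
 have Ff: "is_functor C C (F j)" if "j : J" for j using exact_is_functor[OF F[OF that]] .
 have Fa: "additive_functor C C (F j)" if "j : J" for j using exact_additive[OF F[OF that]] .
 note s = functor_simps[OF Ff] and sub' = additive_functor_sub[OF add_cat add_cat Fa]
  and add' = additive_functorD(2)[OF Fa _ _ _ _ category_axioms]
 note zer' = additive_functor_zer[OF add_cat add_cat Fa]
 note T = dtD[OF t]
 note dA = joint_univD[OF A] and dB = joint_univD[OF B]
 have "ALL j. EX ph. j : J --> (ALL x:Ob. ph x : arr C & src C (ph x) = fob (F j) (Sh x) & tgt C (ph x) = Sh (fob (F j) x) & is_iso C (ph x))
  & (ALL f:arr C. ph (tgt C f) ** far (F j) (Sa f) = Sa (far (F j) f) ** ph (src C f))
  & (ALL x y z f g h. dt x y z f g h --> dt (fob (F j) x) (fob (F j) y) (fob (F j) z) (far (F j) f) (far (F j) g) (ph x ** far (F j) h))"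
  (is "ALL j. EX ph. ?Q j ph")
 proof
  fix j show "EX ph. ?Q j ph"
  proof (cases "j : J")
   case True
   show ?thesis by (rule exact_functorE[OF F[OF True]]) blast
  qed blast
 qed
 then obtain ph where Q: "!!j. ?Q j (ph j)" by (elim choice[THEN exE]) blast
 have ph:
  "!!j x. j : J ==> x : Ob ==> ph j x : arr C"
  "!!j x. j : J ==> x : Ob ==> src C (ph j x) = fob (F j) (Sh x)"
  "!!j x. j : J ==> x : Ob ==> tgt C (ph j x) = Sh (fob (F j) x)"
  "!!j x. j : J ==> x : Ob ==> is_iso C (ph j x)"
  "!!j f. j : J ==> f : arr C ==> ph j (tgt C f) ** far (F j) (Sa f) = Sa (far (F j) f) ** ph j (src C f)"
  "!!j x y z f g h. j : J ==> dt x y z f g h ==> dt (fob (F j) x) (fob (F j) y) (fob (F j) z) (far (F j) f) (far (F j) g) (ph j x ** far (F j) h)"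
  using Q by blast+
 obtain W g' h' where W: "dt A B W k g' h'" using dt_cone[OF k(1)] by blast
 note w = dtD[OF W]
 have "ALL j:J. EX m:Hom (fob (F j) W) (c j). m ** far (F j) g' = g j ** q j & Sa (p j) ** (ph j A ** far (F j) h') = h j ** m"
 proof
  fix j assume j: "j : J"
  show "EX m:Hom (fob (F j) W) (c j). m ** far (F j) g' = g j ** q j & Sa (p j) ** (ph j A ** far (F j) h') = h j ** m"
   by (rule dt_mor[OF ph(6)[OF j W] t[OF j]]) (use dA(2-4)[OF j] dB(2-4)[OF j] k(2)[OF j] in simp_all)
 qed
 then have "EX m. ALL j:J. m j : Hom (fob (F j) W) (c j) & m j ** far (F j) g' = g j ** q j & Sa (p j) ** (ph j A ** far (F j) h') = h j ** m j"
  unfolding Bex_def by (rule bchoice)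
 then obtain m where m: "!!j. j : J ==> m j : arr C" "!!j. j : J ==> src C (m j) = fob (F j) W"
  "!!j. j : J ==> tgt C (m j) = c j" "!!j. j : J ==> m j ** far (F j) g' = g j ** q j"
  "!!j. j : J ==> Sa (p j) ** (ph j A ** far (F j) h') = h j ** m j" by auto
 have SA: "joint_univ J F (%j. Sh (a j)) (Sh A) (%j. Sa (p j) ** ph j A)" by (rule joint_univ_shift[OF A Ff ph(1-5)])
 have SB: "joint_univ J F (%j. Sh (b j)) (Sh B) (%j. Sa (q j) ** ph j B)" by (rule joint_univ_shift[OF B Ff ph(1-5)])
 have hm: "(Sa (p j) ** ph j A) ** far (F j) (h' ** u) = h j ** (m j ** far (F j) u)"
  if j: "j : J" and u: "u : Hom z W" for j u z
 proof -
  note P = ph(1-3)[OF j w(11)] and S = s[OF j] and D = dA(2-)[OF j] and M = m[OF j] and TT = T[OF j]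
  have "(Sa (p j) ** ph j A) ** far (F j) (h' ** u) = (Sa (p j) ** (ph j A ** far (F j) h')) ** far (F j) u" using P S D u w by simp
  also have "\<dots> = h j ** (m j ** far (F j) u)" unfolding M(5) using M(1-3) S u TT w by simp
  finally show ?thesis .
 qed
 have "joint_univ J F c W m" unfolding joint_univ_def
 proof (intro conjI ballI allI impI)
  show "W : Ob" by (rule w)
  show "m j : Hom (fob (F j) W) (c j)" if "j : J" for j using m that by simp
  fix z ps assume z: "z : Ob" and psi: "ALL j:J. ps j : Hom (fob (F j) z) (c j)"
  have ps: "ps j : arr C" "src C (ps j) = fob (F j) z" "tgt C (ps j) = c j" if "j : J" for j using psi that by auto
  have inj: "u = zer C z W" if u: "u : Hom z W" and u0: "!!j. j : J ==> m j ** far (F j) u = zer C (fob (F j) z) (c j)" for u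
  proof -
   have "h' ** u = zer C z (Sh A)"
   proof (rule joint_univ_eq[OF SA Ff])
    fix j assume j: "j : J"
    show "(Sa (p j) ** ph j A) ** far (F j) (h' ** u) = (Sa (p j) ** ph j A) ** far (F j) (zer C z (Sh A))"
     unfolding hm[OF j u] u0[OF j] using T[OF j] s[OF j] zer'[OF j] z w dA(2-4)[OF j] ph(1-3)[OF j w(11)] by simp
   qed (use u w z in simp_all)
   then obtain u' where u': "u' : Hom z B" "g' ** u' = u" using dt_wker2[OF W u] by blast
   have "ALL j:J. EX al:Hom (fob (F j) z) (a j). f j ** al = q j ** far (F j) u'"
   proof
    fix j assume j: "j : J"
    note S = s[OF j] and M = m[OF j] and D = dB(2-)[OF j] and TT = T[OF j]
    have "g j ** (q j ** far (F j) u') = (m j ** far (F j) g') ** far (F j) u'" unfolding M(4) using D TT S u'(1) w by simp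
    also have "\<dots> = m j ** far (F j) u" unfolding u'(2)[symmetric] using M(1-3) S u'(1) w by simp
    finally have e: "g j ** (q j ** far (F j) u') = zer C (fob (F j) z) (c j)" using u0[OF j] by simp
    show "EX al:Hom (fob (F j) z) (a j). f j ** al = q j ** far (F j) u'" by (rule dt_wker[OF t[OF j] _ e]) (use D S u'(1) w in simp)
   qed
   then obtain al where al: "!!j. j : J ==> al j : Hom (fob (F j) z) (a j)" "!!j. j : J ==> f j ** al j = q j ** far (F j) u'" by metis
   obtain v where v: "v : Hom z A" "!!j. j : J ==> p j ** far (F j) v = al j" using joint_univ_map[OF A z, of al] al(1) by blast
   have "u' = k ** v"
   proof (rule joint_univ_eq[OF B Ff u'(1)])
    fix j assume j: "j : J"
    note S = s[OF j] and D = dB(2-)[OF j] dA(2-)[OF j] and TT = T[OF j]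
    have "q j ** far (F j) (k ** v) = (q j ** far (F j) k) ** far (F j) v" using D S v(1) k(1) by simp
    also have "\<dots> = f j ** (p j ** far (F j) v)" unfolding k(2)[OF j] using D S v(1) TT by simp
    finally show "q j ** far (F j) u' = q j ** far (F j) (k ** v)" using v(2)[OF j] al(2)[OF j] by simp
   qed (use k v in simp_all)
   then have "u = (g' ** k) ** v" using u' v w k by simp
   then show ?thesis unfolding dt_cmp0[OF W] using v w by simp
  qed
  have hpsi: "h j ** ps j : Hom (fob (F j) z) (Sh (a j))" if "j : J" for j using ps[OF that] T[OF that] by simp
  obtain v where v: "v : Hom z (Sh A)" "!!j. j : J ==> (Sa (p j) ** ph j A) ** far (F j) v = h j ** ps j"
   using joint_univ_map[OF SA z, of "%j. h j ** ps j"] hpsi by blast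
  have "Sa k ** v = zer C z (Sh B)"
  proof (rule joint_univ_eq[OF SB Ff])
   fix j assume j: "j : J"
   note P = ph(1-3)[OF j w(11)] ph(1-3)[OF j w(12)] and S = s[OF j] and D = dB(2-)[OF j] dA(2-)[OF j] and TT = T[OF j]
   have e1: "ph j B ** far (F j) (Sa k) = Sa (far (F j) k) ** ph j A" using ph(5)[OF j, of k] k(1) by simp
   have "(Sa (q j) ** ph j B) ** far (F j) (Sa k ** v) = Sa (q j) ** ((ph j B ** far (F j) (Sa k)) ** far (F j) v)" using P S D v(1) k(1) w by simp
   also have "\<dots> = Sa (q j ** far (F j) k) ** (ph j A ** far (F j) v)" unfolding e1 using P S D v(1) k(1) w by simp
   also have "\<dots> = Sa (f j) ** ((Sa (p j) ** ph j A) ** far (F j) v)" unfolding k(2)[OF j] using P S D v(1) k(1) w TT by simp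
   also have "\<dots> = (Sa (f j) ** h j) ** ps j" unfolding v(2)[OF j] using TT ps[OF j] by simp
   also have "\<dots> = zer C (fob (F j) z) (Sh (b j))" unfolding dt_cmp2[OF t[OF j]] using TT ps[OF j] by simp
   also have "\<dots> = (Sa (q j) ** ph j B) ** far (F j) (zer C z (Sh B))" using P D w z zer'[OF j] s[OF j] by simp
   finally show "(Sa (q j) ** ph j B) ** far (F j) (Sa k ** v) = (Sa (q j) ** ph j B) ** far (F j) (zer C z (Sh B))" .
  qed (use k v w z in simp_all)
  then obtain u0 where u0: "u0 : Hom z W" "h' ** u0 = v" using dt_wker3[OF W v(1)] by blast
  have mu0: "m j ** far (F j) u0 : Hom (fob (F j) z) (c j)" if "j : J" for j using m[OF that] s[OF that] u0(1) by simp
  have "ALL j:J. EX be:Hom (fob (F j) z) (b j). g j ** be = sub C (ps j) (m j ** far (F j) u0)"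
  proof
   fix j assume j: "j : J"
   have "h j ** (m j ** far (F j) u0) = h j ** ps j" using hm[OF j u0(1)] u0(2) v(2)[OF j] by simp
   then have e: "h j ** sub C (ps j) (m j ** far (F j) u0) = zer C (fob (F j) z) (Sh (a j))" using ps[OF j] mu0[OF j] T[OF j] by (simp add: cmp_sub)
   show "EX be:Hom (fob (F j) z) (b j). g j ** be = sub C (ps j) (m j ** far (F j) u0)"
    by (rule dt_wker2[OF t[OF j] _ e]) (use ps[OF j] mu0[OF j] in simp)
  qed
  then obtain be where be: "!!j. j : J ==> be j : Hom (fob (F j) z) (b j)"
   "!!j. j : J ==> g j ** be j = sub C (ps j) (m j ** far (F j) u0)" by metis
  obtain y where y: "y : Hom z B" "!!j. j : J ==> q j ** far (F j) y = be j" using joint_univ_map[OF B z, of be] be(1) by blast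
  let ?u = "add C u0 (g' ** y)"
  have u: "?u : Hom z W" using u0 y w by simp
  have mu: "m j ** far (F j) ?u = ps j" if j: "j : J" for j
  proof -
   note S = s[OF j] and D = dB(2-)[OF j] and TT = T[OF j] and M = m[OF j]
   have "m j ** far (F j) ?u = add C (m j ** far (F j) u0) (m j ** (far (F j) g' ** far (F j) y))"
    using add'[OF j, of u0 "g' ** y"] S M(1-3) u0(1) y(1) w by (simp add: cmp_add)
   also have "m j ** (far (F j) g' ** far (F j) y) = (g j ** q j) ** far (F j) y" by (rule pre_eq[OF M(4)]) (use S M(1-3) y(1) w in simp_all)
   also have "\<dots> = g j ** be j" using y(1) y(2)[OF j] S D TT by simp
   also have "add C (m j ** far (F j) u0) \<dots> = ps j" unfolding be(2)[OF j] using ps[OF j] mu0[OF j] by simp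
   finally show ?thesis .
  qed
  show "EX! u. u : Hom z W & (ALL j:J. m j ** far (F j) u = ps j)"
  proof (rule ex1I[of _ ?u])
   show "?u : Hom z W & (ALL j:J. m j ** far (F j) ?u = ps j)" using u mu by blast
   fix u' assume u': "u' : Hom z W & (ALL j:J. m j ** far (F j) u' = ps j)"
   have "sub C u' ?u = zer C z W"
   proof (rule inj)
    show "sub C u' ?u : Hom z W" using u u' by simp
    fix j assume j: "j : J"
    have "m j ** far (F j) (sub C u' ?u) = sub C (m j ** far (F j) u') (m j ** far (F j) ?u)"
     using sub'[OF j, of u' ?u] s[OF j] m(1-3)[OF j] u u' by (simp add: cmp_sub)
    also have "\<dots> = sub C (ps j) (ps j)" using u' mu[OF j] j by simp
    finally show "m j ** far (F j) (sub C u' ?u) = zer C (fob (F j) z) (c j)" using ps[OF j] by simp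
   qed
   then show "u' = ?u" by (rule sub_eq_zerD) (use u u' in simp_all)
  qed
 qed
 then have "isomorphic C W E" by (rule joint_univ_unique[OF _ E Ff])
 then show ?thesis using W by blast
qed

lemma idn_functor_exact: "exact_functor C C \<lparr>fob = %x. x, far = %f. f\<rparr>"
 unfolding exact_functor_def additive_functor_def is_functor_def
proof (intro conjI exI[of _ "%x. idn C (Sh x)"] ballI allI impI)
 fix f g h assume t: "(f, g, h) : tri C"
 have "idn C (Sh (src C f)) ** h = h" using tri_dt[OF t, THEN dtD(8)] tri_dt[OF t, THEN dtD(10)] by simp
 then show "(far \<lparr>fob = %x. x, far = %f. f\<rparr> f, far \<lparr>fob = %x. x, far = %f. f\<rparr> g,
     idn C (Sh (src C f)) ** far \<lparr>fob = %x. x, far = %f. f\<rparr> h) : tri C" using t by simp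
qed simp_all

lemma product_triangle:
 assumes t: "!!j. j : J ==> dt (a j) (b j) (c j) (f j) (g j) (h j)"
  and A: "is_product C J a A p" and B: "is_product C J b B q" and E: "is_product C J c E r"
  and k: "k : Hom A B" "!!j. j : J ==> q j ** k = f j ** p j"
 shows "EX W g' h'. dt A B W k g' h' & isomorphic C W E"
proof -
 have e: "is_product C J a A p = joint_univ J (%_. \<lparr>fob = %x. x, far = %f. f\<rparr>) a A p" for a A p
  by (simp add: is_product_def joint_univ_def)
 show ?thesis by (rule joint_univ_triangle[OF idn_functor_exact t A[unfolded e] B[unfolded e] E[unfolded e] k(1)]) (use k in simp_all)
qed

lemma right_adjoint_triangle:
 assumes F: "exact_functor C C F" and t: "dt a b c f g h"
  and A: "univ_arrow C C F a A p" and B: "univ_arrow C C F b B q" and E: "univ_arrow C C F c E r"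
 shows "EX W f' g' h'. dt A B W f' g' h' & isomorphic C W E"
proof -
 have e: "univ_arrow C C F a A p ==> joint_univ {()} (%_. F) (%_. a) A (%_. p)" for a A p unfolding univ_arrow_def joint_univ_def by simp
 note T = dtD[OF t] and s = functor_simps[OF exact_is_functor[OF F]]
 have d: "A : Ob" "p : Hom (fob F A) a" using A unfolding univ_arrow_def by auto
 then obtain k where k: "k : Hom A B" "q ** far F k = f ** p" using joint_univ_map[OF e[OF B] d(1), of "%_. f ** p"] T by auto
 show ?thesis using joint_univ_triangle[OF F t e[OF A] e[OF B] e[OF E] k] by blast
qed

end

section \<open>Verdier quotients by calculus of fractions\<close>

context triangulated_category begin

lemma roofs_iff: "(s, f) : roofs C S \<longleftrightarrow> s : cone_in C S & f : arr C & src C f = src C s"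
 by (auto simp: roofs_def)

lemma roofD:
 assumes "(s, f) : roofs C S"
 shows "s : cone_in C S" "s : arr C" "f : arr C" "src C f = src C s" using assms cone_in_arr[of s S] by (auto simp: roofs_iff)

lemma frac_iff:
 "(s', f') : frac C S s f \<longleftrightarrow> (s, f) : roofs C S & (s', f') : roofs C S &
  (EX u u'. u : arr C & u' : arr C & src C u = src C u' & tgt C u = src C s & tgt C u' = src C s' &
   s ** u = s' ** u' & s ** u : cone_in C S & f ** u = f' ** u')" unfolding frac_def by blast

lemma frac_memI:
 assumes "(s, f) : roofs C S" "(s', f') : roofs C S" "u : Hom m (src C s)" "u' : Hom m (src C s')"
  "s ** u = s' ** u'" "s ** u : cone_in C S" "f ** u = f' ** u'"
 shows "(s', f') : frac C S s f" unfolding frac_iff using assms by (intro conjI exI[of _ u] exI[of _ u']) simp_all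

lemma frac_refl: "(s, f) : roofs C S ==> (s, f) : frac C S s f"
 by (rule frac_memI[of _ _ _ _ _ "idn C (src C s)" "src C s" "idn C (src C s)"]) (use roofD[of s f S] in simp_all)

lemma frac_sym: "(s', f') : frac C S s f ==> (s, f) : frac C S s' f'"
 unfolding frac_iff by metis

lemma frac_tgt:
 assumes "(s', f') : frac C S s f" shows "tgt C s' = tgt C s" "tgt C f' = tgt C f"
proof -
 obtain u u' where u: "(s, f) : roofs C S" "(s', f') : roofs C S" "u : arr C" "u' : arr C" "src C u = src C u'"
  "tgt C u = src C s" "tgt C u' = src C s'" "s ** u = s' ** u'" "f ** u = f' ** u'" using assms unfolding frac_iff by blast
 note r = roofD[OF u(1)] roofD[OF u(2)]
 have "tgt C (s ** u) = tgt C s" "tgt C (s' ** u') = tgt C s'" "tgt C (f ** u) = tgt C f" "tgt C (f' ** u') = tgt C f'" using u(3-7) r by simp_all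
 then show "tgt C s' = tgt C s" "tgt C f' = tgt C f" unfolding u(8,9) by simp_all
qed

lemma frac_trans:
 assumes S: "tsub S" and 1: "(s2, f2) : frac C S s1 f1" and 2: "(s3, f3) : frac C S s2 f2"
 shows "(s3, f3) : frac C S s1 f1"
proof -
 obtain u u2 where u: "(s1, f1) : roofs C S" "(s2, f2) : roofs C S" "u : arr C" "u2 : arr C" "src C u = src C u2"
  "tgt C u = src C s1" "tgt C u2 = src C s2" "s1 ** u = s2 ** u2" "s1 ** u : cone_in C S" "f1 ** u = f2 ** u2" using 1 unfolding frac_iff by blast
 obtain v2 v3 where v: "(s3, f3) : roofs C S" "v2 : arr C" "v3 : arr C" "src C v2 = src C v3"
  "tgt C v2 = src C s2" "tgt C v3 = src C s3" "s2 ** v2 = s3 ** v3" "s2 ** v2 : cone_in C S" "f2 ** v2 = f3 ** v3" using 2 unfolding frac_iff by blast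
 note r = roofD[OF u(1)] roofD[OF u(2)] roofD[OF v(1)]
 have u2: "u2 : cone_in C S" by (rule cone_in_first[OF S, of u2 "src C u2" "src C s2" s2 "tgt C s2"]) (use u r in simp_all)
 obtain m a b where ab: "a : Hom m (src C v2)" "b : Hom m (src C u2)" "a : cone_in C S" "v2 ** a = u2 ** b"
  using cone_in_pullback[OF S u2, of "src C u2" "src C s2" v2 "src C v2"] u v by auto
 have e1: "s1 ** (u ** b) = s2 ** (u2 ** b)" using u(1-7) ab(1,2) r by (simp add: pre_eq[OF u(8)])
 have e2: "s2 ** (v2 ** a) = s3 ** (v3 ** a)" using v(1-6) ab(1,2) r by (simp add: pre_eq[OF v(7)])
 have e3: "f1 ** (u ** b) = f2 ** (u2 ** b)" using u(1-7) ab(1,2) r by (simp add: pre_eq[OF u(10)])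
 have e4: "f2 ** (v2 ** a) = f3 ** (v3 ** a)" using v(1-6) ab(1,2) r by (simp add: pre_eq[OF v(9)])
 have "(s2 ** v2) ** a : cone_in C S" by (rule cone_in_cmp[OF S ab(1) _ ab(3) v(8)]) (use v r in simp)
 then have "s2 ** (v2 ** a) : cone_in C S" using v(1-6) r ab(1,2) by simp
 then show ?thesis by (intro frac_memI[OF u(1) v(1), of "u ** b" m "v3 ** a"]) (use u(1-7) v(1-6) ab r e1 e2 e3 e4 in simp_all)
qed

lemma frac_eq_iff:
 assumes S: "tsub S" and r: "(s', f') : roofs C S"
 shows "frac C S s f = frac C S s' f' \<longleftrightarrow> (s', f') : frac C S s f"
proof
 assume "frac C S s f = frac C S s' f'" then show "(s', f') : frac C S s f" using frac_refl[OF r] by simp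
next
 assume a: "(s', f') : frac C S s f"
 show "frac C S s f = frac C S s' f'" using frac_trans[OF S a] frac_trans[OF S frac_sym[OF a]] by auto
qed

lemma frac_eqI:
 assumes S: "tsub S"
  and "(s, f) : roofs C S" "(s', f') : roofs C S" "u : Hom m (src C s)" "u' : Hom m (src C s')"
  "s ** u = s' ** u'" "s ** u : cone_in C S" "f ** u = f' ** u'"
 shows "frac C S s f = frac C S s' f'" using frac_eq_iff[OF S assms(3)] frac_memI[OF assms(2-)] by blast

lemma verdier_simps [simp]:
 "obj (verdier C S) = Ob"
 "idn (verdier C S) x = frac C S (idn C x) (idn C x)"
 "zer (verdier C S) x y = frac C S (idn C x) (zer C x y)"
 "shift (verdier C S) = \<lparr>fob = Sh, far = frac_map C S Sa\<rparr>" by (simp_all add: verdier_def verdier_pre_def Let_def)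

lemma verdier_arr: "arr (verdier C S) = {frac C S s f | s f. (s, f) : roofs C S}"
 by (simp add: verdier_def verdier_pre_def Let_def)

lemma frac_arr [simp]: "(s, f) : roofs C S ==> frac C S s f : arr (verdier C S)"
 unfolding verdier_arr by blast

lemma frac_src [simp]: assumes "(s, f) : roofs C S" shows "src (verdier C S) (frac C S s f) = tgt C s"
proof -
 have "(THE x. ALL (s', f'):frac C S s f. tgt C s' = x) = tgt C s"
 proof (rule the_equality)
  show "ALL (s', f'):frac C S s f. tgt C s' = tgt C s" using frac_tgt(1)[of _ _ S s f] by blast
  fix x assume "ALL (s', f'):frac C S s f. tgt C s' = x"
  then show "x = tgt C s" using frac_refl[OF assms] by fastforce
 qed
 then show ?thesis by (simp add: verdier_def verdier_pre_def Let_def)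
qed

lemma frac_tgt' [simp]: assumes "(s, f) : roofs C S" shows "tgt (verdier C S) (frac C S s f) = tgt C f"
proof -
 have "(THE x. ALL (s', f'):frac C S s f. tgt C f' = x) = tgt C f"
 proof (rule the_equality)
  show "ALL (s', f'):frac C S s f. tgt C f' = tgt C f" using frac_tgt(2)[of _ _ S s f] by blast
  fix x assume "ALL (s', f'):frac C S s f. tgt C f' = x"
  then show "x = tgt C f" using frac_refl[OF assms] by fastforce
 qed
 then show ?thesis by (simp add: verdier_def verdier_pre_def Let_def)
qed

lemma verdier_arrE:
 assumes "a : Mor (verdier C S) x y"
 obtains s f where "(s, f) : roofs C S" "a = frac C S s f" "tgt C s = x" "tgt C f = y"
proof -
 obtain s f where "(s, f) : roofs C S" "a = frac C S s f" using assms unfolding in_Mor verdier_arr by blast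
 then show ?thesis using that assms by simp
qed

text \<open>The two composites agree on a common refinement of the completions of the cospans.\<close>

lemma frac_cmp_welldef:
 assumes S: "tsub S"
  and a: "(s1, f1) : frac C S s f" and b: "(t1, g1) : frac C S t g" and ft: "tgt C f = tgt C t"
  and c: "(t', f') : roofs C S" "tgt C t' = src C f" "tgt C f' = src C t" "f ** t' = t ** f'"
  and c1: "(t1', f1') : roofs C S" "tgt C t1' = src C f1" "tgt C f1' = src C t1" "f1 ** t1' = t1 ** f1'"
 shows "frac C S (s ** t') (g ** f') = frac C S (s1 ** t1') (g1 ** f1')"
proof -
 obtain u u1 where u: "(s, f) : roofs C S" "(s1, f1) : roofs C S" "u : arr C" "u1 : arr C" "src C u = src C u1"
  "tgt C u = src C s" "tgt C u1 = src C s1" "s ** u = s1 ** u1" "s ** u : cone_in C S" "f ** u = f1 ** u1" using a unfolding frac_iff by blast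
 obtain v v1 where v: "(t, g) : roofs C S" "(t1, g1) : roofs C S" "v : arr C" "v1 : arr C" "src C v = src C v1"
  "tgt C v = src C t" "tgt C v1 = src C t1" "t ** v = t1 ** v1" "t ** v : cone_in C S" "g ** v = g1 ** v1" using b unfolding frac_iff by blast
 note r = roofD[OF u(1)] roofD[OF u(2)] roofD[OF v(1)] roofD[OF v(2)] roofD[OF c(1)] roofD[OF c1(1)]
 define q where "q = src C u"
 have uM: "u : Hom q (src C s)" "u1 : Hom q (src C s1)" using u by (simp_all add: q_def)
 have tM: "t' : Hom (src C t') (src C s)" "t1' : Hom (src C t1') (src C s1)" using r(4,8,18,22) c(2) c1(2) by simp_all
 obtain m0 e0 p0 where m0: "e0 : Hom m0 q" "p0 : Hom m0 (src C t')" "e0 : cone_in C S" "u ** e0 = t' ** p0"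
  using cone_in_pullback[OF S r(17) tM(1) uM(1)] by metis
 obtain m1 e1 p1 where m1: "e1 : Hom m1 q" "p1 : Hom m1 (src C t1')" "e1 : cone_in C S" "u1 ** e1 = t1' ** p1"
  using cone_in_pullback[OF S r(21) tM(2) uM(2)] by metis
 obtain m d1 d0 where m: "d1 : Hom m m1" "d0 : Hom m m0" "d1 : cone_in C S" "e1 ** d1 = e0 ** d0" using cone_in_pullback[OF S m0(3,1) m1(1)] by metis
 have rW: "e0 ** d0 : cone_in C S" unfolding m(4)[symmetric] by (rule cone_in_cmp[OF S m(1) m1(1) m(3) m1(3)])
 let ?r = "e0 ** d0" and ?P = "p0 ** d0" and ?P1 = "p1 ** d1"
 have ty: "?r : Hom m q" "?P : Hom m (src C t')" "?P1 : Hom m (src C t1')" using m0 m1 m by simp_all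
 have tP: "t' ** ?P = u ** ?r" using m0(1,2) m uM c r by (simp add: pre_eq[OF m0(4)[symmetric]])
 have tP1: "t1' ** ?P1 = u1 ** ?r" unfolding m(4)[symmetric] using m1(1,2) m(1-3) uM c1 r by (simp add: pre_eq[OF m1(4)[symmetric]])
 have sP: "s ** (t' ** ?P) = (s ** u) ** ?r" unfolding tP using ty uM r by simp
 have sP1: "s1 ** (t1' ** ?P1) = (s1 ** u1) ** ?r" unfolding tP1 using ty uM r by simp
 have sW: "s ** (t' ** ?P) : cone_in C S" unfolding sP by (rule cone_in_cmp[OF S ty(1) _ rW u(9)]) (use uM r in simp)
 have tfP: "t ** (f' ** ?P) = (f ** u) ** ?r"
 proof -
  have "t ** (f' ** ?P) = f ** (t' ** ?P)" using ty c(1-3) r by (simp add: pre_eq[OF c(4)[symmetric]])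
  then show ?thesis unfolding tP using ty uM r by simp
 qed
 have tfP1: "t1 ** (f1' ** ?P1) = (f1 ** u1) ** ?r"
 proof -
  have "t1 ** (f1' ** ?P1) = f1 ** (t1' ** ?P1)" using ty c1(1-3) r by (simp add: pre_eq[OF c1(4)[symmetric]])
  then show ?thesis unfolding tP1 using ty uM r by simp
 qed
 have eqt: "t1 ** (f1' ** ?P1) = t ** (f' ** ?P)" unfolding tfP tfP1 u(10) ..
 let ?h = "f' ** ?P" and ?h1 = "f1' ** ?P1"
 have hM: "?h : Hom m (src C t)" "?h1 : Hom m (src C t1)" using ty c c1 r by simp_all
 have vM: "v : Hom (src C v) (src C t)" "v1 : Hom (src C v) (src C t1)" using v by simp_all
 have tvM: "t ** v : Hom (src C v) (tgt C t)" and thM: "t ** ?h : Hom m (tgt C t)" using vM hM r(10) by simp_all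
 obtain n k x where n: "k : Hom n m" "x : Hom n (src C v)" "k : cone_in C S" "(t ** ?h) ** k = (t ** v) ** x"
  using cone_in_pullback[OF S v(9) tvM thM] by metis
 have ttM: "t : Hom (src C t) (tgt C t)" "t1 : Hom (src C t1) (tgt C t1)" using r by simp_all
 have hkM: "?h ** k : Hom n (src C t)" "?h1 ** k : Hom n (src C t1)" using hM n(1) by simp_all
 have vxM: "v ** x : Hom n (src C t)" "v1 ** x : Hom n (src C t1)" using vM n(2) by simp_all
 have "t ** (?h ** k) = (t ** ?h) ** k" using hM(1) n(1) ttM(1) by simp
 also have "\<dots> = t ** (v ** x)" unfolding n(4) using vM(1) n(2) ttM(1) by simp
 finally have "t ** (?h ** k) = t ** (v ** x)" .
 then obtain n1 a1 where n1: "a1 : Hom n1 n" "a1 : cone_in C S" "(?h ** k) ** a1 = (v ** x) ** a1"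
  using cone_in_equalize[OF S r(9) ttM(1) hkM(1) vxM(1)] by metis
 have e1': "t1 ** (?h1 ** k) = t1 ** (v1 ** x)"
 proof -
  have "t1 ** (?h1 ** k) = (t1 ** ?h1) ** k" using n(1) hM r by simp
  also have "\<dots> = (t ** v) ** x" unfolding eqt n(4) ..
  also have "\<dots> = t1 ** (v1 ** x)" unfolding v(8) using n(2) vM r by simp
  finally show ?thesis .
 qed
 have hkaM: "(?h1 ** k) ** a1 : Hom n1 (src C t1)" "(v1 ** x) ** a1 : Hom n1 (src C t1)" using hkM(2) vxM(2) n1(1) hM n(1,2) vM by simp_all
 have "t1 ** ((?h1 ** k) ** a1) = (t1 ** (?h1 ** k)) ** a1" using n(1) n1(1) hM ttM by simp
 also have "\<dots> = t1 ** ((v1 ** x) ** a1)" unfolding e1' using n(2) n1(1) vM ttM by simp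
 finally have "t1 ** ((?h1 ** k) ** a1) = t1 ** ((v1 ** x) ** a1)" .
 then obtain n2 a2 where n2: "a2 : Hom n2 n1" "a2 : cone_in C S" "((?h1 ** k) ** a1) ** a2 = ((v1 ** x) ** a1) ** a2"
  using cone_in_equalize[OF S r(13) ttM(2) hkaM] by metis
 let ?Z = "k ** (a1 ** a2)"
 have Z: "?Z : Hom n2 m" "?Z : cone_in C S" using n(1) n1(1) n2(1) cone_in_cmp[OF S _ n(1) cone_in_cmp[OF S n2(1) n1(1) n2(2) n1(2)] n(3)] by simp_all
 have hZ: "?h ** ?Z = v ** (x ** (a1 ** a2))"
 proof -
  have "?h ** ?Z = ((?h ** k) ** a1) ** a2" using n(1) n1(1) n2(1) hM by simp
  also have "\<dots> = v ** (x ** (a1 ** a2))" unfolding n1(3) using n(2) n1(1) n2(1) vM by simp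
  finally show ?thesis .
 qed
 have hZ1: "?h1 ** ?Z = v1 ** (x ** (a1 ** a2))"
 proof -
  have "?h1 ** ?Z = ((?h1 ** k) ** a1) ** a2" using n(1) n1(1) n2(1) hM by simp
  also have "\<dots> = v1 ** (x ** (a1 ** a2))" unfolding n2(3) using n(2) n1(1) n2(1) vM by simp
  finally show ?thesis .
 qed
 have gg: "g ** (?h ** ?Z) = g1 ** (?h1 ** ?Z)" unfolding hZ hZ1 using n(2) n1(1) n2(1) vM r by (simp add: pre_eq[OF v(10)])
 have st: "s ** t' : cone_in C S" "s1 ** t1' : cone_in C S" by (rule cone_in_cmp[OF S _ _ r(17) r(1)], use r c in simp_all)
   (rule cone_in_cmp[OF S _ _ r(21) r(5)], use r c1 in simp_all)
 show ?thesis
 proof (rule frac_eqI[OF S, of _ _ _ _ "?P ** ?Z" n2 "?P1 ** ?Z"])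
  show "(s ** t', g ** f') : roofs C S" "(s1 ** t1', g1 ** f1') : roofs C S" using st r c c1 by (simp_all add: roofs_iff)
  show "?P ** ?Z : Hom n2 (src C (s ** t'))" "?P1 ** ?Z : Hom n2 (src C (s1 ** t1'))" using ty Z r c c1 by simp_all
  have 1: "(s ** t') ** (?P ** ?Z) = (s ** (t' ** ?P)) ** ?Z" using ty(2) Z r c by simp
  have 2: "(s1 ** t1') ** (?P1 ** ?Z) = (s1 ** (t1' ** ?P1)) ** ?Z" using ty(3) Z r c1 by simp
  show "(s ** t') ** (?P ** ?Z) = (s1 ** t1') ** (?P1 ** ?Z)" unfolding 1 2 sP sP1 u(8) ..
  show "(s ** t') ** (?P ** ?Z) : cone_in C S" unfolding 1 by (rule cone_in_cmp[OF S Z(1) _ Z(2) sW]) (use ty(2) r c in simp)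
  have 3: "(g ** f') ** (?P ** ?Z) = g ** (?h ** ?Z)" using ty(2) Z r c by simp
  have 4: "(g1 ** f1') ** (?P1 ** ?Z) = g1 ** (?h1 ** ?Z)" using ty(3) Z r c1 by simp
  show "(g ** f') ** (?P ** ?Z) = (g1 ** f1') ** (?P1 ** ?Z)" unfolding 3 4 by (rule gg)
 qed
qed

lemma cmp_frac:
 assumes S: "tsub S"
  and r: "(s, f) : roofs C S" "(t, g) : roofs C S" "tgt C f = tgt C t"
  and c: "(t', f') : roofs C S" "tgt C t' = src C f" "tgt C f' = src C t" "f ** t' = t ** f'"
 shows "cmp (verdier C S) (frac C S t g) (frac C S s f) = frac C S (s ** t') (g ** f')"
proof -
 let ?A = "{frac C S (s1 ** t1') (g1 ** f1') | s1 f1 t1 g1 t1' f1'.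
       (s1, f1) : frac C S s f & (t1, g1) : frac C S t g & (t1', f1') : roofs C S &
       tgt C t1' = src C f1 & tgt C f1' = src C t1 & f1 ** t1' = t1 ** f1'}"
 have "cmp (verdier C S) (frac C S t g) (frac C S s f) = \<Union>?A" by (simp add: verdier_def verdier_pre_def Let_def)
 moreover have "?A = {frac C S (s ** t') (g ** f')}"
 proof
  show "?A \<subseteq> {frac C S (s ** t') (g ** f')}" using frac_cmp_welldef[OF S _ _ r(3) c] by (intro subsetI) (elim CollectE exE conjE, simp)
  show "{frac C S (s ** t') (g ** f')} \<subseteq> ?A" using frac_refl[OF r(1)] frac_refl[OF r(2)] c by (intro subsetI CollectI) blast
 qed
 ultimately show ?thesis by simp
qed

lemma frac_completion:
 assumes S: "tsub S"
  and r: "(s, f) : roofs C S" "(t, g) : roofs C S" "tgt C f = tgt C t"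
 obtains t' f' where "(t', f') : roofs C S" "tgt C t' = src C f" "tgt C f' = src C t" "f ** t' = t ** f'"
proof -
 note d = roofD[OF r(1)] roofD[OF r(2)]
 obtain v t' f' where "t' : Hom v (src C f)" "f' : Hom v (src C t)" "t' : cone_in C S" "f ** t' = t ** f'"
  by (rule cone_in_pullback[OF S d(5), of "src C t" "tgt C t" f "src C f"]) (use d r in simp_all)
 then show ?thesis using that[of t' f'] by (simp add: roofs_iff)
qed

abbreviation qm where "qm S f \<equiv> frac C S (idn C (src C f)) f"

lemma idn_cone_in: "tsub S ==> x : Ob ==> idn C x : cone_in C S"
 by (rule cone_in_iso) simp_all

lemma idn_roof: "tsub S ==> f : arr C ==> src C f = x ==> (idn C x, f) : roofs C S"
 using idn_cone_in[of S x] by (auto simp: roofs_iff)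

lemma cmp_qm_frac:
 assumes S: "tsub S" and r: "(s, f) : roofs C S" and h: "h : arr C" "src C h = tgt C f"
 shows "cmp (verdier C S) (qm S h) (frac C S s f) = frac C S s (h ** f)"
proof -
 note d = roofD[OF r]
 have "cmp (verdier C S) (qm S h) (frac C S s f) = frac C S (s ** idn C (src C s)) (h ** f)"
  by (rule cmp_frac[OF S r idn_roof[OF S h(1)] _ idn_roof[OF S d(3)]]) (use d h in simp_all)
 then show ?thesis using d by simp
qed

lemma cmp_frac_denominator:
 assumes S: "tsub S" and r: "(s, f) : roofs C S"
 shows "cmp (verdier C S) (frac C S s f) (qm S s) = qm S f"
proof -
 note d = roofD[OF r]
 have "cmp (verdier C S) (frac C S s f) (qm S s) = frac C S (idn C (src C s) ** idn C (src C s)) (f ** idn C (src C s))"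
  by (rule cmp_frac[OF S idn_roof[OF S d(2)] r _ idn_roof[OF S]]) (use d in simp_all)
 then show ?thesis using d by simp
qed

lemma cmp_frac_idn:
 assumes S: "tsub S" and r: "(s, f) : roofs C S"
 shows "cmp (verdier C S) (frac C S s f) (qm S (idn C (tgt C s))) = frac C S s f"
proof -
 note d = roofD[OF r]
 have "cmp (verdier C S) (frac C S s f) (qm S (idn C (tgt C s))) = frac C S (idn C (tgt C s) ** s) (f ** idn C (src C s))"
  using cmp_frac[OF S idn_roof[OF S, of "idn C (tgt C s)" "tgt C s"] r, of s "idn C (src C s)"] d by (simp add: roofs_iff)
 then show ?thesis using d by simp
qed

lemma frac_map_frac:
 assumes S: "tsub S" and F: "is_functor C C F"
  and FW: "!!s. s : cone_in C S ==> far F s : cone_in C S" and r: "(s, f) : roofs C S"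
 shows "frac_map C S (far F) (frac C S s f) = frac C S (far F s) (far F f)"
proof -
 note m = functor_simps[OF F]
 have rr: "(far F s', far F f') : roofs C S" if "(s', f') : roofs C S" for s' f' using roofD[OF that] FW m by (simp add: roofs_iff)
 have *: "frac C S (far F s') (far F f') = frac C S (far F s) (far F f)" if "(s', f') : frac C S s f" for s' f'
 proof -
  obtain u u' where u: "(s', f') : roofs C S" "u : arr C" "u' : arr C" "src C u = src C u'"
  "tgt C u = src C s" "tgt C u' = src C s'" "s ** u = s' ** u'" "s ** u : cone_in C S" "f ** u = f' ** u'"
   using \<open>(s', f') : frac C S s f\<close> unfolding frac_iff by blast
  note d = roofD[OF r] roofD[OF u(1)]
  have e: "far F s ** far F u = far F (s ** u)" "far F f ** far F u = far F (f ** u)"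
   "far F s' ** far F u' = far F (s' ** u')" "far F f' ** far F u' = far F (f' ** u')" using m u(2-6) d by simp_all
  have "frac C S (far F s) (far F f) = frac C S (far F s') (far F f')"
  proof (rule frac_eqI[OF S rr[OF r] rr[OF u(1)]])
   show "far F u : Hom (fob F (src C u)) (src C (far F s))" "far F u' : Hom (fob F (src C u)) (src C (far F s'))" using u(2-6) d m(3-5) by simp_all
   show "far F s ** far F u = far F s' ** far F u'" "far F f ** far F u = far F f' ** far F u'" unfolding e u(7) u(9) by (rule refl)+
   show "far F s ** far F u : cone_in C S" unfolding e by (rule FW[OF u(8)])
  qed
  then show ?thesis by simp
 qed
 have "frac_map C S (far F) (frac C S s f) = \<Union> ((%_. frac C S (far F s) (far F f)) ` frac C S s f)"
  unfolding frac_map_def using * by (intro arg_cong[where f = Union] image_cong) auto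
 then show ?thesis using frac_refl[OF r] by auto
qed

lemma shift_frac_idn:
 assumes S: "tsub S" and x: "x : Ob"
 shows "far (shift (verdier C S)) (idn (verdier C S) x) = idn (verdier C S) (Sh x)"
 using frac_map_frac[OF S additive_functorD(1)[OF shift_additive] cone_in_shift[OF S] idn_roof[OF S arr_idn[OF x]], of x] x by simp

text \<open>Morphisms to a local object extend uniquely along denominators, so fractions that end in one are
  ordinary morphisms.\<close>

lemma qm_local_inj:
 assumes S: "tsub S" and f: "f : Hom x z" "g : Hom x z" and z: "z : perp S"
  and e: "qm S f = qm S g"
 shows "f = g"
proof -
 have x: "x : Ob" using Mor_objs[OF f(1)] by blast
 have "(idn C x, g) : frac C S (idn C x) f" using e frac_refl[OF idn_roof[OF S, of g x]] f by simp
 then obtain u u' where u: "u : arr C" "u' : arr C" "tgt C u = src C (idn C x)" "tgt C u' = src C (idn C x)"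
  "idn C x ** u = idn C x ** u'" "idn C x ** u : cone_in C S" "f ** u = g ** u'" unfolding frac_iff by blast
 have "u = u'" "u : cone_in C S" using u(1-6) x by simp_all
 then show ?thesis using local_cancel[OF S _ _ z f, of u "src C u"] u(1,3,7) x by simp
qed

lemma frac_local:
 assumes S: "tsub S" and r: "(s, f) : roofs C S" and z: "tgt C f : perp S"
 obtains g where "g : Hom (tgt C s) (tgt C f)" "frac C S s f = qm S g"
proof -
 note d = roofD[OF r]
 obtain g where g: "g : Hom (tgt C s) (tgt C f)" "g ** s = f" using local_extend[OF S d(1) _ z, of "src C s" "tgt C s" f] d by auto
 have "frac C S s f = qm S g" by (rule frac_eqI[OF S r idn_roof[OF S], of _ _ "idn C (src C s)" "src C s" s]) (use d g in simp_all)
 then show ?thesis using that g by blast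
qed

text \<open>A right adjoint \<open>k\<close> of the quotient functor yields a Bousfield localization. Write the
  counit at \<open>y\<close> as a fraction \<open>(s, g)\<close>; then \<open>s = \<eta> g\<close>. Since \<open>s\<close> is inverted and the objects \<open>k z\<close>
  are local, the cone \<open>c\<close> of \<open>\<eta>\<close> has no nonzero map to a local object. So \<open>\<eta>\<^sub>c = 0\<close>, whence \<open>1\<^sub>c = 0\<close> in the
  quotient and \<open>c\<close> is a retract of an object of \<open>S\<close>.\<close>

theorem right_adjoint_localizes:
 assumes S: "tsub S" and thick: "!!c d i r. d : S ==> i : Hom c d ==> r : Hom d c ==> r ** i = idn C c ==> c : S"
  and k: "is_functor (verdier C S) C k" and adj: "adjoint C (verdier C S) (quot_functor C S) k"
 obtains \<eta> where "!!y. y : Ob ==> \<eta> y : Hom y (fob k y)" "!!y. y : Ob ==> \<eta> y : cone_in C S"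
  "!!y. y : Ob ==> fob k y : perp S"
  "!!s g. (s, g) : roofs C S ==> far k (frac C S s g) ** (\<eta> (tgt C s) ** s) = \<eta> (tgt C g) ** g"
proof -
 let ?N = "verdier C S"
 note K = functor_simps[OF k, unfolded verdier_simps(1,2)]
 obtain Ph where bij: "!!x y. x : Ob ==> y : Ob ==> bij_betw (Ph x y) (Mor ?N x y) (Hom x (fob k y))"
  and nat: "!!u v a. u : arr C ==> v : arr ?N ==> a : Mor ?N (tgt C u) (src ?N v) ==>
   Ph (src C u) (tgt ?N v) (cmp ?N v (cmp ?N a (qm S u))) = far k v ** (Ph (tgt C u) (src ?N v) a ** u)"
  using adj unfolding adjoint_def quot_functor_def verdier_simps(1) func.simps by blast
 define \<eta> where "\<eta> y = Ph y y (qm S (idn C y))" for y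
 have idr: "(idn C y, idn C y) : roofs C S" if "y : Ob" for y using idn_roof[OF S arr_idn[OF that]] that by simp
 have eta: "\<eta> y : Hom y (fob k y)" if y: "y : Ob" for y
  unfolding \<eta>_def using bij_betwE[OF bij[OF y y], rule_format, of "qm S (idn C y)"] idr[OF y] y by simp
 have K1: "far k (qm S (idn C y)) = idn C (fob k y)" if "y : Ob" for y using K(2)[OF that] that by simp
 have PM: "Ph x y a : Hom x (fob k y)" if "x : Ob" "y : Ob" "a : Mor ?N x y" for x y a
  using bij_betwE[OF bij[OF that(1,2)], rule_format, OF that(3)] .
 have Pinj: "a = b" if "x : Ob" "y : Ob" "a : Mor ?N x y" "b : Mor ?N x y" "Ph x y a = Ph x y b" for x y a b
  by (rule inj_onD[OF bij_betw_imp_inj_on[OF bij[OF that(1,2)]] that(5,3,4)])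
 have A0: "Ph x y (qm S g) = \<eta> y ** g" if g: "g : Hom x y" for x y g
 proof -
  have o: "x : Ob" "y : Ob" using Mor_objs[OF g] by auto
  have "Ph x y (cmp ?N (qm S (idn C y)) (cmp ?N (qm S (idn C y)) (qm S g))) = far k (qm S (idn C y)) ** (\<eta> y ** g)"
   using nat[of g "qm S (idn C y)" "qm S (idn C y)"] g o idr[OF o(2)] by (simp add: \<eta>_def)
  moreover have "cmp ?N (qm S (idn C y)) (qm S g) = qm S g" using cmp_qm_frac[OF S idn_roof[OF S, of g x], of "idn C y"] g o by simp
  ultimately show ?thesis using K1[OF o(2)] g eta[OF o(2)] K(1)[OF o(2)] by simp
 qed
 have A: "Ph (tgt C s) (tgt C g) (frac C S s g) ** s = \<eta> (tgt C g) ** g" if r: "(s, g) : roofs C S" for s g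
 proof -
  note d = roofD[OF r]
  let ?y = "tgt C g"
  have y: "?y : Ob" using d by simp
  have "Ph (src C s) ?y (cmp ?N (qm S (idn C ?y)) (cmp ?N (frac C S s g) (qm S s)))
   = far k (qm S (idn C ?y)) ** (Ph (tgt C s) ?y (frac C S s g) ** s)" using nat[of s "qm S (idn C ?y)" "frac C S s g"] d r y idr[OF y] by simp
  moreover have "cmp ?N (frac C S s g) (qm S s) = qm S g" by (rule cmp_frac_denominator[OF S r])
  moreover have "cmp ?N (qm S (idn C ?y)) (qm S g) = qm S g" using cmp_qm_frac[OF S idn_roof[OF S, of g "src C g"], of "idn C ?y"] d y by simp
  ultimately have "Ph (src C s) ?y (qm S g) = Ph (tgt C s) ?y (frac C S s g) ** s"
   using K1[OF y] PM[of "tgt C s" ?y "frac C S s g"] r d y K(1)[OF y] by simp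
  then show ?thesis using A0[of g "src C s" ?y] d by simp
 qed
 have B: "far k v ** \<eta> x = Ph x y v" if v: "v : Mor ?N x y" for v x y
 proof -
  obtain s f where sf: "(s, f) : roofs C S" "v = frac C S s f" "tgt C s = x" "tgt C f = y" using verdier_arrE[OF v] .
  have x: "x : Ob" using sf roofD[OF sf(1)] tgt_obj by metis
  have "Ph x y (cmp ?N v (cmp ?N (qm S (idn C x)) (qm S (idn C x)))) = far k v ** (\<eta> x ** idn C x)"
   using nat[of "idn C x" v "qm S (idn C x)"] v x idr[OF x] by (simp add: \<eta>_def)
  moreover have "cmp ?N (qm S (idn C x)) (qm S (idn C x)) = qm S (idn C x)" using cmp_qm_frac[OF S idr[OF x], of "idn C x"] x by simp
  moreover have "cmp ?N v (qm S (idn C x)) = v" unfolding sf(2) sf(3)[symmetric] by (rule cmp_frac_idn[OF S sf(1)])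
  ultimately show ?thesis using eta[OF x] by simp
 qed
 have fin: "far k (frac C S s g) ** (\<eta> (tgt C s) ** s) = \<eta> (tgt C g) ** g" if r: "(s, g) : roofs C S" for s g
 proof -
  note d = roofD[OF r]
  have "far k (frac C S s g) : Hom (fob k (tgt C s)) (fob k (tgt C g))" using K(3-5)[of "frac C S s g"] r by simp
  then have "far k (frac C S s g) ** (\<eta> (tgt C s) ** s) = (far k (frac C S s g) ** \<eta> (tgt C s)) ** s" using eta[of "tgt C s"] d by simp
  also have "\<dots> = \<eta> (tgt C g) ** g" using B[of "frac C S s g" "tgt C s" "tgt C g"] A[OF r] r by simp
  finally show ?thesis .
 qed
 obtain z0 where z0: "is_zero C z0" using zero_object by blast
 have z0o: "z0 : Ob" using is_zeroD[OF z0] .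
 have loc: "fob k y : perp S" if y: "y : Ob" for y unfolding perp_def
 proof (intro CollectI conjI ballI subsetI)
  show ky: "fob k y : Ob" using K(1)[OF y] .
  fix x f assume x: "x : S" and f: "f : Hom x (fob k y)"
  have xo: "x : Ob" using Mor_objs[OF f] by blast
  have *: "a = qm S (zer C x y)" if "a : Mor ?N x y" for a
  proof -
   obtain t g where tg: "(t, g) : roofs C S" "a = frac C S t g" "tgt C t = x" "tgt C g = y" using verdier_arrE[OF \<open>a : Mor ?N x y\<close>] .
   note d = roofD[OF tg(1)]
   have "zer C z0 x : cone_in C S" using cone_inI[OF dt_idn2[OF xo z0] x] .
   then have "frac C S t g = frac C S (idn C x) (zer C x y)"
    by (intro frac_eqI[OF S tg(1) idn_roof[OF S], of _ _ "zer C z0 (src C t)" z0 "zer C z0 x"])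
     (use d tg z0o xo y in simp_all)
   then show ?thesis using tg xo y by simp
  qed
  have sur: "EX a:Mor ?N x y. Ph x y a = h" if h: "h : Hom x (fob k y)" for h
  proof -
   have "h : Ph x y ` Mor ?N x y" unfolding bij_betw_imp_surj_on[OF bij[OF xo y]] by (rule h)
   then show ?thesis by (elim imageE) metis
  qed
  obtain a b where "a : Mor ?N x y" "Ph x y a = f" "b : Mor ?N x y" "Ph x y b = zer C x (fob k y)"
   using sur[OF f] sur[of "zer C x (fob k y)"] xo ky by auto
  then show "f : {zer C x (fob k y)}" using *[of a] *[of b] by simp
 qed
 note Rt = perp_triangulated[OF ts_shift_closed[OF S]]
 have W: "\<eta> y : cone_in C S" if y: "y : Ob" for y
 proof -
  have ky: "fob k y : Ob" using K(1)[OF y] .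
  have "idn C (fob k y) : Ph (fob k y) y ` Mor ?N (fob k y) y" unfolding bij_betw_imp_surj_on[OF bij[OF ky y]] by (rule idn_Mor[OF ky])
  then obtain e where e: "e : Mor ?N (fob k y) y" "Ph (fob k y) y e = idn C (fob k y)" by (elim imageE) metis
  obtain s g where sg: "(s, g) : roofs C S" "e = frac C S s g" "tgt C s = fob k y" "tgt C g = y" using verdier_arrE[OF e(1)] .
  note d = roofD[OF sg(1)]
  have se: "s = \<eta> y ** g" using A[OF sg(1)] e(2) sg d by simp
  have sM: "s : Hom (src C s) (fob k y)" using d sg by simp
  have gM: "g : Hom (src C s) y" using d sg by simp
  note ey = eta[OF y]
  have cancel: "th = zer C y z" if z: "z : perp S" and th: "th : Hom y z" "th ** g = zer C (src C s) z" for th z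
  proof -
   have zo: "z : Ob" using perp_obj[OF z] .
   have kz: "fob k z : Ob" using K(1)[OF zo] .
   have r: "(idn C y, th) : roofs C S" using idn_roof[OF S] th by simp
   have kt: "far k (qm S th) : Hom (fob k y) (fob k z)" using K(3-5)[of "qm S th"] r th y by simp
   have 1: "far k (qm S th) ** \<eta> y = \<eta> z ** th" using fin[OF r] th y ey by simp
   have "far k (qm S th) ** s = (far k (qm S th) ** \<eta> y) ** g" unfolding se using kt ey gM by simp
   also have "\<dots> = \<eta> z ** (th ** g)" unfolding 1 using eta[OF zo] th(1) gM by simp
   also have "\<dots> = zer C (fob k y) (fob k z) ** s" unfolding th(2) using eta[OF zo] sM ky kz d by simp
   finally have "far k (qm S th) = zer C (fob k y) (fob k z)" by - (rule local_cancel[OF S d(1) sM loc[OF zo] kt], (use ky kz in simp_all))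
   then have "\<eta> z ** th = \<eta> z ** zer C y z" using 1 ey eta[OF zo] y ky kz by simp
   then have "Ph y z (qm S th) = Ph y z (qm S (zer C y z))" using A0[OF th(1)] A0[of "zer C y z" y z] y zo by simp
   then have "qm S th = qm S (zer C y z)" by (rule Pinj[OF y zo, rotated 2]) (use r th y zo idn_roof[OF S, of "zer C y z" y] in simp_all)
   then show ?thesis using qm_local_inj[OF S th(1) _ z] y zo by simp
  qed
  obtain c p q where t: "dt y (fob k y) c (\<eta> y) p q" using dt_cone[OF ey] by blast
  note T = dtD[OF t]
  have c0: "ph = zer C c z" if z: "z : perp S" and phi: "ph : Hom c z" for ph z
  proof -
   have zo: "z : Ob" using perp_obj[OF z] .
   have "(ph ** p) ** s = (ph ** (p ** \<eta> y)) ** g" unfolding se using phi T ey gM by simp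
   also have "\<dots> = zer C (fob k y) z ** s" unfolding dt_cmp0[OF t] using phi T gM sM zo by simp
   finally have "ph ** p = zer C (fob k y) z" by - (rule local_cancel[OF S d(1) sM z], (use phi T zo in simp_all))
   then obtain ps where psi: "ps : Hom (Sh y) z" "ps ** q = ph" using dt_wcok2[OF t phi] by blast
   obtain z' where z': "z' : Ob" "isomorphic C (Sh z') z" using shift_ess_surj[OF zo] by blast
   obtain a b where ab: "a : Hom (Sh z') z" "b : Hom z (Sh z')" "a ** b = idn C z" using isomorphicE[OF z'(2)] by metis
   have z'l: "z' : perp S" using ts_unshift[OF Rt z'(1)] ts_iso[OF Rt z isomorphic_sym[OF z'(2)]] by blast
   have "b ** ps : Hom (Sh y) (Sh z')" using ab psi by simp
   then obtain \<chi> where chi: "\<chi> : Hom y z'" "Sa \<chi> = b ** ps" using shift_full[OF y z'(1)] by blast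
   have "\<chi> ** g : Hom (src C s) z'" using chi gM by simp
   then obtain x where x: "x : Hom (fob k y) z'" "x ** s = \<chi> ** g" using local_extend[OF S d(1) sM z'l] by blast
   let ?th = "sub C (x ** \<eta> y) \<chi>"
   have "?th ** g = sub C (x ** s) (\<chi> ** g)" unfolding se using x(1) ey chi gM by (simp add: sub_cmp)
   also have "\<dots> = zer C (src C s) z'" unfolding x(2) using chi gM by simp
   finally have "?th = zer C y z'" by (intro cancel[OF z'l]) (use x ey chi in simp_all)
   then have xe: "x ** \<eta> y = \<chi>" by (rule sub_eq_zerD) (use x(1) ey chi in simp_all)
   have "ps = a ** (b ** ps)" using ab psi by (simp add: pre_eq[OF ab(3)])
   also have "\<dots> = a ** (Sa x ** Sa (\<eta> y))" unfolding chi(2)[symmetric] xe[symmetric] using x(1) ey by simp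
   finally have "ph = a ** (Sa x ** (Sa (\<eta> y) ** q))" unfolding psi(2)[symmetric] using ab(1) x(1) ey T by simp
   then show ?thesis unfolding dt_cmp2[OF t] using ab(1) x(1) T ky by simp
  qed
  have co: "c : Ob" by (rule T)
  have "\<eta> c = zer C c (fob k c)" using c0[OF loc[OF co] eta[OF co]] .
  then have "Ph c c (qm S (idn C c)) = Ph c c (qm S (zer C c c))" using A0[of "idn C c" c c] A0[of "zer C c c" c c] co K(1)[OF co] by simp
  then have "qm S (idn C c) = qm S (zer C c c)" by (rule Pinj[OF co co, rotated 2]) (use co idn_roof[OF S, of "zer C c c" c] idr[OF co] in simp_all)
  then have "(idn C c, zer C c c) : frac C S (idn C c) (idn C c)" using frac_refl[OF idn_roof[OF S, of "zer C c c" c]] co by simp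
  then obtain u u' where u: "u : arr C" "u' : arr C" "tgt C u = src C (idn C c)" "tgt C u' = src C (idn C c)"
   "idn C c ** u = idn C c ** u'" "idn C c ** u : cone_in C S" "idn C c ** u = zer C c c ** u'" unfolding frac_iff by blast
  define m where "m = src C u"
  have "u = u'" using u(1-5) co by simp
  then have uM: "u : Hom m c" "u : cone_in C S" "u = zer C m c" using u(1,3,6) co u(7) by (simp_all add: m_def)
  obtain d i h where D: "dt m c d u i h" "d : S" using cone_inE[OF uM(2,1)] .
  note DD = dtD[OF D(1)]
  obtain r where r: "r : Hom d c" "r ** i = idn C c"
  proof -
   have "idn C c ** u = zer C m c" using uM(1) by (simp add: uM(3)[symmetric])
   then show ?thesis using dt_wcok[OF D(1) idn_Mor[OF co]] that by blast
  qed
  have "i : Hom c d" using DD by simp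
  then have "c : S" using thick[OF D(2) _ r] by blast
  then show ?thesis using cone_inI[OF t] by blast
 qed
 show ?thesis using that eta W loc fin by blast
qed

end

section \<open>Bousfield localizations\<close>

text \<open>If every object \<open>x\<close> has a map \<open>\<eta>\<close> with cone in \<open>S\<close> to a local object \<open>L x\<close>, morphisms
  \<open>x \<rightarrow> y\<close> of the Verdier quotient are the same as morphisms \<open>L x \<rightarrow> L y\<close>, and the quotient inherits
  its categorical properties along this fully faithful embedding.\<close>

locale localization = triangulated_category C
 for C :: "('o, 'm, 'z) tricat_scheme" (structure) +
 fixes S :: "'o set" and L :: "'o \<Rightarrow> 'o" and \<eta> :: "'o \<Rightarrow> 'm"
 assumes S: "tsub S"
  and eta: "x : obj C ==> \<eta> x : Mor C x (L x)"
  and eta_cone: "x : obj C ==> \<eta> x : cone_in C S"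
  and L_local: "x : obj C ==> L x : perp S"
begin

abbreviation N where "N \<equiv> verdier C S"

lemma eta_simps [simp]: "x : Ob ==> \<eta> x : arr C" "x : Ob ==> src C (\<eta> x) = x" "x : Ob ==> tgt C (\<eta> x) = L x"
 using eta by auto

lemma L_obj [simp]: "x : Ob ==> L x : Ob"
 using eta Mor_objs by blast

lemma eta_cancel: "x : Ob ==> z : perp S ==> f : Hom (L x) z ==> g : Hom (L x) z ==> f ** \<eta> x = g ** \<eta> x ==> f = g"
 by (rule local_cancel[OF S eta_cone eta])

lemma eta_extend:
 assumes "x : Ob" "z : perp S" "f : Hom x z"
 obtains g where "g : Hom (L x) z" "g ** \<eta> x = f" using local_extend[OF S eta_cone[OF assms(1)] eta[OF assms(1)] assms(2,3)] .

lemma eta_local_iso: "x : perp S ==> is_iso C (\<eta> x)"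
 using local_iso[OF S eta_cone eta _ L_local] perp_obj by blast

lemma L_isomorphic: "x : perp S ==> isomorphic C x (L x)"
 using isomorphicI[OF eta eta_local_iso] perp_obj by blast

lemma roof_cone: "(s, g) : roofs C S ==> \<eta> (tgt C s) ** s : cone_in C S"
 using cone_in_cmp[OF S _ eta _ eta_cone, of s "src C s" "tgt C s"] roofD[of s g S] by simp

definition E where
 "E a = (THE m. m : Hom (L (src N a)) (L (tgt N a)) &
      (ALL (s, g):a. m ** (\<eta> (src N a) ** s) = \<eta> (tgt N a) ** g))"

lemma E_frac:
 assumes r: "(s, g) : roofs C S"
 shows "E (frac C S s g) : Hom (L (tgt C s)) (L (tgt C g))"
  and "E (frac C S s g) ** (\<eta> (tgt C s) ** s) = \<eta> (tgt C g) ** g"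
proof -
 note d = roofD[OF r]
 let ?x = "tgt C s" and ?y = "tgt C g"
 have o: "?x : Ob" "?y : Ob" using d by simp_all
 have esM: "\<eta> ?x ** s : Hom (src C s) (L ?x)" "\<eta> ?y ** g : Hom (src C s) (L ?y)" using d o by simp_all
 obtain m where m: "m : Hom (L ?x) (L ?y)" "m ** (\<eta> ?x ** s) = \<eta> ?y ** g"
  using local_extend[OF S roof_cone[OF r] esM(1) L_local[OF o(2)] esM(2)] by metis
 have all: "m ** (\<eta> ?x ** s') = \<eta> ?y ** g'" if "(s', g') : frac C S s g" for s' g'
 proof -
  obtain u u' where u: "(s', g') : roofs C S" "u : arr C" "u' : arr C" "src C u = src C u'"
   "tgt C u = src C s" "tgt C u' = src C s'" "s ** u = s' ** u'" "s ** u : cone_in C S" "g ** u = g' ** u'"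
   using \<open>(s', g') : frac C S s g\<close> unfolding frac_iff by blast
  note d' = roofD[OF u(1)] and t = frac_tgt[OF that]
  have u'W: "u' : cone_in C S" by (rule cone_in_first[OF S, of u' "src C u'" "src C s'" s' ?x]) (use u(2-6) u(8) u(7) d' t in simp_all)
  have e1: "(m ** (\<eta> ?x ** s')) ** u' = m ** (\<eta> ?x ** (s ** u))" unfolding u(7) using u(2-6) d' t m(1) o by simp
  have e2: "m ** (\<eta> ?x ** (s ** u)) = (m ** (\<eta> ?x ** s)) ** u" using u(2-6) d t m(1) o by simp
  have e3: "(m ** (\<eta> ?x ** s)) ** u = \<eta> ?y ** (g' ** u')" unfolding m(2) u(9)[symmetric] using u(2-6) d o by simp
  have e4: "\<eta> ?y ** (g' ** u') = (\<eta> ?y ** g') ** u'" using u(2-6) d' t o by simp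
  show ?thesis by (rule local_cancel[OF S u'W _ L_local[OF o(2)], of "src C u'" "src C s'"])
    (use u(2-6) d' t m(1) o e1 e2 e3 e4 in \<open>simp_all del: assoc_cmp\<close>)
 qed
 have "E (frac C S s g) = m" unfolding E_def frac_src[OF r] frac_tgt'[OF r]
 proof (rule the_equality)
  show "m : Hom (L ?x) (L ?y) & (ALL (s', g'):frac C S s g. m ** (\<eta> ?x ** s') = \<eta> ?y ** g')" using m all by blast
  fix m' assume m': "m' : Hom (L ?x) (L ?y) & (ALL (s', g'):frac C S s g. m' ** (\<eta> ?x ** s') = \<eta> ?y ** g')"
  then have "m' ** (\<eta> ?x ** s) = \<eta> ?y ** g" using frac_refl[OF r] by blast
  then show "m' = m" by - (rule local_cancel[OF S roof_cone[OF r] esM(1) L_local[OF o(2)]], (use m m' in simp_all))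
 qed
 then show "E (frac C S s g) : Hom (L ?x) (L ?y)" "E (frac C S s g) ** (\<eta> ?x ** s) = \<eta> ?y ** g" using m by simp_all
qed

lemma E_eqI:
 assumes r: "(s, g) : roofs C S" and m: "m : Hom (L (tgt C s)) (L (tgt C g))" "m ** (\<eta> (tgt C s) ** s) = \<eta> (tgt C g) ** g"
 shows "E (frac C S s g) = m" by (rule local_cancel[OF S roof_cone[OF r] _ L_local E_frac(1)[OF r] m(1)])
  (use roofD[OF r] E_frac(2)[OF r] m(2) in simp_all)

lemma N_obj: assumes "a : Mor N x y" shows "x : Ob" "y : Ob"
proof -
 obtain s g where "(s, g) : roofs C S" "tgt C s = x" "tgt C g = y" using verdier_arrE[OF assms] .
 then show "x : Ob" "y : Ob" using roofD[of s g S] tgt_obj by metis+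
qed

lemma E_Mor: assumes "a : Mor N x y" shows "E a : Hom (L x) (L y)"
 using verdier_arrE[OF assms] E_frac(1) by metis

lemma E_inj:
 assumes a: "a : Mor N x y" and b: "b : Mor N x y" and e: "E a = E b"
 shows "a = b"
proof -
 obtain s g where a': "(s, g) : roofs C S" "a = frac C S s g" "tgt C s = x" "tgt C g = y" using verdier_arrE[OF a] .
 obtain t h where b': "(t, h) : roofs C S" "b = frac C S t h" "tgt C t = x" "tgt C h = y" using verdier_arrE[OF b] .
 note d = roofD[OF a'(1)] roofD[OF b'(1)] and o = N_obj[OF a]
 have sM: "s : Hom (src C s) x" "t : Hom (src C t) x" "g : Hom (src C s) y" "h : Hom (src C t) y" using a' b' d by simp_all
 obtain w v u where w: "v : Hom w (src C t)" "u : Hom w (src C s)" "v : cone_in C S" "t ** v = s ** u"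
  using cone_in_pullback[OF S d(1) sM(1,2)] by metis
 have m: "E a : Hom (L x) (L y)" using E_Mor[OF a] .
 have e1: "E a ** (\<eta> x ** s) = \<eta> y ** g" "E a ** (\<eta> x ** t) = \<eta> y ** h" using E_frac(2)[OF a'(1)] E_frac(2)[OF b'(1)] a' b' e by simp_all
 have "\<eta> y ** (g ** u) = (E a ** (\<eta> x ** s)) ** u" unfolding e1 using sM w(2) o by simp
 also have "\<dots> = E a ** (\<eta> x ** (t ** v))" unfolding w(4) using sM w(2) o m by simp
 also have "\<dots> = (E a ** (\<eta> x ** t)) ** v" using sM w(1) o m by simp
 also have "\<dots> = \<eta> y ** (h ** v)" unfolding e1 using sM w(1) o by simp
 finally have e2: "\<eta> y ** (g ** u) = \<eta> y ** (h ** v)" .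
 have guM: "g ** u : Hom w y" "h ** v : Hom w y" using sM w by simp_all
 obtain w' q where q: "q : Hom w' w" "q : cone_in C S" "(g ** u) ** q = (h ** v) ** q"
  using cone_in_equalize[OF S eta_cone[OF o(2)] eta[OF o(2)] guM e2] by metis
 have 1: "s ** (u ** q) = t ** (v ** q)"
 proof -
  have "s ** (u ** q) = (s ** u) ** q" using sM w(2) q(1) by simp
  also have "\<dots> = t ** (v ** q)" unfolding w(4)[symmetric] using sM w(1) q(1) by simp
  finally show ?thesis .
 qed
 have 2: "t ** (v ** q) : cone_in C S" by (rule cone_in_cmp[OF S _ sM(2) cone_in_cmp[OF S q(1) w(1) q(2) w(3)] d(5)]) (use w q in simp)
 have 3: "g ** (u ** q) = h ** (v ** q)"
 proof -
  have "g ** (u ** q) = (g ** u) ** q" using sM w(2) q(1) by simp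
  also have "\<dots> = h ** (v ** q)" unfolding q(3) using sM w(1) q(1) by simp
  finally show ?thesis .
 qed
 show ?thesis unfolding a'(2) b'(2) by (rule frac_eqI[OF S a'(1) b'(1) _ _ 1 _ 3, of w']) (use w(1,2) q(1) 1 2 in simp_all)
qed

lemma E_surj:
 assumes o: "x : Ob" "y : Ob" and m: "m : Hom (L x) (L y)"
 obtains a where "a : Mor N x y" "E a = m"
proof -
 have "m ** \<eta> x : Hom x (L y)" using m o by simp
 then obtain w s g where w: "s : Hom w x" "g : Hom w y" "s : cone_in C S" "(m ** \<eta> x) ** s = \<eta> y ** g"
  using cone_in_pullback[OF S eta_cone[OF o(2)] eta[OF o(2)]] by metis
 have r: "(s, g) : roofs C S" using w by (simp add: roofs_iff)
 have "E (frac C S s g) = m" by (rule E_eqI[OF r]) (use w m o in simp_all)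
 then show ?thesis using that[of "frac C S s g"] r w by simp
qed

lemma E_qm: assumes f: "f : Hom x y" shows "qm S f : Mor N x y" "E (qm S f) ** \<eta> x = \<eta> y ** f"
proof -
 have o: "x : Ob" "y : Ob" using Mor_objs[OF f] by auto
 have r: "(idn C x, f) : roofs C S" using idn_roof[OF S] f by simp
 show "qm S f : Mor N x y" using r f o by simp
 show "E (qm S f) ** \<eta> x = \<eta> y ** f" using E_frac(2)[OF r] f o by simp
qed

lemma N_cmp:
 assumes a: "a : Mor N x y" and b: "b : Mor N y z"
 shows "cmp N b a : Mor N x z" "E (cmp N b a) = E b ** E a"
proof -
 obtain s f where a': "(s, f) : roofs C S" "a = frac C S s f" "tgt C s = x" "tgt C f = y" using verdier_arrE[OF a] .
 obtain t g where b': "(t, g) : roofs C S" "b = frac C S t g" "tgt C t = y" "tgt C g = z" using verdier_arrE[OF b] .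
 note o = N_obj[OF a] N_obj[OF b]
 have ft: "tgt C f = tgt C t" using a' b' by simp
 obtain t' f' where c: "(t', f') : roofs C S" "tgt C t' = src C f" "tgt C f' = src C t" "f ** t' = t ** f'"
  using frac_completion[OF S a'(1) b'(1) ft] .
 note d = roofD[OF a'(1)] roofD[OF b'(1)] roofD[OF c(1)]
 have e: "cmp N b a = frac C S (s ** t') (g ** f')" unfolding a'(2) b'(2) by (rule cmp_frac[OF S a'(1) b'(1) ft c])
 have "s ** t' : cone_in C S" by (rule cone_in_cmp[OF S _ _ d(9) d(1)]) (use d c in simp_all)
 then have r: "(s ** t', g ** f') : roofs C S" using d c by (simp add: roofs_iff)
 show "cmp N b a : Mor N x z" unfolding e using r d c a' b' by simp
 have M: "E a : Hom (L x) (L y)" "E b : Hom (L y) (L z)" using E_Mor a b by blast+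
 have ea: "E a ** (\<eta> x ** s) = \<eta> y ** f" using E_frac(2)[OF a'(1)] a' by simp
 have eb: "E b ** (\<eta> y ** t) = \<eta> z ** g" using E_frac(2)[OF b'(1)] b' by simp
 have "(E b ** E a) ** (\<eta> x ** (s ** t')) = E b ** ((E a ** (\<eta> x ** s)) ** t')" using M d c(1-3) o a'(3,4) b'(3,4) by simp
 also have "\<dots> = E b ** (\<eta> y ** (f ** t'))" unfolding ea using M d c(1-3) o a'(3,4) b'(3,4) by simp
 also have "\<dots> = (E b ** (\<eta> y ** t)) ** f'" unfolding c(4) using M d c(1-3) o a'(3,4) b'(3,4) by simp
 also have "\<dots> = \<eta> z ** (g ** f')" unfolding eb using M d c(1-3) o a'(3,4) b'(3,4) by simp
 finally have *: "(E b ** E a) ** (\<eta> x ** (s ** t')) = \<eta> z ** (g ** f')" .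
 show "E (cmp N b a) = E b ** E a" unfolding e by (rule E_eqI[OF r]) (use * M d c(1-3) a'(3,4) b'(3,4) in simp_all)
qed

lemma N_idn: assumes x: "x : Ob" shows "idn N x : Mor N x x" "E (idn N x) = idn C (L x)"
proof -
 have r: "(idn C x, idn C x) : roofs C S" using idn_roof[OF S] x by simp
 show "idn N x : Mor N x x" using r x by simp
 show "E (idn N x) = idn C (L x)" unfolding verdier_simps by (rule E_eqI[OF r]) (use x in simp_all)
qed

lemma N_category: "category N"
proof
 fix f assume "f : arr N"
 then have "f : Mor N (src N f) (tgt N f)" by simp
 note N_obj[OF this]
 then show "src N f : obj N" "tgt N f : obj N" by simp_all
next
 fix x assume "x : obj N" then show "idn N x : Mor N x x" using N_idn(1) by simp
next
 fix f x y g z assume "f : Mor N x y" "g : Mor N y z" then show "cmp N g f : Mor N x z" by (rule N_cmp(1))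
next
 fix f x y assume f: "f : Mor N x y"
 note o = N_obj[OF f]
 show "cmp N f (idn N x) = f" by (rule E_inj[OF N_cmp(1)[OF N_idn(1)[OF o(1)] f] f])
   (use N_cmp(2)[OF N_idn(1)[OF o(1)] f] N_idn(2)[OF o(1)] E_Mor[OF f] in simp)
 show "cmp N (idn N y) f = f" by (rule E_inj[OF N_cmp(1)[OF f N_idn(1)[OF o(2)]] f])
   (use N_cmp(2)[OF f N_idn(1)[OF o(2)]] N_idn(2)[OF o(2)] E_Mor[OF f] in simp)
next
 fix f w x g y h z assume f: "f : Mor N w x" and g: "g : Mor N x y" and h: "h : Mor N y z"
 note gf = N_cmp[OF f g] and hg = N_cmp[OF g h]
 show "cmp N (cmp N h g) f = cmp N h (cmp N g f)" by (rule E_inj[OF N_cmp(1)[OF f hg(1)] N_cmp(1)[OF gf(1) h]])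
   (use N_cmp(2)[OF f hg(1)] N_cmp(2)[OF gf(1) h] gf(2) hg(2) E_Mor[OF f] E_Mor[OF g] E_Mor[OF h] in simp)
qed

sublocale N: category N by (rule N_category)

lemma E_functor: "is_functor N C \<lparr>fob = L, far = E\<rparr>"
 unfolding is_functor_def
proof (intro conjI ballI impI)
 fix x assume "x : obj N"
 then show "fob \<lparr>fob = L, far = E\<rparr> x : Ob" "far \<lparr>fob = L, far = E\<rparr> (idn N x) = idn C (fob \<lparr>fob = L, far = E\<rparr> x)"
  using N_idn(2)[of x] by simp_all
next
 fix f assume "f : arr N"
 then show "far \<lparr>fob = L, far = E\<rparr> f : Hom (fob \<lparr>fob = L, far = E\<rparr> (src N f)) (fob \<lparr>fob = L, far = E\<rparr> (tgt N f))"
  using E_Mor[of f "src N f" "tgt N f"] by simp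
next
 fix f g assume "f : arr N" "g : arr N" "tgt N f = src N g"
 then show "far \<lparr>fob = L, far = E\<rparr> (cmp N g f) = far \<lparr>fob = L, far = E\<rparr> g ** far \<lparr>fob = L, far = E\<rparr> f"
  using N_cmp(2)[of f "src N f" "tgt N f" g "tgt N g"] by simp
qed

lemma quot_functor: "is_functor C N (quot_functor C S)"
 unfolding is_functor_def
proof (intro conjI ballI impI)
 fix x assume x: "x : Ob"
 then show "fob (quot_functor C S) x : obj N" by (simp add: quot_functor_def)
 show "far (quot_functor C S) (idn C x) = idn N (fob (quot_functor C S) x)" using x by (simp add: quot_functor_def)
next
 fix f assume "f : arr C"
 then show "far (quot_functor C S) f : Mor N (fob (quot_functor C S) (src C f)) (fob (quot_functor C S) (tgt C f))"
  using E_qm(1)[of f "src C f" "tgt C f"] by (simp add: quot_functor_def)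
next
 fix f g assume f: "f : arr C" "g : arr C" "tgt C f = src C g"
 then show "far (quot_functor C S) (g ** f) = cmp N (far (quot_functor C S) g) (far (quot_functor C S) f)"
  using cmp_qm_frac[OF S idn_roof[OF S f(1) refl], of g] by (simp add: quot_functor_def)
qed

lemma qm_cmp: "f : Hom x y ==> g : Hom y z ==> qm S (g ** f) = cmp N (qm S g) (qm S f)"
 using functor_simps(6)[OF quot_functor, of f g] by (simp add: quot_functor_def)

lemma N_isomorphic_iff:
 assumes o: "x : Ob" "y : Ob" shows "isomorphic N x y \<longleftrightarrow> isomorphic C (L x) (L y)"
proof
 assume "isomorphic N x y"
 then show "isomorphic C (L x) (L y)" using functor_isomorphic[OF N_category category_axioms E_functor] by simp
next
 assume "isomorphic C (L x) (L y)"
 then obtain f g where fg: "f : Hom (L x) (L y)" "g : Hom (L y) (L x)" "g ** f = idn C (L x)" "f ** g = idn C (L y)" using isomorphicE by metis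
 obtain a where a: "a : Mor N x y" "E a = f" using E_surj[OF o fg(1)] .
 obtain b where b: "b : Mor N y x" "E b = g" using E_surj[OF o(2,1) fg(2)] .
 have "cmp N b a = idn N x" by (rule E_inj[OF N_cmp(1)[OF a(1) b(1)] N_idn(1)[OF o(1)]]) (simp only: N_cmp(2)[OF a(1) b(1)] N_idn(2)[OF o(1)] a b fg)
 moreover have "cmp N a b = idn N y" by (rule E_inj[OF N_cmp(1)[OF b(1) a(1)] N_idn(1)[OF o(2)]]) (simp only: N_cmp(2)[OF b(1) a(1)] N_idn(2)[OF o(2)] a b fg)
 ultimately show "isomorphic N x y" using N.isomorphicI[OF a(1) N.is_isoI[OF a(1) b(1)]] by blast
qed

lemma N_isomorphic_L: assumes x: "x : Ob" shows "isomorphic N x (L x)"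
 using N_isomorphic_iff[OF x L_obj[OF x]] L_isomorphic[OF L_local[OF x]] by simp

lemma isomorphic_imp_N: "isomorphic C x y ==> isomorphic N x y"
 using functor_isomorphic[OF category_axioms N_category quot_functor] by (simp add: quot_functor_def)

lemma L_zero_iff: assumes x: "x : Ob" shows "is_zero C (L x) \<longleftrightarrow> x : S"
proof -
 obtain c g h where t: "dt x (L x) c (\<eta> x) g h" "c : S" using cone_inE[OF eta_cone[OF x] eta[OF x]] .
 show ?thesis using ts_first[OF S t(1) ts_zero[OF S] t(2)] orth_zero[OF ts_second[OF S t(1) _ t(2)] L_local[OF x]] by blast
qed

lemma E_zer: assumes o: "x : Ob" "y : Ob" shows "zer N x y : Mor N x y" "E (zer N x y) = zer C (L x) (L y)"
proof -
 have r: "(idn C x, zer C x y) : roofs C S" using idn_roof[OF S] o by simp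
 show "zer N x y : Mor N x y" using r o by simp
 show "E (zer N x y) = zer C (L x) (L y)" unfolding verdier_simps by (rule E_eqI[OF r]) (use o in simp_all)
qed

lemma N_zero_iff: "is_zero N x \<longleftrightarrow> x : S"
proof (cases "x : Ob")
 case x: True
 have "is_zero N x \<longleftrightarrow> E (idn N x) = E (zer N x x)" using E_inj[OF N_idn(1)[OF x] E_zer(1)[OF x x]] x by (auto simp: is_zero_def)
 also have "\<dots> \<longleftrightarrow> is_zero C (L x)" unfolding N_idn(2)[OF x] E_zer(2)[OF x x] using x by (simp add: is_zero_def)
 finally show ?thesis using L_zero_iff[OF x] by simp
next
 case False then show ?thesis using ts_sub[OF S] by (auto simp: is_zero_def)
qed

definition Psi where "Psi a = E a ** \<eta> (src N a)"

lemma Psi_Mor: "a : Mor N x y ==> Psi a : Hom x (L y)"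
 using E_Mor[of a x y] N_obj[of a x y] by (simp add: Psi_def)

lemma Psi_inj: assumes a: "a : Mor N x y" and b: "b : Mor N x y" and e: "Psi a = Psi b" shows "a = b"
 by (rule E_inj[OF a b eta_cancel[OF N_obj(1)[OF a] L_local[OF N_obj(2)[OF a]] E_Mor[OF a] E_Mor[OF b]]])
  (use a b e in \<open>simp add: Psi_def\<close>)

lemma Psi_surj:
 assumes o: "x : Ob" "y : Ob" and f: "f : Hom x (L y)"
 obtains a where "a : Mor N x y" "Psi a = f"
proof -
 obtain m where m: "m : Hom (L x) (L y)" "m ** \<eta> x = f" using eta_extend[OF o(1) L_local[OF o(2)] f] .
 obtain a where "a : Mor N x y" "E a = m" using E_surj[OF o m(1)] .
 then show ?thesis using that[of a] m by (simp add: Psi_def)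
qed

lemma Psi_cmp:
 assumes a: "a : Mor N x y" and b: "b : Mor N y z" shows "Psi (cmp N b a) = E b ** Psi a"
 using N_cmp[OF a b] a b E_Mor[OF a] E_Mor[OF b] N_obj[OF a] by (simp add: Psi_def)

lemma Psi_qm: "f : Hom x y ==> Psi (qm S f) = \<eta> y ** f"
 using E_qm[of f x y] unfolding Psi_def in_Mor by metis

lemma Psi_cmp_qm:
 assumes u: "u : Hom x y" and b: "b : Mor N y z" shows "Psi (cmp N b (qm S u)) = Psi b ** u"
proof -
 have "Psi (cmp N b (qm S u)) = E b ** (\<eta> y ** u)" using Psi_cmp[OF E_qm(1)[OF u] b] Psi_qm[OF u] by simp
 also have "\<dots> = Psi b ** u" using E_Mor[OF b] b u Mor_objs[OF u] by (simp add: Psi_def)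
 finally show ?thesis .
qed

lemma L_adjoint: "adjoint C N (quot_functor C S) \<lparr>fob = L, far = E\<rparr>"
 unfolding adjoint_def
proof (intro exI[of _ "%x y. Psi"] conjI ballI)
 fix x y assume o: "x : Ob" "y : obj N"
 show "bij_betw Psi (Mor N (fob (quot_functor C S) x) y) (Hom x (fob \<lparr>fob = L, far = E\<rparr> y))" unfolding bij_betw_def
 proof (intro conjI subset_antisym subsetI)
  show "inj_on Psi (Mor N (fob (quot_functor C S) x) y)" by (rule inj_onI) (rule Psi_inj)
  fix f assume "f : Hom x (fob \<lparr>fob = L, far = E\<rparr> y)"
  then obtain a where "a : Mor N x y" "Psi a = f" using Psi_surj[of x y f] o by auto
  then show "f : Psi ` Mor N (fob (quot_functor C S) x) y" unfolding quot_functor_def by (simp del: in_Mor) blast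
 next
  fix f assume "f : Psi ` Mor N (fob (quot_functor C S) x) y"
  then obtain a where "a : Mor N x y" "f = Psi a" by (auto simp: quot_functor_def)
  then show "f : Hom x (fob \<lparr>fob = L, far = E\<rparr> y)" using Psi_Mor by simp
 qed
next
 fix u v a assume u: "u : arr C" and v: "v : arr N" and a: "a : Mor N (fob (quot_functor C S) (tgt C u)) (src N v)"
 have a': "a : Mor N (tgt C u) (src N v)" using a by (simp add: quot_functor_def)
 have v': "v : Mor N (src N v) (tgt N v)" using v by simp
 have u': "u : Hom (src C u) (tgt C u)" using u by simp
 have "Psi (cmp N v (cmp N a (qm S u))) = E v ** (Psi a ** u)" using Psi_cmp[OF N_cmp(1)[OF E_qm(1)[OF u'] a'] v'] Psi_cmp_qm[OF u' a'] by simp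
 then show "Psi (cmp N v (cmp N a (far (quot_functor C S) u))) = far \<lparr>fob = L, far = E\<rparr> v ** (Psi a ** u)"
  by (simp add: quot_functor_def)
qed

lemma quot_univ_arrow: "y : Ob ==> EX ep. univ_arrow C N (quot_functor C S) y (L y) ep"
 using adjoint_univ_arrow[OF category_axioms N_category quot_functor E_functor L_adjoint, of y] by simp

subsection \<open>Triangles, products and functors of the quotient\<close>

lemma tri_N: "tri N = {t. tri_shape N t & (EX f g h. (f, g, h) : tri C & tri_iso N (qm S f, qm S g, qm S h) t)}"
proof -
 have 1: "tri_shape (verdier_pre C S) t = tri_shape N t" for t by (cases t) (simp add: verdier_def Let_def)
 have 2: "tri_mor (verdier_pre C S) t t' u = tri_mor N t t' u" for t t' u by (cases t; cases t'; cases u) (simp add: verdier_def Let_def)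
 have 3: "is_iso (verdier_pre C S) = is_iso N" by (intro ext) (simp add: is_iso_def inverse_arrows_def verdier_def Let_def)
 have 4: "tri_iso (verdier_pre C S) t t' = tri_iso N t t'" for t t' unfolding tri_iso_def 2 3 ..
 have 5: "tri N = {t. tri_shape (verdier_pre C S) t & (EX (f, g, h):tri C. tri_iso (verdier_pre C S) (qm S f, qm S g, qm S h) t)}"
  by (simp add: verdier_def Let_def quot_functor_def)
 show ?thesis unfolding 5 1 4 by (rule Collect_cong) auto
qed

lemma tri_N_objects:
 assumes "(a, b, c) : tri N"
 obtains x y z f g h where "dt x y z f g h" "isomorphic N x (src N a)" "isomorphic N y (src N b)" "isomorphic N z (src N c)"
proof -
 obtain f g h where t: "(f, g, h) : tri C" and i: "tri_iso N (qm S f, qm S g, qm S h) (a, b, c)" using assms unfolding tri_N by blast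
 note T = tri_dt[OF t] and D = dtD[OF tri_dt[OF t]]
 have q: "src N (qm S f) = src C f" "src N (qm S g) = src C g" "src N (qm S h) = src C h"
  using E_qm(1)[of f "src C f" "tgt C f"] E_qm(1)[of g "src C g" "tgt C g"] E_qm(1)[of h "src C h" "tgt C h"] D by simp_all
 obtain p q' r where "p : Mor N (src C f) (src N a)" "q' : Mor N (src C g) (src N b)" "r : Mor N (src C h) (src N c)"
  "is_iso N p" "is_iso N q'" "is_iso N r" using i unfolding tri_iso_def tri_mor.simps q by blast
 then show ?thesis using that[OF T] N.isomorphicI by blast
qed

lemma qm_tri:
 assumes t: "dt x y z f g h" shows "(qm S f, qm S g, qm S h) : tri N"
proof -
 note T = dtD[OF t]
 have f: "qm S f : Mor N x y" "qm S g : Mor N y z" "qm S h : Mor N z (Sh x)"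
  using E_qm(1)[of f x y] E_qm(1)[of g y z] E_qm(1)[of h z "Sh x"] T by simp_all
 have sh: "far (shift N) (idn N x) = idn N (Sh x)" by (rule shift_frac_idn[OF S T(11)])
 have "tri_iso N (qm S f, qm S g, qm S h) (qm S f, qm S g, qm S h)" unfolding tri_iso_def
 proof (intro exI conjI)
  show "tri_mor N (qm S f, qm S g, qm S h) (qm S f, qm S g, qm S h) (idn N x, idn N y, idn N z)" unfolding tri_mor.simps sh
   using f N.idn_Mor[of x] N.idn_Mor[of y] N.idn_Mor[of z] T(11-13) N.idn_cmp[OF f(1)] N.idn_cmp[OF f(2)] N.idn_cmp[OF f(3)]
    N.cmp_idn[OF f(1)] N.cmp_idn[OF f(2)] N.cmp_idn[OF f(3)] by (simp del: verdier_simps add: verdier_simps(1))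
 qed (use T N.is_iso_idn in \<open>simp_all del: verdier_simps(2)\<close>)
 moreover have "tri_shape N (qm S f, qm S g, qm S h)" using f by (simp del: verdier_simps(2))
 ultimately show ?thesis unfolding tri_N using T(1) by blast
qed

lemma N_unique_to_S: assumes "a : Mor N x z" "b : Mor N x z" "z : S" shows "a = b"
 by (rule E_inj[OF assms(1,2)])
  (use to_zero[of "L z" "E a" "L x"] to_zero[of "L z" "E b" "L x"] E_Mor[OF assms(1)] E_Mor[OF assms(2)]
   L_zero_iff[OF N_obj(2)[OF assms(1)]] assms(3) in metis)

lemma N_unique_from_S: assumes "a : Mor N z x" "b : Mor N z x" "z : S" shows "a = b"
 by (rule E_inj[OF assms(1,2)])
  (use from_zero[of "L z" "E a" "L x"] from_zero[of "L z" "E b" "L x"] E_Mor[OF assms(1)] E_Mor[OF assms(2)]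
   L_zero_iff[OF N_obj(1)[OF assms(1)]] assms(3) in metis)

lemma N_replete:
 assumes D: "triangulated_subcat N D" and x: "x : D" and i: "isomorphic N x y" shows "y : D"
proof -
 obtain a where a: "a : Mor N x y" "is_iso N a" using i unfolding isomorphic_def by blast
 obtain z where z: "is_zero C z" using zero_object by blast
 note o = N_obj[OF a(1)] is_zeroD[OF z]
 have zS: "z : S" using ts_zero[OF S z] .
 have zD: "z : D" using D N_zero_iff[of z] zS unfolding triangulated_subcat_def by blast
 let ?b = "zer N y z" and ?c = "zer N z (Sh x)"
 have M: "?b : Mor N y z" "?c : Mor N z (Sh x)" using E_zer(1) o by simp_all
 have q: "qm S (idn C x) : Mor N x x" "qm S (zer C x z) : Mor N x z" "qm S (zer C z (Sh x)) : Mor N z (Sh x)"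
  using E_qm(1)[of "idn C x" x x] E_qm(1)[of "zer C x z" x z] E_qm(1)[of "zer C z (Sh x)" z "Sh x"] o by simp_all
 have id: "idn N x : Mor N x x" "idn N z : Mor N z z" "idn N (Sh x) : Mor N (Sh x) (Sh x)" using N_idn(1) o by simp_all
 have sh: "far (shift N) (idn N x) = idn N (Sh x)" by (rule shift_frac_idn[OF S o(1)])
 have qi: "qm S (idn C x) = idn N x" using o by simp
 have m1: "cmp N a (qm S (idn C x)) = cmp N a (idn N x)" unfolding qi ..
 have m2: "cmp N (idn N z) (qm S (zer C x z)) = cmp N ?b a" by (rule N_unique_to_S[OF N_cmp(1)[OF q(2) id(2)] N_cmp(1)[OF a(1) M(1)] zS])
 have m3: "cmp N (far (shift N) (idn N x)) (qm S (zer C z (Sh x))) = cmp N ?c (idn N z)"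
  unfolding sh by (rule N_unique_from_S[OF N_cmp(1)[OF q(3) id(3)] N_cmp(1)[OF id(2) M(2)] zS])
 have s1: "src N (qm S (idn C x)) = x" "src N (qm S (zer C x z)) = x" "src N (qm S (zer C z (Sh x))) = z"
  "src N a = x" "src N ?b = y" "src N ?c = z" "tgt N a = y" "tgt N ?b = z" "tgt N ?c = Sh x" using q M a(1) by simp_all
 have "tri_mor N (qm S (idn C x), qm S (zer C x z), qm S (zer C z (Sh x))) (a, ?b, ?c) (idn N x, a, idn N z)"
  unfolding tri_mor.simps s1 using m1 m2 m3 id a(1) by blast
 then have "tri_iso N (qm S (idn C x), qm S (zer C x z), qm S (zer C z (Sh x))) (a, ?b, ?c)"
  unfolding tri_iso_def using a(2) N.is_iso_idn o by (metis verdier_simps(1))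
 moreover have "tri_shape N (a, ?b, ?c)" unfolding tri_shape.simps using M a(1) s1 by simp
 ultimately have "(a, ?b, ?c) : tri N" unfolding tri_N using dtD(1)[OF dt_idn[OF o(1) z]] by blast
 then have "src N a : D & src N ?c : D --> src N ?b : D" using D unfolding triangulated_subcat_def by blast
 then show ?thesis unfolding s1 using x zD by blast
qed

lemma N_triangulated_iff:
 "triangulated_subcat N D \<longleftrightarrow> D \<subseteq> Ob & S \<subseteq> D & (ALL x y. x : D --> isomorphic N x y --> y : D) &
  (ALL x y z f g h. dt x y z f g h --> (x : D & y : D --> z : D) & (y : D & z : D --> x : D) & (x : D & z : D --> y : D))"
 (is "?l \<longleftrightarrow> ?r")
proof
 assume D: ?l
 have "D \<subseteq> Ob" "S \<subseteq> D" using D N_zero_iff unfolding triangulated_subcat_def by auto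
 moreover have "(x : D & y : D --> z : D) & (y : D & z : D --> x : D) & (x : D & z : D --> y : D)"
  if t: "dt x y z f g h" for x y z f g h
 proof -
  note T = dtD[OF t]
  have "src N (qm S f) = x" "src N (qm S g) = y" "src N (qm S h) = z" using E_qm(1)[of f x y] E_qm(1)[of g y z] E_qm(1)[of h z "Sh x"] T by simp_all
  then show ?thesis using D qm_tri[OF t] unfolding triangulated_subcat_def by metis
 qed
 ultimately show ?r using N_replete[OF D] by blast
next
 assume r: ?r
 then have iso: "!!x y. x : D ==> isomorphic N x y ==> y : D" by blast
 show ?l unfolding triangulated_subcat_def
 proof (intro conjI allI impI)
  show "D \<subseteq> obj N" "{z. is_zero N z} \<subseteq> D" using r N_zero_iff by auto
  fix a b c assume "(a, b, c) : tri N"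
  then obtain x y z f g h where t: "dt x y z f g h" and i: "isomorphic N x (src N a)" "isomorphic N y (src N b)" "isomorphic N z (src N c)"
   by (rule tri_N_objects)
  note i' = N.isomorphic_sym[OF i(1)] N.isomorphic_sym[OF i(2)] N.isomorphic_sym[OF i(3)]
  have k: "(x : D & y : D --> z : D) & (y : D & z : D --> x : D) & (x : D & z : D --> y : D)" using r t by blast
  show "src N c : D" if "src N a : D & src N b : D" using k iso[OF _ i'(1)] iso[OF _ i'(2)] iso[OF _ i(3)] that by blast
  show "src N a : D" if "src N b : D & src N c : D" using k iso[OF _ i'(2)] iso[OF _ i'(3)] iso[OF _ i(1)] that by blast
  show "src N b : D" if "src N a : D & src N c : D" using k iso[OF _ i'(1)] iso[OF _ i'(3)] iso[OF _ i(2)] that by blast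
 qed
qed

lemma E_product:
 assumes p: "is_product N J A p pr" shows "is_product C J (%j. L (A j)) (L p) (%j. E (pr j))"
proof (rule is_productI)
 note d = N.is_productD[OF p, unfolded verdier_simps(1)]
 have piM: "pr j : Mor N p (A j)" if "j : J" for j using d that by simp
 show "L p : Ob" using d by simp
 show "E (pr j) : Hom (L p) (L (A j))" if "j : J" for j using E_Mor[OF piM[OF that]] .
 show "EX h:Hom z (L p). ALL j:J. E (pr j) ** h = ph j" if z: "z : Ob" and phi: "!!j. j : J ==> ph j : Hom z (L (A j))" for z ph
 proof -
  have "ALL j:J. EX b. b : Mor N z (A j) & Psi b = ph j" using Psi_surj[OF z d(5) phi] by metis
  then obtain b where b: "!!j. j : J ==> b j : Mor N z (A j)" "!!j. j : J ==> Psi (b j) = ph j" by metis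
  obtain h where h: "h : Mor N z p" "!!j. j : J ==> cmp N (pr j) h = b j" using N.product_map[OF p, of z b] z b(1) unfolding verdier_simps(1) by metis
  have "E (pr j) ** Psi h = ph j" if j: "j : J" for j using Psi_cmp[OF h(1) piM[OF j]] h(2)[OF j] b(2)[OF j] by simp
  then show ?thesis using Psi_Mor[OF h(1)] by blast
 qed
 show "h = h'" if z: "z : Ob" and h: "h : Hom z (L p)" "h' : Hom z (L p)" and e: "!!j. j : J ==> E (pr j) ** h = E (pr j) ** h'" for z h h'
 proof -
  obtain b where b: "b : Mor N z p" "Psi b = h" using Psi_surj[OF z d(1) h(1)] .
  obtain b' where b': "b' : Mor N z p" "Psi b' = h'" using Psi_surj[OF z d(1) h(2)] .
  have "b = b'"
  proof (rule N.product_eq[OF p b(1) b'(1)])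
   fix j assume j: "j : J"
   show "cmp N (pr j) b = cmp N (pr j) b'" by (rule Psi_inj[OF N_cmp(1)[OF b(1) piM[OF j]] N_cmp(1)[OF b'(1) piM[OF j]]])
     (simp only: Psi_cmp[OF b(1) piM[OF j]] Psi_cmp[OF b'(1) piM[OF j]] b(2) b'(2) e[OF j])
  qed
  then show ?thesis using b b' by simp
 qed
qed

lemma qm_local_surj:
 assumes v: "v : Mor N x z" and z: "z : perp S"
 obtains u where "u : Hom x z" "v = qm S u"
proof -
 obtain s f where sf: "(s, f) : roofs C S" "v = frac C S s f" "tgt C s = x" "tgt C f = z" using verdier_arrE[OF v] .
 obtain g where "g : Hom (tgt C s) (tgt C f)" "frac C S s f = qm S g" by (rule frac_local[OF S sf(1)]) (use z sf in simp)
 then show ?thesis using that sf by simp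
qed

lemma local_product:
 assumes p: "is_product C J A p pr" and A: "A ` J \<subseteq> perp S"
 shows "is_product N J A p (%j. qm S (pr j))"
proof (rule N.is_productI)
 note d = is_productD[OF p]
 have pl: "p : perp S" by (rule perp_product[OF p A]) (use ts_sub[OF S] in blast)
 have piM: "pr j : Hom p (A j)" if "j : J" for j using d that by simp
 show "p : obj N" using d by simp
 show "qm S (pr j) : Mor N p (A j)" if "j : J" for j using E_qm(1)[OF piM[OF that]] .
 show "EX h:Mor N z p. ALL j:J. cmp N (qm S (pr j)) h = ph j" if z: "z : obj N" and phi: "!!j. j : J ==> ph j : Mor N z (A j)" for z ph
 proof -
  have zo: "z : Ob" using z by simp
  have "ALL j:J. EX u. u : Hom z (A j) & ph j = qm S u" using qm_local_surj[OF phi] A by (metis image_subset_iff)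
  then obtain u where u: "!!j. j : J ==> u j : Hom z (A j)" "!!j. j : J ==> ph j = qm S (u j)" by metis
  obtain h where h: "h : Hom z p" "!!j. j : J ==> pr j ** h = u j" using product_map[OF p zo, of u] u(1) by metis
  have "cmp N (qm S (pr j)) (qm S h) = ph j" if j: "j : J" for j using qm_cmp[OF h(1) piM[OF j]] h(2)[OF j] u(2)[OF j] by simp
  then show ?thesis using E_qm(1)[OF h(1)] by blast
 qed
 show "h = h'" if z: "z : obj N" and h: "h : Mor N z p" "h' : Mor N z p"
  and e: "!!j. j : J ==> cmp N (qm S (pr j)) h = cmp N (qm S (pr j)) h'" for z h h'
 proof -
  obtain u where u: "u : Hom z p" "h = qm S u" using qm_local_surj[OF h(1) pl] .
  obtain u' where u': "u' : Hom z p" "h' = qm S u'" using qm_local_surj[OF h(2) pl] .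
  have "u = u'"
  proof (rule product_eq[OF p u(1) u'(1)])
   fix j assume j: "j : J"
   have "qm S (pr j ** u) = qm S (pr j ** u')"
    using e[OF j] unfolding u(2) u'(2) qm_cmp[OF u(1) piM[OF j], symmetric] qm_cmp[OF u'(1) piM[OF j], symmetric] .
   then show "pr j ** u = pr j ** u'" by - (rule qm_local_inj[OF S, of _ z "A j"], (use u(1) u'(1) piM[OF j] A j in auto))
  qed
  then show ?thesis using u u' by simp
 qed
qed

lemma induced_functor:
 assumes F: "exact_functor C C F" and FS: "!!x. x : S ==> fob F x : S"
 shows "is_functor N N \<lparr>fob = fob F, far = frac_map C S (far F)\<rparr>"
  and "!!u. u : arr C ==> frac_map C S (far F) (qm S u) = qm S (far F u)"
proof -
 note m = functor_simps[OF exact_is_functor[OF F]]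
 have W: "!!s. s : cone_in C S ==> far F s : cone_in C S" using exact_cone_in[OF F _ FS] .
 have fm: "frac_map C S (far F) (frac C S s f) = frac C S (far F s) (far F f)" "(far F s, far F f) : roofs C S" if r: "(s, f) : roofs C S" for s f
  using frac_map_frac[OF S exact_is_functor[OF F] W r] roofD[OF r] W m by (simp_all add: roofs_iff)
 show qmF: "frac_map C S (far F) (qm S u) = qm S (far F u)" if "u : arr C" for u using fm(1)[OF idn_roof[OF S that refl]] that m by simp
 show "is_functor N N \<lparr>fob = fob F, far = frac_map C S (far F)\<rparr>" unfolding is_functor_def func.simps
 proof (intro conjI ballI impI)
  fix x assume x: "x : obj N"
  then show "fob F x : obj N" using m by simp
  show "frac_map C S (far F) (idn N x) = idn N (fob F x)" using qmF[of "idn C x"] x m by simp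
 next
  fix a assume "a : arr N"
  then obtain s f where "(s, f) : roofs C S" "a = frac C S s f" unfolding verdier_arr by blast
  then show "frac_map C S (far F) a : Mor N (fob F (src N a)) (fob F (tgt N a))" using fm roofD[of s f] m by simp
 next
  fix a b assume ab: "a : arr N" "b : arr N" "tgt N a = src N b"
  obtain s f where a: "(s, f) : roofs C S" "a = frac C S s f" using ab unfolding verdier_arr by blast
  obtain t g where b: "(t, g) : roofs C S" "b = frac C S t g" using ab unfolding verdier_arr by blast
  have ft: "tgt C f = tgt C t" using ab a b by simp
  obtain t' f' where c: "(t', f') : roofs C S" "tgt C t' = src C f" "tgt C f' = src C t" "f ** t' = t ** f'"
   using frac_completion[OF S a(1) b(1) ft] .
  note d = roofD[OF a(1)] roofD[OF b(1)] roofD[OF c(1)]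
  have "s ** t' : cone_in C S" by (rule cone_in_cmp[OF S _ _ d(9) d(1)]) (use d c in simp_all)
  then have r: "(s ** t', g ** f') : roofs C S" using d c by (simp add: roofs_iff)
  have "frac_map C S (far F) (cmp N b a) = frac C S (far F (s ** t')) (far F (g ** f'))"
   unfolding a(2) b(2) cmp_frac[OF S a(1) b(1) ft c] by (rule fm(1)[OF r])
  also have "\<dots> = frac C S (far F s ** far F t') (far F g ** far F f')" using m d c(1-3) by simp
  also have "\<dots> = cmp N (frac C S (far F t) (far F g)) (frac C S (far F s) (far F f))"
  proof (rule cmp_frac[OF S fm(2)[OF a(1)] fm(2)[OF b(1)] _ fm(2)[OF c(1)], symmetric])
   have "far F f ** far F t' = far F (f ** t')" using m d c(1-3) by simp
   also have "\<dots> = far F t ** far F f'" unfolding c(4) using m d c(1-3) by simp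
   finally show "far F f ** far F t' = far F t ** far F f'" .
  qed (use m d c(1-3) ft in simp_all)
  finally show "frac_map C S (far F) (cmp N b a) = cmp N (frac_map C S (far F) b) (frac_map C S (far F) a)"
   unfolding a(2) b(2) fm(1)[OF a(1)] fm(1)[OF b(1)] .
 qed
qed

lemma right_adjoint_local:
 assumes F: "exact_functor C C F" and FS: "!!x. x : S ==> fob F x : S"
  and a: "a : perp S" and r: "univ_arrow C C F a r ep"
 shows "r : perp S" unfolding perp_def
proof (intro CollectI conjI ballI subsetI)
 have ro: "r : Ob" "ep : Hom (fob F r) a" using r unfolding univ_arrow_def by auto
 note m = functor_simps[OF exact_is_functor[OF F]]
 show "r : Ob" by (rule ro)
 fix s f assume s: "s : S" and f: "f : Hom s r"
 have so: "s : Ob" using ts_sub[OF S s] .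
 let ?z = "zer C (fob F s) a"
 have 1: "EX! u. u : Hom s r & ep ** far F u = ?z" using r so m(1)[OF so] perp_obj[OF a] unfolding univ_arrow_def by simp
 have *: "ep ** far F u = ?z" if u: "u : Hom s r" for u by (rule perpD[OF a FS[OF s]]) (use u ro m in simp)
 have "zer C s r : Hom s r" using so ro by simp
 then show "f : {zer C s r}" using 1 *[OF f] *[of "zer C s r"] f by blast
qed

text \<open>The right adjoint of the functor induced on the quotient is computed on local objects.\<close>

lemma induced_univ_arrow:
 assumes F: "exact_functor C C F" and FS: "!!x. x : S ==> fob F x : S"
  and a: "a : Ob" and r: "univ_arrow C C F (L a) r ep"
 shows "EX ep'. univ_arrow N N \<lparr>fob = fob F, far = frac_map C S (far F)\<rparr> a r ep'"
proof -
 note m = functor_simps[OF exact_is_functor[OF F]] and ind = induced_functor(2)[OF F FS]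
 have ro: "r : Ob" "ep : Hom (fob F r) (L a)" using r unfolding univ_arrow_def by auto
 have rl: "r : perp S" by (rule right_adjoint_local[OF F FS L_local[OF a] r])
 obtain e where e: "e : Mor N (fob F r) a" "Psi e = ep" using Psi_surj[OF m(1)[OF ro(1)] a ro(2)] .
 have P: "Psi (cmp N e (qm S (far F u))) = ep ** far F u" "cmp N e (qm S (far F u)) : Mor N (fob F z) a" if u: "u : Hom z r" for u z
 proof -
  have fu: "far F u : Hom (fob F z) (fob F r)" using u m by simp
  show "Psi (cmp N e (qm S (far F u))) = ep ** far F u" using Psi_cmp_qm[OF fu e(1)] unfolding e(2) .
  show "cmp N e (qm S (far F u)) : Mor N (fob F z) a" by (rule N_cmp(1)[OF E_qm(1)[OF fu] e(1)])
 qed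
 have "EX! v. v : Mor N z r & cmp N e (frac_map C S (far F) v) = b" if z: "z : Ob" and b: "b : Mor N (fob F z) a" for z b
 proof -
  have "EX! u. u : Hom z r & ep ** far F u = Psi b" using r z Psi_Mor[OF b] unfolding univ_arrow_def by blast
  then obtain u where u: "u : Hom z r" "ep ** far F u = Psi b" and uu: "!!u'. u' : Hom z r ==> ep ** far F u' = Psi b ==> u' = u" by blast
  show ?thesis
  proof (rule ex1I[of _ "qm S u"])
   have "cmp N e (qm S (far F u)) = b" by (rule Psi_inj[OF P(2)[OF u(1)] b]) (simp only: P(1)[OF u(1)] u(2))
   then show "qm S u : Mor N z r & cmp N e (frac_map C S (far F) (qm S u)) = b" using E_qm(1)[OF u(1)] ind[of u] u(1) by simp
   fix v assume v: "v : Mor N z r & cmp N e (frac_map C S (far F) v) = b"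
   obtain u' where u': "u' : Hom z r" "v = qm S u'" using qm_local_surj[OF _ rl] v by blast
   have "cmp N e (qm S (far F u')) = b" using v u' ind[of u'] by simp
   then have "ep ** far F u' = Psi b" using P(1)[OF u'(1)] by simp
   then show "v = qm S u" using uu[OF u'(1)] u'(2) by simp
  qed
 qed
 then have "univ_arrow N N \<lparr>fob = fob F, far = frac_map C S (far F)\<rparr> a r e"
  unfolding univ_arrow_def func.simps verdier_simps(1) using ro(1) e(1) by blast
 then show ?thesis by blast
qed

text \<open>The embedding \<open>L\<close> of the quotient has a right adjoint at \<open>a\<close> as soon as there is a local
  object through which all maps from local objects to \<open>a\<close> factor uniquely.\<close>

lemma embedding_univ_arrow:
 assumes r: "r : perp S" and e: "e : Hom r a"
  and un: "!!y ph. y : perp S ==> ph : Hom y a ==> EX! u. u : Hom y r & e ** u = ph"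
 shows "EX ep. univ_arrow N C \<lparr>fob = L, far = E\<rparr> a r ep"
proof -
 have ro: "r : Ob" using perp_obj[OF r] .
 obtain g where g: "g : Hom (L r) r" "g ** \<eta> r = idn C r" "\<eta> r ** g = idn C (L r)" using is_isoE[OF eta_local_iso[OF r] eta[OF ro]] by metis
 have key: "(e ** g) ** E (qm S (u ** \<eta> x)) = e ** u" if x: "x : Ob" and u: "u : Hom (L x) r" for x u
 proof -
  have ux: "u ** \<eta> x : Hom x r" using u x by simp
  have "E (qm S (u ** \<eta> x)) = \<eta> r ** u"
   by (rule eta_cancel[OF x L_local[OF ro] E_Mor[OF E_qm(1)[OF ux]]]) (use u x ro E_qm(2)[OF ux] in simp_all)
  then have "(e ** g) ** E (qm S (u ** \<eta> x)) = e ** ((g ** \<eta> r) ** u)" using e g(1) u ro by simp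
  then show ?thesis unfolding g(2) using u e by simp
 qed
 have "EX! v. v : Mor N x r & (e ** g) ** E v = ph" if x: "x : Ob" and phi: "ph : Hom (L x) a" for x ph
 proof -
  obtain u where u: "u : Hom (L x) r" "e ** u = ph" and uu: "!!u'. u' : Hom (L x) r ==> e ** u' = ph ==> u' = u"
   using un[OF L_local[OF x] phi] by blast
  have ux: "u ** \<eta> x : Hom x r" using u x by simp
  show ?thesis
  proof (rule ex1I[of _ "qm S (u ** \<eta> x)"])
   show "qm S (u ** \<eta> x) : Mor N x r & (e ** g) ** E (qm S (u ** \<eta> x)) = ph" using E_qm(1)[OF ux] key[OF x u(1)] u(2) by simp
   fix v assume v: "v : Mor N x r & (e ** g) ** E v = ph"
   obtain w where w: "w : Hom x r" "v = qm S w" using qm_local_surj[OF _ r] v by blast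
   obtain u' where u': "u' : Hom (L x) r" "u' ** \<eta> x = w" using eta_extend[OF x r w(1)] .
   have "e ** u' = ph" using key[OF x u'(1)] v w u' by simp
   then show "v = qm S (u ** \<eta> x)" using uu[OF u'(1)] u' w by simp
  qed
 qed
 then have "univ_arrow N C \<lparr>fob = L, far = E\<rparr> a r (e ** g)" unfolding univ_arrow_def func.simps verdier_simps(1) using ro e g(1) by auto
 then show ?thesis by blast
qed

end

section \<open>Compact generation\<close>

lemma small_insert:
 assumes U: "universe U" and A: "A \<prec> U" shows "insert a A \<prec> U"
proof (cases "finite A")
 case True then show ?thesis using countable_small[OF U, of "insert a A"] by (simp add: countable_finite)
next
 case False then show ?thesis using eq_lesspoll_trans[OF infinite_insert_eqpoll[OF False] A] by simp
qed

lemma preserves_small_coproducts: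
 assumes C: "category C" and D: "category D" and F: "is_functor C D F"
  and p: "preserves_coproducts U C D F" and A: "A \<prec> U" and c: "is_coproduct C A X c io"
 shows "is_coproduct D A (%a. fob F (X a)) (fob F c) (%a. far F (io a))"
proof -
 interpret C: category C by fact
 interpret D: category D by fact
 obtain J f where J: "J \<subseteq> U" "J \<prec> U" "bij_betw f J A" using small_reindex[OF A] .
 have "is_coproduct D J (%j. fob F (X (f j))) (fob F c) (%j. far F (io (f j)))"
  using p J(1,2) C.coproduct_reindex[OF c J(3)] unfolding preserves_coproducts_def by blast
 then have "is_coproduct D A (%a. fob F (X a)) (fob F c) (%a. far F (io (f (inv_into J f a))))"
  using D.coproduct_reindex'[of J "%a. fob F (X a)" f "fob F c" "%j. far F (io (f j))"] J(3) by blast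
 then show ?thesis using bij_betw_inv_into_right[OF J(3)] unfolding is_coproduct_def by (simp cong: ball_cong)
qed

lemma localizing_small_coproduct:
 assumes C: "category C" and S: "localizing U C S" and A: "A \<prec> U" and c: "is_coproduct C A X c io" and X: "!!a. a : A ==> X a : S"
 shows "c : S"
proof -
 interpret C: category C by fact
 obtain J f where J: "J \<subseteq> U" "J \<prec> U" "bij_betw f J A" using small_reindex[OF A] .
 have "(%j. X (f j)) ` J \<subseteq> S" using bij_betwE[OF J(3)] X by blast
 then show ?thesis using S C.coproduct_reindex[OF c J(3)] J(1,2) unfolding localizing_def by blast
qed

context big_tt_category begin

abbreviation "compacts \<equiv> compact_objects U T"

lemma small_coproduct:
 assumes "A \<prec> U" "!!a. a : A ==> X a : Ob"
 obtains c io where "is_coproduct T A X c io"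
proof -
 obtain J f where J: "J \<subseteq> U" "J \<prec> U" "bij_betw f J A" using small_reindex[OF assms(1)] .
 have "(%j. X (f j)) ` J \<subseteq> Ob" using bij_betwE[OF J(3)] assms(2) by blast
 then obtain c io where "is_coproduct T J (%j. X (f j)) c io" using coproducts[OF J(1,2)] by blast
 then show ?thesis using that coproduct_reindex'[OF _ J(3)] by blast
qed

lemma nat_small: "(UNIV :: nat set) \<prec> U"
 using universe unfolding universe_def by blast

lemma localizing_ts: "localizing U T S ==> tsub S"
 unfolding localizing_def by blast

lemma localizing_retract:
 assumes S: "localizing U T S" and d: "d : S" and i: "i : Hom c d" and r: "r : Hom d c" and ri: "r ** i = idn T c"
 shows "c : S"
proof -
 have o: "c : Ob" "d : Ob" using Mor_objs[OF i] by auto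
 obtain b io where b: "is_coproduct T (UNIV :: nat set) (%_. c) b io" using small_coproduct[OF nat_small, of "%_. c"] o by blast
 obtain b' ka where b': "is_coproduct T (UNIV :: nat set) (%_. d) b' ka" using small_coproduct[OF nat_small, of "%_. d"] o by blast
 have "b' : S" using localizing_small_coproduct[OF category_axioms S nat_small b'] d by blast
 then show ?thesis by (rule retract_closed[OF localizing_ts[OF S] i r ri b b'])
qed

lemma compact_obj: "x : compacts ==> x : Ob"
 unfolding compact_objects_def by blast

text \<open>A morphism from a compact object to a coproduct is a finite sum of morphisms to the summands.\<close>

lemma compact_induct:
 assumes x: "x : compacts" and A: "A \<prec> U" and c: "is_coproduct T A X c io" and \<gamma>: "\<gamma> : Hom x c"
  and zero: "P (zer T x c)"
  and plus: "!!f g. f : Hom x c ==> g : Hom x c ==> P f ==> P g ==> P (add T f g)"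
  and incl: "!!a de. a : A ==> de : Hom x (X a) ==> P (io a ** de)"
 shows "P \<gamma>"
proof -
 obtain J f where J: "J \<subseteq> U" "J \<prec> U" "bij_betw f J A" using small_reindex[OF A] .
 note cJ = coproduct_reindex[OF c J(3)] and d = is_coproductD[OF c]
 have fA: "f j : A" if "j : J" for j using bij_betwE[OF J(3)] that by blast
 have xo: "x : Ob" using compact_obj[OF x] .
 interpret G: comm_group "HomG T x c" by (rule comm_group_Mor[OF xo d(1)])
 have gr: "group (HomG T x (X (f j)))" if "j : J" for j using comm_group_Mor[OF xo d(5)[OF fA[OF that]]] unfolding comm_group_def by blast
 let ?g = "%ph. finprod (HomG T x c) (%j. io (f j) ** ph j) {j : J. ph j ~= zer T x (X (f j))}"
 have "bij_betw ?g (carrier (sum_group J (%j. HomG T x (X (f j))))) (Hom x c)" using x J(1,2) cJ unfolding compact_objects_def by blast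
 then have "\<gamma> : ?g ` carrier (sum_group J (%j. HomG T x (X (f j))))" using \<gamma> by (simp only: bij_betw_imp_surj_on)
 then obtain ph where ph: "ph : carrier (sum_group J (%j. HomG T x (X (f j))))" "\<gamma> = ?g ph" by (elim imageE) (rule that)
 have "carrier (sum_group J (%j. HomG T x (X (f j)))) =
   {ph : \<Pi>\<^sub>E j\<in>J. carrier (HomG T x (X (f j))). finite {j : J. ph j ~= one (HomG T x (X (f j)))}}" by (rule carrier_sum_group[OF gr])
 then have ph': "ph : (\<Pi>\<^sub>E j\<in>J. Hom x (X (f j)))" "finite {j : J. ph j ~= zer T x (X (f j))}" using ph(1) unfolding HomG_simps by blast+
 have ph1: "ph j : Hom x (X (f j))" if "j : J" for j by (rule PiE_mem[OF ph'(1) that])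
 note fin = ph'(2)
 have trm: "io (f j) ** ph j : Hom x c" if "j : J" for j using ph1[OF that] d fA[OF that] by simp
 have "P (finprod (HomG T x c) (%j. io (f j) ** ph j) B) & finprod (HomG T x c) (%j. io (f j) ** ph j) B : Hom x c"
  if "finite B" "B \<subseteq> J" for B using that
 proof (induction B rule: finite_induct)
  case empty
  then show ?case using zero xo d(1) by simp
 next
  case (insert b B)
  have b: "b : J" using insert by simp
  have fn: "(%j. io (f j) ** ph j) : B \<rightarrow> carrier (HomG T x c)" using trm insert(4) unfolding HomG_simps by blast
  have "finprod (HomG T x c) (%j. io (f j) ** ph j) (insert b B) =
    add T (io (f b) ** ph b) (finprod (HomG T x c) (%j. io (f j) ** ph j) B)" using G.finprod_insert[OF insert(1,2) fn] trm[OF b] by simp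
  moreover have "P (io (f b) ** ph b)" using incl[OF fA[OF b] ph1[OF b]] .
  ultimately show ?case using plus[OF trm[OF b]] insert trm[OF b] by simp
 qed
 from this[OF fin] show ?thesis unfolding ph(2) by blast
qed

lemma compact_shift_desuspension:
 assumes x: "x : compacts"
 obtains x' th th' where "x' : compacts" "th : Hom (Sh x') x" "th' : Hom x (Sh x')" "th ** th' = idn T x"
proof -
 obtain x' where x': "x' : Ob" "isomorphic T (Sh x') x" using shift_ess_surj[OF compact_obj[OF x]] by blast
 have "x' : compacts" using ts_unshift[OF compact_triangulated x'(1)] ts_iso[OF compact_triangulated x isomorphic_sym[OF x'(2)]] by blast
 then show ?thesis using that isomorphicE[OF x'(2)] by metis
qed

lemma compact_detect_zero:
 assumes y: "y : perp (compacts)" shows "is_zero T y"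
proof -
 let ?O = "perp (compacts)"
 have O: "shift_closed ?O" by (rule ts_shift_closed[OF perp_triangulated[OF ts_shift_closed[OF compact_triangulated]]])
 have "localizing U T (coperp ?O)" unfolding localizing_def
 proof (intro conjI allI impI)
  show "tsub (coperp ?O)" by (rule coperp_triangulated[OF O])
  have O': "?O \<subseteq> Ob" using perp_obj by (rule subsetI)
  fix J X c io assume "X ` J \<subseteq> coperp ?O" "is_coproduct T J X c io"
  from coperp_coproduct[OF this(2,1) O'] show "c : coperp ?O" .
 qed
 moreover have "compacts \<subseteq> coperp ?O"
 proof
  fix x assume x: "x : compacts"
  then show "x : coperp ?O" unfolding coperp_def using perpD[OF _ x] compact_obj[OF x] by blast
 qed
 ultimately have "coperp ?O = Ob" by (rule compactly_generated)
 then have "y : coperp ?O" using perp_obj[OF y] by simp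
 then have "idn T y = zer T y y" using coperpD[OF _ y, of y "idn T y"] perp_obj[OF y] by simp
 then show ?thesis using perp_obj[OF y] by (simp add: is_zero_def)
qed

lemma compact_detect_iso:
 assumes f: "f : Hom x y"
  and inj: "!!c al. c : compacts ==> al : Hom c x ==> f ** al = zer T c y ==> al = zer T c x"
  and surj: "!!c be. c : compacts ==> be : Hom c y ==> EX al:Hom c x. f ** al = be"
 shows "is_iso T f"
proof -
 obtain z g h where t: "dt x y z f g h" using dt_cone[OF f] by blast
 note D = dtD[OF t]
 have "z : perp (compacts)" unfolding perp_def
 proof (intro CollectI conjI ballI subsetI)
  show "z : Ob" by (rule D)
  fix c al assume c: "c : compacts" and a: "al : Hom c z"
  obtain c' th th' where c': "c' : compacts" "th : Hom (Sh c') c" "th' : Hom c (Sh c')" "th ** th' = idn T c" using compact_shift_desuspension[OF c] .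
  have c'o: "c' : Ob" using compact_obj[OF c'(1)] .
  have "(h ** al) ** th : Hom (Sh c') (Sh x)" using a c' D by simp
  then obtain be where b: "be : Hom c' x" "Sa be = (h ** al) ** th" using shift_full[OF c'o D(11)] by blast
  have "Sa (f ** be) = (Sa f ** h) ** (al ** th)" using b a c'(2) D by simp
  also have "\<dots> = Sa (zer T c' y)" unfolding dt_cmp2[OF t] using a c'(2) D c'o by simp
  finally have "f ** be = zer T c' y" by (rule shift_faithful[rotated 2]) (use b D c'o in simp_all)
  then have "be = zer T c' x" using inj[OF c'(1) b(1)] by blast
  then have "((h ** al) ** th) ** th' = zer T c (Sh x)" unfolding b(2)[symmetric] using c' D c'o by simp
  then have "h ** al = zer T c (Sh x)" using a c' D by simp
  then obtain \<gamma> where g: "\<gamma> : Hom c y" "g ** \<gamma> = al" using dt_wker2[OF t a] by blast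
  obtain de where d: "de : Hom c x" "f ** de = \<gamma>" using surj[OF c g(1)] by blast
  have "al = (g ** f) ** de" using g d D by simp
  then show "al : {zer T c z}" unfolding dt_cmp0[OF t] using d D by simp
 qed
 then have "is_zero T z" by (rule compact_detect_zero)
 then show ?thesis by (rule dt_zero_iso[OF t])
qed

end

section \<open>Brown representability\<close>

text \<open>Brown's theorem for contravariant functors \<open>H\<close> to sets: coproducts are sent to products, and an
  element equalized by \<open>al\<close> and \<open>be\<close> extends to the cone of \<open>al - be\<close>.\<close>

locale brown_functor = big_tt_category U T
 for U :: "'u set" and T :: "('o, 'm, 'z) ttcat_scheme" (structure) +
 fixes Hs :: "'o \<Rightarrow> 'h set" and Hm :: "'m \<Rightarrow> 'h \<Rightarrow> 'h"
 assumes Hm_closed: "f : Mor T x y ==> b : Hs y ==> Hm f b : Hs x"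
  and Hm_idn: "x : obj T ==> b : Hs x ==> Hm (idn T x) b = b"
  and Hm_cmp: "f : Mor T x y ==> g : Mor T y z ==> b : Hs z ==> Hm (g ** f) b = Hm f (Hm g b)"
  and H_coproduct: "J \<subseteq> U ==> J \<prec> U ==> is_coproduct T J X c io ==> (!!j. j : J ==> ps j : Hs (X j)) ==>
   EX! a. a : Hs c & (ALL j:J. Hm (io j) a = ps j)"
  and H_cone: "dt x y z (sub T al be) g h ==> al : Mor T x y ==> be : Mor T x y ==> b : Hs y ==> Hm al b = Hm be b ==>
   EX a:Hs z. Hm g a = b"
  and H_small: "x : compacts ==> Hs x \<prec> U"
begin

lemma H_coproduct_ex:
 assumes A: "A \<prec> U" and c: "is_coproduct T A X c io" and b: "!!a. a : A ==> b a : Hs (X a)"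
 obtains e where "e : Hs c" "!!a. a : A ==> Hm (io a) e = b a"
proof -
 obtain J f where J: "J \<subseteq> U" "J \<prec> U" "bij_betw f J A" using small_reindex[OF A] .
 have fA: "f j : A" if "j : J" for j using bij_betwE[OF J(3)] that by blast
 have "EX! a. a : Hs c & (ALL j:J. Hm (io (f j)) a = b (f j))" by (rule H_coproduct[OF J(1,2) coproduct_reindex[OF c J(3)]]) (use fA b in blast)
 then obtain e where e: "e : Hs c" "ALL j:J. Hm (io (f j)) e = b (f j)" by blast
 have "Hm (io a) e = b a" if a: "a : A" for a
 proof -
  obtain j where "j : J" "a = f j" using bij_betw_imp_surj_on[OF J(3)] a by blast
  then show ?thesis using e by blast
 qed
 then show ?thesis using that e(1) by blast
qed

lemma H_coproduct_eq:
 assumes A: "A \<prec> U" and c: "is_coproduct T A X c io" and e: "e : Hs c" "e' : Hs c"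
  and eq: "!!a. a : A ==> Hm (io a) e = Hm (io a) e'"
 shows "e = e'"
proof -
 obtain J f where J: "J \<subseteq> U" "J \<prec> U" "bij_betw f J A" using small_reindex[OF A] .
 have fA: "f j : A" if "j : J" for j using bij_betwE[OF J(3)] that by blast
 note d = is_coproductD[OF c]
 have "EX! a. a : Hs c & (ALL j:J. Hm (io (f j)) a = Hm (io (f j)) e')"
  by (rule H_coproduct[OF J(1,2) coproduct_reindex[OF c J(3)]]) (rule Hm_closed[OF _ e(2)], use fA d in simp)
 then show ?thesis using e eq fA by blast
qed

definition universal_on where
 "universal_on X h \<longleftrightarrow> X : Ob & h : Hs X &
  (ALL x:compacts. (ALL b:Hs x. EX al:Hom x X. Hm al h = b) &
    (ALL al:Hom x X. ALL be:Hom x X. Hm al h = Hm be h --> al = be))"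

text \<open>\<open>X\<close> is enlarged first by enough compact objects to hit all elements of \<open>H\<close>, then repeatedly by
  cones that identify morphisms with the same image in \<open>H\<close>; the homotopy colimit works.\<close>

lemma enlarge_to_universal:
 assumes X0: "X0 : Ob" and h0: "h0 : Hs X0"
 obtains X h i where "universal_on X h" "i : Hom X0 X" "Hm i h = h0"
proof -
 obtain K where K: "K \<subseteq> compacts" "K \<prec> U" "!!x. x : compacts ==> EX y:K. isomorphic T x y" using compact_essentially_small by blast
 have Ko: "x : Ob" if "x : K" for x using K(1) compact_obj that by blast
 \<comment> \<open>a summand for each element of \<open>Hs x\<close> makes evaluation on compact objects surjective\<close>
 define A where "A = insert None (Some ` Sigma K Hs)"
 have A: "A \<prec> U"
 proof -
  have "Some ` Sigma K Hs \<prec> U" by (rule small_image[OF small_Sigma[OF universe K(2)]]) (use K(1) H_small in blast)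
  then show ?thesis unfolding A_def by (rule small_insert[OF universe])
 qed
 define Y where "Y a = (case a of None \<Rightarrow> X0 | Some p \<Rightarrow> fst p)" for a :: "('o \<times> 'h) option"
 define hY where "hY a = (case a of None \<Rightarrow> h0 | Some p \<Rightarrow> snd p)" for a :: "('o \<times> 'h) option"
 have "Y a : Ob" if "a : A" for a using that X0 Ko by (auto simp: A_def Y_def)
 then obtain X1 io1 where c1: "is_coproduct T A Y X1 io1" using small_coproduct[OF A] by blast
 note d1 = is_coproductD[OF c1]
 obtain h1 where h1: "h1 : Hs X1" "!!a. a : A ==> Hm (io1 a) h1 = hY a"
  by (rule H_coproduct_ex[OF A c1, of hY]) (use h0 in \<open>auto simp: A_def Y_def hY_def\<close>)
 have NA: "None : A" by (simp add: A_def)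
 have i0: "io1 None : Hom X0 X1" "Hm (io1 None) h1 = h0" using d1(2-4)[OF NA] h1(2)[OF NA] by (simp_all add: Y_def hY_def)
 have sur1: "EX al:Hom x X1. Hm al h1 = b" if "x : K" "b : Hs x" for x b
 proof -
  have a: "Some (x, b) : A" using that by (simp add: A_def)
  show ?thesis using d1(2-4)[OF a] h1(2)[OF a] by (intro bexI[of _ "io1 (Some (x, b))"]) (simp_all add: Y_def hY_def)
 qed
 \<comment> \<open>a cone identifies all pairs of morphisms from objects of \<open>K\<close> that have the same image\<close>
 define ok where "ok p \<longleftrightarrow> fst p : Ob & snd p : Hs (fst p)" for p :: "'o \<times> 'h"
 define step where "step p p' i \<longleftrightarrow> i : Hom (fst p) (fst p') & Hm i (snd p') = snd p &
  (ALL x:K. ALL al:Hom x (fst p). ALL be:Hom x (fst p). Hm al (snd p) = Hm be (snd p) --> i ** al = i ** be)" for p p' i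
 have ex: "EX p'. ok p' & (EX i. step p p' i)" if p: "ok p" for p
 proof -
  define X where "X = fst p"
  define h where "h = snd p"
  have p': "p = (X, h)" "X : Ob" "h : Hs X" using p unfolding ok_def X_def h_def by simp_all
  define B where "B = Sigma K (%x. {(al, be). al : Hom x X & be : Hom x X & Hm al h = Hm be h})"
  have B: "B \<prec> U" unfolding B_def
  proof (rule small_Sigma[OF universe K(2)])
   fix x assume "x : K"
   then have "Hom x X \<prec> U" using locally_small Ko p'(2) by blast
   then have "Hom x X \<times> Hom x X \<prec> U" by (intro small_Sigma[OF universe])
   then show "{(al, be). al : Hom x X & be : Hom x X & Hm al h = Hm be h} \<prec> U" by (rule small_subset) blast
  qed
  obtain c io where c: "is_coproduct T B fst c io" 
  proof -
   have "fst q : Ob" if "q : B" for q using Ko that unfolding B_def by auto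
   then show ?thesis using small_coproduct[OF B, of fst] that by blast
  qed
  note d = is_coproductD[OF c]
  have Bm: "fst (snd q) : Hom (fst q) X" "snd (snd q) : Hom (fst q) X" "Hm (fst (snd q)) h = Hm (snd (snd q)) h"
   if "q : B" for q using that unfolding B_def by auto
  obtain a where a: "a : Hom c X" "!!q. q : B ==> a ** io q = fst (snd q)" using coproduct_map[OF c p'(2), of "%q. fst (snd q)"] Bm(1) by blast
  obtain b where b: "b : Hom c X" "!!q. q : B ==> b ** io q = snd (snd q)" using coproduct_map[OF c p'(2), of "%q. snd (snd q)"] Bm(2) by blast
  have e: "Hm a h = Hm b h"
  proof (rule H_coproduct_eq[OF B c Hm_closed[OF a(1) p'(3)] Hm_closed[OF b(1) p'(3)]])
   fix q assume q: "q : B"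
   have iq: "io q : Hom (fst q) c" using d q by simp
   show "Hm (io q) (Hm a h) = Hm (io q) (Hm b h)" using Hm_cmp[OF iq a(1) p'(3)] Hm_cmp[OF iq b(1) p'(3)] a(2)[OF q] b(2)[OF q] Bm(3)[OF q] by simp
  qed
  have "sub T a b : Hom c X" using a b by simp
  then obtain X' i k where t: "dt c X X' (sub T a b) i k" using dt_cone by blast
  note D = dtD[OF t]
  obtain h' where h': "h' : Hs X'" "Hm i h' = h" using H_cone[OF t a(1) b(1) p'(3) e] by blast
  have "i ** a = i ** b"
  proof -
   have "sub T (i ** a) (i ** b) = zer T c X'" using dt_cmp0[OF t] a b D by (simp add: cmp_sub)
   then show ?thesis by (rule sub_eq_zerD) (use a b D in simp_all)
  qed
  note iab = this
  have "i ** al = i ** be" if q: "x : K" "al : Hom x X" "be : Hom x X" "Hm al h = Hm be h" for x al be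
  proof -
   have qB: "(x, al, be) : B" using q unfolding B_def by blast
   have "(i ** a) ** io (x, al, be) = i ** al" using a(1) a(2)[OF qB] d(2-4)[OF qB] D by simp
   moreover have "(i ** b) ** io (x, al, be) = i ** be" using b(1) b(2)[OF qB] d(2-4)[OF qB] D by simp
   ultimately show ?thesis using iab by simp
  qed
  note iq = this
  have "step p (X', h') i" unfolding step_def p'(1) fst_conv snd_conv
  proof (intro conjI ballI impI)
   show "i : Hom X X'" using D by simp
   show "Hm i h' = h" by (rule h'(2))
  qed (rule iq)
  moreover have "ok (X', h')" using D h' by (simp add: ok_def)
  ultimately show ?thesis by blast
 qed
 have ok1: "ok (X1, h1)" using d1 h1 by (simp add: ok_def)
 obtain P where P: "P 0 = (X1, h1)" "!!n. ok (P n)" "!!n. EX i. step (P n) (P (Suc n)) i"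
  using dependent_nat_choice[of "%n p. ok p & (n = 0 --> p = (X1, h1))" "%n p p'. EX i. step p p' i"] ok1 ex by auto metis
 obtain i where i: "!!n. step (P n) (P (Suc n)) (i n)" using P(3) by metis
 define Xs where "Xs n = fst (P n)" for n
 define hs where "hs n = snd (P n)" for n
 have Xh: "Xs n : Ob" "hs n : Hs (Xs n)" for n using P(2)[of n] unfolding ok_def Xs_def hs_def by auto
 have im: "i n : Hom (Xs n) (Xs (Suc n))" "Hm (i n) (hs (Suc n)) = hs n" for n using i[of n] unfolding step_def Xs_def hs_def by auto
 have ik: "i n ** al = i n ** be" if "x : K" "al : Hom x (Xs n)" "be : Hom x (Xs n)" "Hm al (hs n) = Hm be (hs n)" for n x al be
  using i[of n] that unfolding step_def Xs_def hs_def by blast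
 \<comment> \<open>the cone of \<open>1 - sh\<close>: maps to it from compact objects factor through a finite stage\<close>
 obtain B io where c: "is_coproduct T (UNIV :: nat set) Xs B io" using small_coproduct[OF nat_small] Xh(1) by blast
 note d = is_coproductD[OF c, simplified]
 obtain sh where sh: "sh : Hom B B" "!!n. sh ** io n = io (Suc n) ** i n"
  by (rule coproduct_map[OF c d(1), of "%n. io (Suc n) ** i n"]) (use d im in simp_all)
 obtain hB where hB: "hB : Hs B" "!!n. Hm (io n) hB = hs n"  by (rule H_coproduct_ex[OF nat_small c, of hs]) (use Xh(2) in simp_all)
 have iM: "io n : Hom (Xs n) B" for n using d by simp
 have "Hm sh hB = hB"
 proof (rule H_coproduct_eq[OF nat_small c Hm_closed[OF sh(1) hB(1)] hB(1)])
  fix n show "Hm (io n) (Hm sh hB) = Hm (io n) hB"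
   using Hm_cmp[OF iM sh(1) hB(1), of n] Hm_cmp[OF im(1) iM hB(1), of n] sh(2)[of n] hB(2)[of n] hB(2)[of "Suc n"] im(2)[of n] by simp
 qed
 then have e: "Hm (idn T B) hB = Hm sh hB" using Hm_idn[OF d(1) hB(1)] by simp
 let ?D = "sub T (idn T B) sh"
 have DM: "?D : Hom B B" using sh d(1) by simp
 obtain X p q where t: "dt B B X ?D p q" using dt_cone[OF DM] by blast
 note tD = dtD[OF t]
 obtain h where h: "h : Hs X" "Hm p h = hB" using H_cone[OF t idn_Mor[OF d(1)] sh(1) hB(1) e] by blast
 have psh: "p ** sh = p"
 proof -
  have "sub T p (p ** sh) = zer T B X" using dt_cmp0[OF t] sh d(1) tD by (simp add: cmp_sub)
  then have "p = p ** sh" by (rule sub_eq_zerD) (use sh d(1) tD in simp_all)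
  then show ?thesis by simp
 qed
 define e where "e n = p ** io n" for n
 have eM: "e n : Hom (Xs n) X" for n using tD d by (simp add: e_def)
 have eS: "e (Suc n) ** i n = e n" for n
 proof -
  have "e (Suc n) ** i n = p ** (sh ** io n)" unfolding e_def sh(2) using tD d im(1)[of n] by simp
  also have "\<dots> = (p ** sh) ** io n" using tD d sh(1) by simp
  finally show ?thesis unfolding psh e_def .
 qed
 have eh: "Hm (e n) h = hs n" for n using Hm_cmp[OF iM _ h(1), of p n] h(2) hB(2)[of n] tD by (simp add: e_def)
 have push: "EX de':Hom x (Xs m). e n ** de = e m ** de'" if "n \<le> m" "de : Hom x (Xs n)" for x n m de using that
 proof (induction m rule: dec_induct)
  case base
  then show ?case by blast
 next
  case (step m)
  then obtain de' where d': "de' : Hom x (Xs m)" "e n ** de = e m ** de'" by blast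
  have "e m ** de' = e (Suc m) ** (i m ** de')" using d'(1) eM[of "Suc m"] im(1)[of m] eS[of m] by (simp add: pre_eq[OF eS])
  moreover have "i m ** de' : Hom x (Xs (Suc m))" using d'(1) im(1)[of m] by simp
  ultimately show ?case using d'(2) by metis
 qed
 have fac: "EX n. EX de:Hom x (Xs n). al = e n ** de" if x: "x : compacts" and a: "al : Hom x X" for x al
 proof -
  have xo: "x : Ob" using compact_obj[OF x] .
  have "q ** al = zer T x (Sh B)"
  proof -
   obtain x' th th' where x': "x' : compacts" "th : Hom (Sh x') x" "th' : Hom x (Sh x')" "th ** th' = idn T x"
    using compact_shift_desuspension[OF x] .
   have x'o: "x' : Ob" using compact_obj[OF x'(1)] .
   have "(q ** al) ** th : Hom (Sh x') (Sh B)" using a x' tD by simp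
   then obtain be where be: "be : Hom x' B" "Sa be = (q ** al) ** th" using shift_full[OF x'o d(1)] by blast
   have "Sa (?D ** be) = (Sa ?D ** q) ** (al ** th)" using be(1) be(2) a x'(2) tD by simp
   also have "\<dots> = Sa (zer T x' B)" unfolding dt_cmp2[OF t] using a x'(2) tD x'o by simp
   finally have "?D ** be = zer T x' B" by (rule shift_faithful[rotated 2]) (use be(1) tD x'o d in simp_all)
   then have "sub T be (sh ** be) = zer T x' B" using be(1) sh(1) d(1) by (simp add: sub_cmp)
   then have bsh: "be = sh ** be" by (rule sub_eq_zerD) (use be(1) sh(1) in simp_all)
   have ex_map: "EX ta. ta : Hom B B & (ALL n. ta ** io n = ph n)" if phi: "!!n. ph n : Hom (Xs n) B" for ph
    by (rule coproduct_map[OF c d(1), of ph, OF phi]) blast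
   have "ALL k. EX ta. ta : Hom B B & (ALL n. ta ** io n = (if n < k then io n else zer T (Xs n) B))"
   proof
    fix k :: nat
    have "(if n < k then io n else zer T (Xs n) B) : Hom (Xs n) B" for n using iM[of n] Xh(1)[of n] d(1) by simp
    then show "EX ta. ta : Hom B B & (ALL n. ta ** io n = (if n < k then io n else zer T (Xs n) B))"
     using ex_map[of "%n. if n < k then io n else zer T (Xs n) B"] by blast
   qed
   then obtain ta where tau: "!!k. ta k : Hom B B" "!!k n. ta k ** io n = (if n < k then io n else zer T (Xs n) B)" by metis
   have tt: "ta l ** ta k = ta k" if "k \<le> l" for k l
   proof (rule coproduct_eq[OF c])
    fix n show "(ta l ** ta k) ** io n = ta k ** io n" using that tau(1)[of k] tau(1)[of l] tau(2)[of k n] tau(2)[of l n] iM[of n] Xh(1)[of n] by simp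
   qed (use tau(1) in simp_all)
   \<comment> \<open>by compactness \<open>be\<close> lands in finitely many summands, and \<open>be = sh be\<close> pushes it out of them\<close>
   have "EX k. ta k ** be = be"
   proof (rule compact_induct[OF x'(1) nat_small c be(1)])
    show "EX k. ta k ** zer T x' B = zer T x' B" using tau(1)[of 0] x'o by (intro exI[of _ 0]) simp
    show "EX k. ta k ** (io n ** de) = io n ** de" if "de : Hom x' (Xs n)" for n de
    proof -
     have "(ta (Suc n) ** io n) ** de = ta (Suc n) ** (io n ** de)" by (rule assoc_cmp) (use that iM[of n] tau(1)[of "Suc n"] in simp_all)
     then have "ta (Suc n) ** (io n ** de) = io n ** de" unfolding tau(2) by simp
     then show ?thesis by blast
    qed
    fix f g assume f: "f : Hom x' B" and g: "g : Hom x' B" and kf: "EX k. ta k ** f = f" and kg: "EX k. ta k ** g = g"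
    obtain k l where kl: "ta k ** f = f" "ta l ** g = g" using kf kg by blast
    let ?m = "max k l"
    have mf: "ta ?m ** f = f"
    proof -
     have "ta ?m ** (ta k ** f) = ta k ** f" using pre_eq[OF tt[of k ?m], of f] tau(1) f by simp
     then show ?thesis using kl by simp
    qed
    have mg: "ta ?m ** g = g"
    proof -
     have "ta ?m ** (ta l ** g) = ta l ** g" using pre_eq[OF tt[of l ?m], of g] tau(1) g by simp
     then show ?thesis using kl by simp
    qed
    have "ta ?m ** add T f g = add T f g" using mf mg f g tau(1)[of ?m] by (simp add: cmp_add)
    then show "EX k. ta k ** add T f g = add T f g" by blast
   qed
   then obtain N where N: "ta N ** be = be" by blast
   have "ta k ** be = zer T x' B" for k
   proof (induction k)
    case 0
    have "ta 0 = zer T B B" by (rule coproduct_eq[OF c]) (use tau[of 0] d Xh in simp_all)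
    then show ?case using be(1) d(1) by simp
   next
    case (Suc k)
    have "ta (Suc k) ** sh = sh ** ta k"
    proof (rule coproduct_eq[OF c])
     fix n
     have "(ta (Suc k) ** sh) ** io n = (ta (Suc k) ** io (Suc n)) ** i n"
      using tau(1)[of "Suc k"] sh(1) sh(2)[of n] iM[of n] iM[of "Suc n"] im(1)[of n] by simp
     moreover have "(sh ** ta k) ** io n = sh ** (ta k ** io n)" using tau(1)[of k] sh(1) iM[of n] by simp
     ultimately show "(ta (Suc k) ** sh) ** io n = (sh ** ta k) ** io n" unfolding tau(2) using sh im(1)[of n] Xh(1) d(1) by simp
    qed (use tau(1) sh in simp_all)
    then have 1: "(ta (Suc k) ** sh) ** be = (sh ** ta k) ** be" by simp
    have "ta (Suc k) ** (sh ** be) = sh ** (ta k ** be)" using 1 tau(1) sh(1) be(1) by simp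
    then show ?case unfolding Suc using bsh[symmetric] sh(1) x'o by simp
   qed
   then have "be = zer T x' B" using N by metis
   then have "((q ** al) ** th) ** th' = zer T x (Sh B)" unfolding be(2)[symmetric] using x' x'o d by simp
   then show ?thesis using a x' tD by simp
  qed
  then obtain \<gamma> where g: "\<gamma> : Hom x B" "p ** \<gamma> = al" using dt_wker2[OF t a] by blast
  have "EX n. EX de:Hom x (Xs n). p ** \<gamma> = e n ** de"
  proof (rule compact_induct[OF x nat_small c g(1)])
   show "EX n. EX de:Hom x (Xs n). p ** zer T x B = e n ** de"
    by (intro exI[of _ 0] bexI[of _ "zer T x (Xs 0)"]) (use tD xo Xh(1) eM[of 0] in simp_all)
   show "EX n. EX de':Hom x (Xs n). p ** (io m ** de) = e n ** de'" if "de : Hom x (Xs m)" for m de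
    by (intro exI[of _ m] bexI[of _ de]) (use that tD d in \<open>simp_all add: e_def\<close>)
   fix f g assume f: "f : Hom x B" and g: "g : Hom x B"
    and nf: "EX n. EX de:Hom x (Xs n). p ** f = e n ** de" and ng: "EX n. EX de:Hom x (Xs n). p ** g = e n ** de"
   obtain n de where n: "de : Hom x (Xs n)" "p ** f = e n ** de" using nf by blast
   obtain m ep where m: "ep : Hom x (Xs m)" "p ** g = e m ** ep" using ng by blast
   obtain de' where d': "de' : Hom x (Xs (max n m))" "e n ** de = e (max n m) ** de'" using push[OF max.cobounded1 n(1)] by blast
   obtain ep' where e': "ep' : Hom x (Xs (max n m))" "e m ** ep = e (max n m) ** ep'" using push[OF max.cobounded2 m(1)] by blast
   have "p ** add T f g = add T (p ** f) (p ** g)" using f g tD by (simp add: cmp_add)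
   also have "\<dots> = e (max n m) ** add T de' ep'" unfolding n(2) m(2) d'(2) e'(2) using d'(1) e'(1) eM[of "max n m"] by (simp add: cmp_add)
   finally show "EX n. EX de:Hom x (Xs n). p ** add T f g = e n ** de"
    by (intro exI[of _ "max n m"] bexI[of _ "add T de' ep'"]) (use d' e' in simp_all)
  qed
  then show ?thesis using g(2) by simp
 qed
 have surK: "EX al:Hom x X. Hm al h = b" if x: "x : K" and b: "b : Hs x" for x b
 proof -
  have X0': "Xs 0 = X1" "hs 0 = h1" using P(1) by (simp_all add: Xs_def hs_def)
  obtain al where a: "al : Hom x (Xs 0)" "Hm al (hs 0) = b" using sur1[OF x b] X0' by metis
  then show ?thesis using Hm_cmp[OF a(1) eM h(1)] eh[of 0] eM[of 0] by (intro bexI[of _ "e 0 ** al"]) simp_all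
 qed
 have injK: "al = be" if x: "x : K" and ab: "al : Hom x X" "be : Hom x X" "Hm al h = Hm be h" for x al be
 proof -
  have xc: "x : compacts" using K(1) x by blast
  obtain n de where n: "de : Hom x (Xs n)" "al = e n ** de" using fac[OF xc ab(1)] by blast
  obtain m ep where m: "ep : Hom x (Xs m)" "be = e m ** ep" using fac[OF xc ab(2)] by blast
  let ?m = "max n m"
  obtain de' where d': "de' : Hom x (Xs ?m)" "e n ** de = e ?m ** de'" using push[OF max.cobounded1 n(1)] by blast
  obtain ep' where e': "ep' : Hom x (Xs ?m)" "e m ** ep = e ?m ** ep'" using push[OF max.cobounded2 m(1)] by blast
  have "Hm de' (hs ?m) = Hm ep' (hs ?m)"
   using ab(3) unfolding n(2) m(2) d'(2) e'(2) using Hm_cmp[OF d'(1) eM h(1)] Hm_cmp[OF e'(1) eM h(1)] eh by simp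
  then have i: "i ?m ** de' = i ?m ** ep'" using ik[OF x d'(1) e'(1)] by blast
  have "e ?m ** de' = e (Suc ?m) ** (i ?m ** de')" by (rule pre_eq[OF eS, symmetric]) (use eM[of "Suc ?m"] im(1)[of ?m] d'(1) in simp_all)
  also have "\<dots> = e ?m ** ep'" unfolding i by (rule pre_eq[OF eS]) (use eM[of "Suc ?m"] im(1)[of ?m] e'(1) in simp_all)
  finally show ?thesis using n(2) m(2) d'(2) e'(2) by simp
 qed
 have "universal_on X h" unfolding universal_on_def
 proof (intro conjI ballI impI)
  show "X : Ob" "h : Hs X" using tD h by simp_all
  fix x assume x: "x : compacts"
  obtain y where y: "y : K" "isomorphic T x y" using K(3)[OF x] by blast
  obtain th th' where th: "th : Hom x y" "th' : Hom y x" "th' ** th = idn T x" using isomorphicE[OF y(2)] by metis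
  have xo: "x : Ob" using compact_obj[OF x] .
  show "EX al:Hom x X. Hm al h = b" if b: "b : Hs x" for b
  proof -
   obtain al where a: "al : Hom y X" "Hm al h = Hm th' b" using surK[OF y(1) Hm_closed[OF th(2) b]] by blast
   have "Hm (al ** th) h = Hm (th' ** th) b" using Hm_cmp[OF th(1) a(1) h(1)] Hm_cmp[OF th(1,2) b] a(2) by simp
   also have "\<dots> = b" unfolding th(3) by (rule Hm_idn[OF xo b])
   finally show ?thesis using a(1) th(1) by (intro bexI[of _ "al ** th"]) simp_all
  qed
  show "al = be" if a: "al : Hom x X" and b: "be : Hom x X" and eq: "Hm al h = Hm be h" for al be
  proof -
   have M: "al ** th' : Hom y X" "be ** th' : Hom y X" using a b th by simp_all
   have "al ** th' = be ** th'" by (rule injK[OF y(1) M]) (simp only: Hm_cmp[OF th(2) a h(1)] Hm_cmp[OF th(2) b h(1)] eq)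
   then have "(al ** th') ** th = (be ** th') ** th" by simp
   then show ?thesis using a b th by simp
  qed
 qed
 moreover have "e 0 ** io1 None : Hom X0 X" using eM[of 0] i0 P(1) by (simp add: Xs_def)
 moreover have "Hm (e 0 ** io1 None) h = h0"
  using Hm_cmp[of "io1 None" X0 "Xs 0" "e 0" X h] i0 eM[of 0] h(1) eh[of 0] P(1) by (simp add: Xs_def hs_def)
 ultimately show ?thesis using that by blast
qed

lemma universal_on_iso:
 assumes X: "universal_on X h" and X': "universal_on X' h'" and f: "f : Hom X X'" "Hm f h' = h"
 shows "is_iso T f"
proof (rule compact_detect_iso[OF f(1)])
 have h: "h : Hs X" "h' : Hs X'" "X : Ob" "X' : Ob" using X X' unfolding universal_on_def by auto
 fix c assume c: "c : compacts"
 have co: "c : Ob" using compact_obj[OF c] .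
 have *: "Hm (f ** al) h' = Hm al h" if "al : Hom c X" for al using Hm_cmp[OF that f(1) h(2)] f(2) by simp
 show "al = zer T c X" if a: "al : Hom c X" and e: "f ** al = zer T c X'" for al
 proof -
  have z: "zer T c X : Hom c X" using co h by simp
  have "f ** zer T c X = zer T c X'" using f co by simp
  then have "Hm al h = Hm (zer T c X) h" using *[OF a] *[OF z] e by simp
  then show ?thesis using X c a z unfolding universal_on_def by blast
 qed
 show "EX al:Hom c X. f ** al = be" if b: "be : Hom c X'" for be
 proof -
  obtain al where a: "al : Hom c X" "Hm al h = Hm be h'" using X c Hm_closed[OF b h(2)] unfolding universal_on_def by blast
  have "f ** al : Hom c X'" using a f by simp
  then have "f ** al = be" using *[OF a(1)] a(2) X' c b unfolding universal_on_def by metis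
  then show ?thesis using a(1) by blast
 qed
qed

theorem brown_representability:
 "EX X h. X : Ob & h : Hs X & (ALL y:Ob. bij_betw (%al. Hm al h) (Hom y X) (Hs y))"
proof -
 have E: "({} :: nat set) \<prec> U" by (rule countable_small[OF universe]) simp
 obtain c io where c0: "is_coproduct T ({} :: nat set) (%_. undefined) c io" using small_coproduct[OF E, of "%_. undefined"] by blast
 obtain h0 where h0: "h0 : Hs c" using H_coproduct_ex[OF E c0, of undefined] by blast
 obtain X h i where X: "universal_on X h" using enlarge_to_universal[OF is_coproductD(1)[OF c0] h0] by blast
 have Xh: "X : Ob" "h : Hs X" using X unfolding universal_on_def by auto
 have "bij_betw (%al. Hm al h) (Hom y X) (Hs y)" if y: "y : Ob" for y unfolding bij_betw_def
 proof (intro conjI inj_onI subset_antisym subsetI)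
  fix al be assume a: "al : Hom y X" and b: "be : Hom y X" and e: "Hm al h = Hm be h"
  have "sub T al be : Hom y X" using a b by simp
  then obtain X1 g k where t: "dt y X X1 (sub T al be) g k" using dt_cone by blast
  note D = dtD[OF t]
  obtain h1 where h1: "h1 : Hs X1" "Hm g h1 = h" using H_cone[OF t a b Xh(2) e] by blast
  obtain X' h' i where X': "universal_on X' h'" "i : Hom X1 X'" "Hm i h' = h1" using enlarge_to_universal[OF D(13) h1(1)] .
  have h'M: "h' : Hs X'" using X'(1) unfolding universal_on_def by blast
  have gM: "g : Hom X X1" using D by simp
  have igM: "i ** g : Hom X X'" using X' D by simp
  have "is_iso T (i ** g)" by (rule universal_on_iso[OF X X'(1) igM]) (simp only: Hm_cmp[OF gM X'(2) h'M] X'(3) h1(2))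
  then obtain j where j: "j : Hom X' X" "j ** (i ** g) = idn T X" using is_isoE[OF _ igM] by metis
  have "sub T (g ** al) (g ** be) = zer T y X1" using dt_cmp0[OF t] a b D by (simp add: cmp_sub)
  then have ga: "g ** al = g ** be" by (rule sub_eq_zerD) (use a b D in simp_all)
  have "al = (j ** (i ** g)) ** al" unfolding j(2) using a by simp
  also have "\<dots> = j ** (i ** (g ** al))" using j(1) X'(2) gM a by simp
  also have "\<dots> = (j ** (i ** g)) ** be" unfolding ga using j(1) X'(2) gM b by simp
  also have "\<dots> = be" unfolding j(2) using b by simp
  finally show "al = be" .
 next
  fix b assume "b : (%al. Hm al h) ` Hom y X" then show "b : Hs y" using Hm_closed[OF _ Xh(2)] by blast
 next
  fix b assume b: "b : Hs y"
  have small: "(UNIV :: bool set) \<prec> U" by (rule countable_small[OF universe]) simp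
  obtain c io where c: "is_coproduct T (UNIV :: bool set) (%i. if i then X else y) c io"
   by (rule small_coproduct[OF small, of "%i. if i then X else y"]) (use Xh y in simp_all)
  obtain h1 where h1: "h1 : Hs c" "!!i. Hm (io i) h1 = (if i then h else b)"
   by (rule H_coproduct_ex[OF small c, of "%i. if i then h else b"]) (use Xh b in simp_all)
  have co: "c : Ob" "io True : Hom X c" "io False : Hom y c"
   using is_coproductD(1)[OF c] is_coproductD(2-4)[OF c, of True] is_coproductD(2-4)[OF c, of False] by simp_all
  obtain X' h' i where X': "universal_on X' h'" "i : Hom c X'" "Hm i h' = h1" using enlarge_to_universal[OF co(1) h1(1)] .
  have h'M: "h' : Hs X'" using X'(1) unfolding universal_on_def by blast
  have fM: "i ** io True : Hom X X'" using X' co by simp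
  have fh: "Hm (i ** io True) h' = h" using Hm_cmp[OF co(2) X'(2) h'M] X'(3) h1(2)[of True] by simp
  have "is_iso T (i ** io True)" by (rule universal_on_iso[OF X X'(1) fM fh])
  then obtain j where j: "j : Hom X' X" "(i ** io True) ** j = idn T X'" using is_isoE[OF _ fM] by metis
  have jM: "j ** (i ** io False) : Hom y X" using j X' co by simp
  have "Hm (j ** (i ** io False)) h = Hm ((i ** io True) ** (j ** (i ** io False))) h'" using Hm_cmp[OF jM fM h'M] fh by simp
  also have "(i ** io True) ** (j ** (i ** io False)) = ((i ** io True) ** j) ** (i ** io False)" using j(1) X'(2) co by simp
  also have "Hm \<dots> h' = b" unfolding j(2) using Hm_cmp[OF co(3) X'(2) h'M] X'(2,3) h1(2)[of False] co by simp
  finally show "b : (%al. Hm al h) ` Hom y X" using jM by blast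
 qed
 then show ?thesis using Xh by blast
qed

end

section \<open>Products and internal homs\<close>

context big_tt_category begin

lemma small_product:
 fixes X :: "'i \<Rightarrow> 'o"
 assumes A: "A \<prec> U" and X: "!!a. a : A ==> X a : Ob"
 obtains p pr where "is_product T A X p pr"
proof -
 let ?H = "%z. PiE A (%a. Hom z (X a))" and ?m = "%ph b. (\<lambda>a\<in>A. b a ** ph)"
 have mem: "b a : Hom z (X a)" if "b : ?H z" "a : A" for b a z using that by (rule PiE_mem)
 interpret B: brown_functor U T ?H ?m
 proof unfold_locales
  show cl: "?m f b : ?H x" if f: "f : Hom x y" and b: "b : ?H y" for f x y b
  proof (rule PiE_I)
   fix a assume a: "a : A" then show "?m f b a : Hom x (X a)" using mem[OF b a] f by simp
  qed simp
  have eq: "b = b'" if "b : ?H x" "b' : ?H x" "!!a. a : A ==> b a = b' a" for b b' x using that by (rule PiE_ext)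
  show "?m (idn T x) b = b" if x: "x : Ob" and b: "b : ?H x" for x b by (rule eq[OF cl[OF idn_Mor[OF x] b] b]) (use mem[OF b] in simp)
  show "?m (g ** f) b = ?m f (?m g b)" if f: "f : Hom x y" and g: "g : Hom y z" and b: "b : ?H z" for f g x y z b
   by (rule restrict_ext) (use mem[OF b] f g in simp)
  show "EX! a. a : ?H c & (ALL j:J. ?m (io j) a = ps j)"
   if J: "J \<subseteq> U" "J \<prec> U" and c: "is_coproduct T J Y c io" and psi: "!!j. j : J ==> ps j : ?H (Y j)" for J Y c io ps
  proof -
   note d = is_coproductD[OF c]
   have "EX h. h : Hom c (X a) & (ALL j:J. h ** io j = ps j a)" if a: "a : A" for a
    by (rule coproduct_map[OF c X[OF a], of "%j. ps j a", OF mem[OF psi a]]) blast+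
   then obtain h where h: "!!a. a : A ==> h a : Hom c (X a)" "!!a j. a : A ==> j : J ==> h a ** io j = ps j a" by metis
   show ?thesis
   proof (rule ex1I[of _ "\<lambda>a\<in>A. h a"], intro conjI ballI)
    show "(\<lambda>a\<in>A. h a) : ?H c" by (rule PiE_I) (use h(1) in simp_all)
    show "?m (io j) (\<lambda>a\<in>A. h a) = ps j" if j: "j : J" for j
    proof (rule eq[OF _ psi[OF j]])
     show "?m (io j) (\<lambda>a\<in>A. h a) : ?H (Y j)" by (rule PiE_I) (use h(1) d j in simp_all)
     show "?m (io j) (\<lambda>a\<in>A. h a) a = ps j a" if "a : A" for a using h(2) that j by simp
    qed
    fix b assume b: "b : ?H c & (ALL j:J. ?m (io j) b = ps j)"
    show "b = (\<lambda>a\<in>A. h a)"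
    proof (rule eq)
     show "b : ?H c" using b by blast
     show "(\<lambda>a\<in>A. h a) : ?H c" by (rule PiE_I) (use h(1) in simp_all)
     fix a assume a: "a : A"
     have bh: "b a = h a"
     proof (rule coproduct_eq[OF c _ h(1)[OF a]])
      show "b a : Hom c (X a)" using mem b a by blast
      fix j assume j: "j : J"
      have "?m (io j) b a = ps j a" using b j by metis
      then show "b a ** io j = h a ** io j" using h(2)[OF a j] a by simp
     qed
     then show "b a = (\<lambda>a\<in>A. h a) a" using a by simp
    qed
   qed
  qed
  show "EX a:?H z. ?m g a = b"
   if t: "dt x y z (sub T al be) g h" and ab: "al : Hom x y" "be : Hom x y" and b: "b : ?H y" and e: "?m al b = ?m be b"
   for x y z al be g h b
  proof -
   note D = dtD[OF t]
   have "EX v:Hom z (X a). v ** g = b a" if a: "a : A" for a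
   proof (rule dt_wcok[OF t mem[OF b a]])
    have "?m al b a = ?m be b a" using e by metis
    then show "b a ** sub T al be = zer T x (X a)" using mem[OF b a] ab a by (simp add: cmp_sub)
   qed
   then obtain v where v: "!!a. a : A ==> v a : Hom z (X a)" "!!a. a : A ==> v a ** g = b a" by metis
   have vH: "(\<lambda>a\<in>A. v a) : ?H z" by (rule PiE_I) (use v(1) in simp_all)
   have "?m g (\<lambda>a\<in>A. v a) = b"
   proof (rule eq[OF _ b])
    show "?m g (\<lambda>a\<in>A. v a) : ?H y" by (rule PiE_I) (use v(2) mem[OF b] in simp_all)
    show "?m g (\<lambda>a\<in>A. v a) a = b a" if "a : A" for a using v(2) that by simp
   qed
   then show ?thesis using vH by blast
  qed
  show "?H x \<prec> U" if "x : compacts" for x by (rule small_PiE[OF universe A]) (use locally_small compact_obj[OF that] X in blast)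
 qed
 obtain p pr where p: "p : Ob" "pr : ?H p" and bij: "!!y. y : Ob ==> bij_betw (%al. ?m al pr) (Hom y p) (?H y)"
  using B.brown_representability by blast
 have "is_product T A X p pr"
 proof (rule is_productI)
  show "p : Ob" by fact
  show "pr j : Hom p (X j)" if "j : A" for j using mem[OF p(2) that] .
  show "EX h:Hom z p. ALL j:A. pr j ** h = ph j" if z: "z : Ob" and phi: "!!j. j : A ==> ph j : Hom z (X j)" for z ph
  proof -
   have "(\<lambda>a\<in>A. ph a) : (%al. ?m al pr) ` Hom z p" unfolding bij_betw_imp_surj_on[OF bij[OF z]] by (rule PiE_I) (use phi in simp_all)
   then obtain h where h: "h : Hom z p" "(\<lambda>a\<in>A. ph a) = ?m h pr" by (elim imageE) (rule that)
   have "pr j ** h = ph j" if "j : A" for j using fun_cong[OF h(2), of j] that by simp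
   then show ?thesis using h(1) by blast
  qed
  show "h = h'" if z: "z : Ob" and h: "h : Hom z p" "h' : Hom z p" and e: "!!j. j : A ==> pr j ** h = pr j ** h'" for z h h'
   by (rule inj_onD[OF bij_betw_imp_inj_on[OF bij[OF z]] _ h]) (rule restrict_ext, rule e)
 qed
 then show ?thesis using that by blast
qed

lemma coproduct_preserving_right_adjoint:
 assumes F: "exact_functor T T F" and Fc: "preserves_coproducts U T T F" and y: "y : Ob"
 shows "EX r ep. univ_arrow T T F y r ep"
proof -
 note s = functor_simps[OF exact_is_functor[OF F]]
 let ?H = "%z. Hom (fob F z) y" and ?m = "%ph b. b ** far F ph"
 interpret B: brown_functor U T ?H ?m
 proof unfold_locales
  show "?m f b : ?H x" if "f : Hom x z" "b : ?H z" for f x z b using that s by simp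
  show "?m (idn T x) b = b" if "x : Ob" "b : ?H x" for x b using that s by simp
  show "?m (g ** f) b = ?m f (?m g b)" if "f : Hom x w" "g : Hom w z" "b : ?H z" for f g x w z b using that s by simp
  show "EX! a. a : ?H c & (ALL j:J. ?m (io j) a = ps j)"
   if J: "J \<subseteq> U" "J \<prec> U" and c: "is_coproduct T J Y c io" and psi: "!!j. j : J ==> ps j : ?H (Y j)" for J Y c io ps
  proof -
   have Fp: "is_coproduct T J (%j. fob F (Y j)) (fob F c) (%j. far F (io j))" using Fc J c unfolding preserves_coproducts_def by blast
   then show ?thesis using y psi unfolding is_coproduct_def by blast
  qed
  show "EX a:?H z. ?m g a = b"
   if t: "dt x w z (sub T al be) g h" and ab: "al : Hom x w" "be : Hom x w" and b: "b : ?H w" and e: "?m al b = ?m be b"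
   for x w z al be g h b
  proof -
   note D = dtD[OF t]
   obtain h' where t': "dt (fob F x) (fob F w) (fob F z) (far F (sub T al be)) (far F g) h'" using exact_dt[OF F t] by blast
   have "far F (sub T al be) = sub T (far F al) (far F be)"
    by (rule additive_functor_sub[OF add_cat add_cat exact_additive[OF F]]) (use ab in simp_all)
   then have "b ** far F (sub T al be) = zer T (fob F x) y" using ab b s e by (simp add: cmp_sub)
   then show ?thesis using dt_wcok[OF t' b] by blast
  qed
  show "?H x \<prec> U" if "x : compacts" for x using locally_small[OF s(1)[OF compact_obj[OF that]] y] .
 qed
 obtain r ep where r: "r : Ob" "ep : ?H r" and bij: "!!z. z : Ob ==> bij_betw (%al. ?m al ep) (Hom z r) (?H z)"
  using B.brown_representability by blast
 have "EX! u. u : Hom z r & ep ** far F u = ph" if z: "z : Ob" and phi: "ph : Hom (fob F z) y" for z ph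
 proof -
  have "ph : (%al. ?m al ep) ` Hom z r" unfolding bij_betw_imp_surj_on[OF bij[OF z]] by (rule phi)
  then obtain u where u: "u : Hom z r" "ph = ?m u ep" by (elim imageE) (rule that)
  show ?thesis
  proof (rule ex1I[of _ u])
   show "u : Hom z r & ep ** far F u = ph" using u by blast
   fix v assume v: "v : Hom z r & ep ** far F v = ph"
   show "v = u" by (rule inj_onD[OF bij_betw_imp_inj_on[OF bij[OF z]]]) (use u v in simp_all)
  qed
 qed
 then show ?thesis using r unfolding univ_arrow_def by blast
qed

end

section \<open>Characters of abelian groups\<close>

text \<open>Homomorphisms defined on a subgroup of \<open>A\<close>, represented by their graphs.\<close>

definition hom_graph where
 "hom_graph A D G \<longleftrightarrow> G \<subseteq> carrier A \<times> carrier D & (one A, one D) : G &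
  (ALL x y x' y'. (x, y) : G --> (x', y') : G --> (monoid.mult A x x', monoid.mult D y y') : G) &
  (ALL x y. (x, y) : G --> (m_inv A x, m_inv D y) : G) &
  (ALL y. (one A, y) : G --> y = one D)"

definition divisible where
 "divisible D \<longleftrightarrow> (ALL d:carrier D. ALL n::nat. n > 0 --> (EX q:carrier D. pow D q n = d))"

context
 fixes A :: "'a monoid" and D :: "'d monoid"
 assumes A: "comm_group A" and D: "comm_group D"
begin

abbreviation mulA (infixl \<open>+A\<close> 70) where "x +A y \<equiv> x \<otimes>\<^bsub>A\<^esub> y"
abbreviation powA (infixr \<open>^A\<close> 75) where "x ^A k \<equiv> x [^]\<^bsub>A\<^esub> k"
abbreviation "iA \<equiv> m_inv A"
abbreviation "eA \<equiv> one A"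

abbreviation mulD (infixl \<open>+D\<close> 70) where "x +D y \<equiv> x \<otimes>\<^bsub>D\<^esub> y"
abbreviation powD (infixr \<open>^D\<close> 75) where "x ^D k \<equiv> x [^]\<^bsub>D\<^esub> k"
abbreviation "iD \<equiv> m_inv D"
abbreviation "eD \<equiv> one D"

interpretation A: comm_group A by (rule A)
interpretation D: comm_group D by (rule D)

lemma hom_graphD:
 assumes "hom_graph A D G"
 shows "(x, y) : G ==> x : carrier A" "(x, y) : G ==> y : carrier D" "(eA, eD) : G"
  "(x, y) : G ==> (x', y') : G ==> (x +A x', y +D y') : G"
  "(x, y) : G ==> (iA x, iD y) : G" "(eA, y) : G ==> y = eD" using assms unfolding hom_graph_def by blast+

lemma hom_graph_pow:
 assumes G: "hom_graph A D G" and x: "(x, y) : G" shows "(x ^A (k::int), y ^D k) : G"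
proof -
 have nat: "(x ^A (n::nat), y ^D n) : G" for n by (induction n) (use hom_graphD(3,4)[OF G] x in simp_all)
 show ?thesis
 proof (cases k)
  case (nonneg n) then show ?thesis using nat[of n] by (simp add: int_pow_int)
 next
  case (neg n)
  have c: "x : carrier A" "y : carrier D" using hom_graphD(1,2)[OF G x] by auto
  show ?thesis unfolding neg A.int_pow_neg_int[OF c(1)] D.int_pow_neg_int[OF c(2)] by (rule hom_graphD(5)[OF G nat])
 qed
qed

lemma hom_graph_fun:
 assumes G: "hom_graph A D G" and x: "(x, y) : G" "(x, y') : G" shows "y = y'"
proof -
 note h = hom_graphD[OF G]
 have "(x +A iA x, y +D iD y') : G" using h(4)[OF x(1) h(5)[OF x(2)]] .
 then have "y +D iD y' = eD" using h(1)[OF x(1)] h(6) by simp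
 then show ?thesis using h(2)[OF x(1)] h(2)[OF x(2)] D.inv_equality D.inv_inv by (metis D.inv_closed)
qed

lemma hom_graph_step:
 assumes G: "hom_graph A D G" and a: "a : carrier A" and q: "q : carrier D"
  and comp: "!!(k::int) d. (a ^A k, d) : G ==> d = q ^D k"
 obtains G' where "hom_graph A D G'" "G \<subseteq> G'" "(a, q) : G'"
proof -
 note h = hom_graphD[OF G]
 define G' where "G' = {(x +A a ^A k, y +D q ^D k) | x y (k::int). (x, y) : G}"
 have "hom_graph A D G'" unfolding hom_graph_def
 proof (intro conjI allI impI)
  show "G' \<subseteq> carrier A \<times> carrier D" unfolding G'_def using h(1,2) a q by auto
  have "(eA +A a ^A (0::int), eD +D q ^D (0::int)) : G'" unfolding G'_def using h(3) by blast
  then show "(eA, eD) : G'" by simp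
 next
  fix u v u' v' assume "(u, v) : G'" "(u', v') : G'"
  then obtain x y k x' y' l where e: "u = x +A a ^A (k::int)" "v = y +D q ^D k" "(x, y) : G"
   "u' = x' +A a ^A (l::int)" "v' = y' +D q ^D l" "(x', y') : G" unfolding G'_def by blast
  have "u +A u' = (x +A x') +A a ^A (k + l)" "v +D v' = (y +D y') +D q ^D (k + l)"
   using h(1,2)[OF e(3)] h(1,2)[OF e(6)] a q unfolding e A.int_pow_mult[OF a] D.int_pow_mult[OF q] by (simp_all add: A.m_ac D.m_ac)
  then show "(u +A u', v +D v') : G'" unfolding G'_def using h(4)[OF e(3,6)] by blast
 next
  fix u v assume "(u, v) : G'"
  then obtain x y k where e: "u = x +A a ^A (k::int)" "v = y +D q ^D k" "(x, y) : G" unfolding G'_def by blast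
  have "iA u = iA x +A a ^A (- k)" "iD v = iD y +D q ^D (- k)"
   using h(1,2)[OF e(3)] a q unfolding e A.int_pow_neg[OF a] D.int_pow_neg[OF q] by (simp_all add: A.inv_mult D.inv_mult)
  then show "(iA u, iD v) : G'" unfolding G'_def using h(5)[OF e(3)] by blast
 next
  fix v assume "(eA, v) : G'"
  then obtain x y k where e: "eA = x +A a ^A (k::int)" "v = y +D q ^D k" "(x, y) : G" unfolding G'_def by blast
  have c: "x : carrier A" "y : carrier D" using h(1,2)[OF e(3)] by auto
  have "a ^A k +A x = eA" unfolding e(1) by (rule A.m_comm) (use c(1) a in simp_all)
  then have "iA x = a ^A k" by (rule A.inv_equality) (use c(1) a in simp_all)
  then have "iD y = q ^D k" using comp[of k "iD y"] h(5)[OF e(3)] by simp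
  then show "v = eD" unfolding e(2) using c(2) D.r_inv[OF c(2)] by simp
 qed
 moreover have "G \<subseteq> G'"
 proof
  fix p assume p: "p : G"
  obtain x y where xy: "p = (x, y)" by (cases p)
  have "(x +A a ^A (0::int), y +D q ^D (0::int)) : G'" unfolding G'_def using p xy by blast
  then show "p : G'" using h(1,2) p xy by simp
 qed
 moreover have "(a, q) : G'"
 proof -
  have "(eA +A a ^A (1::int), eD +D q ^D (1::int)) : G'" unfolding G'_def using h(3) by blast
  then show ?thesis using a q by simp
 qed
 ultimately show ?thesis using that by blast
qed

lemma hom_graph_compatible:
 assumes G: "hom_graph A D G" and a: "a : carrier A" and div: "divisible D"
 obtains q where "q : carrier D" "!!(k::int) d. (a ^A k, d) : G ==> d = q ^D k"
proof (cases "EX n::nat. n > 0 & (EX d. (a ^A n, d) : G)")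
 case True
 note h = hom_graphD[OF G]
 define n where "n = (LEAST n::nat. n > 0 & (EX d. (a ^A n, d) : G))"
 have n: "n > 0" "EX d. (a ^A n, d) : G" using LeastI_ex[OF True] unfolding n_def by auto
 have least: "~ (EX d. (a ^A r, d) : G)" if "0 < r" "r < n" for r :: nat
  using not_less_Least[of r "%n. n > 0 & (EX d. (a ^A n, d) : G)"] that unfolding n_def by blast
 obtain d where d: "(a ^A n, d) : G" using n by blast
 obtain q where q: "q : carrier D" "q ^D n = d" using div h(2)[OF d] n(1) unfolding divisible_def by blast
 have "d' = q ^D k" if k: "(a ^A (k::int), d') : G" for k d'
 proof -
  define m where "m = k div int n"
  define r where "r = nat (k mod int n)"
  have r: "int r = k mod int n" "r < n" using n(1) by (auto simp: r_def nat_less_iff)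
  have kk: "k = int n * m + int r" using r unfolding m_def by simp
  have an: "a ^A n = a ^A (int n)" "q ^D n = q ^D (int n)" by (simp_all add: int_pow_int)
  have p1: "(a ^A (int n * m), q ^D (int n * m)) : G"
   using hom_graph_pow[OF G d, of m] A.int_pow_pow[OF a, of "int n" m] D.int_pow_pow[OF q(1), of "int n" m] unfolding q(2)[symmetric] an by simp
  have p2: "(a ^A k +A iA (a ^A (int n * m)), d' +D iD (q ^D (int n * m))) : G" using h(4)[OF k h(5)[OF p1]] .
  have "a ^A k +A iA (a ^A (int n * m)) = a ^A (int r)" using A.int_pow_diff[OF a, of k "int n * m"] kk by simp
  then have p3: "(a ^A r, d' +D iD (q ^D (int n * m))) : G" using p2 by (simp add: int_pow_int)
  then have r0: "r = 0" using least[OF _ r(2)] by blast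
  then have "d' +D iD (q ^D (int n * m)) = eD" using p3 h(6) by simp
  then have "d' = q ^D (int n * m)" using h(2)[OF k] q(1) D.inv_solve_right'[of "eD" d' "q ^D (int n * m)"] by simp
  then show ?thesis using kk r0 by simp
 qed
 then show ?thesis using that q(1) by blast
next
 case False
 note h = hom_graphD[OF G]
 have "d = eD ^D k" if k: "(a ^A (k::int), d) : G" for k d
 proof (cases k)
  case (nonneg n)
  then have "n = 0" using False k by (auto simp: int_pow_int)
  then show ?thesis using k nonneg h(6) by simp
 next
  case (neg n)
  have "a ^A k = iA (a ^A Suc n)" unfolding neg by (rule A.int_pow_neg_int[OF a])
  then have "iA (a ^A k) = a ^A Suc n" using A.inv_inv[OF A.nat_pow_closed[OF a]] by metis
  then have "(a ^A Suc n, iD d) : G" using h(5)[OF k] by metis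
  then show ?thesis using False zero_less_Suc by blast
 qed
 then show ?thesis using that[of "eD"] by blast
qed

text \<open>By Zorn's lemma there is a maximal extension; divisibility would extend it by one more element.\<close>

lemma divisible_injective:
 assumes G: "hom_graph A D G" and div: "divisible D"
 obtains \<chi> where "\<chi> : hom A D" "!!x y. (x, y) : G ==> \<chi> x = y"
proof -
 let ?\<A> = "{G'. hom_graph A D G' & G \<subseteq> G'}"
 have "EX M:?\<A>. ALL X:?\<A>. M \<subseteq> X --> X = M"
 proof (rule subset_Zorn_nonempty)
  show "?\<A> ~= {}" using G by blast
  fix \<C> assume ne: "\<C> ~= {}" and ch: "subset.chain ?\<A> \<C>"
  have C: "hom_graph A D X" "G \<subseteq> X" if "X : \<C>" for X using ch that unfolding subset.chain_def by blast+
  have two: "EX Z:\<C>. p : Z & p' : Z" if pp: "p : \<Union>\<C>" "p' \<in> \<Union>\<C>" for p p'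
  proof -
   obtain X Y where "X : \<C>" "p : X" "Y : \<C>" "p' : Y" using pp by blast
   moreover have "X \<subseteq> Y | Y \<subseteq> X" using ch calculation unfolding subset.chain_def by blast
   ultimately show ?thesis by blast
  qed
  have "hom_graph A D (\<Union>\<C>)" unfolding hom_graph_def
  proof (intro conjI allI impI)
   show "\<Union>\<C> \<subseteq> carrier A \<times> carrier D" using C(1) unfolding hom_graph_def by blast
   show "(eA, eD) : \<Union>\<C>" using ne C(1) hom_graphD(3) by blast
   show "(x +A x', y +D y') : \<Union>\<C>" if "(x, y) \<in> \<Union>\<C>" "(x', y') \<in> \<Union>\<C>" for x y x' y'
    using two[OF that] C(1) hom_graphD(4) by blast
   show "(iA x, iD y) : \<Union>\<C>" if "(x, y) \<in> \<Union>\<C>" for x y using that C(1) hom_graphD(5) by blast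
   show "y = eD" if "(eA, y) : \<Union>\<C>" for y using that C(1) hom_graphD(6) by blast
  qed
  then show "\<Union>\<C> \<in> ?\<A>" using ne C(2) by blast
 qed
 then obtain M where M0: "M : ?\<A>" "ALL X:?\<A>. M \<subseteq> X --> X = M" by (rule bexE)
 have M: "hom_graph A D M" "G \<subseteq> M" using M0(1) by simp_all
 have Mmax: "X = M" if X: "hom_graph A D X" "M \<subseteq> X" for X
 proof -
  have "X : ?\<A>" using X(1) order_trans[OF M(2) X(2)] by simp
  from M0(2)[rule_format, OF this X(2)] show ?thesis .
 qed
 note h = hom_graphD[OF M(1)]
 have total: "EX d. (a, d) : M" if a: "a : carrier A" for a
 proof -
  obtain q where q: "q : carrier D" "!!(k::int) d. (a ^A k, d) : M ==> d = q ^D k" by (rule hom_graph_compatible[OF M(1) a div]) blast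
  obtain G' where "hom_graph A D G'" "M \<subseteq> G'" "(a, q) : G'" by (rule hom_graph_step[OF M(1) a q]) simp_all
  then show ?thesis using Mmax by metis
 qed
 define \<chi> where "\<chi> a = (THE d. (a, d) : M)" for a
 have chi: "\<chi> a = d" if "(a, d) : M" for a d unfolding \<chi>_def by (rule the_equality) (use that hom_graph_fun[OF M(1)] in blast)+
 have chiM: "(a, \<chi> a) : M" if "a : carrier A" for a using total[OF that] chi by blast
 have "\<chi> : hom A D" by (rule homI) (use h(2) chiM in blast, use chi h(4) chiM in blast)
 then show ?thesis using that chi M(2) by blast
qed

end

lemma character_detects:
 fixes A :: "'a monoid" and D :: "'d monoid"
 assumes A: "comm_group A" and D: "comm_group D" and div: "divisible D" and a: "a : carrier A" "a ~= one A"
  and tors: "!!n::nat. n \<ge> 2 ==> EX q:carrier D. q ~= one D & pow D q n = one D"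
 obtains \<chi> where "\<chi> : hom A D" "\<chi> a ~= one D"
proof -
 interpret A: comm_group A by (rule A)
 interpret D: comm_group D by (rule D)
 define n where "n = (if A.ord a = 0 then 2 else A.ord a)"
 have "A.ord a ~= 1" using A.ord_eq_1[OF a(1)] a(2) by simp
 then have "n \<ge> 2" by (auto simp: n_def)
 then obtain q where q: "q : carrier D" "q ~= \<one>\<^bsub>D\<^esub>" "q [^]\<^bsub>D\<^esub> n = \<one>\<^bsub>D\<^esub>" using tors by blast
 have G: "hom_graph A D {(\<one>\<^bsub>A\<^esub>, \<one>\<^bsub>D\<^esub>)}" unfolding hom_graph_def by auto
 have "d = q [^]\<^bsub>D\<^esub> k" if k: "(a [^]\<^bsub>A\<^esub> (k::int), d) : {(\<one>\<^bsub>A\<^esub>, \<one>\<^bsub>D\<^esub>)}" for k d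
 proof -
  have d: "d = \<one>\<^bsub>D\<^esub>" and e: "a [^]\<^bsub>A\<^esub> k = \<one>\<^bsub>A\<^esub>" using k by auto
  have "int (A.ord a) dvd k" using e A.int_pow_eq_id[OF a(1), of k] by simp
  then have "int n dvd k" by (auto simp: n_def)
  then obtain m where m: "k = int n * m" by (elim dvdE)
  have "q [^]\<^bsub>D\<^esub> k = (q [^]\<^bsub>D\<^esub> int n) [^]\<^bsub>D\<^esub> m" unfolding m by (rule D.int_pow_pow[OF q(1), symmetric])
  then show ?thesis unfolding d using q(3) by (simp add: int_pow_int)
 qed
 then obtain G' where G': "hom_graph A D G'" "(a, q) : G'" using hom_graph_step[OF A D G a(1) q(1)] by blast
 obtain \<chi> where "\<chi> : hom A D" "!!x y. (x, y) : G' ==> \<chi> x = y" using divisible_injective[OF A D G'(1) div] by blast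
 then show ?thesis using that G'(2) q(2) by metis
qed

lemma QZ_facts:
 shows QZ_comm_group: "comm_group QZ" and QZ_divisible: "divisible QZ" and QZ_countable: "countable (carrier QZ)"
  and QZ_torsion: "(n::nat) \<ge> 2 ==> EX q:carrier QZ. q ~= one QZ & pow QZ q n = one QZ"
proof -
 define R :: "rat monoid" where "R = \<lparr>carrier = UNIV, monoid.mult = (+), one = 0\<rparr>"
 have R: "comm_group R" by (rule comm_groupI) (auto simp: R_def intro: exI[of _ "- x" for x])
 interpret R: comm_group R by (rule R)
 have sub: "subgroup \<int> R"
 proof
  show "\<int> \<subseteq> carrier R" "\<one>\<^bsub>R\<^esub> : \<int>" by (simp_all add: R_def)
  show "x \<otimes>\<^bsub>R\<^esub> y : \<int>" if "x : \<int>" "y : \<int>" for x y using that by (simp add: R_def)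
  fix x :: rat assume x: "x : \<int>"
  have "inv\<^bsub>R\<^esub> x = - x" by (rule R.inv_equality) (simp_all add: R_def)
  then show "inv\<^bsub>R\<^esub> x : \<int>" using x by simp
 qed
 have Q: "QZ = R Mod \<int>" by (simp add: QZ_def R_def)
 show cg: "comm_group QZ" unfolding Q by (rule R.abelian_FactGroup[OF sub])
 interpret Q: comm_group QZ by (rule cg)
 have nrm: "normal \<int> R" by (rule R.normal_iff_subgroup[THEN iffD2, OF sub])
 define c where "c r = \<int> #>\<^bsub>R\<^esub> r" for r
 have car: "carrier QZ = range c" unfolding Q carrier_FactGroup c_def by (auto simp: R_def)
 have hom: "c : hom R QZ" unfolding c_def Q by (rule normal.r_coset_hom_Mod[OF nrm])
 have one: "\<one>\<^bsub>QZ\<^esub> = \<int>" unfolding Q by simp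
 have c1: "c r = \<one>\<^bsub>QZ\<^esub> \<longleftrightarrow> r : \<int>" for r
 proof
  assume "c r = \<one>\<^bsub>QZ\<^esub>"
  moreover have "r : c r" unfolding c_def r_coset_def by (auto simp: R_def intro: bexI[of _ 0])
  ultimately show "r : \<int>" unfolding one by simp
 next
  assume r: "r : \<int>"
  show "c r = \<one>\<^bsub>QZ\<^esub>" unfolding one c_def by (rule R.coset_join2[OF _ sub r]) (simp add: R_def)
 qed
 have cpow: "c r [^]\<^bsub>QZ\<^esub> (n::nat) = c (of_nat n * r)" for r n
 proof (induction n)
  case 0
  have "c 0 = \<one>\<^bsub>QZ\<^esub>" using c1[of 0] by simp
  then show ?case by simp
 next
  case (Suc n)
  have "c (of_nat n * r + r) = c (of_nat n * r) \<otimes>\<^bsub>QZ\<^esub> c r" using hom_mult[OF hom, of "of_nat n * r" r] by (simp add: R_def)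
  then show ?case using Suc by (simp add: algebra_simps)
 qed
 show "divisible QZ" unfolding divisible_def
 proof (intro ballI allI impI)
  fix d and n :: nat assume d: "d : carrier QZ" and n: "n > 0"
  obtain r where r: "d = c r" using d car by blast
  have "c (r / of_nat n) [^]\<^bsub>QZ\<^esub> n = d" unfolding cpow r using n by simp
  then show "EX q:carrier QZ. q [^]\<^bsub>QZ\<^esub> n = d" using car by blast
 qed
 show "countable (carrier QZ)" unfolding car by simp
 show "EX q:carrier QZ. q ~= \<one>\<^bsub>QZ\<^esub> & q [^]\<^bsub>QZ\<^esub> n = \<one>\<^bsub>QZ\<^esub>" if n: "n \<ge> 2" for n :: nat
 proof (intro bexI[of _ "c (1 / of_nat n)"] conjI)
  have "1 / (of_nat n :: rat) ~: \<int>"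
  proof
   assume "1 / (of_nat n :: rat) : \<int>"
   then obtain z where z: "1 / (of_nat n :: rat) = of_int z" by (elim Ints_cases)
   have "0 < (of_int z :: rat)" "(of_int z :: rat) < 1" using n by (simp_all add: z[symmetric])
   then show False by simp
  qed
  then show "c (1 / of_nat n) ~= \<one>\<^bsub>QZ\<^esub>" unfolding c1 .
  show "c (1 / of_nat n) [^]\<^bsub>QZ\<^esub> n = \<one>\<^bsub>QZ\<^esub>" unfolding cpow c1 using n by simp
  show "c (1 / of_nat n) : carrier QZ" using car by blast
 qed
qed

section \<open>Brown--Comenetz duals cogenerate\<close>

context triangulated_category begin

lemma sub_sub_same:
 assumes "a : arr C" "b : arr C" "src C b = src C a" "tgt C b = tgt C a"
 shows "sub C a (sub C a b) = b" using add_sub_same[of b "sub C a b"] assms by simp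

lemma sub_sub_sub:
 assumes a: "a : arr C" and b: "b : arr C" "src C b = src C a" "tgt C b = tgt C a"
  and c: "c : arr C" "src C c = src C a" "tgt C c = tgt C a"
 shows "sub C (sub C a b) (sub C a c) = sub C c b"
proof -
 let ?x = "sub C a b" and ?y = "sub C a c" and ?w = "sub C c b"
 have M: "?x : Hom (src C a) (tgt C a)" "?y : Hom (src C a) (tgt C a)" "?w : Hom (src C a) (tgt C a)" using a b c by simp_all
 have "add C b (add C ?w ?y) = add C (add C b ?w) ?y" using M b by (simp add: add_assoc)
 also have "\<dots> = a" using b c a by simp
 also have "\<dots> = add C b ?x" using a b by simp
 finally have "add C ?w ?y = ?x" by - (rule add_cancel[of b], use M b in simp_all)
 then have "sub C ?x ?y = sub C (add C ?w ?y) ?y" by simp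
 also have "\<dots> = ?w" by (rule add_sub_same) (use M in simp_all)
 finally show ?thesis .
qed

end

context big_tt_category begin

lemma char_groupD:
 assumes "\<chi> : char_group T x y" "x : Ob" "y : Ob"
 shows "f : Hom x y ==> \<chi> f : carrier QZ" "f : Hom x y ==> g : Hom x y ==> \<chi> (add T f g) = \<chi> f \<otimes>\<^bsub>QZ\<^esub> \<chi> g"
  "\<chi> (zer T x y) = \<one>\<^bsub>QZ\<^esub>" "\<chi> : extensional (Hom x y)"
proof -
 have h: "\<chi> : hom (HomG T x y) QZ" "\<chi> : extensional (Hom x y)" using assms(1) unfolding char_group_def by blast+
 have G: "group (HomG T x y)" "group QZ" using comm_group_Mor[OF assms(2,3)] QZ_comm_group by (simp_all add: comm_group_def)
 show "\<chi> f : carrier QZ" if "f : Hom x y" using hom_carrier[OF h(1)] that by auto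
 show "\<chi> (add T f g) = \<chi> f \<otimes>\<^bsub>QZ\<^esub> \<chi> g" if "f : Hom x y" "g : Hom x y" using hom_mult[OF h(1), of f g] that by simp
 show "\<chi> (zer T x y) = \<one>\<^bsub>QZ\<^esub>" using hom_one[OF h(1) G] by simp
 show "\<chi> : extensional (Hom x y)" by (rule h)
qed

lemma char_groupI:
 assumes "!!f. f : Hom x y ==> \<chi> f : carrier QZ"
  "!!f g. f : Hom x y ==> g : Hom x y ==> \<chi> (add T f g) = \<chi> f \<otimes>\<^bsub>QZ\<^esub> \<chi> g"
  "\<chi> : extensional (Hom x y)"
 shows "\<chi> : char_group T x y" unfolding char_group_def using assms by (intro IntI homI) (simp_all del: in_Mor)

lemma coproduct_projections:
 assumes c: "is_coproduct T J X c io"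
 obtains pr where "!!j. j : J ==> pr j : Hom c (X j)" "!!j. j : J ==> pr j ** io j = idn T (X j)"
  "!!i j. i : J ==> j : J ==> i ~= j ==> pr j ** io i = zer T (X i) (X j)"
proof -
 note d = is_coproductD[OF c]
 have "ALL j:J. EX p. p : Hom c (X j) & (ALL i:J. p ** io i = (if i = j then idn T (X j) else zer T (X i) (X j)))"
 proof
  fix j assume j: "j : J"
  have e: "(if i = j then idn T (X j) else zer T (X i) (X j)) : Hom (X i) (X j)" if "i : J" for i using d(5)[OF j] d(5)[OF that] by simp
  obtain p where "p : Hom c (X j)" "!!i. i : J ==> p ** io i = (if i = j then idn T (X j) else zer T (X i) (X j))"
   by (rule coproduct_map[OF c d(5)[OF j], of "%i. if i = j then idn T (X j) else zer T (X i) (X j)", OF e]) (assumption, rule that, assumption, (drule meta_spec, drule (1) meta_mp, assumption))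
  then show "EX p. p : Hom c (X j) & (ALL i:J. p ** io i = (if i = j then idn T (X j) else zer T (X i) (X j)))" by blast
 qed
 then obtain pr where p: "!!j. j : J ==> pr j : Hom c (X j)"
  "!!j i. j : J ==> i : J ==> pr j ** io i = (if i = j then idn T (X j) else zer T (X i) (X j))" by metis
 show ?thesis
 proof (rule that)
  show "pr j : Hom c (X j)" if "j : J" for j using p(1)[OF that] .
  show "pr j ** io j = idn T (X j)" if "j : J" for j using p(2)[OF that that] by simp
  show "pr j ** io i = zer T (X i) (X j)" if "i : J" "j : J" "i ~= j" for i j using p(2)[OF that(2,1)] that(3) by simp
 qed
qed

lemma brown_comenetz_dual_exists:
 assumes x: "x : compacts"
 shows "EX d. brown_comenetz_dual T x d"
proof -
 have xo: "x : Ob" using compact_obj[OF x] .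
 interpret Q: comm_group QZ by (rule QZ_comm_group)
 let ?H = "%y. char_group T x y" and ?m = "%u \<chi>. (\<lambda>b\<in>Hom x (src T u). \<chi> (u ** b))"
 interpret B: brown_functor U T ?H ?m
 proof unfold_locales
  show "?m f b : ?H y" if f: "f : Hom y z" and b: "b : ?H z" for f y z b
  proof -
   have o: "y : Ob" "z : Ob" using Mor_objs[OF f] by auto
   note h = char_groupD[OF b xo o(2)]
   have m: "f ** g : Hom x z" if "g : Hom x y" for g using that f by simp
   have sf: "src T f = y" using f by simp
   show ?thesis unfolding sf
   proof (rule char_groupI)
    show "(\<lambda>b'\<in>Hom x y. b (f ** b')) g : carrier QZ" if "g : Hom x y" for g
     unfolding restrict_apply'[OF that] by (rule h(1)[OF m[OF that]])
    show "(\<lambda>b'\<in>Hom x y. b (f ** b')) (add T g g') = (\<lambda>b'\<in>Hom x y. b (f ** b')) g \<otimes>\<^bsub>QZ\<^esub> (\<lambda>b'\<in>Hom x y. b (f ** b')) g'"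
     if g: "g : Hom x y" "g' : Hom x y" for g g'
    proof -
     have "add T g g' : Hom x y" using g by simp
     moreover have "f ** add T g g' = add T (f ** g) (f ** g')" using f g by (simp add: cmp_add)
     ultimately show ?thesis using h(2)[OF m[OF g(1)] m[OF g(2)]] g by (simp del: in_Mor)
    qed
   qed simp
  qed
  show "?m (idn T y) b = b" if y: "y : Ob" and b: "b : ?H y" for y b
  proof (rule extensionalityI[of _ "Hom x y"])
   show "?m (idn T y) b : extensional (Hom x y)" using y by simp
   show "b : extensional (Hom x y)" using char_groupD(4)[OF b xo y] .
   show "?m (idn T y) b g = b g" if "g : Hom x y" for g using that y by simp
  qed
  show "?m (g ** f) b = ?m f (?m g b)" if f: "f : Hom y z" and g: "g : Hom z w" for f g y z w b
   by (rule ext) (use f g in \<open>simp add: restrict_def\<close>)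
  show "EX! a. a : ?H c & (ALL j:J. ?m (io j) a = ps j)"
   if J: "J \<subseteq> U" "J \<prec> U" and c: "is_coproduct T J X c io" and psi: "!!j. j : J ==> ps j : ?H (X j)" for J X c io ps
  proof -
   note d = is_coproductD[OF c]
   have h: "f : Hom x (X j) ==> ps j f : carrier QZ"
    "f : Hom x (X j) ==> g : Hom x (X j) ==> ps j (add T f g) = ps j f \<otimes>\<^bsub>QZ\<^esub> ps j g"
    "ps j (zer T x (X j)) = \<one>\<^bsub>QZ\<^esub>" "ps j : extensional (Hom x (X j))" if "j : J" for j f g
    by (rule char_groupD[OF psi[OF that] xo d(5)[OF that]]; assumption)+
   have iM: "io j : Hom (X j) c" if "j : J" for j using d that by simp
   obtain pr where p: "!!j. j : J ==> pr j : Hom c (X j)" "!!j. j : J ==> pr j ** io j = idn T (X j)"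
    "!!i j. i : J ==> j : J ==> i ~= j ==> pr j ** io i = zer T (X i) (X j)" using coproduct_projections[OF c] by blast
   define S where "S \<gamma> = {j : J. pr j ** \<gamma> ~= zer T x (X j)}" for \<gamma>
   have pg: "pr j ** \<gamma> : Hom x (X j)" if "j : J" "\<gamma> : Hom x c" for j \<gamma> using p(1)[OF that(1)] that(2) by simp
   have padd: "pr j ** add T f g = add T (pr j ** f) (pr j ** g)" if "j : J" "f : Hom x c" "g : Hom x c" for j f g
    using p(1)[OF that(1)] that(2,3) by (simp add: cmp_add)
   have Sadd: "S (add T f g) \<subseteq> S f \<union> S g" if fg: "f : Hom x c" "g : Hom x c" for f g
   proof
    fix j assume j: "j : S (add T f g)"
    then have jJ: "j : J" by (simp add: S_def)
    show "j : S f \<union> S g"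
    proof (rule ccontr)
     assume "j ~: S f \<union> S g"
     then have "pr j ** f = zer T x (X j)" "pr j ** g = zer T x (X j)" using jJ by (auto simp: S_def)
     then have "pr j ** add T f g = zer T x (X j)" unfolding padd[OF jJ fg] using xo d(5)[OF jJ] by simp
     then show False using j by (simp add: S_def)
    qed
   qed
   have Sinc: "S (io j ** de) \<subseteq> {j}" if j: "j : J" and de: "de : Hom x (X j)" for j de
   proof
    fix i assume i: "i : S (io j ** de)"
    then have iJ: "i : J" by (simp add: S_def)
    show "i : {j}"
    proof (rule ccontr)
     assume "i ~: {j}"
     then have "pr i ** io j = zer T (X j) (X i)" using p(3)[OF j iJ] by auto
     then have "pr i ** (io j ** de) = zer T (X j) (X i) ** de" by (rule pre_eq) (use p(1)[OF iJ] iM[OF j] de in simp_all)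
     then have "pr i ** (io j ** de) = zer T x (X i)" using de d(5)[OF iJ] by simp
     then show False using i by (simp add: S_def)
    qed
   qed
   have Sfin: "finite (S \<gamma>)" if g: "\<gamma> : Hom x c" for \<gamma>
   proof (rule compact_induct[OF x J(2) c g])
    have "S (zer T x c) = {}" unfolding S_def using p(1) xo by auto
    then show "finite (S (zer T x c))" by simp
    show "finite (S (add T f g))" if "f : Hom x c" "g : Hom x c" "finite (S f)" "finite (S g)" for f g
     using Sadd[OF that(1,2)] that(3,4) finite_subset by blast
    show "finite (S (io a ** de))" if "a : J" "de : Hom x (X a)" for a de using Sinc[OF that] finite_subset by blast
   qed
   define t where "t \<gamma> j = ps j (pr j ** \<gamma>)" for \<gamma> j
   have tc: "t \<gamma> : B \<rightarrow> carrier QZ" if "\<gamma> : Hom x c" "B \<subseteq> J" for \<gamma> B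
    unfolding t_def using h(1)[OF _ pg[OF _ that(1)]] that(2) by blast
   define X' where "X' = (\<lambda>\<gamma>\<in>Hom x c. finprod QZ (t \<gamma>) (S \<gamma>))"
   have big: "finprod QZ (t \<gamma>) (S \<gamma>) = finprod QZ (t \<gamma>) B" if g: "\<gamma> : Hom x c" and B: "finite B" "S \<gamma> \<subseteq> B" "B \<subseteq> J" for \<gamma> B
   proof (rule Q.finprod_mono_neutral_cong_left[OF B(1,2)])
    show "t \<gamma> i = \<one>\<^bsub>QZ\<^esub>" if "i : B - S \<gamma>" for i using that B(3) h(3)[of i] unfolding t_def S_def by auto
   qed (use tc[OF g B(3)] in simp_all)
   have SJ: "S \<gamma> \<subseteq> J" for \<gamma> by (auto simp: S_def)
   have X'H: "X' : ?H c"
   proof (rule char_groupI)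
    show "X' \<gamma> : carrier QZ" if "\<gamma> : Hom x c" for \<gamma>
     unfolding X'_def restrict_apply'[OF that] by (rule Q.finprod_closed[OF tc[OF that SJ]])
    show "X' (add T f g) = X' f \<otimes>\<^bsub>QZ\<^esub> X' g" if f: "f : Hom x c" and g: "g : Hom x c" for f g
    proof -
     have fg: "add T f g : Hom x c" using f g by simp
     let ?B = "S f \<union> S g"
     have B: "finite ?B" "?B \<subseteq> J" using Sfin[OF f] Sfin[OF g] SJ by auto
     have "finprod QZ (t (add T f g)) ?B = finprod QZ (%j. t f j \<otimes>\<^bsub>QZ\<^esub> t g j) ?B"
     proof (rule Q.finprod_cong')
      show "(%j. t f j \<otimes>\<^bsub>QZ\<^esub> t g j) : ?B \<rightarrow> carrier QZ" using tc[OF f B(2)] tc[OF g B(2)] by (auto simp: Pi_iff)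
      fix j assume "j : ?B"
      then have j: "j : J" using B(2) by blast
      show "t (add T f g) j = t f j \<otimes>\<^bsub>QZ\<^esub> t g j" unfolding t_def padd[OF j f g] by (rule h(2)[OF j pg[OF j f] pg[OF j g]])
     qed simp
     also have "\<dots> = finprod QZ (t f) ?B \<otimes>\<^bsub>QZ\<^esub> finprod QZ (t g) ?B" by (rule Q.finprod_multf[OF tc[OF f B(2)] tc[OF g B(2)]])
     finally show ?thesis unfolding X'_def restrict_apply'[OF f] restrict_apply'[OF g] restrict_apply'[OF fg]
      using big[OF f B(1) _ B(2)] big[OF g B(1) _ B(2)] big[OF fg B(1) Sadd[OF f g] B(2)] by simp
    qed
   qed (simp add: X'_def)
   have X'i: "?m (io j) X' = ps j" if j: "j : J" for j
   proof (rule extensionalityI[of _ "Hom x (X j)"])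
    show "?m (io j) X' : extensional (Hom x (X j))" using d(3)[OF j] by simp
    show "ps j : extensional (Hom x (X j))" by (rule h(4)[OF j])
    fix de assume de: "de : Hom x (X j)"
    have id: "io j ** de : Hom x c" using iM[OF j] de by simp
    have pid: "pr j ** (io j ** de) = de" using p(1)[OF j] iM[OF j] de by (simp add: pre_eq[OF p(2)[OF j]])
    have "X' (io j ** de) = finprod QZ (t (io j ** de)) {j}"
     unfolding X'_def restrict_apply'[OF id] by (rule big[OF id _ Sinc[OF j de]]) (use j in simp_all)
    also have "\<dots> = t (io j ** de) j" using Q.finprod_insert[of "{}" j "t (io j ** de)"] tc[OF id, of "{j}"] j by (simp add: Pi_iff)
    also have "\<dots> = ps j de" unfolding t_def pid ..
    finally have e: "X' (io j ** de) = ps j de" .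
    have "de : Hom x (src T (io j))" using de d(3)[OF j] by simp
    then show "?m (io j) X' de = ps j de" using e by (simp del: in_Mor)
   qed
   show ?thesis
   proof (rule ex1I[of _ X'], intro conjI ballI)
    show "X' : ?H c" by (rule X'H)
    show "?m (io j) X' = ps j" if "j : J" for j by (rule X'i[OF that])
    fix a assume a: "a : ?H c & (ALL j:J. ?m (io j) a = ps j)"
    note ha = char_groupD[OF conjunct1[OF a] xo d(1)] and hx = char_groupD[OF X'H xo d(1)]
    show "a = X'"
    proof (rule extensionalityI[OF ha(4) hx(4)])
     fix \<gamma> assume g: "\<gamma> : Hom x c"
     show "a \<gamma> = X' \<gamma>"
     proof (rule compact_induct[OF x J(2) c g, of "%\<gamma>. a \<gamma> = X' \<gamma>"])
      show "a (zer T x c) = X' (zer T x c)" using ha(3) hx(3) by simp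
      show "a (add T f g) = X' (add T f g)" if "f : Hom x c" "g : Hom x c" "a f = X' f" "a g = X' g" for f g
       using ha(2)[OF that(1,2)] hx(2)[OF that(1,2)] that(3,4) by simp
      fix j de assume j: "j : J" and de: "de : Hom x (X j)"
      have de': "de : Hom x (src T (io j))" using de d(3)[OF j] by simp
      have "?m (io j) a de = ?m (io j) X' de" using a X'i[OF j] j by metis
      then show "a (io j ** de) = X' (io j ** de)" unfolding restrict_apply'[OF de'] .
     qed
    qed
   qed
  qed
  show "EX a:?H z. ?m g a = b"
   if t: "dt w y z (sub T al be) g h" and ab: "al : Hom w y" "be : Hom w y" and b: "b : ?H y" and e: "?m al b = ?m be b"
   for w y z al be g h b
  proof -
   note D = dtD[OF t]
   note hb = char_groupD[OF b xo D(12)]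
   have gM: "g ** f : Hom x z" if "f : Hom x y" for f using that D by simp
   have ker: "b f = \<one>\<^bsub>QZ\<^esub>" if f: "f : Hom x y" "g ** f = zer T x z" for f
   proof -
    obtain v where v: "v : Hom x w" "sub T al be ** v = f" using dt_wker[OF t f] by blast
    have av: "al ** v : Hom x y" "be ** v : Hom x y" using v(1) ab by simp_all
    have vs: "v : Hom x (src T al)" "v : Hom x (src T be)" using v(1) ab by simp_all
    have eq: "b (al ** v) = b (be ** v)" using fun_cong[OF e, of v] unfolding restrict_apply'[OF vs(1)] restrict_apply'[OF vs(2)] .
    have "f = sub T (al ** v) (be ** v)" unfolding v(2)[symmetric] using v(1) ab by (simp add: sub_cmp)
    then have "add T f (be ** v) = al ** v" using av by simp
    then have "b f \<otimes>\<^bsub>QZ\<^esub> b (be ** v) = b (al ** v)" using hb(2)[OF f(1) av(2)] by simp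
    then show ?thesis unfolding eq using hb(1)[OF f(1)] hb(1)[OF av(2)] by (simp add: Q.l_cancel_one')
   qed
   interpret Gy: comm_group "HomG T x y" by (rule comm_group_Mor[OF xo D(12)])
   interpret Gz: comm_group "HomG T x z" by (rule comm_group_Mor[OF xo D(13)])
   have gadd: "g ** add T f f' = add T (g ** f) (g ** f')" if "f : Hom x y" "f' : Hom x y" for f f' using that D by (simp add: cmp_add)
   let ?G = "{(g ** f, b f) | f. f : Hom x y}"
   have "hom_graph (HomG T x z) QZ ?G" unfolding hom_graph_def HomG_simps
   proof (intro conjI allI impI)
    show "?G \<subseteq> Hom x z \<times> carrier QZ" using gM hb(1) by blast
    have "(g ** zer T x y, b (zer T x y)) : ?G" using xo D(12) by auto
    then show "(zer T x z, \<one>\<^bsub>QZ\<^esub>) : ?G" using hb(3) D xo by simp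
    fix u v assume "(u, v) : ?G"
    then obtain f where f: "u = g ** f" "v = b f" "f : Hom x y" by blast
    have nu: "inv\<^bsub>HomG T x z\<^esub> (g ** f) = neg T (g ** f)" using gM[OF f(3)] by (simp add: neg_def)
    have nM: "neg T f : Hom x y" using f(3) by simp
    have "b (neg T f) = inv\<^bsub>QZ\<^esub> b f"
    proof (rule Q.inv_equality[symmetric])
     have "add T (neg T f) f = zer T x y" using neg_add[of f] f(3) by simp
     then show "b (neg T f) \<otimes>\<^bsub>QZ\<^esub> b f = \<one>\<^bsub>QZ\<^esub>" using hb(2)[OF nM f(3)] hb(3) by simp
    qed (use hb(1) f(3) nM in blast)+
    moreover have "g ** neg T f = neg T (g ** f)" using f(3) D by (simp add: cmp_neg)
    ultimately show "(inv\<^bsub>HomG T x z\<^esub> u, inv\<^bsub>QZ\<^esub> v) : ?G" unfolding f(1,2) nu using nM by (intro CollectI exI[of _ "neg T f"]) simp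
    fix u' v' assume "(u', v') : ?G"
    then obtain f' where f': "u' = g ** f'" "v' = b f'" "f' : Hom x y" by blast
    have "add T f f' : Hom x y" using f(3) f'(3) by simp
    then show "(add T u u', v \<otimes>\<^bsub>QZ\<^esub> v') : ?G"
     unfolding f(1,2) f'(1,2) using gadd[OF f(3) f'(3)] hb(2)[OF f(3) f'(3)] by (intro CollectI exI[of _ "add T f f'"]) simp
   next
    fix v assume "(zer T x z, v) : ?G"
    then obtain f where f: "zer T x z = g ** f" "v = b f" "f : Hom x y" by blast
    show "v = \<one>\<^bsub>QZ\<^esub>" unfolding f(2) by (rule ker[OF f(3) f(1)[symmetric]])
   qed
   from divisible_injective[OF comm_group_Mor[OF xo D(13)] QZ_comm_group this QZ_divisible]
   obtain \<chi> where chi: "\<chi> : hom (HomG T x z) QZ" "!!u v. (u, v) : ?G ==> \<chi> u = v" by blast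
   let ?c = "restrict \<chi> (Hom x z)"
   have cM: "?c : ?H z"
   proof (rule char_groupI)
    show "?c f : carrier QZ" if "f : Hom x z" for f unfolding restrict_apply'[OF that] using hom_carrier[OF chi(1)] that by auto
    show "?c (add T f f') = ?c f \<otimes>\<^bsub>QZ\<^esub> ?c f'" if ff: "f : Hom x z" "f' : Hom x z" for f f'
    proof -
     have "add T f f' : Hom x z" using ff by simp
     then show ?thesis unfolding restrict_apply'[OF ff(1)] restrict_apply'[OF ff(2)] using hom_mult[OF chi(1), of f f'] ff by (simp del: in_Mor)
    qed
   qed simp
   have "?m g ?c = b"
   proof (rule extensionalityI[of _ "Hom x y"])
    show "?m g ?c : extensional (Hom x y)" using D(6) by simp
    show "b : extensional (Hom x y)" by (rule hb(4))
    fix f assume f: "f : Hom x y"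
    then have f': "f : Hom x (src T g)" using D(6) by simp
    show "?m g ?c f = b f" unfolding restrict_apply'[OF f'] restrict_apply'[OF gM[OF f]] by (rule chi(2)) (use f in blast)
   qed
   then show ?thesis using cM by blast
  qed
  show "?H y \<prec> U" if y: "y : compacts" for y
  proof (rule small_subset)
   show "(Hom x y \<rightarrow>\<^sub>E carrier QZ) \<prec> U"
    by (rule small_PiE[OF universe locally_small[OF xo compact_obj[OF y]]]) (rule countable_small[OF universe QZ_countable])
   show "?H y \<subseteq> (Hom x y \<rightarrow>\<^sub>E carrier QZ)"
    using char_groupD(1,4)[OF _ xo compact_obj[OF y]] unfolding PiE_def Pi_def by blast
  qed
 qed
 obtain d \<chi> where d: "d : Ob" "\<chi> : ?H d" and bij: "!!y. y : Ob ==> bij_betw (%al. ?m al \<chi>) (Hom y d) (?H y)"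
  using B.brown_representability by blast
 have "brown_comenetz_dual T x d" unfolding brown_comenetz_dual_def
 proof (intro conjI exI[of _ "%y al. ?m al \<chi>"] ballI)
  show "d : Ob" by (rule d)
  show "bij_betw (%al. ?m al \<chi>) (Hom y d) (?H y)" if "y : Ob" for y by (rule bij[OF that])
  show "?m (a ** u) \<chi> = (\<lambda>b\<in>Hom x (src T u). ?m a \<chi> (u ** b))" if "u : arr T" "a : Hom (tgt T u) d" for u a
   by (rule ext) (use that in \<open>simp add: restrict_def\<close>)
 qed
 then show ?thesis by blast
qed

lemma compact_skeleton:
 obtains K where "K \<subseteq> compacts" "K \<prec> U" "!!x. x : compacts ==> EX! y. y : K & isomorphic T x y"
proof -
 obtain K where K: "K \<subseteq> compacts" "K \<prec> U" "!!x. x : compacts ==> EX y:K. isomorphic T x y" using compact_essentially_small by blast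
 define rep where "rep x = (SOME y. y : K & isomorphic T x y)" for x
 have rep: "rep x : K & isomorphic T x (rep x)" if "x : compacts" for x unfolding rep_def by (rule someI_ex) (use K(3)[OF that] in blast)
 have rep_eq: "rep x = rep y" if "isomorphic T x y" for x y
 proof -
  have "(%z. z : K & isomorphic T x z) = (%z. z : K & isomorphic T y z)"
   using isomorphic_trans[OF that] isomorphic_trans[OF isomorphic_sym[OF that]] by blast
  then show ?thesis unfolding rep_def by simp
 qed
 have "EX! y. y : rep ` K & isomorphic T x y" if x: "x : compacts" for x
 proof (rule ex1I[of _ "rep x"])
  have r: "rep x : K" "isomorphic T x (rep x)" using rep[OF x] by auto
  show "rep x : rep ` K & isomorphic T x (rep x)" using r rep_eq[OF r(2)] by auto
  fix y assume y: "y : rep ` K & isomorphic T x y"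
  then obtain y0 where y0: "y0 : K" "y = rep y0" by blast
  have "rep y0 = rep y" using rep_eq rep K(1) y0 by blast
  then show "y = rep x" using rep_eq y y0 by metis
 qed
 moreover have "rep ` K \<subseteq> compacts" using rep K(1) by blast
 ultimately show ?thesis using that[of "rep ` K"] small_image[OF K(2)] by blast
qed

abbreviation I where "I \<equiv> BC U T"

lemma BC_spec:
 obtains K D pr where "K \<subseteq> compacts" "ALL x:compacts. EX! y. y : K & isomorphic T x y"
  "ALL x:K. brown_comenetz_dual T x (D x)" "is_product T K D I pr"
proof -
 obtain K where K: "K \<subseteq> compacts" "K \<prec> U" "!!x. x : compacts ==> EX! y. y : K & isomorphic T x y" using compact_skeleton by blast
 have "EX d. brown_comenetz_dual T x d" if "x : K" for x using brown_comenetz_dual_exists K(1) that by blast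
 then obtain D where D: "!!x. x : K ==> brown_comenetz_dual T x (D x)" by metis
 have "D x : Ob" if "x : K" for x using D[OF that] unfolding brown_comenetz_dual_def by blast
 then obtain p pr where "is_product T K D p pr" using small_product[OF K(2), of D] by blast
 then have "EX K D pr. K \<subseteq> compacts & (ALL x:compacts. EX! y. y : K & isomorphic T x y) &
    (ALL x:K. brown_comenetz_dual T x (D x)) & is_product T K D p pr" using K D by (intro exI[of _ K] exI[of _ D] exI[of _ pr] conjI ballI) simp_all
 then have "EX K D pr. K \<subseteq> compacts & (ALL x:compacts. EX! y. y : K & isomorphic T x y) &
    (ALL x:K. brown_comenetz_dual T x (D x)) & is_product T K D I pr" unfolding BC_def by (rule someI)
 then show ?thesis by (elim exE conjE) (rule that)
qed

lemma BC_obj: "I : Ob"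
 by (rule BC_spec) (rule is_productD(1))

text \<open>Characters of \<open>Hom (x, X)\<close> separate its elements, so maps to \<open>I\<close> detect nonzero maps from
  compact objects.\<close>

lemma BC_detects:
 assumes x: "x : compacts" and a: "al : Hom x X" "al ~= zer T x X"
 shows "EX ph:Hom X I. ph ** al ~= zer T x I"
proof -
 obtain K D pr where K: "K \<subseteq> compacts" "ALL x:compacts. EX! y. y : K & isomorphic T x y"
  "ALL x:K. brown_comenetz_dual T x (D x)" and p: "is_product T K D I pr" by (rule BC_spec) (rule that)
 note d = is_productD[OF p]
 have o: "x : Ob" "X : Ob" using Mor_objs[OF a(1)] by auto
 obtain y where y: "y : K" "isomorphic T x y" using K(2)[rule_format, OF x] by (elim ex1E conjE) (rule that)
 obtain th th' where th: "th : Hom x y" "th' : Hom y x" "th' ** th = idn T x" by (rule isomorphicE[OF y(2)]) (rule that)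
 have yo: "y : Ob" using Mor_objs[OF th(1)] by blast
 let ?b = "al ** th'"
 have bM: "?b : Hom y X" using a th by simp
 have b0: "?b ~= zer T y X"
 proof
  assume "?b = zer T y X"
  then have "?b ** th = zer T x X" using th o by simp
  then show False using a th by simp
 qed
 obtain Ph where bij: "!!z. z : Ob ==> bij_betw (Ph z) (Hom z (D y)) (char_group T y z)"
  and nat: "!!u a. u : arr T ==> a : Hom (tgt T u) (D y) ==> Ph (src T u) (a ** u) = (\<lambda>b\<in>Hom y (src T u). Ph (tgt T u) a (u ** b))"
  using K(3)[rule_format, OF y(1)] unfolding brown_comenetz_dual_def by blast
 obtain \<chi> where chi: "\<chi> : hom (HomG T y X) QZ" "\<chi> ?b ~= \<one>\<^bsub>QZ\<^esub>"
  using character_detects[OF comm_group_Mor[OF yo o(2)] QZ_comm_group QZ_divisible, of ?b] bM b0 QZ_torsion by auto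
 let ?c = "restrict \<chi> (Hom y X)"
 have cM: "?c : char_group T y X"
 proof (rule char_groupI)
  show "?c f : carrier QZ" if "f : Hom y X" for f unfolding restrict_apply'[OF that] using hom_carrier[OF chi(1)] that by auto
  show "?c (add T f f') = ?c f \<otimes>\<^bsub>QZ\<^esub> ?c f'" if ff: "f : Hom y X" "f' : Hom y X" for f f'
  proof -
   have "add T f f' : Hom y X" using ff by simp
   then show ?thesis unfolding restrict_apply'[OF ff(1)] restrict_apply'[OF ff(2)] using hom_mult[OF chi(1), of f f'] ff by (simp del: in_Mor)
  qed
 qed simp
 have "?c : Ph X ` Hom X (D y)" unfolding bij_betw_imp_surj_on[OF bij[OF o(2)]] by (rule cM)
 then obtain ph0 where f0: "?c = Ph X ph0" "ph0 : Hom X (D y)" by (rule imageE)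
 have ev: "Ph y (ph0 ** u) (idn T y) = ?c u" if u: "u : Hom y X" for u using nat[of u ph0] u f0(2) yo by (simp add: f0(1)[symmetric])
 have f0b: "ph0 ** ?b ~= zer T y (D y)"
 proof
  assume e: "ph0 ** ?b = zer T y (D y)"
  have zM: "zer T y X : Hom y X" using yo o by simp
  have "ph0 ** zer T y X = zer T y (D y)" using f0(2) yo by simp
  then have "?c ?b = ?c (zer T y X)" using ev[OF bM] ev[OF zM] e by simp
  then show False using chi(2) char_groupD(3)[OF cM yo o(2)] unfolding restrict_apply'[OF bM] by simp
 qed
 have "(if k = y then ph0 else zer T X (D k)) : Hom X (D k)" if "k : K" for k using f0(2) o d(5)[OF that] by simp
 then obtain ph where phi: "ph : Hom X I" "!!k. k : K ==> pr k ** ph = (if k = y then ph0 else zer T X (D k))"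
  using product_map[OF p o(2), of "%k. if k = y then ph0 else zer T X (D k)"] by blast
 have "ph ** al ~= zer T x I"
 proof
  assume e: "ph ** al = zer T x I"
  have "ph0 ** ?b = (pr y ** ph) ** ?b" using phi(2)[OF y(1)] by simp
  also have "\<dots> = pr y ** ((ph ** al) ** th')" using phi(1) a(1) th(2) d(2-4)[OF y(1)] by simp
  also have "\<dots> = zer T y (D y)" unfolding e using th(2) d(1) d(2-4)[OF y(1)] yo by simp
  finally show False using f0b by simp
 qed
 then show ?thesis using phi(1) by blast
qed

lemma product_closed:
 assumes D: "!!J A p pr. J \<subseteq> U ==> J \<prec> U ==> A ` J \<subseteq> D ==> is_product T J A p pr ==> p : D"
  and B: "B \<prec> U" and X: "!!b. b : B ==> X b : D" and p: "is_product T B X p pr"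
 shows "p : D"
proof -
 obtain J f where J: "J \<subseteq> U" "J \<prec> U" "bij_betw f J B" using small_reindex[OF B] .
 have "(%j. X (f j)) ` J \<subseteq> D" using bij_betwE[OF J(3)] X by blast
 then show ?thesis using D[OF J(1,2) _ product_reindex[OF p J(3)]] by blast
qed

text \<open>Every \<open>X\<close> embeds, as seen by compact objects, into a product of copies of \<open>I\<close>; iterating on the
  fibres gives a tower of phantom maps \<open>X\<^sub>n\<^sub>+\<^sub>1 \<rightarrow> X\<^sub>n\<close> whose limit vanishes, because \<open>1 - sh\<close> is
  invertible on \<open>\<Prod> X\<^sub>n\<close>. The octahedral axiom compares \<open>1 - sh\<close> on \<open>\<Prod> X\<^sub>n\<close> with \<open>1 - sh\<close> on the
  constant product \<open>\<Prod> X\<close>, whose fibre is \<open>X\<close>.\<close>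

theorem BC_cogenerates:
 assumes D: "tsub D"
  and prod: "!!J A p pr. J \<subseteq> U ==> J \<prec> U ==> A ` J \<subseteq> D ==> is_product T J A p pr ==> p : D"
  and ID: "I : D"
 shows "D = Ob"
proof -
 have step: "EX X' u. u : Hom X' X & u : cone_in T D & (ALL c:compacts. ALL al:Hom c X'. u ** al = zer T c X)"
  if X: "X : Ob" for X
 proof -
  have small: "Hom X I \<prec> U" by (rule locally_small[OF X BC_obj])
  obtain J pr where J: "is_product T (Hom X I) (%_. I) J pr" using small_product[OF small, of "%_. I"] BC_obj by blast
  note d = is_productD[OF J]
  have JD: "J : D" by (rule product_closed[OF prod small _ J]) (use ID in simp_all)
  obtain i where i: "i : Hom X J" "!!ph. ph : Hom X I ==> pr ph ** i = ph" using product_map[OF J X, of "%ph. ph"] by blast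
  obtain X' u h where t: "dt X' X J u i h" using dt_fibre[OF i(1)] by blast
  note t' = dtD[OF t]
  have "Sh X' : Ob" using t' by simp
  have "u ** al = zer T c X" if c: "c : compacts" and al: "al : Hom c X'" for c al
  proof (rule ccontr)
   assume ne: "u ** al ~= zer T c X"
   have co: "c : Ob" using compact_obj[OF c] .
   have ua: "u ** al : Hom c X" using t' al by simp
   obtain ph where phi: "ph : Hom X I" "ph ** (u ** al) ~= zer T c I" using BC_detects[OF c ua ne] by blast
   have "ph ** (u ** al) = pr ph ** ((i ** u) ** al)" using t' al i(1) d(2-4)[OF phi(1)] by (subst i(2)[OF phi(1), symmetric]) simp
   also have "\<dots> = zer T c I" unfolding dt_cmp0[OF t] using al t' d(2-4)[OF phi(1)] co by simp
   finally show False using phi(2) by simp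
  qed
  then show ?thesis using cone_inI[OF t JD] t' by (intro exI[of _ X'] exI[of _ u]) simp
 qed
 then obtain nx nu where n: "!!X. X : Ob ==> nu X : Hom (nx X) X" "!!X. X : Ob ==> nu X : cone_in T D"
  "!!X c al. X : Ob ==> c : compacts ==> al : Hom c (nx X) ==> nu X ** al = zer T c X" by metis
 have "X : D" if X: "X : Ob" for X
 proof -
  define Xs where "Xs k = (nx ^^ k) X" for k
  define us where "us k = nu (Xs k)" for k
  define as where "as = rec_nat (idn T X) (%k a. a ** us k)"
  have Xs0: "Xs 0 = X" and XsS: "Xs (Suc k) = nx (Xs k)" for k by (simp_all add: Xs_def)
  have as0: "as 0 = idn T X" and asS: "as (Suc k) = as k ** us k" for k by (simp_all add: as_def)
  have Xo: "Xs k : Ob" for k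
  proof (induction k)
   case 0 then show ?case using X Xs0 by simp
  next
   case (Suc k) then show ?case using Mor_objs[OF n(1)[OF Suc]] XsS by simp
  qed
  have uM: "us k : Hom (Xs (Suc k)) (Xs k)" "us k : cone_in T D" for k using n(1,2)[OF Xo[of k]] by (simp_all add: us_def XsS del: in_Mor)
  have ph: "us k ** al = zer T c (Xs k)" if "c : compacts" "al : Hom c (Xs (Suc k))" for k c al
   using n(3)[OF Xo[of k] that(1)] that(2) by (simp add: us_def XsS del: in_Mor)
  have aM: "as k : Hom (Xs k) X & as k : cone_in T D" for k
  proof (induction k)
   case 0 then show ?case using X cone_in_iso[OF D is_iso_idn[OF X]] by (simp add: as0 Xs0)
  next
   case (Suc k)
   have "as (Suc k) : cone_in T D" unfolding asS by (rule cone_in_cmp[OF D uM(1) conjunct1[OF Suc] uM(2) conjunct2[OF Suc]])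
   then show ?case using Suc uM(1)[of k] by (simp add: asS)
  qed
  have "ALL k. EX c g h. dt (Xs k) X c (as k) g h & c : D" using cone_inE[OF conjunct2[OF aM] conjunct1[OF aM]] by metis
  then obtain cs gs hs where cs: "!!k. dt (Xs k) X (cs k) (as k) (gs k) (hs k)" "!!k. cs k : D" by metis
  obtain P pr where P: "is_product T (UNIV :: nat set) Xs P pr" using small_product[OF nat_small, of Xs] Xo by blast
  obtain Q rh where Q: "is_product T (UNIV :: nat set) (%_. X) Q rh" using small_product[OF nat_small, of "%_. X"] X by blast
  obtain E ep where E: "is_product T (UNIV :: nat set) cs E ep" using small_product[OF nat_small, of cs] dtD(13)[OF cs(1)] by blast
  note dP = is_productD[OF P, simplified] and dQ = is_productD[OF Q, simplified]
  have ED: "E : D" by (rule product_closed[OF prod nat_small cs(2) E])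
  have aM': "as k : arr T" "src T (as k) = Xs k" "tgt T (as k) = X" for k using aM[of k] by auto
  have uM': "us k : arr T" "src T (us k) = Xs (Suc k)" "tgt T (us k) = Xs k" for k using uM(1)[of k] by auto
  obtain k where k: "k : Hom P Q" "!!j. rh j ** k = as j ** pr j" by (rule product_map[OF Q dP(1), of "%j. as j ** pr j"]) (use aM' dP in simp_all)
  obtain W g' h' where W: "dt P Q W k g' h'" "isomorphic T W E" using product_triangle[OF cs(1) P Q E k(1) k(2)] by blast
  have kD: "k : cone_in T D" by (rule cone_inI[OF W(1) ts_iso[OF D ED isomorphic_sym[OF W(2)]]])
  have sM: "sub T (pr j) (us j ** pr (Suc j)) : Hom P (Xs j)" for j using uM' dP by simp
  obtain s where s: "s : Hom P P" "!!j. pr j ** s = sub T (pr j) (us j ** pr (Suc j))"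
   by (rule product_map[OF P dP(1), of "%j. sub T (pr j) (us j ** pr (Suc j))", OF sM]) simp
  obtain s' where s': "s' : Hom Q Q" "!!j. rh j ** s' = sub T (rh j) (rh (Suc j))"
   by (rule product_map[OF Q dQ(1), of "%j. sub T (rh j) (rh (Suc j))"]) (use dQ in simp_all)
  have sph: "pr j ** (s ** be) = pr j ** be" if c: "c : compacts" and b: "be : Hom c P" for c be j
  proof -
   have co: "c : Ob" using compact_obj[OF c] .
   have pb: "pr (Suc j) ** be : Hom c (Xs (Suc j))" using dP b by simp
   have "pr j ** (s ** be) = sub T (pr j) (us j ** pr (Suc j)) ** be" by (rule pre_eq[OF s(2)]) (use s(1) dP b in simp_all)
   also have "\<dots> = sub T (pr j ** be) (us j ** (pr (Suc j) ** be))" using dP uM' b by (simp add: sub_cmp)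
   also have "\<dots> = pr j ** be" unfolding ph[OF c pb] using dP b co by simp
   finally show ?thesis .
  qed
  have "is_iso T s"
  proof (rule compact_detect_iso[OF s(1)])
   fix c assume c: "c : compacts"
   have co: "c : Ob" using compact_obj[OF c] .
   have sb: "s ** be = be" if b: "be : Hom c P" for be by (rule product_eq[OF P]) (use s(1) b sph[OF c b] in simp_all)
   show "al = zer T c P" if "al : Hom c P" "s ** al = zer T c P" for al using sb[OF that(1)] that(2) by simp
   show "EX al:Hom c P. s ** al = be" if "be : Hom c P" for be using sb[OF that] that by blast
  qed
  then have sD: "s : cone_in T D" by (rule cone_in_iso[OF D])
  have ks: "s' ** k = k ** s"
  proof (rule product_eq[OF Q])
   fix j :: nat
   have "rh j ** (s' ** k) = sub T (rh j) (rh (Suc j)) ** k" by (rule pre_eq[OF s'(2)]) (use s'(1) dQ k(1) in simp_all)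
   also have "\<dots> = sub T (as j ** pr j) (as j ** (us j ** pr (Suc j)))"
    using dQ k(1) k(2)[of j] k(2)[of "Suc j"] asS[of j] aM'[of j] uM'[of j] dP(2-4)[of "Suc j"] by (simp add: sub_cmp)
   also have "\<dots> = as j ** (pr j ** s)" unfolding s(2) using aM' uM' dP by (simp add: cmp_sub)
   also have "\<dots> = rh j ** (k ** s)" using pre_eq[OF k(2)[of j], of s] aM' dP dQ k(1) s(1) by simp
   finally show "rh j ** (s' ** k) = rh j ** (k ** s)" .
  qed (use s(1) s'(1) k(1) in simp_all)
  have "s' ** k : cone_in T D" unfolding ks by (rule cone_in_cmp[OF D s(1) k(1) sD kD])
  then have s'D: "s' : cone_in T D" by (rule cone_in_second[OF D k(1) s'(1) kD])
  \<comment> \<open>\<open>1 - sh\<close> on the constant product is a split epimorphism with kernel \<open>X\<close>\<close>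
  obtain de where de: "de : Hom X Q" "!!j. rh j ** de = idn T X" by (rule product_map[OF Q X, of "%_. idn T X"]) (use X in simp_all)
  define ta where "ta = rec_nat (zer T Q X) (%j t. sub T t (rh j))"
  have t0: "ta 0 = zer T Q X" and tS: "ta (Suc j) = sub T (ta j) (rh j)" for j by (simp_all add: ta_def)
  have tM: "ta j : Hom Q X" for j by (induction j) (use t0 tS dQ X in simp_all)
  have tM': "ta j : arr T" "src T (ta j) = Q" "tgt T (ta j) = X" for j using tM[of j] by auto
  obtain r where r: "r : Hom Q Q" "!!j. rh j ** r = ta j" by (rule product_map[OF Q dQ(1), of ta, OF tM]) simp
  have "EX h. dt X Q Q de s' h"
  proof (rule dt_split[OF de(1) s'(1) _ r(1)])
   show "rh 0 : Hom Q X" using dQ by simp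
   show "rh 0 ** de = idn T X" by (rule de)
   show "s' ** r = idn T Q"
   proof (rule product_eq[OF Q])
    fix j :: nat
    have "rh j ** (s' ** r) = sub T (rh j) (rh (Suc j)) ** r" by (rule pre_eq[OF s'(2)]) (use s'(1) dQ r(1) in simp_all)
    also have "\<dots> = sub T (ta j) (sub T (ta j) (rh j))" using dQ r(1) r(2)[of j] r(2)[of "Suc j"] tS[of j] by (simp add: sub_cmp)
    also have "\<dots> = rh j ** idn T Q" using sub_sub_same[of "ta j" "rh j"] tM' dQ by simp
    finally show "rh j ** (s' ** r) = rh j ** idn T Q" .
   qed (use s'(1) r(1) dQ in simp_all)
   show "s' ** de = zer T X Q"
   proof (rule product_eq[OF Q])
    fix j :: nat
    have "rh j ** (s' ** de) = sub T (rh j) (rh (Suc j)) ** de" by (rule pre_eq[OF s'(2)]) (use s'(1) dQ de(1) in simp_all)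
    then show "rh j ** (s' ** de) = rh j ** zer T X Q" using dQ de X by (simp add: sub_cmp)
   qed (use s'(1) de dQ X in simp_all)
   show "add T (de ** rh 0) (r ** s') = idn T Q"
   proof (rule product_eq[OF Q])
    fix j :: nat
    have ts: "ta j ** s' = sub T (rh j) (rh 0)" for j
    proof (induction j)
     case 0 then show ?case using t0 s'(1) dQ X by simp
    next
     case (Suc j)
     have "ta (Suc j) ** s' = sub T (sub T (rh j) (rh 0)) (sub T (rh j) (rh (Suc j)))"
      unfolding tS using tM' dQ s'(1) s'(2)[of j] Suc by (simp add: sub_cmp)
     also have "\<dots> = sub T (rh (Suc j)) (rh 0)" by (rule sub_sub_sub) (use dQ in simp_all)
     finally show ?case .
    qed
    have "rh j ** add T (de ** rh 0) (r ** s') = add T (rh j ** (de ** rh 0)) (rh j ** (r ** s'))" using dQ de(1) r(1) s'(1) by (simp add: cmp_add)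
    also have "rh j ** (de ** rh 0) = rh 0" using dQ de X by (simp add: pre_eq[OF de(2)])
    also have "rh j ** (r ** s') = sub T (rh j) (rh 0)" using dQ r(1) s'(1) ts[of j] by (simp add: pre_eq[OF r(2)])
    also have "add T (rh 0) (sub T (rh j) (rh 0)) = rh j" using dQ by simp
    finally show "rh j ** add T (de ** rh 0) (r ** s') = rh j ** idn T Q" using dQ by simp
   qed (use dQ de(1) r(1) s'(1) in simp_all)
  qed
  then obtain h where t: "dt X Q Q de s' h" by blast
  show ?thesis by (rule ts_unshift[OF D X cone_inD[OF D s'D dt_rot[OF t]]])
 qed
 then show ?thesis using ts_sub[OF D] by blast
qed

end

section \<open>Smashing ideals and their idempotents\<close>

context big_tt_category begin

lemma tensor_functor_simps [simp]:
 "fob (ltensor T x) y = x >< y" "far (ltensor T x) f = idn T x ## f"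
 "fob (rtensor T x) y = y >< x" "far (rtensor T x) f = f ## idn T x" by (simp_all add: ltensor_def rtensor_def)

lemma ltensor_functor: "x : Ob ==> is_functor T T (ltensor T x)"
 and rtensor_functor: "x : Ob ==> is_functor T T (rtensor T x)"
 by (rule exact_is_functor[OF ltensor_exact], assumption) (rule exact_is_functor[OF rtensor_exact])

declare ten_obj [simp] unit_obj [simp]

lemma ten_simps [simp]:
 "f : arr T ==> g : arr T ==> f ## g : arr T"
 "f : arr T ==> g : arr T ==> src T (f ## g) = src T f >< src T g"
 "f : arr T ==> g : arr T ==> tgt T (f ## g) = tgt T f >< tgt T g" using ten_Mor[of f "src T f" "tgt T f" g "src T g" "tgt T g"] by simp_all

lemma structure_simps [simp]:
 "x : Ob ==> y : Ob ==> z : Ob ==> assoc T x y z : arr T"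
 "x : Ob ==> y : Ob ==> z : Ob ==> src T (assoc T x y z) = (x >< y) >< z"
 "x : Ob ==> y : Ob ==> z : Ob ==> tgt T (assoc T x y z) = x >< (y >< z)"
 "x : Ob ==> lunit T x : arr T" "x : Ob ==> src T (lunit T x) = unit T >< x" "x : Ob ==> tgt T (lunit T x) = x"
 "x : Ob ==> runit T x : arr T" "x : Ob ==> src T (runit T x) = x >< unit T" "x : Ob ==> tgt T (runit T x) = x"
 using assoc_iso[of x y z] lunit_iso[of x] runit_iso[of x] by simp_all

lemma idn_ten_cmp: "x : Ob ==> f : arr T ==> g : arr T ==> src T g = tgt T f ==>
  idn T x ## (g ** f) = (idn T x ## g) ** (idn T x ## f)"
 and ten_idn_cmp: "x : Ob ==> f : arr T ==> g : arr T ==> src T g = tgt T f ==>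
  (g ** f) ## idn T x = (g ## idn T x) ** (f ## idn T x)" using functor_simps(6)[OF ltensor_functor] functor_simps(6)[OF rtensor_functor] by simp_all

lemma ten_exchange: "f : Hom x x' ==> g : Hom y y' ==> f ## g = (f ## idn T y') ** (idn T x ## g)"
 and ten_exchange': "f : Hom x x' ==> g : Hom y y' ==> f ## g = (idn T x' ## g) ** (f ## idn T y)"
 using ten_cmp[of "idn T x" x x f x' g y y' "idn T y'" y'] ten_cmp[of f x x' "idn T x'" x' "idn T y" y y g y']
  Mor_objs[of f x x'] Mor_objs[of g y y'] by simp_all

lemma assoc_isomorphic: "x : Ob ==> y : Ob ==> z : Ob ==> isomorphic T ((x >< y) >< z) (x >< (y >< z))"
 and lunit_isomorphic: "x : Ob ==> isomorphic T (unit T >< x) x"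
 and runit_isomorphic: "x : Ob ==> isomorphic T (x >< unit T) x" using assoc_iso lunit_iso runit_iso isomorphicI by blast+

lemma braid_isomorphic: assumes "x : Ob" "y : Ob" shows "isomorphic T (x >< y) (y >< x)"
 by (rule isomorphicI[OF braid_Mor is_isoI[OF braid_Mor braid_Mor braid_symmetric braid_symmetric]]) (rule assms)+

lemma ten_isomorphic:
 assumes i: "isomorphic T x x'" "isomorphic T y y'" shows "isomorphic T (x >< y) (x' >< y')"
proof -
 have o: "x : Ob" "y' : Ob" using isomorphic_objs[OF i(1)] isomorphic_objs[OF i(2)] by simp_all
 have "isomorphic T (x >< y) (x >< y')" using functor_isomorphic[OF category_axioms category_axioms ltensor_functor[OF o(1)] i(2)] by simp
 moreover have "isomorphic T (x >< y') (x' >< y')" using functor_isomorphic[OF category_axioms category_axioms rtensor_functor[OF o(2)] i(1)] by simp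
 ultimately show ?thesis by (rule isomorphic_trans)
qed

lemma swap_isomorphic:
 assumes o: "x : Ob" "y : Ob" "z : Ob" shows "isomorphic T (x >< (y >< z)) (y >< (x >< z))"
 by (rule isomorphic_trans[OF isomorphic_sym[OF assoc_isomorphic]
    isomorphic_trans[OF ten_isomorphic[OF braid_isomorphic isomorphic_refl] assoc_isomorphic]]) (rule o)+

lemma ten_zero: assumes z: "is_zero T x" and y: "y : Ob" shows "is_zero T (y >< x)" "is_zero T (x >< y)"
 using additive_functor_zero[OF add_cat add_cat exact_additive[OF ltensor_exact[OF y]] z]
  additive_functor_zero[OF add_cat add_cat exact_additive[OF rtensor_exact[OF y]] z] by simp_all

lemma ideal_ten:
 assumes M: "localizing_ideal U T M" and s: "s : M" and x: "x : Ob" shows "x >< s : M" "s >< x : M"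
proof -
 have ts: "tsub M" using M localizing_ts unfolding localizing_ideal_def by blast
 show "x >< s : M" using M s x unfolding localizing_ideal_def by blast
 from ts_iso[OF ts this braid_isomorphic[OF x ts_sub[OF ts s]]] show "s >< x : M" .
qed

text \<open>For \<open>x\<close> with dual \<open>d\<close>, a map \<open>al : s \<rightarrow> f \<otimes> x\<close> is recovered from its mate \<open>s \<otimes> d \<rightarrow> f\<close> up to an
  isomorphism \<open>th\<close>, which the pentagon and a triangle identity compute; if \<open>f\<close> is local, the mate vanishes
  because \<open>s \<otimes> d\<close> is in the ideal.\<close>

lemma local_ten_rigid:
 assumes M: "localizing_ideal U T M" and f: "f : perp M" and x: "x : rigid_objects T"
 shows "f >< x : perp M"
proof -
 let ?u = "unit T"
 have o: "x : Ob" "f : Ob" using x perp_obj[OF f] unfolding rigid_objects_def by blast+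
 obtain d \<eta> ep where d: "d : Ob" "\<eta> : Hom ?u (d >< x)" "ep : Hom (x >< d) ?u"
  and zz: "lunit T x ** (ep ## idn T x) ** inv_arr T (assoc T x d x) ** (idn T x ## \<eta>) = runit T x"
  using x unfolding rigid_objects_def by (elim CollectE conjE bexE) (rule that)
 define a' where "a' = inv_arr T (assoc T x d x)"
 have "inverse_arrows T (assoc T x d x) a'" unfolding a'_def by (rule inv_arr_inverse) (use assoc_iso o d in blast)
 then have a': "a' : Hom (x >< (d >< x)) ((x >< d) >< x)" "a' ** assoc T x d x = idn T ((x >< d) >< x)"
  using o d unfolding inverse_arrows_def by simp_all
 have inv: "EX b. b : Hom (y >< (z >< w)) ((y >< z) >< w) & b ** assoc T y z w = idn T ((y >< z) >< w) &
   assoc T y z w ** b = idn T (y >< (z >< w))" if "y : Ob" "z : Ob" "w : Ob" for y z w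
  using is_isoE[OF conjunct2[OF assoc_iso[OF that]] conjunct1[OF assoc_iso[OF that]]] by metis
 have fx: "f >< x : Ob" "x >< d : Ob" using o d by simp_all
 obtain b where b: "b : Hom ((f >< x) >< (d >< x)) (((f >< x) >< d) >< x)"
  "b ** assoc T (f >< x) d x = idn T (((f >< x) >< d) >< x)" "assoc T (f >< x) d x ** b = idn T ((f >< x) >< (d >< x))"
  using inv[OF fx(1) d(1) o(1)] by blast
 obtain r where r: "r = runit T f ** (idn T f ## ep) ** assoc T f x d" "r : Hom ((f >< x) >< d) f" using o d by simp
 define th where "th = (r ## idn T x) ** b ** (idn T (f >< x) ## \<eta>)"
 have "th = (idn T f ## runit T x) ** assoc T f x ?u"
 proof -
  let ?a2 = "assoc T f (x >< d) x" and ?a3 = "assoc T f x (d >< x)" and ?A = "assoc T f x d ## idn T x"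
  have "(idn T f ## assoc T x d x) ** (?a2 ** (?A ** b)) = ((idn T f ## assoc T x d x) ** ?a2 ** ?A) ** b" using o d b(1) by simp
  also have "\<dots> = ?a3" unfolding pentagon[OF o(2,1) d(1) o(1)] using o d(1) b by simp
  finally have P: "(idn T f ## assoc T x d x) ** (?a2 ** (?A ** b)) = ?a3" .
  have "?a2 ** (?A ** b) = ((idn T f ## a') ** (idn T f ## assoc T x d x)) ** (?a2 ** (?A ** b))"
   using o d(1) a' b(1) by (simp add: idn_ten_cmp[symmetric] ten_idn)
  also have "\<dots> = (idn T f ## a') ** ?a3" unfolding P[symmetric] using o d(1) a'(1) b(1) by simp
  finally have Q: "?a2 ** (?A ** b) = (idn T f ## a') ** ?a3" .
  have nat1: "?a3 ** (idn T (f >< x) ## \<eta>) = (idn T f ## (idn T x ## \<eta>)) ** assoc T f x ?u"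
   using assoc_natural[of "idn T f" f f "idn T x" x x \<eta> ?u "d >< x"] o d by (simp add: ten_idn)
  have nat2: "assoc T f ?u x ** ((idn T f ## ep) ## idn T x) = (idn T f ## (ep ## idn T x)) ** ?a2"
   using assoc_natural[of "idn T f" f f ep "x >< d" ?u "idn T x" x x] o d by simp
  have "r ## idn T x = (runit T f ## idn T x) ** (((idn T f ## ep) ## idn T x) ** ?A)" unfolding r(1) using o d by (simp add: ten_idn_cmp)
  also have "\<dots> = (idn T f ## lunit T x) ** ((assoc T f ?u x ** ((idn T f ## ep) ## idn T x)) ** ?A)"
   unfolding triangle[OF o(2,1), symmetric] using o d by simp
  also have "\<dots> = (idn T f ## lunit T x) ** ((idn T f ## (ep ## idn T x)) ** (?a2 ** ?A))" unfolding nat2 using o d by simp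
  finally have "th = (idn T f ## lunit T x) ** ((idn T f ## (ep ## idn T x)) ** ((?a2 ** (?A ** b)) ** (idn T (f >< x) ## \<eta>)))"
   unfolding th_def using o d b(1) by simp
  also have "\<dots> = (idn T f ## lunit T x) ** ((idn T f ## (ep ## idn T x)) ** ((idn T f ## a') ** (?a3 ** (idn T (f >< x) ## \<eta>))))"
   unfolding Q using o d a'(1) by simp
  also have "\<dots> = (idn T f ## (lunit T x ** (ep ## idn T x) ** a' ** (idn T x ## \<eta>))) ** assoc T f x ?u"
   unfolding nat1 using o d a'(1) by (simp add: idn_ten_cmp)
  finally show ?thesis unfolding a'_def zz .
 qed
 moreover have "is_iso T (idn T f ## runit T x)"
  using functor_iso[OF category_axioms category_axioms ltensor_functor[OF o(2)]] runit_iso[OF o(1)] by simp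
 ultimately have iso: "is_iso T th" using is_iso_cmp[of "assoc T f x ?u"] assoc_iso[OF o(2,1) unit_obj] o by simp
 have thM: "th : Hom ((f >< x) >< ?u) (f >< x)" unfolding th_def using o d b(1) r(2) by simp
 have "al = zer T s (f >< x)" if s: "s : M" and al: "al : Hom s (f >< x)" for s al
 proof -
  have so: "s : Ob" using Mor_objs[OF al] by simp
  obtain c where c: "c : Hom (s >< (d >< x)) ((s >< d) >< x)" "assoc T s d x ** c = idn T (s >< (d >< x))" using inv[OF so d(1) o(1)] by blast
  have "r ** (al ## idn T d) : Hom (s >< d) f" using r(2) al so d by simp
  from perpD[OF f ideal_ten(2)[OF M s d(1)] this] have mate: "r ** (al ## idn T d) = zer T (s >< d) f" .
  have "assoc T (f >< x) d x ** ((al ## idn T d) ## idn T x) = (al ## idn T (d >< x)) ** assoc T s d x"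
   using assoc_natural[of al s "f >< x" "idn T d" d d "idn T x" x x] al o d by (simp add: ten_idn)
  then have "b ** ((assoc T (f >< x) d x ** ((al ## idn T d) ## idn T x)) ** c) = b ** (((al ## idn T (d >< x)) ** assoc T s d x) ** c)" by simp
  then have nat: "((al ## idn T d) ## idn T x) ** c = b ** (al ## idn T (d >< x))" using al o so d(1) b c by (simp add: pre_eq[OF b(2)])
  have "th ** (al ## idn T ?u) = (r ## idn T x) ** (b ** ((idn T (f >< x) ## \<eta>) ** (al ## idn T ?u)))"
   unfolding th_def using al o d b(1) r(2) by simp
  also have "(idn T (f >< x) ## \<eta>) ** (al ## idn T ?u) = (al ## idn T (d >< x)) ** (idn T s ## \<eta>)"
   using ten_exchange[OF al d(2)] ten_exchange'[OF al d(2)] by simp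
  also have "(r ## idn T x) ** (b ** \<dots>) = (r ## idn T x) ** ((b ** (al ## idn T (d >< x))) ** (idn T s ## \<eta>))"
   using al o so d b(1) r(2) by simp
  also have "\<dots> = ((r ** (al ## idn T d)) ## idn T x) ** (c ** (idn T s ## \<eta>))"
   unfolding nat[symmetric] using al o so d c(1) r(2) by (simp add: ten_idn_cmp)
  also have "(r ** (al ## idn T d)) ## idn T x = zer T ((s >< d) >< x) (f >< x)"
   unfolding mate using additive_functor_zer[OF add_cat add_cat exact_additive[OF rtensor_exact[OF o(1)]], of "s >< d" f] so o d by simp
  finally have z: "th ** (al ## idn T ?u) = zer T (s >< ?u) (f >< x)" using so o d c(1) by simp
  obtain t where t: "t : Hom (f >< x) ((f >< x) >< ?u)" "t ** th = idn T ((f >< x) >< ?u)" by (rule is_isoE[OF iso thM])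
  have "al ## idn T ?u = (t ** th) ** (al ## idn T ?u)" unfolding t(2) using al o by simp
  also have "\<dots> = t ** (th ** (al ## idn T ?u))" using t(1) thM al by simp
  also have "\<dots> = zer T (s >< ?u) ((f >< x) >< ?u)" unfolding z using t(1) so o by simp
  finally have "al ** runit T s = zer T (s >< ?u) (f >< x)" using runit_natural[OF al] so o by simp
  moreover obtain q where q: "q : Hom s (s >< ?u)" "runit T s ** q = idn T s"
   using is_isoE[OF conjunct2[OF runit_iso[OF so]] conjunct1[OF runit_iso[OF so]]] by metis
  ultimately have "(al ** runit T s) ** q = zer T s (f >< x)" using o so by simp
  then show ?thesis using al q so by simp
 qed
 then show ?thesis using o unfolding perp_def by (simp del: in_Mor) blast
qed

end

context localization begin

lemma qm_coproduct:
 assumes c: "is_coproduct C J X c io" shows "is_coproduct N J X c (%j. qm S (io j))"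
proof -
 interpret N: category N by (rule N_category)
 note d = is_coproductD[OF c]
 have iM: "io j : Hom (X j) c" if "j : J" for j using d(2-4)[OF that] d(1) by simp
 show ?thesis
 proof (rule N.is_coproductI)
  show "c : obj N" using d(1) by simp
  show "qm S (io j) : Mor N (X j) c" if "j : J" for j by (rule E_qm(1)[OF iM[OF that]])
  fix z assume z: "z : obj N"
  show "EX h:Mor N c z. ALL j:J. cmp N h (qm S (io j)) = ph j" if phi: "!!j. j : J ==> ph j : Mor N (X j) z" for ph
  proof -
   have zo: "z : Ob" using z by simp
   obtain u where u: "u : Hom c (L z)" "!!j. j : J ==> u ** io j = Psi (ph j)"
    by (rule coproduct_map[OF c L_obj[OF zo], of "%j. Psi (ph j)", OF Psi_Mor[OF phi]]) blast+
   obtain h where h: "h : Mor N c z" "Psi h = u" by (rule Psi_surj[OF d(1) zo u(1)])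
   have "cmp N h (qm S (io j)) = ph j" if j: "j : J" for j by (rule Psi_inj[OF N.cmp_Mor[OF E_qm(1)[OF iM[OF j]] h(1)] phi[OF j]])
     (simp only: Psi_cmp_qm[OF iM[OF j] h(1)] h(2) u(2)[OF j])
   then show ?thesis using h(1) by blast
  qed
  show "h = h'" if h: "h : Mor N c z" "h' : Mor N c z" and e: "!!j. j : J ==> cmp N h (qm S (io j)) = cmp N h' (qm S (io j))" for h h'
  proof (rule Psi_inj[OF h], rule coproduct_eq[OF c Psi_Mor[OF h(1)] Psi_Mor[OF h(2)]])
   show "Psi h ** io j = Psi h' ** io j" if "j : J" for j
    unfolding Psi_cmp_qm[OF iM[OF that] h(1), symmetric] Psi_cmp_qm[OF iM[OF that] h(2), symmetric] e[OF that] ..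
  qed
 qed
qed

end

context big_tt_category begin

lemma localizing_preimage:
 assumes S: "localizing U T S" and F: "exact_functor T T F" and Fc: "preserves_coproducts U T T F"
 shows "localizing U T {x : Ob. fob F x : S}" unfolding localizing_def
proof (intro conjI allI impI)
 show "tsub {x : Ob. fob F x : S}" by (rule exact_preimage[OF F localizing_ts[OF S]])
 fix J :: "'u set" and X c io
 assume J: "J \<subseteq> U" "J \<prec> U" and X: "X ` J \<subseteq> {x : Ob. fob F x : S}" and c: "is_coproduct T J X c io"
 have "is_coproduct T J (%j. fob F (X j)) (fob F c) (%j. far F (io j))" using Fc J c unfolding preserves_coproducts_def by blast
 moreover have "(%j. fob F (X j)) ` J \<subseteq> S" using X by blast
 ultimately have "fob F c : S" using S J unfolding localizing_def by blast
 then show "c : {x : Ob. fob F x : S}" using is_coproductD(1)[OF c] by simp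
qed

lemma smashing_ideal: "smashing U T M ==> localizing_ideal U T M"
 and smashing_localizing: "smashing U T M ==> localizing U T M"
 and smashing_ts: "smashing U T M ==> tsub M" unfolding smashing_def localizing_ideal_def using localizing_ts by blast+

text \<open>The right adjoint \<open>k\<close> identifies the quotient with the local objects, and both \<open>k\<close> and the quotient
  functor preserve coproducts, so coproducts of local objects are local.\<close>

lemma smashing_localization:
 assumes M: "smashing U T M"
 obtains L \<eta> where "localization T M L \<eta>" "localizing U T (perp M)"
proof -
 note ts = smashing_ts[OF M]
 obtain k where k: "is_functor (verdier T M) T k" "adjoint T (verdier T M) (quot_functor T M) k"
  "preserves_coproducts U (verdier T M) T k" using M unfolding smashing_def by blast
 have thick: "c : M" if "d : M" "i : Hom c d" "r : Hom d c" "r ** i = idn T c" for c d i r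
  by (rule localizing_retract[OF smashing_localizing[OF M] that])
 show ?thesis
 proof (rule right_adjoint_localizes[OF ts thick k(1,2)])
  fix \<eta> assume eta: "!!y. y : Ob ==> \<eta> y : Hom y (fob k y)" "!!y. y : Ob ==> \<eta> y : cone_in T M"
   "!!y. y : Ob ==> fob k y : perp M"
  interpret l: localization T M "fob k" \<eta> by unfold_locales (use ts eta in blast)+
  have ro: "tsub (perp M)" by (rule perp_triangulated[OF ts_shift_closed[OF ts]])
  have "localizing U T (perp M)" unfolding localizing_def
  proof (intro conjI allI impI ro)
   fix J :: "'u set" and X c io
   assume J: "J \<subseteq> U" "J \<prec> U" and X: "X ` J \<subseteq> perp M" and c: "is_coproduct T J X c io"
   have "is_coproduct T J (%j. fob k (X j)) (fob k c) (%j. far k (frac T M (idn T (src T (io j))) (io j)))"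
    using k(3) J l.qm_coproduct[OF c] unfolding preserves_coproducts_def by blast
   then have "is_coproduct T J X (fob k c) (%j. far k (frac T M (idn T (src T (io j))) (io j)) ** \<eta> (X j))"
   proof (rule coproduct_replace)
    fix j assume "j : J"
    then have x: "X j : perp M" using X by blast
    show "\<eta> (X j) : Hom (X j) (fob k (X j)) & is_iso T (\<eta> (X j))" using eta(1)[OF perp_obj[OF x]] l.eta_local_iso[OF x] ..
   qed
   then obtain th where th: "th : Hom c (fob k c)" "is_iso T th" by (rule coproduct_unique[OF c]) (rule that)
   have "isomorphic T (fob k c) c" by (rule isomorphic_sym[OF isomorphicI[OF th]])
   then show "c : perp M" using ts_iso[OF ro eta(3)[OF is_coproductD(1)[OF c]]] by blast
  qed
  then show ?thesis using that l.localization_axioms by blast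
 qed
qed

text \<open>The objects \<open>X\<close> with \<open>f \<otimes> X\<close> local form a localizing subcategory that contains the rigid objects.\<close>

lemma local_ten:
 assumes M: "smashing U T M" and f: "f : perp M" and X: "X : Ob"
 shows "f >< X : perp M"
proof -
 have fo: "f : Ob" using perp_obj[OF f] .
 obtain L \<eta> where "localizing U T (perp M)" using smashing_localization[OF M] by metis
 from localizing_preimage[OF this ltensor_exact[OF fo] ltensor_coproducts[OF fo]]
 have "localizing U T {x : Ob. f >< x : perp M}" by simp
 moreover have "compacts \<subseteq> {x : Ob. f >< x : perp M}" using local_ten_rigid[OF smashing_ideal[OF M] f] compact_eq_rigid compact_obj by blast
 ultimately have "{x : Ob. f >< x : perp M} = Ob" by (rule compactly_generated)
 then show ?thesis using X by blast
qed

abbreviation "\<f> M \<equiv> right_idem T M"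
abbreviation "\<e> M \<equiv> left_idem T M"

text \<open>The object \<open>right_idem\<close> is defined by a chosen right adjoint, known only up to isomorphism, so the unit
  of the localization above is transported to it.\<close>

lemma right_idem_arrow:
 assumes M: "smashing U T M"
 shows "\<f> M : perp M" "EX i. i : Hom (unit T) (\<f> M) & i : cone_in T M"
proof -
 note ts = smashing_ts[OF M]
 obtain L \<eta> where l: "localization T M L \<eta>" using smashing_localization[OF M] by metis
 interpret l: localization T M L \<eta> by (rule l)
 have ro: "tsub (perp M)" by (rule perp_triangulated[OF ts_shift_closed[OF ts]])
 obtain ep where u: "univ_arrow T (verdier T M) (quot_functor T M) (unit T) (L (unit T)) ep" using l.quot_univ_arrow[OF unit_obj] by blast
 have e: "\<f> M = fob (right_adjoint T (verdier T M) (quot_functor T M)) (unit T)"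
  by (simp add: right_idem_def localization_functor_def func_comp_def kfun_def quot_functor_def)
 have ex: "EX r ep. univ_arrow T (verdier T M) (quot_functor T M) y r ep" if "y : obj (verdier T M)" for y using l.quot_univ_arrow[of y] that by auto
 have "isomorphic T (\<f> M) (L (unit T))" unfolding e
  by (rule right_adjoint_isomorphic[OF category_axioms l.N_category l.quot_functor ex u]) simp_all
 then have i: "isomorphic T (L (unit T)) (\<f> M)" by (rule isomorphic_sym)
 show "\<f> M : perp M" by (rule ts_iso[OF ro l.L_local[OF unit_obj] i])
 obtain th where th: "th : Hom (L (unit T)) (\<f> M)" "is_iso T th" using isomorphicE[OF i] by metis
 have "th ** \<eta> (unit T) : cone_in T M" by (rule cone_in_cmp[OF ts l.eta[OF unit_obj] th(1) l.eta_cone[OF unit_obj] cone_in_iso[OF ts th(2)]])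
 moreover have "th ** \<eta> (unit T) : Hom (unit T) (\<f> M)" using th l.eta[OF unit_obj] by simp
 ultimately show "EX i. i : Hom (unit T) (\<f> M) & i : cone_in T M" by blast
qed

text \<open>The map \<open>X \<cong> 1 \<otimes> X \<rightarrow> f \<otimes> X\<close>. Any two choices of an arrow \<open>1 \<rightarrow> f\<close> with cone in the ideal
  differ by an automorphism of \<open>f\<close>.\<close>

definition localize where
 "localize M X = ((SOME i. i : Hom (unit T) (\<f> M) & i : cone_in T M) ## idn T X) ** inv_arr T (lunit T X)"

lemma right_idem_obj [simp]: "smashing U T M ==> \<f> M : Ob"
 using right_idem_arrow(1) perp_obj by blast

lemma lunit_inv:
 assumes X: "X : Ob"
 shows "inv_arr T (lunit T X) : Hom X (unit T >< X)" "lunit T X ** inv_arr T (lunit T X) = idn T X"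
  "inv_arr T (lunit T X) ** lunit T X = idn T (unit T >< X)" "is_iso T (inv_arr T (lunit T X))"
proof -
 have "inverse_arrows T (lunit T X) (inv_arr T (lunit T X))" by (rule inv_arr_inverse) (use lunit_iso X in blast)
 then show h: "inv_arr T (lunit T X) : Hom X (unit T >< X)" "lunit T X ** inv_arr T (lunit T X) = idn T X"
  "inv_arr T (lunit T X) ** lunit T X = idn T (unit T >< X)" using X unfolding inverse_arrows_def by simp_all
 show "is_iso T (inv_arr T (lunit T X))" by (rule is_isoI[OF h(1) _ h(2,3)]) (use X in simp)
qed

lemma localize_natural:
 assumes M: "smashing U T M" and u: "u : Hom X Y"
 shows "(idn T (\<f> M) ## u) ** localize M X = localize M Y ** u"
proof -
 have o: "X : Ob" "Y : Ob" using Mor_objs[OF u] by simp_all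
 define i where "i = (SOME i. i : Hom (unit T) (\<f> M) & i : cone_in T M)"
 have i: "i : Hom (unit T) (\<f> M)" using someI_ex[OF right_idem_arrow(2)[OF M]] unfolding i_def by blast
 note l = lunit_inv[OF o(1)] lunit_inv[OF o(2)]
 have "inv_arr T (lunit T Y) ** u = inv_arr T (lunit T Y) ** ((u ** lunit T X) ** inv_arr T (lunit T X))" using u l o by simp
 also have "\<dots> = inv_arr T (lunit T Y) ** (lunit T Y ** ((idn T (unit T) ## u) ** inv_arr T (lunit T X)))"
  unfolding lunit_natural[OF u, symmetric] using u l o by simp
 also have "\<dots> = (idn T (unit T) ## u) ** inv_arr T (lunit T X)" using u l(1) l(5) o by (simp add: pre_eq[OF l(7)])
 finally have e: "inv_arr T (lunit T Y) ** u = (idn T (unit T) ## u) ** inv_arr T (lunit T X)" .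
 have "localize M Y ** u = (i ## idn T Y) ** (inv_arr T (lunit T Y) ** u)" unfolding localize_def i_def[symmetric] using i u l o by simp
 also have "\<dots> = ((i ## idn T Y) ** (idn T (unit T) ## u)) ** inv_arr T (lunit T X)" unfolding e using i u l o by simp
 also have "(i ## idn T Y) ** (idn T (unit T) ## u) = (idn T (\<f> M) ## u) ** (i ## idn T X)"
  using ten_exchange[OF i u] ten_exchange'[OF i u] by simp
 also have "\<dots> ** inv_arr T (lunit T X) = (idn T (\<f> M) ## u) ** localize M X" unfolding localize_def i_def[symmetric] using i u l o M by simp
 finally show ?thesis ..
qed

text \<open>Localization away from a smashing ideal is tensoring with \<open>f\<close>: the cone of \<open>X \<rightarrow> f \<otimes> X\<close> is
  the cone of \<open>1 \<rightarrow> f\<close> tensored with \<open>X\<close>, hence in the ideal.\<close>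

theorem tensor_localization:
 assumes M: "smashing U T M"
 shows "localization T M (%X. \<f> M >< X) (localize M)"
proof
 note ts = smashing_ts[OF M]
 define i where "i = (SOME i. i : Hom (unit T) (\<f> M) & i : cone_in T M)"
 have i: "i : Hom (unit T) (\<f> M)" "i : cone_in T M" using someI_ex[OF right_idem_arrow(2)[OF M]] unfolding i_def by blast+
 show "tsub M" by (rule ts)
 fix x assume x: "x : Ob"
 note l = lunit_inv[OF x]
 have iM: "i ## idn T x : Hom (unit T >< x) (\<f> M >< x)" using i x by simp
 have e: "localize M x = (i ## idn T x) ** inv_arr T (lunit T x)" unfolding localize_def i_def ..
 show "localize M x : Hom x (\<f> M >< x)" unfolding e using i(1) x l(1) by simp
 have "i ## idn T x : cone_in T M" using exact_cone_in[OF rtensor_exact[OF x] i(2), of M] ideal_ten(2)[OF smashing_ideal[OF M] _ x] by simp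
 then show "localize M x : cone_in T M" unfolding e by (rule cone_in_cmp[OF ts l(1) iM cone_in_iso[OF ts l(4)]])
 show "\<f> M >< x : perp M" by (rule local_ten[OF M right_idem_arrow(1)[OF M] x])
qed

lemma right_idem_zero_iff: "smashing U T M ==> X : Ob ==> is_zero T (\<f> M >< X) \<longleftrightarrow> X : M"
 by (rule localization.L_zero_iff[OF tensor_localization])

lemma right_idem_local: "smashing U T M ==> X : perp M ==> isomorphic T X (\<f> M >< X)"
 by (rule localization.L_isomorphic[OF tensor_localization])

text \<open>The fibre \<open>c\<close> of \<open>y \<rightarrow> f \<otimes> y\<close> is in the ideal, and maps from the ideal to \<open>y\<close> factor uniquely
  through it, so it is the coreflection of \<open>y\<close>. For \<open>X\<close> in the ideal \<open>f \<otimes> X\<close> vanishes, so that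
  \<open>e \<otimes> X \<rightarrow> X\<close> is an isomorphism.\<close>

lemma left_idem:
 assumes M: "smashing U T M"
 shows "\<e> M : M" "X : M ==> isomorphic T (\<e> M >< X) X"
proof -
 note ts = smashing_ts[OF M]
 interpret l: localization T M "%X. \<f> M >< X" "localize M" by (rule tensor_localization[OF M])
 let ?S = "full_subcat T M" and ?J = "\<lparr>fob = (%x. x), far = (%f. f)\<rparr>"
 have SM: "f : Mor ?S x y \<longleftrightarrow> f : Hom x y & x : M & y : M" for f x y unfolding Mor_def full_subcat_def by auto
 have S: "obj ?S = M" "idn ?S = idn T" "cmp ?S = cmp T" "src ?S = src T" "tgt ?S = tgt T" unfolding full_subcat_def by simp_all
 have MT: "x : Ob" if "x : M" for x using ts_sub[OF ts that] .
 interpret S: category ?S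
 proof
  show "src ?S f : obj ?S" "tgt ?S f : obj ?S" if "f : arr ?S" for f using that unfolding full_subcat_def by simp_all
  show "idn ?S x : Mor ?S x x" if "x : obj ?S" for x using that MT unfolding SM S by simp
  show "cmp ?S g f : Mor ?S x z" if "f : Mor ?S x y" "g : Mor ?S y z" for f g x y z using that unfolding SM S by simp
  show "cmp ?S f (idn ?S x) = f" "cmp ?S (idn ?S y) f = f" if "f : Mor ?S x y" for f x y using that unfolding SM S by simp_all
  show "cmp ?S (cmp ?S h g) f = cmp ?S h (cmp ?S g f)" if "f : Mor ?S w x" "g : Mor ?S x y" "h : Mor ?S y z" for f g h w x y z
   using that unfolding SM S by simp
 qed
 have J: "is_functor ?S T ?J" unfolding is_functor_def S using MT by (auto simp: full_subcat_def)
 have fib: "EX c ep h. c : M & dt c y (\<f> M >< y) ep (localize M y) h & univ_arrow ?S T ?J y c ep" if y: "y : Ob" for y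
 proof -
  obtain c ep h where t: "dt c y (\<f> M >< y) ep (localize M y) h" using dt_fibre[OF l.eta[OF y]] by blast
  note D = dtD[OF t]
  have c: "c : M" using ts_unshift[OF ts D(11)] cone_inD[OF ts l.eta_cone[OF y] dt_rot[OF t]] by blast
  obtain x p q where t': "dt x c y p ep q" using dt_fibre[of ep c y] D by auto
  have "isomorphic T (\<f> M >< y) (Sh x)" using dt_cone_unique[OF t dt_rot[OF t']] .
  then have "Sh x : perp M" using ts_iso[OF perp_triangulated[OF ts_shift_closed[OF ts]] l.L_local[OF y]] by blast
  then have x: "x : perp M" using ts_unshift[OF perp_triangulated[OF ts_shift_closed[OF ts]]] dtD(11)[OF t'] by blast
  have "EX! u. u : Hom z c & ep ** u = ph" if z: "z : M" and phi: "ph : Hom z y" for z ph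
  proof (rule ex_ex1I)
   have "localize M y ** ph = zer T z (\<f> M >< y)" by (rule perpD[OF l.L_local[OF y] z]) (use phi D in simp)
   from dt_wker[OF t phi this] show "EX u. u : Hom z c & ep ** u = ph" by blast
   fix u u' assume u: "u : Hom z c & ep ** u = ph" and u': "u' : Hom z c & ep ** u' = ph"
   have s: "sub T u u' : Hom z c" using u u' by simp
   have "ep ** sub T u u' = zer T z y" using u u' D phi by (simp add: cmp_sub)
   then obtain v where v: "v : Hom z x" "p ** v = sub T u u'" using dt_wker[OF t' s] by blast
   then have "sub T u u' = zer T z c" using perpD[OF x z v(1)] dtD[OF t'] MT[OF z] by simp
   then show "u = u'" by (rule sub_eq_zerD) (use u u' in blast)+
  qed
  then have "EX! u. u : Mor ?S z c & ep ** u = ph" if "z : M" "ph : Hom z y" for z ph using that c unfolding SM by (simp del: in_Mor)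
  moreover have "ep : Hom c y" using D by simp
  ultimately have "univ_arrow ?S T ?J y c ep" unfolding univ_arrow_def S(1) using c by (simp del: in_Mor)
  then show ?thesis using c t by blast
 qed
 obtain c ep h where c: "c : M" "dt c (unit T) (\<f> M >< unit T) ep (localize M (unit T)) h" "univ_arrow ?S T ?J (unit T) c ep"
  using fib[OF unit_obj] by blast
 have "isomorphic ?S (\<e> M) c" unfolding left_idem_def acyclization_functor_def
  by (rule right_adjoint_isomorphic[OF S.category_axioms category_axioms J _ c(3) unit_obj]) (use fib in blast)
 then have i: "isomorphic T c (\<e> M)"
  using isomorphic_sym unfolding isomorphic_def is_iso_def inverse_arrows_def SM S by (force simp: full_subcat_def)
 show "\<e> M : M" by (rule ts_iso[OF ts c(1) i])
 show "isomorphic T (\<e> M >< X) X" if X: "X : M"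
 proof -
  have Xo: "X : Ob" by (rule MT[OF X])
  obtain h' where t: "dt (c >< X) (unit T >< X) ((\<f> M >< unit T) >< X) (ep ## idn T X) (localize M (unit T) ## idn T X) h'"
   using exact_dt[OF rtensor_exact[OF Xo] c(2)] by auto
  have "isomorphic T (\<f> M >< X) ((\<f> M >< unit T) >< X)"
   by (rule ten_isomorphic[OF isomorphic_sym[OF runit_isomorphic] isomorphic_refl]) (use M Xo in simp_all)
  then have "is_zero T ((\<f> M >< unit T) >< X)" using is_zero_isomorphic right_idem_zero_iff[OF M Xo] X by blast
  from dt_zero_iso[OF t this] have "isomorphic T (c >< X) (unit T >< X)" by (rule isomorphicI[rotated]) (use dtD[OF t] in simp)
  then show ?thesis using isomorphic_trans[OF ten_isomorphic[OF isomorphic_sym[OF i] isomorphic_refl[OF Xo]]]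
    isomorphic_trans[OF _ lunit_isomorphic[OF Xo]] by blast
 qed
qed

end

section \<open>Joins of smashing ideals and the objects \<open>\<Gamma>\<^sub>P\<close>\<close>

context big_tt_category begin

text \<open>A coproduct in the quotient is the image of one in \<open>T\<close>, which \<open>F\<close> preserves; the embedding \<open>E\<close> of the
  quotient then preserves it because \<open>E\<close> and \<open>F\<close> agree on morphisms of \<open>T\<close>.\<close>

lemma localization_smashing:
 assumes K: "localizing_ideal U T K" and l: "localization T K (fob F) \<eta>"
  and F: "is_functor T T F" "preserves_coproducts U T T F"
  and nat: "!!x y u. u : Hom x y ==> far F u ** \<eta> x = \<eta> y ** u"
 shows "smashing U T K"
proof -
 interpret l: localization T K "fob F" \<eta> by (rule l)
 have "is_coproduct T J (%j. fob F (X j)) (fob F c) (%j. l.E (io j))"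
  if J: "J \<subseteq> U" "J \<prec> U" and c: "is_coproduct l.N J X c io" for J X c io
 proof -
  note dc = l.N.is_coproductD[OF c]
  have "X ` J \<subseteq> Ob" using dc(5) by auto
  then obtain b ka where b: "is_coproduct T J X b ka" using coproducts[OF J] by blast
  note db = is_coproductD[OF b]
  have kM: "ka j : Hom (X j) b" if "j : J" for j using db(1) db(2-4)[OF that] by simp
  obtain th where th: "th : Mor l.N b c" "is_iso l.N th" and e: "!!j. j : J ==> cmp l.N th (qm K (ka j)) = io j"
   by (rule l.N.coproduct_unique[OF l.qm_coproduct[OF b] c]) blast
  have Ei: "l.E th : Hom (fob F b) (fob F c)" "is_iso T (l.E th)"
   using l.E_Mor[OF th(1)] functor_iso[OF l.N_category category_axioms l.E_functor th(2)] by simp_all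
  have "is_coproduct T J (%j. fob F (X j)) (fob F b) (%j. far F (ka j))" using F(2) J b unfolding preserves_coproducts_def by blast
  from coproduct_iso[OF this Ei] have r: "is_coproduct T J (%j. fob F (X j)) (fob F c) (%j. l.E th ** far F (ka j))" .
  have Eq: "l.E th ** far F (ka j) = l.E (io j)" if j: "j : J" for j
  proof -
   have q: "qm K (ka j) : Mor l.N (X j) b" by (rule l.E_qm(1)[OF kM[OF j]])
   have "far F (ka j) : Hom (fob F (X j)) (fob F b)" using functor_simps[OF F(1)] kM[OF j] by simp
   then have "l.E (qm K (ka j)) = far F (ka j)" by (rule l.eta_cancel[OF db(5)[OF j] l.L_local[OF db(1)] l.E_Mor[OF q]])
     (simp only: l.E_qm(2)[OF kM[OF j]] nat[OF kM[OF j]])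
   then show ?thesis using l.N_cmp(2)[OF q th(1)] e[OF j] by simp
  qed
  show ?thesis using r Eq unfolding is_coproduct_def by simp
 qed
 then show ?thesis unfolding smashing_def preserves_coproducts_def
  using K l.E_functor l.L_adjoint by (intro conjI exI[of _ "\<lparr>fob = fob F, far = l.E\<rparr>"]) simp_all
qed

text \<open>The join of \<open>P\<close> and \<open>Q\<close> is the kernel of \<open>f\<^sub>P \<otimes> f\<^sub>Q \<otimes> -\<close>.\<close>

lemma join_smashing:
 assumes P: "smashing U T P" and Q: "smashing U T Q"
 defines "K \<equiv> {X : Ob. \<f> Q >< X : P}"
 shows "smashing U T K" "P \<subseteq> K" "Q \<subseteq> K"
proof -
 interpret p: localization T P "%X. \<f> P >< X" "localize P" by (rule tensor_localization[OF P])
 interpret q: localization T Q "%X. \<f> Q >< X" "localize Q" by (rule tensor_localization[OF Q])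
 note tsP = smashing_ts[OF P] and tsQ = smashing_ts[OF Q]
 have o: "\<f> P : Ob" "\<f> Q : Ob" using P Q by simp_all
 show PK: "P \<subseteq> K" unfolding K_def using ideal_ten(1)[OF smashing_ideal[OF P] _ o(2)] ts_sub[OF tsP] by blast
 show QK: "Q \<subseteq> K" unfolding K_def using right_idem_zero_iff[OF Q] ts_zero[OF tsP] ts_sub[OF tsQ] by blast
 have locK: "localizing U T K" unfolding K_def
  using localizing_preimage[OF smashing_localizing[OF P] ltensor_exact[OF o(2)] ltensor_coproducts[OF o(2)]] by simp
 have "x >< s : K" if x: "x : Ob" and s: "s : K" for x s
 proof -
  have so: "s : Ob" "\<f> Q >< s : P" using s unfolding K_def by blast+
  have "\<f> Q >< (x >< s) : P" by (rule ts_iso[OF tsP ideal_ten(1)[OF smashing_ideal[OF P] so(2) x] swap_isomorphic[OF x o(2) so(1)]])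
  then show ?thesis using x so unfolding K_def by simp
 qed
 then have K: "localizing_ideal U T K" unfolding localizing_ideal_def using locK by blast
 note tsK = localizing_ts[OF locK]
 let ?F = "\<lparr>fob = %X. \<f> P >< (\<f> Q >< X), far = %u. idn T (\<f> P) ## (idn T (\<f> Q) ## u)\<rparr>"
 define \<eta> where "\<eta> X = localize P (\<f> Q >< X) ** localize Q X" for X
 have cm: "s : cone_in T P ==> s : cone_in T K" "s : cone_in T Q ==> s : cone_in T K" for s using PK QK unfolding cone_in_def by blast+
 show "smashing U T K"
 proof (rule localization_smashing[OF K])
  show "is_functor T T ?F" unfolding is_functor_def using o by (auto simp: ten_idn idn_ten_cmp)
  have "is_coproduct T J (%j. \<f> P >< (\<f> Q >< X j)) (\<f> P >< (\<f> Q >< c)) (%j. idn T (\<f> P) ## (idn T (\<f> Q) ## io j))"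
   if J: "J \<subseteq> U" "J \<prec> U" and c: "is_coproduct T J X c io" for J X c io
  proof -
   have "is_coproduct T J (%j. \<f> Q >< X j) (\<f> Q >< c) (%j. idn T (\<f> Q) ## io j)"
    using ltensor_coproducts[OF o(2)] J c unfolding preserves_coproducts_def tensor_functor_simps by blast
   then show ?thesis using ltensor_coproducts[OF o(1)] J unfolding preserves_coproducts_def tensor_functor_simps by blast
  qed
  then show "preserves_coproducts U T T ?F" unfolding preserves_coproducts_def by simp
  show "far ?F u ** \<eta> x = \<eta> y ** u" if u: "u : Hom x y" for x y u
  proof -
   have xy: "x : Ob" "y : Ob" using Mor_objs[OF u] by simp_all
   have u': "idn T (\<f> Q) ## u : Hom (\<f> Q >< x) (\<f> Q >< y)" using u o by simp
   have "far ?F u ** \<eta> x = ((idn T (\<f> P) ## (idn T (\<f> Q) ## u)) ** localize P (\<f> Q >< x)) ** localize Q x"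
    unfolding \<eta>_def using u o xy by simp
   also have "\<dots> = localize P (\<f> Q >< y) ** ((idn T (\<f> Q) ## u) ** localize Q x)" unfolding localize_natural[OF P u'] using u o xy by simp
   also have "\<dots> = \<eta> y ** u" unfolding localize_natural[OF Q u] \<eta>_def using u o xy by simp
   finally show ?thesis .
  qed
  show "localization T K (fob ?F) \<eta>"
  proof
   show "tsub K" by (rule tsK)
   fix x assume x: "x : Ob"
   then have fx: "\<f> Q >< x : Ob" using o by simp
   show "\<eta> x : Hom x (fob ?F x)" unfolding \<eta>_def using x o by simp
   show "\<eta> x : cone_in T K" unfolding \<eta>_def
    by (rule cone_in_cmp[OF tsK q.eta[OF x] p.eta[OF fx] cm(2)[OF q.eta_cone[OF x]] cm(1)[OF p.eta_cone[OF fx]]])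
   let ?z = "\<f> P >< (\<f> Q >< x)"
   have zP: "?z : perp P" by (rule p.L_local[OF fx])
   have zQ: "?z : perp Q" by (rule ts_iso[OF perp_triangulated[OF ts_shift_closed[OF tsQ]] q.L_local swap_isomorphic]) (use x o in simp_all)
   have "al = zer T s ?z" if s: "s : K" and al: "al : Hom s ?z" for s al
   proof -
    have so: "s : Ob" "\<f> Q >< s : P" using s unfolding K_def by blast+
    obtain g where g: "g : Hom (\<f> Q >< s) ?z" "g ** localize Q s = al" by (rule q.eta_extend[OF so(1) zQ al])
    have "g = zer T (\<f> Q >< s) ?z" by (rule perpD[OF zP so(2) g(1)])
    then show ?thesis using g(2) so x o by simp
   qed
   then show "fob ?F x : perp K" using o x unfolding perp_def by (simp del: in_Mor) blast
  qed
 qed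
qed

end

text \<open>For \<open>x \<in> ph S\<close> outside \<open>ph M\<close>, the complement of the closure of \<open>x\<close> is the largest open set that
  misses \<open>x\<close>, so the corresponding smashing ideal is prime.\<close>

lemma prime_separation:
 fixes T :: "('o, 'm, 'z) ttcat_scheme"
 assumes sp: "smashing_frame_spatial U T" and M: "smashing U T M" and S: "smashing U T S" "S \<subseteq> obj T" and ne: "~ S \<subseteq> M"
 obtains R where "R : Spcs U T" "M \<subseteq> R" "~ S \<subseteq> R"
proof -
 obtain X :: "'o set topology" and ph where bij: "bij_betw ph {S. smashing U T S} {V. openin X V}"
  and mono0: "ALL S S'. smashing U T S --> smashing U T S' --> (S \<subseteq> S' \<longleftrightarrow> ph S \<subseteq> ph S')"
  using sp unfolding smashing_frame_spatial_def by (elim exE conjE) (rule that)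
 note mono = mono0[rule_format]
 have op: "openin X (ph S)" if "smashing U T S" for S using bspec[OF bij_betwE[OF bij], of S] that by simp
 have sur: "EX S. smashing U T S & ph S = V" if "openin X V" for V
 proof -
  have "V : ph ` {S. smashing U T S}" unfolding bij_betw_imp_surj_on[OF bij] using that by simp
  then show ?thesis by (elim imageE) (rule exI, simp)
 qed
 obtain x where x: "x : ph S" "x ~: ph M" using mono[OF S(1) M] ne by blast
 define W where "W = topspace X - X closure_of {x}"
 have xt: "x : topspace X" using openin_subset[OF op[OF S(1)]] x(1) by blast
 have W: "openin X W" unfolding W_def by (rule openin_diff) simp_all
 have xW: "x ~: W" unfolding W_def using xt by (simp add: in_closure_of)
 have sub: "V \<subseteq> W \<longleftrightarrow> x ~: V" if V: "openin X V" for V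
 proof
  show "V \<subseteq> W ==> x ~: V" using xW by blast
  assume xV: "x ~: V"
  have "V \<inter> X closure_of {x} = {}" using openin_Int_closure_of_eq_empty[OF V, of "{x}"] xV by simp
  then show "V \<subseteq> W" using openin_subset[OF V] unfolding W_def by blast
 qed
 obtain R where R: "smashing U T R" "ph R = W" using sur[OF W] by blast
 have RM: "M \<subseteq> R" using mono[OF M R(1)] sub[OF op[OF M]] x(2) R(2) by blast
 have SR: "~ S \<subseteq> R" using mono[OF S(1) R(1)] x(1) xW R(2) by blast
 have "S1 \<subseteq> R | S2 \<subseteq> R" if s: "smashing U T S1" "smashing U T S2" and i: "S1 \<inter> S2 \<subseteq> R" for S1 S2
 proof -
  obtain S3 where S3: "smashing U T S3" "ph S3 = ph S1 \<inter> ph S2" using sur[OF openin_Int[OF op[OF s(1)] op[OF s(2)]]] by blast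
  have "S3 \<subseteq> R" using mono[OF S3(1) s(1)] mono[OF S3(1) s(2)] S3(2) i by blast
  then have "x ~: ph S1 \<inter> ph S2" using mono[OF S3(1) R(1)] R(2) S3(2) xW by blast
  then show ?thesis using mono[OF s(1) R(1)] mono[OF s(2) R(1)] sub[OF op[OF s(1)]] sub[OF op[OF s(2)]] R(2) by blast
 qed
 then have "R : Spcs U T" unfolding Spcs_def using R(1) SR S(2) by blast
 then show ?thesis using that RM SR by blast
qed

locale spatial_TD_category = big_tt_category U T
 for U :: "'u set" and T :: "('o, 'm, 'z) ttcat_scheme" (structure) +
 assumes spatial: "smashing_frame_spatial U T" and TD: "Spcs_TD U T"
begin

abbreviation "\<gamma> Q \<equiv> Gam U T Q"

lemma Spcs_smashing: "Q : Spcs U T ==> smashing U T Q" unfolding Spcs_def by blast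

lemma Gam_witness:
 assumes Q: "Q : Spcs U T"
 obtains S where "smashing U T S" "~ S \<subseteq> Q" "!!R. R : Spcs U T ==> Q \<subseteq> R ==> R ~= Q ==> S \<subseteq> R" "\<gamma> Q = \<e> S >< \<f> Q"
proof -
 let ?p = "%S. smashing U T S & {Q} = Spcs_open U T S \<inter> Spcs_closed U T Q"
 obtain S S' where S: "smashing U T S" "{Q} = Spcs_open U T S \<inter> Spcs_closed U T S'" using TD Q unfolding Spcs_TD_def by blast
 have "Q : Spcs_closed U T S'" using S(2) by blast
 then have "{Q} = Spcs_open U T S \<inter> Spcs_closed U T Q" using S(2) Q unfolding Spcs_closed_def by blast
 then have p: "?p (SOME S. ?p S)" using S(1) by (intro someI[of ?p]) blast
 then have "Q : Spcs_open U T (SOME S. ?p S)" by blast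
 then have 1: "~ (SOME S. ?p S) \<subseteq> Q" unfolding Spcs_open_def by blast
 have 2: "(SOME S. ?p S) \<subseteq> R" if "R : Spcs U T" "Q \<subseteq> R" "R ~= Q" for R
  using p that unfolding Spcs_open_def Spcs_closed_def by blast
 show ?thesis by (rule that[OF _ 1 2]) (use p in \<open>auto simp: Gam_def Let_def\<close>)
qed

lemma left_idem_obj: "smashing U T S ==> \<e> S : Ob"
 using left_idem(1) ts_sub[OF smashing_ts] by blast

lemma Gam_obj [simp]: assumes Q: "Q : Spcs U T" shows "\<gamma> Q : Ob"
proof -
 obtain S where "smashing U T S" "\<gamma> Q = \<e> S >< \<f> Q" by (rule Gam_witness[OF Q]) (rule that)
 then show ?thesis using left_idem_obj Spcs_smashing[OF Q] by simp
qed

lemma Gam_right_idem: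
 assumes P: "P : Spcs U T" and Q: "Q : Spcs U T" and PQ: "P \<subseteq> Q" shows "isomorphic T (\<gamma> Q) (\<f> P >< \<gamma> Q)"
proof -
 note s = Spcs_smashing[OF P] Spcs_smashing[OF Q]
 obtain S where S: "smashing U T S" "\<gamma> Q = \<e> S >< \<f> Q" by (rule Gam_witness[OF Q]) (rule that)
 have "\<e> S >< \<f> Q : perp Q" by (rule ts_iso[OF perp_triangulated[OF ts_shift_closed[OF smashing_ts[OF s(2)]]]
     local_ten[OF s(2) right_idem_arrow(1)[OF s(2)] left_idem_obj[OF S(1)]] braid_isomorphic])
   (use s left_idem_obj[OF S(1)] in simp_all)
 then have "\<gamma> Q : perp P" using PQ unfolding S(2) perp_def by blast
 then show ?thesis by (rule right_idem_local[OF s(1)])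
qed

text \<open>If \<open>P\<close> is not contained in \<open>Q\<close>, then the join of \<open>P\<close> and \<open>Q\<close> contains the ideal \<open>S\<close> that isolates
  \<open>Q\<close>: otherwise a prime containing the join, but not \<open>S\<close>, would have to be \<open>Q\<close>.\<close>

lemma Gam_right_idem_zero:
 assumes P: "P : Spcs U T" and Q: "Q : Spcs U T" and PQ: "~ P \<subseteq> Q" shows "is_zero T (\<f> P >< \<gamma> Q)"
proof -
 note s = Spcs_smashing[OF P] Spcs_smashing[OF Q]
 obtain S where S: "smashing U T S" "~ S \<subseteq> Q" "!!R. R : Spcs U T ==> Q \<subseteq> R ==> R ~= Q ==> S \<subseteq> R" "\<gamma> Q = \<e> S >< \<f> Q"
  using Gam_witness[OF Q] by blast
 let ?K = "{X : Ob. \<f> Q >< X : P}"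
 note K = join_smashing[OF s]
 have "S \<subseteq> ?K"
 proof (rule ccontr)
  assume "~ S \<subseteq> ?K"
  then obtain R where R: "R : Spcs U T" "?K \<subseteq> R" "~ S \<subseteq> R"
   using prime_separation[OF spatial K(1) S(1)] ts_sub[OF smashing_ts[OF S(1)]] by blast
  then have "R = Q" using S(3) K(3) by blast
  then show False using PQ K(2) R(2) by blast
 qed
 then have "\<f> Q >< \<e> S : P" using left_idem(1)[OF S(1)] by blast
 then have "\<e> S >< \<f> Q : P" by (rule ts_iso[OF smashing_ts[OF s(1)] _ braid_isomorphic]) (use s left_idem_obj[OF S(1)] in simp_all)
 then show ?thesis using right_idem_zero_iff[OF s(1) Gam_obj[OF Q]] S(4) by simp
qed

lemma Gam_ten_zero:
 assumes R: "R : Spcs U T" and Q: "Q : Spcs U T" and RQ: "~ R \<subseteq> Q" shows "is_zero T (\<gamma> R >< \<gamma> Q)"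
proof -
 obtain S where S: "smashing U T S" "\<gamma> R = \<e> S >< \<f> R" by (rule Gam_witness[OF R]) (rule that)
 note o = left_idem_obj[OF S(1)] right_idem_obj[OF Spcs_smashing[OF R]] Gam_obj[OF Q]
 have "is_zero T (\<e> S >< (\<f> R >< \<gamma> Q))" by (rule ten_zero(1)[OF Gam_right_idem_zero[OF R Q RQ] o(1)])
 from is_zero_isomorphic[OF this isomorphic_sym[OF assoc_isomorphic[OF o]]] show ?thesis unfolding S(2) .
qed

text \<open>Of two distinct primes one does not contain the other.\<close>

lemma Gam_orthogonal:
 assumes R: "R : Spcs U T" and Q: "Q : Spcs U T" and RQ: "R ~= Q" shows "is_zero T (\<gamma> R >< \<gamma> Q)"
proof (cases "R \<subseteq> Q")
 case True
 then have "is_zero T (\<gamma> Q >< \<gamma> R)" using Gam_ten_zero[OF Q R] RQ by blast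
 then show ?thesis by (rule is_zero_isomorphic[OF _ braid_isomorphic[OF Gam_obj[OF Q] Gam_obj[OF R]]])
qed (rule Gam_ten_zero[OF R Q])

text \<open>With \<open>\<Gamma>\<^sub>Q = e\<^sub>S \<otimes> f\<^sub>Q\<close>, both factors fix \<open>\<Gamma>\<^sub>Q\<close>: it lies in \<open>S\<close> and is local for \<open>Q\<close>.\<close>

lemma Gam_idempotent:
 assumes Q: "Q : Spcs U T" shows "isomorphic T (\<gamma> Q >< \<gamma> Q) (\<gamma> Q)"
proof -
 obtain S where S: "smashing U T S" "\<gamma> Q = \<e> S >< \<f> Q" by (rule Gam_witness[OF Q]) (rule that)
 note o = left_idem_obj[OF S(1)] right_idem_obj[OF Spcs_smashing[OF Q]] Gam_obj[OF Q]
 have "\<gamma> Q : S" unfolding S(2) by (rule ideal_ten(2)[OF smashing_ideal[OF S(1)] left_idem(1)[OF S(1)] o(2)])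
 from left_idem(2)[OF S(1) this] have 1: "isomorphic T (\<e> S >< \<gamma> Q) (\<gamma> Q)" .
 have 2: "isomorphic T (\<e> S >< (\<f> Q >< \<gamma> Q)) (\<e> S >< \<gamma> Q)"
  by (rule ten_isomorphic[OF isomorphic_refl[OF o(1)] isomorphic_sym[OF Gam_right_idem[OF Q Q order_refl]]])
 from isomorphic_trans[OF assoc_isomorphic[OF o] isomorphic_trans[OF 2 1]] show ?thesis unfolding S(2)[symmetric] .
qed

end

section \<open>Internal homs and colocalizing submodules\<close>

lemma regular_module_simps [simp]:
 "obj (regular_module U T) = obj T" "arr (regular_module U T) = arr T" "src (regular_module U T) = src T"
 "tgt (regular_module U T) = tgt T" "idn (regular_module U T) = idn T" "cmp (regular_module U T) = cmp T"
 "zer (regular_module U T) = zer T" "tri (regular_module U T) = tri T" "act (regular_module U T) = ltensor T"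
 "cogen (regular_module U T) = BC U T" by (simp_all add: regular_module_def tricat.defs ttmodule.defs)

context big_tt_category begin

abbreviation "ihom x a \<equiv> hom_star (regular_module U T) x a"

lemma regular_is_zero [simp]: "is_zero (regular_module U T) = is_zero T"
 by (simp add: is_zero_def fun_eq_iff)

lemma hom_universal:
 assumes o: "x : Ob" "a : Ob"
 shows "EX ep. univ_arrow T T (ltensor T x) a (ihom x a) ep"
proof -
 let ?R = "right_adjoint T T (ltensor T x)"
 have e: "ihom x a = fob ?R a" by (simp add: hom_star_def right_adjoint_def is_functor_def adjoint_def Mor_def)
 have "EX G. is_functor T T G & adjoint T T (ltensor T x) G" by (rule right_adjoint_exists[OF category_axioms category_axioms ltensor_functor[OF o(1)]
     coproduct_preserving_right_adjoint[OF ltensor_exact[OF o(1)] ltensor_coproducts[OF o(1)]]])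
 then have "is_functor T T ?R & adjoint T T (ltensor T x) ?R" unfolding right_adjoint_def by (rule someI_ex)
 then show ?thesis unfolding e using adjoint_univ_arrow[OF category_axioms category_axioms ltensor_functor[OF o(1)] _ _ o(2)] by blast
qed

lemma hom_universalE:
 assumes o: "x : Ob" "a : Ob"
 obtains ep where "ihom x a : Ob" "ep : Hom (x >< ihom x a) a"
  "!!z ph. z : Ob ==> ph : Hom (x >< z) a ==> EX u:Hom z (ihom x a). ep ** (idn T x ## u) = ph"
  "!!z u v. u : Hom z (ihom x a) ==> v : Hom z (ihom x a) ==> ep ** (idn T x ## u) = ep ** (idn T x ## v) ==> u = v"
proof -
 obtain ep where u: "univ_arrow T T (ltensor T x) a (ihom x a) ep" using hom_universal[OF o] by blast
 note u' = u[unfolded univ_arrow_def tensor_functor_simps]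
 note h = conjunct1[OF u'] conjunct1[OF conjunct2[OF u']] and un = conjunct2[OF conjunct2[OF u'], rule_format]
 show ?thesis
 proof (rule that[OF h])
  show "EX u:Hom z (ihom x a). ep ** (idn T x ## u) = ph" if "z : Ob" "ph : Hom (x >< z) a" for z ph
   using un[OF that] by (elim ex1E conjE) (rule bexI)
  fix z u v assume u: "u : Hom z (ihom x a)" and v: "v : Hom z (ihom x a)" and e: "ep ** (idn T x ## u) = ep ** (idn T x ## v)"
  have "ep ** (idn T x ## v) : Hom (x >< z) a" using v h o Mor_objs[OF u] by simp
  from un[OF conjunct1[OF Mor_objs[OF u]] this] u v e show "u = v" by (elim ex1E) metis
 qed
qed

lemma hom_obj [simp]: "x : Ob ==> a : Ob ==> ihom x a : Ob"
 using hom_universal unfolding univ_arrow_def by blast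

lemma hom_isomorphicI:
 assumes o: "x : Ob" "a : Ob" and r: "r : Ob" "ep : Hom (x >< r) a"
  and ex: "!!z ph. z : Ob ==> ph : Hom (x >< z) a ==> EX u:Hom z r. ep ** (idn T x ## u) = ph"
  and un: "!!z u v. z : Ob ==> u : Hom z r ==> v : Hom z r ==> ep ** (idn T x ## u) = ep ** (idn T x ## v) ==> u = v"
 shows "isomorphic T (ihom x a) r"
proof -
 obtain ep' where u: "univ_arrow T T (ltensor T x) a (ihom x a) ep'" using hom_universal[OF o] by blast
 have "EX! u. u : Hom z r & ep ** (idn T x ## u) = ph" if "z : Ob" "ph : Hom (x >< z) a" for z ph
 proof (rule ex_ex1I)
  show "EX u. u : Hom z r & ep ** (idn T x ## u) = ph" using ex[OF that] by blast
  show "u = v" if "u : Hom z r & ep ** (idn T x ## u) = ph" "v : Hom z r & ep ** (idn T x ## v) = ph" for u v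
   by (rule un[OF \<open>z : Ob\<close>]) (use that in simp_all)
 qed
 then have "univ_arrow T T (ltensor T x) a r ep" unfolding univ_arrow_def tensor_functor_simps using r by blast
 from univ_arrow_unique[OF category_axioms category_axioms ltensor_functor[OF o(1)] u this] show ?thesis .
qed

lemma hom_isomorphic_left:
 assumes i: "isomorphic T x x'" and a: "a : Ob" shows "isomorphic T (ihom x a) (ihom x' a)"
proof -
 obtain th th' where th: "th : Hom x x'" "th' : Hom x' x" "th' ** th = idn T x" "th ** th' = idn T x'" "x : Ob" "x' : Ob"
  by (rule isomorphicE[OF i]) (rule that)
 let ?h = "ihom x' a"
 obtain ep where h: "?h : Ob" and e: "ep : Hom (x' >< ?h) a"
  and ex: "!!z ph. z : Ob ==> ph : Hom (x' >< z) a ==> EX u:Hom z ?h. ep ** (idn T x' ## u) = ph"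
  and un: "!!z u v. u : Hom z ?h ==> v : Hom z ?h ==> ep ** (idn T x' ## u) = ep ** (idn T x' ## v) ==> u = v"
  using hom_universalE[OF th(6) a] by blast
 have inv: "(th' ## idn T z) ** (th ## idn T z) = idn T (x >< z)" "(th ## idn T z) ** (th' ## idn T z) = idn T (x' >< z)" if "z : Ob" for z
  using that th by (simp_all add: ten_idn_cmp[symmetric] ten_idn)
 have key: "ep ** (idn T x' ## u) = ((ep ** (th ## idn T ?h)) ** (idn T x ## u)) ** (th' ## idn T z)"
  and key2: "(ep ** (th ## idn T ?h)) ** (idn T x ## u) = (ep ** (idn T x' ## u)) ** (th ## idn T z)"
  if u: "u : Hom z ?h" for u z
 proof -
  have z: "z : Ob" using Mor_objs[OF u] by simp
  have x: "(th ## idn T ?h) ** (idn T x ## u) = (idn T x' ## u) ** (th ## idn T z)" using ten_exchange[OF th(1) u] ten_exchange'[OF th(1) u] by simp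
  have "(ep ** (th ## idn T ?h)) ** (idn T x ## u) = ep ** ((th ## idn T ?h) ** (idn T x ## u))" using u th e h by simp
  then show k2: "(ep ** (th ## idn T ?h)) ** (idn T x ## u) = (ep ** (idn T x' ## u)) ** (th ## idn T z)" unfolding x using u th e h z by simp
  show "ep ** (idn T x' ## u) = ((ep ** (th ## idn T ?h)) ** (idn T x ## u)) ** (th' ## idn T z)" unfolding k2 using u th e h z inv(2)[OF z] by simp
 qed
 show ?thesis
 proof (rule hom_isomorphicI[OF th(5) a h, of "ep ** (th ## idn T ?h)"])
  show "ep ** (th ## idn T ?h) : Hom (x >< ?h) a" using e th h by simp
  show "EX u:Hom z ?h. (ep ** (th ## idn T ?h)) ** (idn T x ## u) = ph" if z: "z : Ob" and p: "ph : Hom (x >< z) a" for z ph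
  proof -
   have "ph ** (th' ## idn T z) : Hom (x' >< z) a" using z p th by simp
   from ex[OF z this] obtain u where u: "u : Hom z ?h" "ep ** (idn T x' ## u) = ph ** (th' ## idn T z)" by blast
   have "(ph ** (th' ## idn T z)) ** (th ## idn T z) = ph" using z p th inv(1)[OF z] by simp
   then show ?thesis using key2[OF u(1)] u by (intro bexI[of _ u]) simp_all
  qed
  show "u = v" if "u : Hom z ?h" "v : Hom z ?h"
   "(ep ** (th ## idn T ?h)) ** (idn T x ## u) = (ep ** (th ## idn T ?h)) ** (idn T x ## v)" for z u v
   by (rule un[OF that(1,2)]) (simp only: key[OF that(1)] key[OF that(2)] that(3))
 qed
qed

lemma hom_isomorphic_right:
 assumes x: "x : Ob" and i: "isomorphic T a b" shows "isomorphic T (ihom x a) (ihom x b)"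
proof -
 obtain th th' where th: "th : Hom b a" "th' : Hom a b" "th' ** th = idn T b" "th ** th' = idn T a" "b : Ob" "a : Ob"
  by (rule isomorphicE[OF isomorphic_sym[OF i]]) (rule that)
 let ?h = "ihom x b"
 obtain ep where h: "?h : Ob" and e: "ep : Hom (x >< ?h) b"
  and ex: "!!z ph. z : Ob ==> ph : Hom (x >< z) b ==> EX u:Hom z ?h. ep ** (idn T x ## u) = ph"
  and un: "!!z u v. u : Hom z ?h ==> v : Hom z ?h ==> ep ** (idn T x ## u) = ep ** (idn T x ## v) ==> u = v" using hom_universalE[OF x th(5)] by blast
 have key: "ep ** (idn T x ## u) = th' ** ((th ** ep) ** (idn T x ## u))" if u: "u : Hom z ?h" for u z
  using u th e h x Mor_objs[OF u] by (simp add: pre_eq[OF th(3)])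
 show ?thesis
 proof (rule hom_isomorphicI[OF x th(6) h, of "th ** ep"])
  show "th ** ep : Hom (x >< ?h) a" using e th by simp
  show "EX u:Hom z ?h. (th ** ep) ** (idn T x ## u) = ph" if z: "z : Ob" and p: "ph : Hom (x >< z) a" for z ph
  proof -
   have "th' ** ph : Hom (x >< z) b" using p th by simp
   from ex[OF z this] obtain u where u: "u : Hom z ?h" "ep ** (idn T x ## u) = th' ** ph" by blast
   have "(th ** ep) ** (idn T x ## u) = th ** (ep ** (idn T x ## u))" using u(1) th e h x z by simp
   then have "(th ** ep) ** (idn T x ## u) = ph" unfolding u(2) using p th by (simp add: pre_eq[OF th(4)])
   then show ?thesis using u(1) by blast
  qed
  show "u = v" if "u : Hom z ?h" "v : Hom z ?h" "(th ** ep) ** (idn T x ## u) = (th ** ep) ** (idn T x ## v)" for z u v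
   by (rule un[OF that(1,2)]) (simp only: key[OF that(1)] key[OF that(2)] that(3))
 qed
qed

lemma hom_hom:
 assumes x: "x : Ob" and y: "y : Ob" and a: "a : Ob"
 shows "isomorphic T (ihom (y >< x) a) (ihom x (ihom y a))"
proof -
 let ?k = "ihom y a" and ?h = "ihom x (ihom y a)"
 obtain ep where k: "?k : Ob" and e: "ep : Hom (y >< ?k) a"
  and ex: "!!z ph. z : Ob ==> ph : Hom (y >< z) a ==> EX u:Hom z ?k. ep ** (idn T y ## u) = ph"
  and un: "!!z u v. u : Hom z ?k ==> v : Hom z ?k ==> ep ** (idn T y ## u) = ep ** (idn T y ## v) ==> u = v" using hom_universalE[OF y a] by blast
 obtain de where h: "?h : Ob" and d: "de : Hom (x >< ?h) ?k"
  and dex: "!!z ph. z : Ob ==> ph : Hom (x >< z) ?k ==> EX u:Hom z ?h. de ** (idn T x ## u) = ph"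
  and dun: "!!z u v. u : Hom z ?h ==> v : Hom z ?h ==> de ** (idn T x ## u) = de ** (idn T x ## v) ==> u = v" using hom_universalE[OF x k] by blast
 let ?e = "ep ** ((idn T y ## de) ** assoc T y x ?h)"
 have key: "?e ** (idn T (y >< x) ## u) = (ep ** (idn T y ## (de ** (idn T x ## u)))) ** assoc T y x z" if u: "u : Hom z ?h" for u z
 proof -
  have z: "z : Ob" using Mor_objs[OF u] by simp
  have "?e ** (idn T (y >< x) ## u) = ep ** ((idn T y ## de) ** (assoc T y x ?h ** ((idn T y ## idn T x) ## u)))"
   using u e d h x y a z by (simp add: ten_idn)
  also have "assoc T y x ?h ** ((idn T y ## idn T x) ## u) = (idn T y ## (idn T x ## u)) ** assoc T y x z"
   by (rule assoc_natural) (use u x y in simp_all)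
  finally show ?thesis using u e d h x y a z k by (simp add: idn_ten_cmp)
 qed
 have inv: "EX b:Hom (y >< (x >< z)) ((y >< x) >< z). b ** assoc T y x z = idn T ((y >< x) >< z) & assoc T y x z ** b = idn T (y >< (x >< z))"
  if z: "z : Ob" for z using is_isoE[OF conjunct2[OF assoc_iso[OF y x z]] conjunct1[OF assoc_iso[OF y x z]]] by metis
 show ?thesis
 proof (rule hom_isomorphicI[OF _ a h, of _ ?e])
  show "y >< x : Ob" using x y by simp
  show "?e : Hom ((y >< x) >< ?h) a" using e d h x y by simp
  show "EX u:Hom z ?h. ?e ** (idn T (y >< x) ## u) = ph" if z: "z : Ob" and p: "ph : Hom ((y >< x) >< z) a" for z ph
  proof -
   obtain b where b: "b : Hom (y >< (x >< z)) ((y >< x) >< z)" "b ** assoc T y x z = idn T ((y >< x) >< z)" using inv[OF z] by blast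
   have xz: "x >< z : Ob" and pb: "ph ** b : Hom (y >< (x >< z)) a" using x z p b by simp_all
   obtain v where v: "v : Hom (x >< z) ?k" "ep ** (idn T y ## v) = ph ** b" using ex[OF xz pb] by blast
   obtain u where u: "u : Hom z ?h" "de ** (idn T x ## u) = v" using dex[OF z v(1)] by blast
   have "?e ** (idn T (y >< x) ## u) = ph" unfolding key[OF u(1)] u(2) v(2) using p b x y z by simp
   then show ?thesis using u(1) by blast
  qed
  show "u = v" if z: "z : Ob" and u: "u : Hom z ?h" and v: "v : Hom z ?h"
   and eq: "?e ** (idn T (y >< x) ## u) = ?e ** (idn T (y >< x) ## v)" for z u v
  proof -
   obtain b where b: "b : Hom (y >< (x >< z)) ((y >< x) >< z)" "assoc T y x z ** b = idn T (y >< (x >< z))" using inv[OF z] by blast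
   have w: "de ** (idn T x ## w) : Hom (x >< z) ?k" if "w : Hom z ?h" for w using that d x h by simp
   have "ep ** (idn T y ## (de ** (idn T x ## w))) = (?e ** (idn T (y >< x) ## w)) ** b" if ww: "w : Hom z ?h" for w
    unfolding key[OF ww] using w[OF ww] e b x y z k by simp
   then show ?thesis using dun[OF u v un[OF w[OF u] w[OF v]]] u v eq by metis
  qed
 qed
qed

lemma hom_swap:
 assumes o: "x : Ob" "y : Ob" "a : Ob" shows "isomorphic T (ihom x (ihom y a)) (ihom y (ihom x a))"
 by (rule isomorphic_trans[OF isomorphic_sym[OF hom_hom]
    isomorphic_trans[OF hom_isomorphic_left[OF braid_isomorphic] hom_hom]]) (rule o)+

text \<open>The common source of vanishing: maps \<open>s \<rightarrow> [x, a]\<close> are maps \<open>x \<otimes> s \<rightarrow> a\<close>.\<close>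

lemma hom_perp:
 assumes o: "x : Ob" "a : Ob" and S: "S \<subseteq> Ob" and z: "!!s ph. s : S ==> ph : Hom (x >< s) a ==> ph = zer T (x >< s) a"
 shows "ihom x a : perp S"
proof -
 obtain ep where h: "ihom x a : Ob" and e: "ep : Hom (x >< ihom x a) a"
  and ex: "!!z ph. z : Ob ==> ph : Hom (x >< z) a ==> EX u:Hom z (ihom x a). ep ** (idn T x ## u) = ph"
  and un: "!!z u v. u : Hom z (ihom x a) ==> v : Hom z (ihom x a) ==> ep ** (idn T x ## u) = ep ** (idn T x ## v) ==> u = v"
  using hom_universalE[OF o] by blast
 have "u = zer T s (ihom x a)" if s: "s : S" and u: "u : Hom s (ihom x a)" for s u
 proof (rule un[OF u])
  have so: "s : Ob" using s S by blast
  show zM: "zer T s (ihom x a) : Hom s (ihom x a)" using so h by simp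
  have "ep ** (idn T x ## w) : Hom (x >< s) a" if "w : Hom s (ihom x a)" for w using that e o h by simp
  from z[OF s this] show "ep ** (idn T x ## u) = ep ** (idn T x ## zer T s (ihom x a))" using u zM by metis
 qed
 then show ?thesis unfolding perp_def using h by blast
qed

lemma hom_local:
 assumes M: "localizing_ideal U T M" and x: "x : Ob" and a: "a : perp M" shows "ihom x a : perp M"
proof (rule hom_perp[OF x perp_obj[OF a]])
 show "M \<subseteq> Ob" using M localizing_ts ts_sub unfolding localizing_ideal_def by blast
 show "ph = zer T (x >< s) a" if "s : M" "ph : Hom (x >< s) a" for s ph by (rule perpD[OF a ideal_ten(1)[OF M that(1) x] that(2)])
qed

lemma hom_zero:
 assumes o: "x : Ob" "a : Ob" and z: "is_zero T x | is_zero T a" shows "is_zero T (ihom x a)"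
proof (rule orth_zero[of _ "Ob"])
 show "ihom x a : perp (Ob)"
 proof (rule hom_perp[OF o order_refl])
  fix s ph assume s: "s : Ob" and p: "ph : Hom (x >< s) a"
  from z show "ph = zer T (x >< s) a"
  proof
   assume "is_zero T x" from from_zero[OF ten_zero(2)[OF this s] p] show ?thesis .
  next
   assume "is_zero T a" from to_zero[OF this p] show ?thesis .
  qed
 qed
qed (use o in simp)

lemma hom_right_idem_local:
 assumes M: "smashing U T M" and a: "a : Ob" shows "ihom (\<f> M) a : perp M"
proof (rule hom_perp[OF _ a])
 show "M \<subseteq> Ob" using ts_sub[OF smashing_ts[OF M]] by blast
 fix s ph assume s: "s : M" and p: "ph : Hom (\<f> M >< s) a"
 have "is_zero T (\<f> M >< s)" using right_idem_zero_iff[OF M ts_sub[OF smashing_ts[OF M] s]] s by blast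
 from from_zero[OF this p] show "ph = zer T (\<f> M >< s) a" .
qed (use M in simp)

lemma hom_right_idem:
 assumes M: "smashing U T M" and a: "a : perp M" shows "isomorphic T (ihom (\<f> M) a) a"
proof -
 interpret l: localization T M "%X. \<f> M >< X" "localize M" by (rule tensor_localization[OF M])
 have ao: "a : Ob" by (rule perp_obj[OF a])
 obtain ep where e: "ep : Hom (\<f> M >< a) a" "ep ** localize M a = idn T a" using is_isoE[OF l.eta_local_iso[OF a] l.eta[OF ao]] by metis
 have key: "(ep ** (idn T (\<f> M) ## u)) ** localize M z = u" if u: "u : Hom z a" for u z
 proof -
  have z: "z : Ob" using Mor_objs[OF u] by simp
  have "(ep ** (idn T (\<f> M) ## u)) ** localize M z = ep ** ((idn T (\<f> M) ## u) ** localize M z)" using u e(1) z M by simp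
  also have "\<dots> = (ep ** localize M a) ** u" unfolding localize_natural[OF M u] using u e(1) ao by simp
  finally show ?thesis using u e(2) by simp
 qed
 show ?thesis
 proof (rule hom_isomorphicI[OF _ ao ao e(1)])
  fix z assume z: "z : Ob"
  show "EX u:Hom z a. ep ** (idn T (\<f> M) ## u) = ph" if p: "ph : Hom (\<f> M >< z) a" for ph
  proof
   show u: "ph ** localize M z : Hom z a" using p z by simp
   show "ep ** (idn T (\<f> M) ## (ph ** localize M z)) = ph" by (rule l.eta_cancel[OF z a _ p]) (use e(1) u M in simp, rule key[OF u])
  qed
  show "u = v" if "u : Hom z a" "v : Hom z a" "ep ** (idn T (\<f> M) ## u) = ep ** (idn T (\<f> M) ## v)" for u v
   by (rule trans[OF sym[OF key[OF that(1)]] trans[OF arg_cong[OF that(3), of "%w. w ** localize M z"] key[OF that(2)]]])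
 qed (use M in simp)
qed

lemma hom_triangle:
 assumes x: "x : Ob" and t: "dt a b c f g h"
 shows "EX f' g' h' W. dt (ihom x a) (ihom x b) W f' g' h' & isomorphic T W (ihom x c)"
proof -
 note D = dtD(11-13)[OF t]
 obtain p q r where u: "univ_arrow T T (ltensor T x) a (ihom x a) p" "univ_arrow T T (ltensor T x) b (ihom x b) q"
  "univ_arrow T T (ltensor T x) c (ihom x c) r"
  using hom_universal[OF x D(1)] hom_universal[OF x D(2)] hom_universal[OF x D(3)] by (elim exE) (rule that)
 from right_adjoint_triangle[OF ltensor_exact[OF x] t u] show ?thesis by blast
qed

lemma hom_product:
 assumes x: "x : Ob" and p: "is_product T J A p pr"
 shows "EX pr'. is_product T J (%j. ihom x (A j)) (ihom x p) pr'"
proof -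
 note d = is_productD[OF p]
 obtain ep where h: "ihom x p : Ob" and e: "ep : Hom (x >< ihom x p) p"
  and ex: "!!z ph. z : Ob ==> ph : Hom (x >< z) p ==> EX u:Hom z (ihom x p). ep ** (idn T x ## u) = ph"
  and un: "!!z u v. u : Hom z (ihom x p) ==> v : Hom z (ihom x p) ==> ep ** (idn T x ## u) = ep ** (idn T x ## v) ==> u = v"
  using hom_universalE[OF x d(1)] by blast
 have "EX de rh. de : Hom (x >< ihom x (A j)) (A j) & rh : Hom (ihom x p) (ihom x (A j)) & de ** (idn T x ## rh) = pr j ** ep &
  (ALL z u v. u : Hom z (ihom x (A j)) --> v : Hom z (ihom x (A j)) --> de ** (idn T x ## u) = de ** (idn T x ## v) --> u = v)"
  if j: "j : J" for j
 proof -
  have m: "pr j ** ep : Hom (x >< ihom x p) (A j)" using e d(2-4)[OF j] by simp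
  obtain de where "ihom x (A j) : Ob" "de : Hom (x >< ihom x (A j)) (A j)"
   "!!z ph. z : Ob ==> ph : Hom (x >< z) (A j) ==> EX u:Hom z (ihom x (A j)). de ** (idn T x ## u) = ph"
   "!!z u v. u : Hom z (ihom x (A j)) ==> v : Hom z (ihom x (A j)) ==> de ** (idn T x ## u) = de ** (idn T x ## v) ==> u = v"
   using hom_universalE[OF x d(5)[OF j]] by blast
  note D = this
  obtain rh where "rh : Hom (ihom x p) (ihom x (A j))" "de ** (idn T x ## rh) = pr j ** ep" using D(3)[OF h m] by blast
  then show ?thesis using D(2,4) by (intro exI[of _ de] exI[of _ rh] conjI allI impI) blast+
 qed
 then obtain de rh where D: "!!j. j : J ==> de j : Hom (x >< ihom x (A j)) (A j)" "!!j. j : J ==> rh j : Hom (ihom x p) (ihom x (A j))"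
  "!!j. j : J ==> de j ** (idn T x ## rh j) = pr j ** ep"
  "!!j z u v. j : J ==> u : Hom z (ihom x (A j)) ==> v : Hom z (ihom x (A j)) ==>
   de j ** (idn T x ## u) = de j ** (idn T x ## v) ==> u = v" by metis
 have key: "de j ** (idn T x ## (rh j ** u)) = pr j ** (ep ** (idn T x ## u))" if j: "j : J" and u: "u : Hom z (ihom x p)" for j u z
 proof -
  have "de j ** (idn T x ## (rh j ** u)) = (de j ** (idn T x ## rh j)) ** (idn T x ## u)"
   using D(1)[OF j] D(2)[OF j] u x Mor_objs[OF D(2)[OF j]] by (simp add: idn_ten_cmp)
  then show ?thesis unfolding D(3)[OF j] using d(2-4)[OF j] e u x h by simp
 qed
 have "is_product T J (%j. ihom x (A j)) (ihom x p) rh"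
 proof (rule is_productI[OF h D(2)])
  fix z assume z: "z : Ob"
  show "EX u:Hom z (ihom x p). ALL j:J. rh j ** u = ps j" if psi: "!!j. j : J ==> ps j : Hom z (ihom x (A j))" for ps
  proof -
   have "de j ** (idn T x ## ps j) : Hom (x >< z) (A j)" if "j : J" for j using D(1)[OF that] psi[OF that] x by simp
   then obtain w where w: "w : Hom (x >< z) p" "!!j. j : J ==> pr j ** w = de j ** (idn T x ## ps j)"
    using product_map[OF p, of "x >< z" "%j. de j ** (idn T x ## ps j)"] x z ten_obj by metis
   obtain u where u: "u : Hom z (ihom x p)" "ep ** (idn T x ## u) = w" using ex[OF z w(1)] by blast
   have "rh j ** u = ps j" if j: "j : J" for j
   proof (rule D(4)[OF j _ psi[OF j]])
    show "rh j ** u : Hom z (ihom x (A j))" using D(2)[OF j] u(1) by simp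
    show "de j ** (idn T x ## (rh j ** u)) = de j ** (idn T x ## ps j)" unfolding key[OF j u(1)] u(2) by (rule w(2)[OF j])
   qed
   then show ?thesis using u(1) by blast
  qed
  show "u = v" if u: "u : Hom z (ihom x p)" and v: "v : Hom z (ihom x p)" and eq: "!!j. j : J ==> rh j ** u = rh j ** v" for u v
  proof (rule un[OF u v], rule product_eq[OF p])
   show "ep ** (idn T x ## u) : Hom (x >< z) p" "ep ** (idn T x ## v) : Hom (x >< z) p" using u v e x h by simp_all
   show "pr j ** (ep ** (idn T x ## u)) = pr j ** (ep ** (idn T x ## v))" if j: "j : J" for j
    unfolding key[OF j u, symmetric] key[OF j v, symmetric] eq[OF j] ..
  qed
 qed
 then show ?thesis by blast
qed

abbreviation "submod D \<equiv> hom_submodule U T (regular_module U T) D"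
abbreviation "gen A \<equiv> coloc U T (regular_module U T) A"

lemma submod_iff:
 "submod D \<longleftrightarrow> tsub D &
  (ALL J A p pr. J \<subseteq> U --> J \<prec> U --> A ` J \<subseteq> D --> is_product T J A p pr --> p : D) & (ALL x:Ob. ALL a:D. ihom x a : D)"
 by (simp add: hom_submodule_def triangulated_subcat_def is_product_def Mor_def)

lemma submod_ts: "submod D ==> tsub D"
 and submod_product: "submod D ==> J \<subseteq> U ==> J \<prec> U ==> A ` J \<subseteq> D ==> is_product T J A p pr ==> p : D"
 and submod_hom: "submod D ==> x : Ob ==> a : D ==> ihom x a : D"
 and submod_obj: "submod D ==> a : D ==> a : Ob" unfolding submod_iff using ts_sub by blast+

lemma submod_iso: "submod D ==> isomorphic T a b ==> a : D \<longleftrightarrow> b : D"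
 using ts_iso[OF submod_ts] isomorphic_sym by blast

lemma submod_all: "submod (Ob)"
 unfolding submod_iff using ts_obj is_productD(1) by (auto simp: hom_obj)

lemma submod_Inter:
 assumes ne: "\<D> ~= {}" and D: "!!D. D : \<D> ==> submod D" shows "submod (\<Inter>\<D>)" unfolding submod_iff
proof (intro conjI allI impI ballI)
 show "tsub (\<Inter>\<D>)"
 proof (rule triangulated_subcatI)
  show "\<Inter>\<D> \<subseteq> Ob" using ne submod_obj[OF D] by blast
  show "z : \<Inter>\<D>" if "is_zero T z" for z using ts_zero[OF submod_ts[OF D] that] by blast
  fix x y z f g h assume t: "dt x y z f g h"
  show "z : \<Inter>\<D>" if "x \<in> \<Inter>\<D>" "y \<in> \<Inter>\<D>" using ts_third[OF submod_ts[OF D] t] that by blast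
  show "x : \<Inter>\<D>" if "y \<in> \<Inter>\<D>" "z \<in> \<Inter>\<D>" using ts_first[OF submod_ts[OF D] t] that by blast
  show "y : \<Inter>\<D>" if "x \<in> \<Inter>\<D>" "z \<in> \<Inter>\<D>" using ts_second[OF submod_ts[OF D] t] that by blast
 qed
 show "p : \<Inter>\<D>" if J: "J \<subseteq> U" "J \<prec> U" "A ` J \<subseteq> \<Inter>\<D>" and p: "is_product T J A p pr" for J A p pr
 proof
  fix X assume X: "X : \<D>"
  then have "A ` J \<subseteq> X" using J(3) by blast
  from submod_product[OF D[OF X] J(1,2) this p] show "p : X" .
 qed
 show "ihom x a : \<Inter>\<D>" if "x \<in> Ob" "a : \<Inter>\<D>" for x a using submod_hom[OF D that(1)] that(2) by blast
qed

lemma gen_submod: assumes A: "A \<subseteq> Ob" shows "submod (gen A)"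
 unfolding coloc_def by (rule submod_Inter) (use submod_all A in blast)+

lemma gen_sub: "A \<subseteq> gen A" and gen_least: "submod D ==> A \<subseteq> D ==> gen A \<subseteq> D"
 unfolding coloc_def by blast+

lemma gen_isomorphic:
 assumes i: "isomorphic T a b" shows "gen {a} = gen {b}" unfolding coloc_def using submod_iso[OF _ i] by simp blast

text \<open>This closure property drives all later arguments: \<open>[y, -]\<close> is exact, preserves products and commutes with
  every \<open>[x, -]\<close>, so what holds for a generator passes to all that it generates.\<close>

lemma submod_preimage:
 assumes D: "submod D" and y: "y : Ob" shows "submod {a : Ob. ihom y a : D}" unfolding submod_iff
proof (intro conjI allI impI ballI)
 note ts = submod_ts[OF D]
 show "tsub {a : Ob. ihom y a : D}"
 proof (rule triangulated_subcatI)
  show "z : {a : Ob. ihom y a : D}" if "is_zero T z" for z using ts_zero[OF ts hom_zero[OF y is_zeroD[OF that]]] that is_zeroD[OF that] by simp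
  fix a b c f g h assume t: "dt a b c f g h"
  note d = dtD(11-13)[OF t]
  obtain f' g' h' W where t': "dt (ihom y a) (ihom y b) W f' g' h'" "isomorphic T W (ihom y c)" using hom_triangle[OF y t] by blast
  note w = submod_iso[OF D t'(2)]
  show "c : {a : Ob. ihom y a : D}" if "a : {a : Ob. ihom y a : D}" "b : {a : Ob. ihom y a : D}" using ts_third[OF ts t'(1)] that d w by blast
  show "a : {a : Ob. ihom y a : D}" if "b : {a : Ob. ihom y a : D}" "c : {a : Ob. ihom y a : D}" using ts_first[OF ts t'(1)] that d w by blast
  show "b : {a : Ob. ihom y a : D}" if "a : {a : Ob. ihom y a : D}" "c : {a : Ob. ihom y a : D}" using ts_second[OF ts t'(1)] that d w by blast
 qed blast
 show "p : {a : Ob. ihom y a : D}"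
  if J: "J \<subseteq> U" "J \<prec> U" "A ` J \<subseteq> {a : Ob. ihom y a : D}" and p: "is_product T J A p pr" for J A p pr
 proof -
  obtain pr' where "is_product T J (%j. ihom y (A j)) (ihom y p) pr'" using hom_product[OF y p] by blast
  moreover have "(%j. ihom y (A j)) ` J \<subseteq> D" using J(3) by blast
  ultimately show ?thesis using submod_product[OF D J(1,2)] is_productD(1)[OF p] by blast
 qed
 show "ihom x a : {a : Ob. ihom y a : D}" if x: "x : Ob" and a: "a : {a : Ob. ihom y a : D}" for x a
  using submod_hom[OF D x, of "ihom y a"] submod_iso[OF D hom_swap[OF x y, of a]] a x y by simp
qed

text \<open>The zero objects are the right orthogonal of \<open>T\<close>, and lie in every submodule.\<close>

lemma submod_zeros: "submod {a. is_zero T a}"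
proof -
 have "submod (\<Inter>{D. submod D})" by (rule submod_Inter) (use submod_all in blast)+
 moreover have "\<Inter>{D. submod D} = {a. is_zero T a}"
 proof
  show "{a. is_zero T a} \<subseteq> \<Inter>{D. submod D}" using ts_zero[OF submod_ts] by blast
  obtain z where z: "is_zero T z" using zero_object by blast
  have e: "perp (Ob) = {a. is_zero T a}" using orth_zero perp_obj to_zero is_zeroD unfolding perp_def by blast
  have "submod (perp (Ob))" unfolding submod_iff
  proof (intro conjI allI impI ballI)
   show "tsub (perp (Ob))" by (rule perp_triangulated[OF ts_shift_closed[OF ts_obj]])
   show "p : perp (Ob)" if "A ` J \<subseteq> perp (Ob)" "is_product T J A p pr" for J A p pr by (rule perp_product[OF that(2,1) order_refl])
   show "ihom x a : perp (Ob)" if "x : Ob" "a : perp (Ob)" for x a using hom_zero[OF that(1)] that(2) is_zeroD unfolding e by blast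
  qed
  then show "\<Inter>{D. submod D} \<subseteq> {a. is_zero T a}" unfolding e by blast
 qed
 ultimately show ?thesis by simp
qed

lemma submod_perp: assumes M: "smashing U T M" shows "submod (perp M)"
 unfolding submod_iff
proof (intro conjI allI impI ballI)
 show "tsub (perp M)" by (rule perp_triangulated[OF ts_shift_closed[OF smashing_ts[OF M]]])
 show "p : perp M" if "A ` J \<subseteq> perp M" "is_product T J A p pr" for J A p pr
  using perp_product[OF that(2,1)] ts_sub[OF smashing_ts[OF M]] by blast
qed (rule hom_local[OF smashing_ideal[OF M]])

text \<open>The local objects are generated by \<open>[f, I]\<close>, since \<open>[f, -]\<close> fixes them and \<open>I\<close> generates everything.\<close>

lemma gen_BC: "gen {I} = Ob"
 by (rule BC_cogenerates[OF submod_ts[OF gen_submod] submod_product[OF gen_submod]])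
  (use BC_obj gen_sub[of "{I}"] in simp_all)

lemma gen_perp: assumes M: "smashing U T M" shows "perp M = gen {ihom (\<f> M) I}"
proof
 have f: "\<f> M : Ob" using M by simp
 have s: "submod (gen {ihom (\<f> M) I})" by (rule gen_submod) (use f BC_obj in simp)
 have "gen {I} \<subseteq> {a : Ob. ihom (\<f> M) a : gen {ihom (\<f> M) I}}"
  by (rule gen_least[OF submod_preimage[OF s f]]) (use BC_obj gen_sub[of "{ihom (\<f> M) I}"] in simp)
 then have "ihom (\<f> M) a : gen {ihom (\<f> M) I}" if "a : Ob" for a using that unfolding gen_BC by blast
 then show "perp M \<subseteq> gen {ihom (\<f> M) I}" using submod_iso[OF s hom_right_idem[OF M]] perp_obj by blast
 show "gen {ihom (\<f> M) I} \<subseteq> perp M" by (rule gen_least[OF submod_perp[OF M]]) (use hom_right_idem_local[OF M BC_obj] in simp)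
qed

end

section \<open>Costratification relative to a submodule\<close>

lemma costratified_iff:
 "costratified U T N \<longleftrightarrow>
  (ALL W. W \<subseteq> cosupp U T N (cogen N) --> hom_submodule U T N {a : obj N. cosupp U T N a \<subseteq> W} &
    (\<Union>a\<in>{a : obj N. cosupp U T N a \<subseteq> W}. cosupp U T N a) = W) &
  (ALL C. hom_submodule U T N C --> (\<Union>a\<in>C. cosupp U T N a) \<subseteq> cosupp U T N (cogen N) &
    {a : obj N. cosupp U T N a \<subseteq> (\<Union>a\<in>C. cosupp U T N a)} = C)"
 by (simp only: costratified_def Let_def image_subset_iff Ball_def Pow_iff mem_Collect_eq imp_conjR all_conj_distrib conj_ac)

context spatial_TD_category begin

abbreviation "cs a \<equiv> cosupp U T (regular_module U T) a"

definition minimal where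
 "minimal D \<longleftrightarrow> (ALL C. submod C --> C \<subseteq> D --> C = {a. is_zero T a} | C = D)"

abbreviation "supported X W \<equiv> {a : X. cs a \<subseteq> W}"
abbreviation "total_cs C \<equiv> \<Union>a\<in>C. cs a"

text \<open>Costratification of the submodule \<open>X\<close>, with \<open>c\<close> in the role of \<open>I\<close>.\<close>

definition costratifies where
 "costratifies X c \<longleftrightarrow>
  (ALL W. W \<subseteq> cs c --> submod (supported X W) & total_cs (supported X W) = W) &
  (ALL C. submod C --> C \<subseteq> X --> total_cs C \<subseteq> cs c & supported X (total_cs C) = C)"

lemma cs_iff: "Q : cs a \<longleftrightarrow> Q : Spcs U T & ~ is_zero T (ihom (\<gamma> Q) a)"
 by (simp add: cosupp_def)

lemma cs_isomorphic: assumes i: "isomorphic T a b" shows "cs a = cs b"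
proof -
 have "is_zero T (ihom (\<gamma> Q) a) \<longleftrightarrow> is_zero T (ihom (\<gamma> Q) b)" if "Q : Spcs U T" for Q
  using is_zero_isomorphic hom_isomorphic_right[OF Gam_obj[OF that]] i isomorphic_sym by blast
 then show ?thesis unfolding cosupp_def by auto
qed

lemma annihilator_submod: "y : Ob ==> submod {a : Ob. is_zero T (ihom y a)}"
 using submod_preimage[OF submod_zeros] by simp

lemma ihom_Gam_idempotent:
 assumes Q: "Q : Spcs U T" and a: "a : Ob" shows "isomorphic T (ihom (\<gamma> Q) (ihom (\<gamma> Q) a)) (ihom (\<gamma> Q) a)"
 by (rule isomorphic_trans[OF isomorphic_sym[OF hom_hom] hom_isomorphic_left[OF Gam_idempotent]]) (use assms in simp_all)

text \<open>\<open>[\<Gamma>\<^sub>R, [\<Gamma>\<^sub>Q, a]] = [\<Gamma>\<^sub>Q \<otimes> \<Gamma>\<^sub>R, a]\<close> vanishes for \<open>R \<noteq> Q\<close>, and vanishing under \<open>[\<Gamma>\<^sub>R, -]\<close>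
  passes to the submodule generated.\<close>

lemma cs_gen_Gam:
 assumes Q: "Q : Spcs U T" and a: "a : Ob" and b: "b : gen {ihom (\<gamma> Q) a}" shows "cs b \<subseteq> {Q}"
proof
 fix R assume R: "R : cs b"
 then have Rs: "R : Spcs U T" by (simp add: cs_iff)
 show "R : {Q}"
 proof (rule ccontr)
  assume "R ~: {Q}"
  then have "is_zero T (ihom (\<gamma> Q >< \<gamma> R) a)" using hom_zero[OF _ a] Gam_orthogonal[OF Q Rs] Q Rs by simp
  from is_zero_isomorphic[OF this hom_hom] have "is_zero T (ihom (\<gamma> R) (ihom (\<gamma> Q) a))" using Q Rs a by simp
  then have "gen {ihom (\<gamma> Q) a} \<subseteq> {b : Ob. is_zero T (ihom (\<gamma> R) b)}"
   by (intro gen_least annihilator_submod) (use Q Rs a in simp_all)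
  then show False using b R by (auto simp: cs_iff)
 qed
qed

lemma cs_zeros: "total_cs {a. is_zero T a} = {}"
 using hom_zero Gam_obj is_zeroD by (auto simp: cs_iff)

text \<open>A submodule of \<open>coloc [\<Gamma>\<^sub>Q, c]\<close> has cosupport \<open>{}\<close> or \<open>{Q}\<close>, and costratification recovers
  it from its cosupport.\<close>

lemma costratifies_minimal:
 assumes X: "submod X" and c: "c : X" and co: "costratifies X c" and Q: "Q : Spcs U T"
 shows "minimal (gen {ihom (\<gamma> Q) c})" unfolding minimal_def
proof (intro allI impI)
 let ?M = "gen {ihom (\<gamma> Q) c}"
 fix C assume C: "submod C" "C \<subseteq> ?M"
 have co': "supported X (total_cs C) = C" if "submod C" "C \<subseteq> X" for C
  by (rule conjunct2[OF conjunct2[OF co[unfolded costratifies_def], rule_format, OF that]])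
 have cO: "c : Ob" by (rule submod_obj[OF X c])
 have M: "submod ?M" by (rule gen_submod) (use Q cO in simp)
 have MX: "?M \<subseteq> X" by (rule gen_least[OF X]) (use submod_hom[OF X Gam_obj[OF Q] c] in simp)
 have ZX: "{a. is_zero T a} \<subseteq> X" using ts_zero[OF submod_ts[OF X]] by blast
 have "total_cs ?M \<subseteq> {Q}" using cs_gen_Gam[OF Q cO] by blast
 moreover have "total_cs C \<subseteq> total_cs ?M" using C(2) by blast
 moreover have two: "B = {} | B = A" if "A \<subseteq> {Q}" "B \<subseteq> A" for A B :: "'o set set" using that by blast
 ultimately have "total_cs C = total_cs {a. is_zero T a} | total_cs C = total_cs ?M" unfolding cs_zeros by (intro two)
 then show "C = {a. is_zero T a} | C = ?M"
 proof (elim disjE)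
  assume "total_cs C = total_cs {a. is_zero T a}"
  then have "supported X (total_cs C) = supported X (total_cs {a. is_zero T a})" by (rule arg_cong)
  then show ?thesis unfolding co'[OF C(1) order_trans[OF C(2) MX]] co'[OF submod_zeros ZX] ..
 next
  assume "total_cs C = total_cs ?M"
  then have "supported X (total_cs C) = supported X (total_cs ?M)" by (rule arg_cong)
  then show ?thesis unfolding co'[OF C(1) order_trans[OF C(2) MX]] co'[OF M MX] ..
 qed
qed

text \<open>The point is to recover a submodule \<open>C\<close> from its cosupport. If \<open>Q\<close> is in the cosupport of some
  \<open>b \<in> C\<close>, then \<open>[\<Gamma>\<^sub>Q, b]\<close> is a nonzero object of the minimal submodule \<open>coloc [\<Gamma>\<^sub>Q, c]\<close>, which is
  therefore contained in \<open>C\<close>. Hence \<open>C\<close> contains \<open>[\<Gamma>\<^sub>Q, a]\<close> for all \<open>Q\<close> as soon as the cosupport of \<open>a\<close>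
  lies in that of \<open>C\<close>; the colocal-to-global principle then gives \<open>a \<in> C\<close>.\<close>

lemma minimal_costratifies:
 assumes X: "X = gen {c}" and c: "c : Ob"
  and local_global: "!!a. a : Ob ==> gen {a} = gen {ihom (\<gamma> Q) a | Q. Q : Spcs U T}"
  and min: "!!Q. Q : Spcs U T ==> minimal (gen {ihom (\<gamma> Q) c})"
 shows "costratifies X c"
proof -
 have sX: "submod X" unfolding X by (rule gen_submod) (use c in simp)
 have cX: "c : X" unfolding X using gen_sub[of "{c}"] by simp
 have XO: "X \<subseteq> Ob" using submod_obj[OF sX] by blast
 have below: "cs a \<subseteq> cs c" if a: "a : X" for a
 proof
  fix R assume R: "R : cs a"
  show "R : cs c"
  proof (rule ccontr)
   assume n: "R ~: cs c"
   then have "X \<subseteq> {b : Ob. is_zero T (ihom (\<gamma> R) b)}" unfolding X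
    by (intro gen_least annihilator_submod) (use R c in \<open>simp_all add: cs_iff\<close>)
   then show False using a R by (auto simp: cs_iff)
  qed
 qed
 have sup: "submod (supported X W)" for W
 proof -
  have e: "supported X W = \<Inter>(insert X {{a \<in> Ob. is_zero T (ihom (\<gamma> R) a)} | R. R : Spcs U T - W})"
   using XO unfolding cosupp_def by auto
  show ?thesis unfolding e
  proof (rule submod_Inter)
   fix D assume "D : insert X {{a : Ob. is_zero T (ihom (\<gamma> R) a)} | R. R : Spcs U T - W}"
   then show "submod D" using sX annihilator_submod[OF Gam_obj] by blast
  qed simp
 qed
 have full: "total_cs (supported X W) = W" if W: "W \<subseteq> cs c" for W
 proof
  show "W \<subseteq> total_cs (supported X W)"
  proof
   fix Q assume QW: "Q : W"
   then have Q: "Q : Spcs U T" "~ is_zero T (ihom (\<gamma> Q) c)" using W by (auto simp: cs_iff)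
   let ?b = "ihom (\<gamma> Q) c"
   have "cs ?b \<subseteq> {Q}" by (rule cs_gen_Gam[OF Q(1) c]) (use gen_sub in blast)
   moreover have "?b : X" by (rule submod_hom[OF sX Gam_obj[OF Q(1)] cX])
   moreover have "Q : cs ?b" using is_zero_isomorphic[OF _ ihom_Gam_idempotent[OF Q(1) c]] Q by (auto simp: cs_iff)
   ultimately show "Q : total_cs (supported X W)" using QW by blast
  qed
 qed blast
 have inv: "supported X (total_cs C) = C" if C: "submod C" "C \<subseteq> X" for C
 proof
  show "C \<subseteq> supported X (total_cs C)" using C(2) by blast
  show "supported X (total_cs C) \<subseteq> C"
  proof
   fix a assume "a : supported X (total_cs C)"
   then have a: "a : X" "cs a \<subseteq> total_cs C" "a : Ob" using XO by blast+
   have point: "ihom (\<gamma> Q) x : gen {ihom (\<gamma> Q) c}" if Q: "Q : Spcs U T" and x: "x : X" for Q x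
   proof -
    have s: "submod (gen {ihom (\<gamma> Q) c})" by (rule gen_submod) (use Q c in simp)
    have "X \<subseteq> {x : Ob. ihom (\<gamma> Q) x : gen {ihom (\<gamma> Q) c}}" unfolding X
     by (rule gen_least[OF submod_preimage[OF s Gam_obj[OF Q]]]) (use c gen_sub[of "{ihom (\<gamma> Q) c}"] in simp)
    then show ?thesis using x by blast
   qed
   have "ihom (\<gamma> Q) a : C" if Q: "Q : Spcs U T" for Q
   proof (cases "is_zero T (ihom (\<gamma> Q) a)")
    case True then show ?thesis by (rule ts_zero[OF submod_ts[OF C(1)]])
   next
    case False
    then obtain b where b: "b : C" "Q : cs b" using a(2) Q by (auto simp: cs_iff)
    let ?B = "gen {ihom (\<gamma> Q) b}"
    have bC: "ihom (\<gamma> Q) b : C" by (rule submod_hom[OF C(1) Gam_obj[OF Q] b(1)])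
    have sB: "submod ?B" by (rule gen_submod) (use submod_obj[OF C(1) bC] in simp)
    have "?B \<subseteq> gen {ihom (\<gamma> Q) c}" by (rule gen_least[OF gen_submod]) (use Q c point[OF Q] b(1) C(2) in auto)
    moreover have "?B ~= {a. is_zero T a}" using b(2) gen_sub[of "{ihom (\<gamma> Q) b}"] by (auto simp: cs_iff)
    ultimately have "?B = gen {ihom (\<gamma> Q) c}" using min[OF Q] sB unfolding minimal_def by blast
    then have "ihom (\<gamma> Q) a : ?B" using point[OF Q a(1)] by simp
    moreover have "?B \<subseteq> C" by (rule gen_least[OF C(1)]) (use bC in simp)
    ultimately show ?thesis by blast
   qed
   then have "gen {ihom (\<gamma> Q) a | Q. Q : Spcs U T} \<subseteq> C" by (intro gen_least[OF C(1)]) blast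
   then show "a : C" using local_global[OF a(3)] gen_sub[of "{a}"] by blast
  qed
 qed
 have tot: "total_cs C \<subseteq> cs c" if "C \<subseteq> X" for C using below that by blast
 show ?thesis unfolding costratifies_def by (intro conjI allI impI) (rule sup, rule full, assumption, rule tot, assumption, rule inv, assumption+)
qed

lemma cominimality_regular: "cominimality U T (regular_module U T) \<longleftrightarrow> (ALL Q:Spcs U T. minimal (gen {ihom (\<gamma> Q) I}))"
 by (simp add: cominimality_def minimal_def)

lemma costratified_regular: "costratified U T (regular_module U T) \<longleftrightarrow> costratifies (Ob) I"
proof -
 have "(submod C --> C \<subseteq> Ob --> ph) \<longleftrightarrow> (submod C --> ph)" for C ph using submod_obj by blast
 then show ?thesis by (simp only: costratified_iff costratifies_def regular_module_simps)
qed

end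

section \<open>Submodules of the quotients\<close>

lemma quotient_module_simps [simp]:
 "obj (quotient_module U T M) = obj (verdier T M)" "arr (quotient_module U T M) = arr (verdier T M)"
 "src (quotient_module U T M) = src (verdier T M)" "tgt (quotient_module U T M) = tgt (verdier T M)"
 "idn (quotient_module U T M) = idn (verdier T M)" "cmp (quotient_module U T M) = cmp (verdier T M)"
 "zer (quotient_module U T M) = zer (verdier T M)" "tri (quotient_module U T M) = tri (verdier T M)"
 "act (quotient_module U T M) = (%x. \<lparr>fob = fob (ltensor T x), far = frac_map T M (far (ltensor T x))\<rparr>)"
 "cogen (quotient_module U T M) = fob (ellfun T M) (BC U T)" by (simp_all add: quotient_module_def tricat.defs ttmodule.defs)

locale prime_quotient = spatial_TD_category U T
 for U :: "'u set" and T :: "('o, 'm, 'z) ttcat_scheme" (structure) +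
 fixes P :: "'o set"
 assumes prime: "P : Spcs U T"
begin

abbreviation "f \<equiv> \<f> P"
abbreviation "N \<equiv> verdier T P"
abbreviation "NM \<equiv> quotient_module U T P"
abbreviation "qsubmod D \<equiv> hom_submodule U T NM D"

lemmas sm = Spcs_smashing[OF prime]

interpretation l: localization T P "%X. f >< X" "localize P" by (rule tensor_localization[OF sm])

lemma f_obj: "f : Ob" using sm by simp

lemma local_f: "x : Ob ==> f >< x : perp P" by (rule l.L_local)

lemma local_iso_f: "x : perp P ==> isomorphic T (f >< x) x"
 by (rule isomorphic_sym[OF right_idem_local[OF sm]])

lemma N_zero: "is_zero NM a \<longleftrightarrow> a : Ob & is_zero T (f >< a)"
proof -
 have "is_zero NM a \<longleftrightarrow> is_zero N a" unfolding is_zero_def by simp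
 then show ?thesis using l.N_zero_iff right_idem_zero_iff[OF sm] ts_sub[OF smashing_ts[OF sm]] by blast
qed

text \<open>The internal hom of the quotient is computed on local representatives.\<close>

lemma quotient_hom:
 assumes x: "x : Ob" and a: "a : Ob"
 shows "isomorphic N (hom_star NM x a) (ihom x (f >< a))"
proof -
 let ?A = "\<lparr>fob = fob (ltensor T x), far = frac_map T P (far (ltensor T x))\<rparr>"
 have e: "hom_star NM x a = fob (right_adjoint N N ?A) a" by (simp add: hom_star_def right_adjoint_def is_functor_def adjoint_def Mor_def)
 have FS: "fob (ltensor T x) s : P" if "s : P" for s using ideal_ten(1)[OF smashing_ideal[OF sm] that x] by simp
 have u: "EX ep. univ_arrow N N ?A b (ihom x (f >< b)) ep" if b: "b : Ob" for b
  using hom_universal[OF x, of "f >< b"] l.induced_univ_arrow[OF ltensor_exact[OF x] FS b] b f_obj by auto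
 obtain ep where ua: "univ_arrow N N ?A a (ihom x (f >< a)) ep" using u[OF a] by blast
 have ex: "EX r ep. univ_arrow N N ?A b r ep" if "b : obj N" for b using u[of b] that by auto
 show ?thesis unfolding e by (rule right_adjoint_isomorphic[OF l.N_category l.N_category l.induced_functor(1)[OF ltensor_exact[OF x] FS] ex ua])
   (use a in simp_all)
qed

lemma quotient_hom_local:
 assumes x: "x : Ob" and a: "a : Ob"
 shows "hom_star NM x a : Ob" "isomorphic T (f >< hom_star NM x a) (ihom x (f >< a))"
proof -
 note i = quotient_hom[OF x a]
 show o: "hom_star NM x a : Ob" using l.N.isomorphic_objs[OF i] by simp
 have h: "ihom x (f >< a) : Ob" using x a f_obj by simp
 have "isomorphic T (f >< hom_star NM x a) (f >< ihom x (f >< a))" using i l.N_isomorphic_iff[OF o h] by simp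
 then show "isomorphic T (f >< hom_star NM x a) (ihom x (f >< a))"
  by (rule isomorphic_trans[OF _ local_iso_f[OF hom_local[OF smashing_ideal[OF sm] x local_f[OF a]]]])
qed

text \<open>The right adjoint of \<open>k\<close> is represented by \<open>[f, -]\<close>: for local \<open>y\<close>, maps \<open>y \<rightarrow> a\<close> are maps
  \<open>f \<otimes> y \<rightarrow> a\<close>.\<close>

lemma quotient_cogen:
 shows "cogen NM : Ob" "isomorphic T (f >< cogen NM) (ihom f I)"
proof -
 note ts = smashing_ts[OF sm]
 let ?k = "kfun T P"
 have "is_functor N T ?k & adjoint T N (quot_functor T P) ?k"
  unfolding kfun_def right_adjoint_def by (rule someI_ex, intro exI conjI, rule l.E_functor, rule l.L_adjoint)
 then have k: "is_functor N T ?k" "adjoint T N (quot_functor T P) ?k" by blast+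
 have thick: "c : P" if "d : P" "i : Hom c d" "r : Hom d c" "r ** i = idn T c" for c d i r
  by (rule localizing_retract[OF smashing_localizing[OF sm] that])
 have ua: "EX ep. univ_arrow N T ?k a (ihom f a) ep" if a: "a : Ob" for a
 proof (rule right_adjoint_localizes[OF ts thick k])
  fix \<eta> assume eta: "!!y. y : Ob ==> \<eta> y : Hom y (fob ?k y)" "!!y. y : Ob ==> \<eta> y : cone_in T P"
   "!!y. y : Ob ==> fob ?k y : perp P"
   and rel: "!!s g. (s, g) : roofs T P ==> far ?k (frac T P s g) ** (\<eta> (tgt T s) ** s) = \<eta> (tgt T g) ** g"
  interpret k: localization T P "fob ?k" \<eta> by unfold_locales (use ts eta in blast)+
  have agree: "k.E u = far ?k u" if u: "u : Mor N x y" for u x y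
  proof -
   obtain s g where r: "(s, g) : roofs T P" "u = frac T P s g" "tgt T s = x" "tgt T g = y" by (rule verdier_arrE[OF u]) (rule that)
   have "far ?k u : Hom (fob ?k x) (fob ?k y)" using functor_simps(3-5)[OF k(1)] u by simp
   then show ?thesis unfolding r(2) by (intro k.E_eqI[OF r(1)]) (use r rel[OF r(1)] in simp_all)
  qed
  let ?r = "ihom f a"
  obtain ep where h: "?r : Ob" and e: "ep : Hom (f >< ?r) a"
   and ex: "!!z ph. z : Ob ==> ph : Hom (f >< z) a ==> EX u:Hom z ?r. ep ** (idn T f ## u) = ph"
   and un: "!!z u v. u : Hom z ?r ==> v : Hom z ?r ==> ep ** (idn T f ## u) = ep ** (idn T f ## v) ==> u = v"
   using hom_universalE[OF f_obj a] by blast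
  have key: "(ep ** localize P ?r) ** u = (ep ** (idn T f ## u)) ** localize P y" if u: "u : Hom y ?r" for u y
  proof -
   have y: "y : Ob" using Mor_objs[OF u] by simp
   have "(ep ** localize P ?r) ** u = ep ** (localize P ?r ** u)" using u e h by simp
   then show ?thesis unfolding localize_natural[OF sm u, symmetric] using u e h y f_obj by simp
  qed
  have "EX ep'. univ_arrow N T \<lparr>fob = fob ?k, far = k.E\<rparr> a ?r ep'"
  proof (rule k.embedding_univ_arrow)
   show "?r : perp P" by (rule hom_right_idem_local[OF sm a])
   show "ep ** localize P ?r : Hom ?r a" using e h by simp
   fix y ph assume y: "y : perp P" and p: "ph : Hom y a"
   have yo: "y : Ob" by (rule perp_obj[OF y])
   obtain \<eta>' where i: "\<eta>' : Hom (f >< y) y" "\<eta>' ** localize P y = idn T y" "localize P y ** \<eta>' = idn T (f >< y)"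
    by (rule is_isoE[OF l.eta_local_iso[OF y] l.eta[OF yo]]) (rule that)
   show "EX! u. u : Hom y ?r & (ep ** localize P ?r) ** u = ph"
   proof (rule ex_ex1I)
    have "ph ** \<eta>' : Hom (f >< y) a" using p i(1) by simp
    from ex[OF yo this] obtain u where u: "u : Hom y ?r" "ep ** (idn T f ## u) = ph ** \<eta>'" by blast
    have "(ph ** \<eta>') ** localize P y = ph" using p i(1,2) yo by simp
    then show "EX u. u : Hom y ?r & (ep ** localize P ?r) ** u = ph" using u key[OF u(1)] by metis
    fix u v assume u: "u : Hom y ?r & (ep ** localize P ?r) ** u = ph" and v: "v : Hom y ?r & (ep ** localize P ?r) ** v = ph"
    have "ep ** (idn T f ## w) = ph ** \<eta>'" if w: "w : Hom y ?r" "(ep ** localize P ?r) ** w = ph" for w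
    proof -
     have "ph ** \<eta>' = ((ep ** (idn T f ## w)) ** localize P y) ** \<eta>'" using key[OF w(1)] w(2) by simp
     also have "\<dots> = (ep ** (idn T f ## w)) ** (localize P y ** \<eta>')" using w(1) e h f_obj yo i(1) by simp
     finally show ?thesis unfolding i(3) using w(1) e h f_obj by simp
    qed
    then show "u = v" using un u v by metis
   qed
  qed
  then obtain ep' where "univ_arrow N T \<lparr>fob = fob ?k, far = k.E\<rparr> a ?r ep'" by blast
  then have "univ_arrow N T ?k a ?r ep'" unfolding univ_arrow_def using agree by (simp cong: conj_cong)
  then show ?thesis by blast
 qed
 obtain ep where uI: "univ_arrow N T ?k I (ihom f I) ep" using ua[OF BC_obj] by blast
 have i: "isomorphic N (cogen NM) (ihom f I)" unfolding quotient_module_simps ellfun_def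
  by (rule right_adjoint_isomorphic[OF l.N_category category_axioms k(1) _ uI BC_obj]) (use ua in blast)
 show o: "cogen NM : Ob" using l.N.isomorphic_objs[OF i] by simp
 have h: "ihom f I : Ob" using f_obj BC_obj by simp
 have "isomorphic T (f >< cogen NM) (f >< ihom f I)" using i l.N_isomorphic_iff[OF o h] by simp
 then show "isomorphic T (f >< cogen NM) (ihom f I)" by (rule isomorphic_trans[OF _ local_iso_f[OF hom_right_idem_local[OF sm BC_obj]]])
qed

lemma qsubmod_iff:
 "qsubmod C \<longleftrightarrow> triangulated_subcat N C &
  (ALL J A p pr. J \<subseteq> U --> J \<prec> U --> A ` J \<subseteq> C --> is_product N J A p pr --> p : C) & (ALL x:Ob. ALL a:C. hom_star NM x a : C)"
 by (simp add: hom_submodule_def triangulated_subcat_def is_product_def Mor_def is_zero_def)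

text \<open>These are mutually inverse bijections between the submodules of \<open>T / P\<close> and the
  submodules of \<open>T\<close> that consist of local objects.\<close>

abbreviation "locals C \<equiv> C \<inter> perp P"
abbreviation "pullback D \<equiv> {x : Ob. f >< x : D}"

lemma qsubmod_obj: "qsubmod C ==> x : C ==> x : Ob"
 unfolding qsubmod_iff triangulated_subcat_def by auto

lemma qsubmod_iso: "qsubmod C ==> isomorphic N x y ==> x : C \<longleftrightarrow> y : C"
 unfolding qsubmod_iff using l.N_replete[of C] l.N.isomorphic_sym by blast

lemma qsubmod_f: "qsubmod C ==> x : Ob ==> x : C \<longleftrightarrow> f >< x : C"
 using qsubmod_iso l.N_isomorphic_L by blast

lemma locals_submod: assumes C: "qsubmod C" shows "submod (locals C)"
 unfolding submod_iff
proof (intro conjI allI impI ballI)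
 note C' = C[unfolded qsubmod_iff l.N_triangulated_iff]
 have tri: "dt x y z f' g h ==> (x : C & y : C --> z : C) & (y : C & z : C --> x : C) & (x : C & z : C --> y : C)"
  for x y z f' g h by (rule conjunct2[OF conjunct2[OF conjunct2[OF conjunct1[OF C']]], THEN spec, THEN spec, THEN spec, THEN spec,
     THEN spec, THEN spec, THEN mp])
 note PC = conjunct1[OF conjunct2[OF conjunct1[OF C']]] conjunct1[OF conjunct1[OF C']]
 have ro: "tsub (perp P)" by (rule perp_triangulated[OF ts_shift_closed[OF smashing_ts[OF sm]]])
 show "tsub (locals C)"
 proof (rule triangulated_subcatI)
  show "z : locals C" if "is_zero T z" for z using ts_zero[OF ro that] ts_zero[OF smashing_ts[OF sm] that] PC(1) by blast
  fix x y z f' g h assume t: "dt x y z f' g h"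
  show "z : locals C" if "x : locals C" "y : locals C" using ts_third[OF ro t] tri[OF t] that by blast
  show "x : locals C" if "y : locals C" "z : locals C" using ts_first[OF ro t] tri[OF t] that by blast
  show "y : locals C" if "x : locals C" "z : locals C" using ts_second[OF ro t] tri[OF t] that by blast
 qed (use PC in blast)
 show "p : locals C" if J: "J \<subseteq> U" "J \<prec> U" "A ` J \<subseteq> locals C" and p: "is_product T J A p pr" for J A p pr
 proof
  have A: "A ` J \<subseteq> C" "A ` J \<subseteq> perp P" using J(3) by blast+
  show "p : C" by (rule conjunct1[OF conjunct2[OF C'], rule_format, OF J(1,2) A(1) l.local_product[OF p A(2)]])
  show "p : perp P" by (rule perp_product[OF p A(2)]) (use ts_sub[OF smashing_ts[OF sm]] in blast)
 qed
 show "ihom x a : locals C" if x: "x : Ob" and a: "a : locals C" for x a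
 proof
  have ao: "a : Ob" "a : perp P" "a : C" using a PC by blast+
  show loc: "ihom x a : perp P" by (rule hom_local[OF smashing_ideal[OF sm] x ao(2)])
  have "hom_star NM x a : C" using conjunct2[OF conjunct2[OF C']] x ao(3) by blast
  then have "ihom x (f >< a) : C" using qsubmod_iso[OF C quotient_hom[OF x ao(1)]] by blast
  then show "ihom x a : C" using qsubmod_iso[OF C l.isomorphic_imp_N[OF hom_isomorphic_right[OF x local_iso_f[OF ao(2)]]]] by blast
 qed
qed

lemma pullback_qsubmod: assumes D: "submod D" shows "qsubmod (pullback D)"
 unfolding qsubmod_iff l.N_triangulated_iff
proof (intro conjI allI impI ballI)
 note ts = submod_ts[OF D]
 show "P \<subseteq> pullback D" using right_idem_zero_iff[OF sm] ts_zero[OF ts] ts_sub[OF smashing_ts[OF sm]] by blast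
 show "y : pullback D" if "x : pullback D" "isomorphic N x y" for x y
  using that l.N_isomorphic_iff[of x y] l.N.isomorphic_objs[OF that(2)] submod_iso[OF D] by auto
 fix x y z f' g h assume t: "dt x y z f' g h"
 obtain h' where t': "dt (f >< x) (f >< y) (f >< z) (idn T f ## f') (idn T f ## g) h'" using exact_dt[OF ltensor_exact[OF f_obj] t] by auto
 note d = dtD(11-13)[OF t]
 show "z : pullback D" if "x : pullback D & y : pullback D" using ts_third[OF ts t'] that d by blast
 show "x : pullback D" if "y : pullback D & z : pullback D" using ts_first[OF ts t'] that d by blast
 show "y : pullback D" if "x : pullback D & z : pullback D" using ts_second[OF ts t'] that d by blast
next
 show "p : pullback D" if J: "J \<subseteq> U" "J \<prec> U" "A ` J \<subseteq> pullback D" and p: "is_product N J A p pr" for J A p pr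
 proof -
  have "(%j. f >< A j) ` J \<subseteq> D" using J(3) by blast
  then have "f >< p : D" using submod_product[OF D J(1,2) _ l.E_product[OF p]] by blast
  then show ?thesis using l.N.is_productD(1)[OF p] by simp
 qed
 show "hom_star NM x a : pullback D" if x: "x : Ob" and a: "a : pullback D" for x a
 proof -
  have ao: "a : Ob" "f >< a : D" using a by blast+
  show ?thesis using submod_iso[OF D quotient_hom_local(2)[OF x ao(1)]] submod_hom[OF D x ao(2)] quotient_hom_local(1)[OF x ao(1)] by blast
 qed
qed blast

lemma pullback_locals: assumes C: "qsubmod C" shows "pullback (locals C) = C"
 using qsubmod_f[OF C] qsubmod_obj[OF C] local_f by blast

lemma locals_pullback: assumes D: "submod D" "D \<subseteq> perp P" shows "locals (pullback D) = D"
 using submod_iso[OF D(1) local_iso_f] submod_obj[OF D(1)] D(2) perp_obj by blast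

lemma coloc_quotient: assumes a: "a : Ob" shows "coloc U T NM {a} = pullback (gen {f >< a})"
proof
 have s: "submod (gen {f >< a})" by (rule gen_submod) (use a f_obj in simp)
 show "coloc U T NM {a} \<subseteq> pullback (gen {f >< a})"
  unfolding coloc_def[of U T NM] using pullback_qsubmod[OF s] gen_sub[of "{f >< a}"] a by blast
 show "pullback (gen {f >< a}) \<subseteq> coloc U T NM {a}" unfolding coloc_def[of U T NM]
 proof (rule Inter_greatest)
  fix C assume "C : {C. qsubmod C & {a} \<subseteq> C}"
  then have C: "qsubmod C" "a : C" by blast+
  then have "{f >< a} \<subseteq> locals C" using qsubmod_f[OF C(1) a] local_f[OF a] by blast
  from gen_least[OF locals_submod[OF C(1)] this] show "pullback (gen {f >< a}) \<subseteq> C" using pullback_locals[OF C(1)] by blast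
 qed
qed

lemma minimal_pullback:
 assumes D: "submod D" "D \<subseteq> perp P"
 shows "(ALL C. qsubmod C --> C \<subseteq> pullback D --> C = {a. is_zero NM a} | C = pullback D) \<longleftrightarrow> minimal D"
proof -
 have Z: "{a. is_zero NM a} = pullback {a. is_zero T a}" using N_zero by blast
 have ZP: "{a. is_zero T a} \<subseteq> perp P" using ts_zero[OF perp_triangulated[OF ts_shift_closed[OF smashing_ts[OF sm]]]] by blast
 show ?thesis unfolding minimal_def Z
 proof (intro iffI allI impI)
  fix C assume h: "ALL C. qsubmod C --> C \<subseteq> pullback D --> C = pullback {a. is_zero T a} | C = pullback D" and C: "submod C" "C \<subseteq> D"
  have "pullback C \<subseteq> pullback D" using C(2) by blast
  then have "pullback C = pullback {a. is_zero T a} | pullback C = pullback D" using h pullback_qsubmod[OF C(1)] by blast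
  note lp = locals_pullback[OF C(1) order_trans[OF C(2) D(2)]]
  show "C = {a. is_zero T a} | C = D" using \<open>pullback C = _ | _\<close>
  proof (elim disjE)
   assume "pullback C = pullback {a. is_zero T a}"
   then have "locals (pullback C) = locals (pullback {a. is_zero T a})" by (rule arg_cong)
   then show ?thesis unfolding lp locals_pullback[OF submod_zeros ZP] ..
  next
   assume "pullback C = pullback D"
   then have "locals (pullback C) = locals (pullback D)" by (rule arg_cong)
   then show ?thesis unfolding lp locals_pullback[OF D] ..
  qed
 next
  fix C assume h: "ALL C. submod C --> C \<subseteq> D --> C = {a. is_zero T a} | C = D" and C: "qsubmod C" "C \<subseteq> pullback D"
  have "locals C \<subseteq> D" using C(2) locals_pullback[OF D] by blast
  then have "locals C = {a. is_zero T a} | locals C = D" using h locals_submod[OF C(1)] by blast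
  then show "C = pullback {a. is_zero T a} | C = pullback D" using pullback_locals[OF C(1)] by auto
 qed
qed

lemma cominimality_quotient: "cominimality U T NM \<longleftrightarrow> (ALL Q:Spcs U T. minimal (gen {ihom (\<gamma> Q) (ihom f I)}))"
proof -
 have "(ALL C. qsubmod C --> C \<subseteq> coloc U T NM {hom_star NM (\<gamma> Q) (cogen NM)} -->
    C = {a. is_zero NM a} | C = coloc U T NM {hom_star NM (\<gamma> Q) (cogen NM)}) \<longleftrightarrow> minimal (gen {ihom (\<gamma> Q) (ihom f I)})"
  if Q: "Q : Spcs U T" for Q
 proof -
  let ?G = "hom_star NM (\<gamma> Q) (cogen NM)" and ?H = "ihom (\<gamma> Q) (ihom f I)"
  note q = quotient_hom_local[OF Gam_obj[OF Q] quotient_cogen(1)]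
  have i: "isomorphic T (f >< ?G) ?H" by (rule isomorphic_trans[OF q(2) hom_isomorphic_right[OF Gam_obj[OF Q] quotient_cogen(2)]])
  have c: "coloc U T NM {?G} = pullback (gen {?H})" unfolding coloc_quotient[OF q(1)] gen_isomorphic[OF i] ..
  have "?H : perp P" by (rule hom_local[OF smashing_ideal[OF sm] Gam_obj[OF Q] hom_right_idem_local[OF sm BC_obj]])
  then have "gen {?H} \<subseteq> perp P" by (intro gen_least[OF submod_perp[OF sm]]) simp
  moreover have "submod (gen {?H})" by (rule gen_submod) (use Q f_obj BC_obj in simp)
  ultimately show ?thesis unfolding c by (intro minimal_pullback)
 qed
 then show ?thesis unfolding cominimality_def by (rule ball_cong[OF refl])
qed

text \<open>\<open>[\<Gamma>\<^sub>Q, [f\<^sub>P, I]]\<close> is \<open>[\<Gamma>\<^sub>Q, I]\<close> if \<open>P \<subseteq> Q\<close> and zero otherwise.\<close>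

lemma minimal_localize:
 assumes Q: "Q : Spcs U T" and m: "minimal (gen {ihom (\<gamma> Q) I})" shows "minimal (gen {ihom (\<gamma> Q) (ihom f I)})"
proof (cases "P \<subseteq> Q")
 case True
 have "isomorphic T (ihom (\<gamma> Q) I) (ihom (\<gamma> Q) (ihom f I))"
  by (rule isomorphic_trans[OF hom_isomorphic_left[OF Gam_right_idem[OF prime Q True] BC_obj] hom_hom[OF Gam_obj[OF Q] f_obj BC_obj]])
 then show ?thesis using m gen_isomorphic by simp
next
 case False
 have "is_zero T (ihom (f >< \<gamma> Q) I)" using hom_zero[OF _ BC_obj] Gam_right_idem_zero[OF prime Q False] f_obj Q by simp
 then have "is_zero T (ihom (\<gamma> Q) (ihom f I))" by (rule is_zero_isomorphic[OF _ hom_hom[OF Gam_obj[OF Q] f_obj BC_obj]])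
 then have "gen {ihom (\<gamma> Q) (ihom f I)} \<subseteq> {a. is_zero T a}" by (intro gen_least[OF submod_zeros]) simp
 moreover have "{a. is_zero T a} \<subseteq> C" if "submod C" for C using ts_zero[OF submod_ts[OF that]] by blast
 ultimately show ?thesis unfolding minimal_def by blast
qed

text \<open>\<open>[\<Gamma>\<^sub>P, I]\<close> is already local for \<open>P\<close>; this is why minimality can be tested prime by prime.\<close>

lemma minimal_at_prime:
 assumes m: "minimal (gen {ihom (\<gamma> P) (ihom f I)})" shows "minimal (gen {ihom (\<gamma> P) I})"
proof -
 have "isomorphic T (ihom (\<gamma> P) I) (ihom (\<gamma> P) (ihom f I))"
  by (rule isomorphic_trans[OF hom_isomorphic_left[OF Gam_right_idem[OF prime prime order_refl] BC_obj]
     hom_hom[OF Gam_obj[OF prime] f_obj BC_obj]])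
 then show ?thesis using m gen_isomorphic by simp
qed

lemma costratified_quotient: "costratified U T NM \<longleftrightarrow> costratifies (perp P) (ihom f I)"
proof -
 let ?c = "ihom f I" and ?X = "perp P"
 have cq: "cosupp U T NM a = cs (f >< a)" if a: "a : Ob" for a
 proof -
  have "is_zero NM (hom_star NM (\<gamma> Q) a) \<longleftrightarrow> is_zero T (ihom (\<gamma> Q) (f >< a))" if Q: "Q : Spcs U T" for Q
   unfolding N_zero using quotient_hom_local[OF Gam_obj[OF Q] a] is_zero_isomorphic isomorphic_sym by blast
  then show ?thesis unfolding cosupp_def by auto
 qed
 define th where "th W = {a : obj NM. cosupp U T NM a \<subseteq> W}" for W
 define \<sigma> where "\<sigma> C = (\<Union>a\<in>C. cosupp U T NM a)" for C
 have cc: "cosupp U T NM (cogen NM) = cs ?c" unfolding cq[OF quotient_cogen(1)] by (rule cs_isomorphic[OF quotient_cogen(2)])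
 have th: "th W = pullback (supported ?X W)" for W unfolding th_def using cq local_f by auto
 have locals_th: "locals (th W) = supported ?X W" for W unfolding th using cs_isomorphic[OF local_iso_f] local_f perp_obj by blast
 have sg: "\<sigma> C = total_cs (locals C)" if C: "qsubmod C" for C
 proof
  show "\<sigma> C \<subseteq> total_cs (locals C)" unfolding \<sigma>_def
  proof (rule UN_least)
   fix a assume a: "a : C"
   have ao: "a : Ob" by (rule qsubmod_obj[OF C a])
   have "f >< a : locals C" using qsubmod_f[OF C ao] a local_f[OF ao] by blast
   then show "cosupp U T NM a \<subseteq> total_cs (locals C)" unfolding cq[OF ao] by blast
  qed
  show "total_cs (locals C) \<subseteq> \<sigma> C" unfolding \<sigma>_def
  proof (rule UN_least)
   fix a assume a: "a : locals C"
   then have "a : Ob" "a : perp P" using perp_obj by blast+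
   then have "cs a = cosupp U T NM a" using cq[of a] cs_isomorphic[OF local_iso_f, of a] by simp
   then show "cs a \<subseteq> (\<Union>a\<in>C. cosupp U T NM a)" using a by blast
  qed
 qed
 have "costratified U T NM \<longleftrightarrow> (ALL W. W \<subseteq> cs ?c --> qsubmod (th W) & \<sigma> (th W) = W) &
  (ALL C. qsubmod C --> \<sigma> C \<subseteq> cs ?c & th (\<sigma> C) = C)" by (simp only: costratified_iff cc th_def \<sigma>_def)
 also have "\<dots> \<longleftrightarrow> costratifies ?X ?c" unfolding costratifies_def
 proof (intro iffI conjI allI impI; elim conjE)
  fix W assume h: "ALL W. W \<subseteq> cs ?c --> qsubmod (th W) & \<sigma> (th W) = W" and W: "W \<subseteq> cs ?c"
  then have q: "qsubmod (th W)" "\<sigma> (th W) = W" by blast+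
  show "submod (supported ?X W)" using locals_submod[OF q(1)] unfolding locals_th .
  show "total_cs (supported ?X W) = W" using sg[OF q(1)] q(2) unfolding locals_th by simp
 next
  fix C assume h: "ALL C. qsubmod C --> \<sigma> C \<subseteq> cs ?c & th (\<sigma> C) = C" and C: "submod C" "C \<subseteq> ?X"
  note q = pullback_qsubmod[OF C(1)]
  have s: "\<sigma> (pullback C) = total_cs C" unfolding sg[OF q] locals_pullback[OF C] ..
  have d: "total_cs C \<subseteq> cs ?c" "th (total_cs C) = pullback C" using h q unfolding s[symmetric] by blast+
  show "total_cs C \<subseteq> cs ?c" by (rule d(1))
  show "supported ?X (total_cs C) = C" unfolding locals_th[symmetric] d(2) by (rule locals_pullback[OF C])
 next
  fix W assume h: "ALL W. W \<subseteq> cs ?c --> submod (supported ?X W) & total_cs (supported ?X W) = W" and W: "W \<subseteq> cs ?c"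
  then have s: "submod (supported ?X W)" "total_cs (supported ?X W) = W" by blast+
  show q: "qsubmod (th W)" unfolding th by (rule pullback_qsubmod[OF s(1)])
  show "\<sigma> (th W) = W" unfolding sg[OF q] locals_th by (rule s(2))
 next
  fix C assume h: "ALL C. submod C --> C \<subseteq> ?X --> total_cs C \<subseteq> cs ?c & supported ?X (total_cs C) = C" and C: "qsubmod C"
  have d: "total_cs (locals C) \<subseteq> cs ?c" "supported ?X (total_cs (locals C)) = locals C" using h locals_submod[OF C] by blast+
  show "\<sigma> C \<subseteq> cs ?c" unfolding sg[OF C] by (rule d(1))
  show "th (\<sigma> C) = C" unfolding sg[OF C] th d(2) by (rule pullback_locals[OF C])
 qed
 finally show ?thesis .
qed

end

text \<open>Part (b) reduces to part (a), because the colocal-to-global principle for \<open>T\<close> makes costratification and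
  cominimality equivalent both for \<open>T\<close> and for each \<open>T / P\<close>.\<close>

theorem corollary5p5:
  fixes U :: "'u set" and T :: "('o, 'm) ttcat"
  assumes "big_tt_category U T"
    and "smashing_frame_spatial U T"
    and "Spcs_TD U T"
  shows "(cominimality U T (regular_module U T) \<longleftrightarrow>
            (\<forall>P\<in>Spcs U T. cominimality U T (quotient_module U T P))) \<and>
         (colocal_to_global U T (regular_module U T) \<longrightarrow>
            (costratified U T (regular_module U T) \<longleftrightarrow>
              (\<forall>P\<in>Spcs U T. costratified U T (quotient_module U T P))))"
proof -
 interpret big_tt_category U T by (rule assms(1))
 interpret spatial_TD_category U T by unfold_locales (rule assms(2,3))+
 have quot: "prime_quotient U T P" if "P : Spcs U T" for P by unfold_locales (rule that)
 have 1: "minimal (gen {ihom (\<gamma> Q) I})" if "P = Q" "P : Spcs U T" "cominimality U T (quotient_module U T P)" for P Q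
  using prime_quotient.minimal_at_prime[OF quot[OF that(2)]] prime_quotient.cominimality_quotient[OF quot[OF that(2)]] that by blast
 have a: "cominimality U T (regular_module U T) \<longleftrightarrow> (ALL P:Spcs U T. cominimality U T (quotient_module U T P))"
 proof
  assume "cominimality U T (regular_module U T)"
  then show "ALL P:Spcs U T. cominimality U T (quotient_module U T P)" unfolding cominimality_regular
   using prime_quotient.cominimality_quotient[OF quot] prime_quotient.minimal_localize[OF quot] by blast
 next
  assume "ALL P:Spcs U T. cominimality U T (quotient_module U T P)"
  then show "cominimality U T (regular_module U T)" unfolding cominimality_regular using 1 by blast
 qed
 have b: "costratified U T (regular_module U T) \<longleftrightarrow> (ALL P:Spcs U T. costratified U T (quotient_module U T P))"
  if lg: "colocal_to_global U T (regular_module U T)"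
 proof -
  have lg': "gen {a} = gen {ihom (\<gamma> Q) a | Q. Q : Spcs U T}" if "a : obj T" for a using lg that unfolding colocal_to_global_def by simp
  have cm: "costratified U T (regular_module U T) \<longleftrightarrow> cominimality U T (regular_module U T)"
   unfolding costratified_regular cominimality_regular
   using costratifies_minimal[OF submod_all BC_obj] minimal_costratifies[OF gen_BC[symmetric] BC_obj lg'] by blast
  have cn: "costratified U T (quotient_module U T P) \<longleftrightarrow> cominimality U T (quotient_module U T P)" if P: "P : Spcs U T" for P
  proof -
   note s = Spcs_smashing[OF P]
   have o: "ihom (\<f> P) I : obj T" using s BC_obj by simp
   show ?thesis unfolding prime_quotient.costratified_quotient[OF quot[OF P]] prime_quotient.cominimality_quotient[OF quot[OF P]]
    using costratifies_minimal[OF submod_perp[OF s] hom_right_idem_local[OF s BC_obj]]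
     minimal_costratifies[OF gen_perp[OF s] o lg'] by blast
  qed
  show ?thesis using a cm cn by blast
 qed
 show ?thesis using a b by blast
qed

end
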